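(* Consider the semi-polynomial Markov chain $X_{t+1}=F(X_t,e_t)$ described in the context, where the $e_t$ are i.i.d. with distribution $\Gamma$ absolutely continuous with respect to Lebesgue measure on $\mathbb{R}^m$, $E=\mathrm{supp}(\Gamma)$, and where there are $a\in\mathrm{int}(E)$ and $T\in V\cap U$ such that for every $z\in V\cap U$ the sequence $X_0^z=z$, $X_t^z=F(X_{t-1}^z,a)$ ($t\ge1$) converges to $T$. Let $W$ be the Zariski closure of the orbit $S_T$. Suppose in addition that there exist a small set $C\in\mathcal{B}(W\cap U)$, positive constants $\alpha<1$, $b<\infty$ and a function $\mathcal{V}\ge1$ on $W\cap U$ such that $$P\mathcal{V}(x)\le\alpha\,\mathcal{V}(x)+b\,1_C(x)\qquad\forall x\in W\cap U .$$ Then the Markov chain $(X_t)_{t\in\mathbb{N}}$ is positive Harris recurrent and geometrically ergodic on the algebraic variety of states $W\cap U$. Furthermore, the strictly stationary process $(X_t)_{t\in\mathbb{Z}}$ is geometrically $\beta$-mixing and $\pi(\mathcal{V}):=\mathbb{E}[\mathcal{V}(X_t)]<\infty$, where $\pi$ is the stationary distribution.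
   Context: Algebraic geometry. An algebraic set in $\mathbb{R}^n$ is the common zero set of finitely many real polynomials; it is irreducible (an algebraic variety) if it is not the union of two proper algebraic subsets. The Zariski closure of a set is the smallest algebraic set containing it. A map is regular if each component is a quotient $P/Q$ of real polynomials with $Q$ without zeros on the domain. Semi-polynomial setting. $V\subseteq\mathbb{R}^n$ is an algebraic variety, $U\subseteq\mathbb{R}^n$ is open, and $F:U\times\mathbb{R}^m\to U$ is a $C^1$-map for which there exist a $C^1$-map $f:U\times\mathbb{R}^m\to\mathbb{R}^m$ and a map $\varphi:\mathbb{R}^n\times\mathbb{R}^m\to\mathbb{R}^n$ such that: $F(z,y)=\varphi(z,f(z,y))$ for all $(z,y)\in U\times\mathbb{R}^m$; $\varphi((V\cap U)\times\mathbb{R}^m)\subseteq V\cap U$; $\varphi$ is regular in $(z,y)$; for all $z\in U$ the map $f_z=f(z,\cdot)$ is a $C^1$-diffeomorphism of $\mathbb{R}^m$ onto $\mathbb{R}^m$ and $(z,y)\mapsto f_z^{-1}(y)$ is continuous on $U\times\mathbb{R}^m$. The transition kernel is $P(z,A)=\Gamma(\{y:F(z,y)\in A\})$, and $P\mathcal{V}(x)=\mathbb{E}[\mathcal{V}(X_1)\mid X_0=x]$. Put $F^1=F$, $F^k(z,y_1,\dots,y_k)=F(F^{k-1}(z,y_1,\dots,y_{k-1}),y_k)$. The orbit is $S_T=\bigcup_{k\in\mathbb{N}^*}\{F^k(T,y_1,\dots,y_k):y_1,\dots,y_k\in E\}$, with $\mathbb{N}^*=\{1,2,\dots\}$. The chain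 can be restricted to $W\cap U$ (i.e. $F(W\cap U,\mathbb{R}^m)\subseteq W\cap U$); $\mathcal{B}(W\cap U)$ is the Borel $\sigma$-algebra of the Euclidean topology. A set $C$ is small if for some $k\ge1$ there is a non-trivial measure $\nu$ with $P^k(x,A)\ge\nu(A)$ for all $x\in C$ and all measurable $A$. Geometric ergodicity: there are an invariant probability $\pi$ and $r>1$ with $\sum_n r^n\|P^n(x,\cdot)-\pi\|_{TV}<\infty$ for all $x$. A strictly stationary process $(Z_n)_{n\in\mathbb{Z}}$ is geometrically $\beta$-mixing if $\beta(k)=\mathbb{E}\big[\sup_{D\in\sigma(Z_s:s\ge k)}|\mathbb{P}(D\mid\sigma(Z_s:s\le0))-\mathbb{P}(D)|\big]$ decays at least exponentially fast in $k$. *)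

theory Defs
  imports "HOL-Probability.Probability"
begin

section \<open>Algebraic sets and regular maps\<close>

definition algebraic_set :: "'a::euclidean_space set \<Rightarrow> bool" where
  "algebraic_set A \<longleftrightarrow>
     (\<exists>P. finite P \<and> (\<forall>p\<in>P. real_polynomial_function p) \<and> A = {x. \<forall>p\<in>P. p x = 0})"

definition algebraic_variety :: "'a::euclidean_space set \<Rightarrow> bool" where
  "algebraic_variety V \<longleftrightarrow> algebraic_set V \<and>
     \<not> (\<exists>A B. algebraic_set A \<and> algebraic_set B \<and> A \<subset> V \<and> B \<subset> V \<and> V = A \<union> B)"

text \<open>The intersection of all algebraic sets containing the given one; by Hilbert's basis
  theorem it is itself algebraic, hence the smallest such set.\<close>

definition zariski_closure :: "'a::euclidean_space set \<Rightarrow> 'a set" where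
  "zariski_closure S = algebraic_set hull S"

definition regular_on :: "'a::euclidean_space set \<Rightarrow> ('a \<Rightarrow> real ^ 'n) \<Rightarrow> bool" where
  "regular_on D g \<longleftrightarrow>
     (\<forall>i. \<exists>P Q. real_polynomial_function P \<and> real_polynomial_function Q \<and>
        (\<forall>x\<in>D. Q x \<noteq> 0 \<and> g x $ i = P x / Q x))"

section \<open>Semi-polynomial systems\<close>

text \<open>Only used for open \<open>S\<close>.\<close>

definition C1_on :: "'a::real_normed_vector set \<Rightarrow> ('a \<Rightarrow> 'b::real_normed_vector) \<Rightarrow> bool" where
  "C1_on S f \<longleftrightarrow>
     (\<exists>f'. (\<forall>x\<in>S. (f has_derivative blinfun_apply (f' x)) (at x)) \<and> continuous_on S f')"

definition C1_diffeomorphism :: "('a::real_normed_vector \<Rightarrow> 'b::real_normed_vector) \<Rightarrow> bool" where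
  "C1_diffeomorphism g \<longleftrightarrow> bij g \<and> C1_on UNIV g \<and> C1_on UNIV (inv g)"

definition semi_polynomial ::
    "(real ^ 'n) set \<Rightarrow> (real ^ 'n) set \<Rightarrow> ((real ^ 'n) \<times> (real ^ 'm) \<Rightarrow> real ^ 'n) \<Rightarrow> bool" where
  "semi_polynomial V U F \<longleftrightarrow>
     algebraic_variety V \<and> open U \<and>
     F ` (U \<times> UNIV) \<subseteq> U \<and> C1_on (U \<times> UNIV) F \<and>
     (\<exists>(f :: (real ^ 'n) \<times> (real ^ 'm) \<Rightarrow> real ^ 'm)
       (\<phi> :: (real ^ 'n) \<times> (real ^ 'm) \<Rightarrow> real ^ 'n).
        C1_on (U \<times> UNIV) f \<and>
        (\<forall>z\<in>U. \<forall>y. F (z, y) = \<phi> (z, f (z, y))) \<and>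
        \<phi> ` ((V \<inter> U) \<times> UNIV) \<subseteq> V \<inter> U \<and>
        regular_on UNIV \<phi> \<and>
        (\<forall>z\<in>U. C1_diffeomorphism (\<lambda>y. f (z, y))) \<and>
        continuous_on (U \<times> UNIV) (\<lambda>(z, y). inv (\<lambda>u. f (z, u)) y))"

text \<open>\<open>trajectory F z y k\<close> is \<open>F\<^sup>k(z, y\<^sub>1, \<dots>, y\<^sub>k)\<close>, the inputs being \<open>y 0, \<dots>, y (k - 1)\<close>.\<close>

primrec trajectory :: "('a \<times> 'b \<Rightarrow> 'a) \<Rightarrow> 'a \<Rightarrow> (nat \<Rightarrow> 'b) \<Rightarrow> nat \<Rightarrow> 'a" where
  "trajectory F z y 0 = z"
| "trajectory F z y (Suc t) = F (trajectory F z y t, y t)"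

definition orbit :: "('a \<times> 'b \<Rightarrow> 'a) \<Rightarrow> 'b set \<Rightarrow> 'a \<Rightarrow> 'a set" where
  "orbit F E T = {trajectory F T y k | k y. k \<ge> 1 \<and> (\<forall>i<k. y i \<in> E)}"

definition measure_support :: "'a::topological_space measure \<Rightarrow> 'a set" where
  "measure_support \<Gamma> = {y. \<forall>G. open G \<and> y \<in> G \<longrightarrow> emeasure \<Gamma> G > 0}"

section \<open>Markov chains on a measurable space \<open>M\<close>\<close>

text \<open>\<open>P(z, A) = \<Gamma>{y. F(z, y) \<in> A}\<close> for \<open>A\<close> in the Borel sets of \<open>S\<close>, provided \<open>F\<close> maps
  \<open>S \<times> UNIV\<close> into \<open>S\<close>.\<close>

definition transition_kernel ::
    "'b measure \<Rightarrow> ('a::topological_space \<times> 'b \<Rightarrow> 'a) \<Rightarrow> 'a set \<Rightarrow> 'a \<Rightarrow> 'a measure" where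
  "transition_kernel \<Gamma> F S z = distr \<Gamma> (restrict_space borel S) (\<lambda>y. F (z, y))"

primrec kernel_power :: "'a measure \<Rightarrow> ('a \<Rightarrow> 'a measure) \<Rightarrow> nat \<Rightarrow> 'a \<Rightarrow> 'a measure" where
  "kernel_power M K 0 x = return M x"
| "kernel_power M K (Suc n) x = K x \<bind> kernel_power M K n"

definition small_set :: "'a measure \<Rightarrow> ('a \<Rightarrow> 'a measure) \<Rightarrow> 'a set \<Rightarrow> bool" where
  "small_set M K C \<longleftrightarrow> C \<in> sets M \<and>
     (\<exists>k\<ge>1. \<exists>\<nu>. sets \<nu> = sets M \<and> emeasure \<nu> (space M) \<noteq> 0 \<and>
        (\<forall>x\<in>C. \<forall>A\<in>sets M. emeasure (kernel_power M K k x) A \<ge> emeasure \<nu> A))"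

definition stationary_distribution :: "'a measure \<Rightarrow> ('a \<Rightarrow> 'a measure) \<Rightarrow> 'a measure \<Rightarrow> bool" where
  "stationary_distribution M K \<pi> \<longleftrightarrow> prob_space \<pi> \<and> sets \<pi> = sets M \<and>
     (\<forall>A\<in>sets M. emeasure \<pi> A = (\<integral>\<^sup>+x. emeasure (K x) A \<partial>\<pi>))"

definition irreducibility_measure :: "'a measure \<Rightarrow> ('a \<Rightarrow> 'a measure) \<Rightarrow> 'a measure \<Rightarrow> bool" where
  "irreducibility_measure M K \<psi> \<longleftrightarrow>
     sets \<psi> = sets M \<and> sigma_finite_measure \<psi> \<and> emeasure \<psi> (space M) \<noteq> 0 \<and>
     (\<forall>A\<in>sets M. emeasure \<psi> A > 0 \<longrightarrow>
        (\<forall>x\<in>space M. \<exists>n\<ge>1. emeasure (kernel_power M K n x) A > 0))"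

definition maximal_irreducibility_measure ::
    "'a measure \<Rightarrow> ('a \<Rightarrow> 'a measure) \<Rightarrow> 'a measure \<Rightarrow> bool" where
  "maximal_irreducibility_measure M K \<psi> \<longleftrightarrow> irreducibility_measure M K \<psi> \<and>
     (\<forall>\<psi>'. irreducibility_measure M K \<psi>' \<longrightarrow> absolutely_continuous \<psi> \<psi>')"

text \<open>\<open>X x\<close> is the chain with kernel \<open>K\<close> started at \<open>x\<close>, realised on the probability space \<open>\<Omega>\<close>.
  The notion follows Meyn and Tweedie: from every state, every set charged by the
  maximal irreducibility measure is visited infinitely often almost surely.\<close>

definition harris_recurrent ::
    "'a measure \<Rightarrow> ('a \<Rightarrow> 'a measure) \<Rightarrow> 'w measure \<Rightarrow> ('a \<Rightarrow> nat \<Rightarrow> 'w \<Rightarrow> 'a) \<Rightarrow> bool" where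
  "harris_recurrent M K \<Omega> X \<longleftrightarrow>
     (\<exists>\<psi>. maximal_irreducibility_measure M K \<psi> \<and>
        (\<forall>A\<in>sets M. emeasure \<psi> A > 0 \<longrightarrow>
           (\<forall>x\<in>space M. AE \<omega> in \<Omega>. \<exists>\<^sub>\<infinity>t. X x t \<omega> \<in> A)))"

definition positive_harris_recurrent ::
    "'a measure \<Rightarrow> ('a \<Rightarrow> 'a measure) \<Rightarrow> 'w measure \<Rightarrow> ('a \<Rightarrow> nat \<Rightarrow> 'w \<Rightarrow> 'a) \<Rightarrow> bool" where
  "positive_harris_recurrent M K \<Omega> X \<longleftrightarrow>
     harris_recurrent M K \<Omega> X \<and> (\<exists>\<pi>. stationary_distribution M K \<pi>)"

text \<open>The total variation norm of the signed measure \<open>\<mu> - \<nu>\<close> for finite \<open>\<mu>\<close>, \<open>\<nu>\<close>: the supremum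
  of \<open>|\<mu>(g) - \<nu>(g)|\<close> over measurable \<open>|g| \<le> 1\<close>.\<close>

definition tv_norm_diff :: "'a measure \<Rightarrow> 'a measure \<Rightarrow> 'a measure \<Rightarrow> real" where
  "tv_norm_diff M \<mu> \<nu> =
     (SUP g\<in>{g \<in> borel_measurable M. \<forall>x\<in>space M. \<bar>g x\<bar> \<le> 1}.
        \<bar>(\<integral>x. g x \<partial>\<mu>) - (\<integral>x. g x \<partial>\<nu>)\<bar>)"

definition geometrically_ergodic :: "'a measure \<Rightarrow> ('a \<Rightarrow> 'a measure) \<Rightarrow> bool" where
  "geometrically_ergodic M K \<longleftrightarrow>
     (\<exists>\<pi> r. stationary_distribution M K \<pi> \<and> r > 1 \<and>
        (\<forall>x\<in>space M. summable (\<lambda>n. r ^ n * tv_norm_diff M (kernel_power M K n x) \<pi>)))"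

section \<open>Processes\<close>

definition iid_process ::
    "'w measure \<Rightarrow> ('i \<Rightarrow> 'w \<Rightarrow> 'b::topological_space) \<Rightarrow> 'b measure \<Rightarrow> bool" where
  "iid_process \<Omega> e \<Gamma> \<longleftrightarrow> prob_space \<Omega> \<and>
     prob_space.indep_vars \<Omega> (\<lambda>_. borel) e UNIV \<and> (\<forall>t. distr \<Omega> borel (e t) = \<Gamma>)"

definition strictly_stationary :: "'w measure \<Rightarrow> 'a measure \<Rightarrow> (int \<Rightarrow> 'w \<Rightarrow> 'a) \<Rightarrow> bool" where
  "strictly_stationary \<Omega> M Z \<longleftrightarrow>
     (\<forall>t. Z t \<in> measurable \<Omega> M) \<and>
     (\<forall>h. distr \<Omega> (Pi\<^sub>M UNIV (\<lambda>_. M)) (\<lambda>\<omega> t. Z (t + h) \<omega>) =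
          distr \<Omega> (Pi\<^sub>M UNIV (\<lambda>_. M)) (\<lambda>\<omega> t. Z t \<omega>))"

definition generated_algebra ::
    "'w measure \<Rightarrow> 'a measure \<Rightarrow> ('i \<Rightarrow> 'w \<Rightarrow> 'a) \<Rightarrow> 'i set \<Rightarrow> 'w measure" where
  "generated_algebra \<Omega> M Z I =
     sigma (space \<Omega>) {Z s -` A \<inter> space \<Omega> | s A. s \<in> I \<and> A \<in> sets M}"

text \<open>A strictly stationary two-sided version of the Markov chain \<open>Z\<^sub>t\<^sub>+\<^sub>1 = F(Z\<^sub>t, e\<^sub>t)\<close>: the noise
  from time \<open>t\<close> on is independent of the states up to time \<open>t\<close>.\<close>

definition stationary_chain ::
    "'w measure \<Rightarrow> 'a measure \<Rightarrow> ('a \<times> 'b::topological_space \<Rightarrow> 'a) \<Rightarrow> 'b measure \<Rightarrow>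
     (int \<Rightarrow> 'w \<Rightarrow> 'a) \<Rightarrow> (int \<Rightarrow> 'w \<Rightarrow> 'b) \<Rightarrow> bool" where
  "stationary_chain \<Omega> M F \<Gamma> Z e \<longleftrightarrow>
     iid_process \<Omega> e \<Gamma> \<and> strictly_stationary \<Omega> M Z \<and>
     (\<forall>t. AE \<omega> in \<Omega>. Z (t + 1) \<omega> = F (Z t \<omega>, e t \<omega>)) \<and>
     (\<forall>t. prob_space.indep_set \<Omega>
            (sets (generated_algebra \<Omega> M Z {..t})) (sets (generated_algebra \<Omega> borel e {t..})))"

text \<open>Conditional probabilities are only defined up to null sets, so the supremum over the
  uncountably many future events in the mixing coefficient is the essential supremum of a family
  of random variables.\<close>

definition is_essential_supremum ::
    "'w measure \<Rightarrow> 'i set \<Rightarrow> ('i \<Rightarrow> 'w \<Rightarrow> real) \<Rightarrow> ('w \<Rightarrow> real) \<Rightarrow> bool" where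
  "is_essential_supremum \<Omega> I Y S \<longleftrightarrow>
     S \<in> borel_measurable \<Omega> \<and> (\<forall>i\<in>I. AE \<omega> in \<Omega>. Y i \<omega> \<le> S \<omega>) \<and>
     (\<forall>S'\<in>borel_measurable \<Omega>. (\<forall>i\<in>I. AE \<omega> in \<Omega>. Y i \<omega> \<le> S' \<omega>) \<longrightarrow> (AE \<omega> in \<Omega>. S \<omega> \<le> S' \<omega>))"

definition beta_coefficient :: "'w measure \<Rightarrow> 'a measure \<Rightarrow> (int \<Rightarrow> 'w \<Rightarrow> 'a) \<Rightarrow> nat \<Rightarrow> real" where
  "beta_coefficient \<Omega> M Z k =
     (\<integral>\<omega>. (SOME S. is_essential_supremum \<Omega> (sets (generated_algebra \<Omega> M Z {int k..}))
              (\<lambda>D \<omega>. \<bar>real_cond_exp \<Omega> (generated_algebra \<Omega> M Z {..0}) (indicator D) \<omega>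
                       - measure \<Omega> D\<bar>) S) \<omega> \<partial>\<Omega>)"

definition geometrically_beta_mixing ::
    "'w measure \<Rightarrow> 'a measure \<Rightarrow> (int \<Rightarrow> 'w \<Rightarrow> 'a) \<Rightarrow> bool" where
  "geometrically_beta_mixing \<Omega> M Z \<longleftrightarrow>
     (\<exists>c \<rho>. 0 < \<rho> \<and> \<rho> < 1 \<and> (\<forall>k. beta_coefficient \<Omega> M Z k \<le> c * \<rho> ^ k))"

end

theory Submission
  imports Defs "HOL-Library.Function_Algebras"
begin

text \<open>
  Substituting \<open>u = f(z, y)\<close> turns \<open>F\<close> into the regular map \<open>\<phi>\<close> with unrestricted inputs. Hence the
  ideal of the orbit is prime (restrict to lines in the input space), the dimensions of the sets
  reachable in \<open>k\<close> steps stabilise after at most \<open>n\<close> steps, and \<open>W\<close> is an invariant irreducible variety.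
  A transcendence basis of the functions on the set reached after \<open>n\<close> steps gives, near a generic point,
  coordinates on \<open>W\<close> that \<open>n\<close> noise variables move freely. As \<open>\<Gamma>\<close> has a density, the laws of \<open>X\<^sub>n\<close>
  started at two points near \<open>T\<close> therefore overlap by a uniform amount.

  Every state is driven towards \<open>T\<close> with positive probability and the drift condition brings the chain
  to the small set \<open>C\<close> in bounded mean time, so this overlap holds on sublevel sets of the Lyapunov
  function at one common time. Harris' theorem in the form of Hairer and Mattingly then yields
  \<open>\<bar>P\<^sup>n g(x) - \<pi>(g)\<bar> \<le> D \<rho>\<^sup>n Lyap(x)\<close> for \<open>\<bar>g\<bar> \<le> 1\<close>, and this gives the remaining claims: the probability of
  never visiting a set of positive \<open>\<pi>\<close>-measure is a bounded subharmonic function vanishing on that set,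
  hence zero, and by the Markov property \<open>Prob(A | X\<^sub>s, s \<le> 0) - Prob(A)\<close> is at most \<open>D \<rho>\<^sup>k Lyap(X\<^sub>0)\<close>
  for every event \<open>A\<close> of the future from time \<open>k\<close> on.
\<close>

section \<open>Rings of real functions and Hilbert's basis theorem\<close>

text \<open>The density of \<open>\<Gamma>\<close> may be unbounded and need not stay away from zero
  on any open set. What survives near \<open>T\<close> is an overlap:
  \<open>P(z, A) + P(z', - A)\<close> is bounded below uniformly in \<open>A\<close> and in the two
  starting points. It is found on a ball that a superlevel set of the density almost fills, and it
  is exactly what the contraction argument consumes. The maps are compared for all starting points
  near \<open>T\<close> at once, which is why derivatives at \<open>T\<close> are taken in the
  strict sense.

  Visits to the small set \<open>C\<close> might be periodic, so a common time has to come from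
  elsewhere: the convergence to \<open>T\<close> under the constant input \<open>a\<close> lets
  every state charge a neighbourhood of \<open>T\<close> at all large times.

  Transcendence degree is handled with rings of functions instead of fields of fractions: a relation
  counts if its leading coefficient does not vanish identically on the set considered. The gain is
  that properties such as being polynomial, being stationary in a direction or taking equal values
  at two points need to be checked on generators only.\<close>

definition fun_ring :: "('x \<Rightarrow> real) set \<Rightarrow> bool" where
  "fun_ring A \<longleftrightarrow> (\<forall>r. (\<lambda>_. r) \<in> A) \<and>
     (\<forall>f\<in>A. \<forall>g\<in>A. (\<lambda>x. f x + g x) \<in> A \<and> (\<lambda>x. f x * g x) \<in> A)"

text \<open>\<open>t\<close> is a function and not an indeterminate, so one function may have
  several coefficient sequences and bounds \<open>n\<close>. Degrees below always refer to a chosen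
  representation.\<close>

definition upoly :: "(nat \<Rightarrow> 'x \<Rightarrow> real) \<Rightarrow> nat \<Rightarrow> ('x \<Rightarrow> real) \<Rightarrow> 'x \<Rightarrow> real" where
  "upoly c n t = (\<lambda>x. \<Sum>i\<le>n. c i x * t x ^ i)"

definition adjoin :: "('x \<Rightarrow> real) set \<Rightarrow> ('x \<Rightarrow> real) \<Rightarrow> ('x \<Rightarrow> real) set" where
  "adjoin A t = {upoly c n t | c n. range c \<subseteq> A}"

text \<open>The head of the list is adjoined last. \<open>indep\<close> follows the same recursion,
  so that each entry is tested against the ring of the entries behind it.\<close>

fun gen :: "('x \<Rightarrow> real) list \<Rightarrow> ('x \<Rightarrow> real) set" where
  "gen [] = range (\<lambda>r _. r)"
| "gen (g # gs) = adjoin (gen gs) g"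

inductive_set gen_ideal :: "('x \<Rightarrow> real) set \<Rightarrow> ('x \<Rightarrow> real) set \<Rightarrow> ('x \<Rightarrow> real) set"
  for A S where
  zero: "(\<lambda>_. 0) \<in> gen_ideal A S"
| step: "c \<in> A \<Longrightarrow> f \<in> S \<Longrightarrow> g \<in> gen_ideal A S \<Longrightarrow> (\<lambda>x. c x * f x + g x) \<in> gen_ideal A S"

text \<open>Stated for arbitrary subsets \<open>S\<close>, with the generators taken from
  \<open>S\<close> itself. In this form it directly replaces an infinite system of equations by a
  finite subsystem.\<close>

definition noetherian :: "('x \<Rightarrow> real) set \<Rightarrow> bool" where
  "noetherian A \<longleftrightarrow> (\<forall>S\<subseteq>A. \<exists>F\<subseteq>S. finite F \<and> S \<subseteq> gen_ideal A F)"

lemma fun_ringD: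
  assumes "fun_ring A"
  shows "(\<lambda>_. r) \<in> A"
    and "f \<in> A \<Longrightarrow> g \<in> A \<Longrightarrow> (\<lambda>x. f x + g x) \<in> A"
    and "f \<in> A \<Longrightarrow> g \<in> A \<Longrightarrow> (\<lambda>x. f x * g x) \<in> A"
  using assms by (auto simp: fun_ring_def)

lemma fun_ring_diff:
  assumes "fun_ring A" "f \<in> A" "g \<in> A"
  shows "(\<lambda>x. f x - g x) \<in> A"
  using fun_ringD(2)[OF assms(1,2) fun_ringD(3)[OF assms(1) fun_ringD(1)[OF assms(1), of "-1"] assms(3)]]
  by simp

lemma fun_ring_sum:
  assumes A: "fun_ring A" and f: "\<And>i. i \<in> I \<Longrightarrow> f i \<in> A"
  shows "(\<lambda>x. \<Sum>i\<in>I. f i x) \<in> A"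
proof (cases "finite I")
  case True
  then show ?thesis using f
    by (induction I) (auto intro: fun_ringD[OF A])
qed (simp add: fun_ringD[OF A])

lemma fun_ring_power:
  assumes A: "fun_ring A" and f: "f \<in> A"
  shows "(\<lambda>x. f x ^ n) \<in> A"
  by (induction n) (auto intro: fun_ringD[OF A] f)

lemma upoly_in_ring:
  assumes "fun_ring A" "range c \<subseteq> A" "t \<in> A"
  shows "upoly c n t \<in> A"
  unfolding upoly_def using assms
  by (intro fun_ring_sum fun_ringD(3) fun_ring_power) auto

lemma upoly_pad:
  assumes "n \<le> m"
  shows "upoly c n t = upoly (\<lambda>i. if i \<le> n then c i else (\<lambda>_. 0)) m t"
proof
  fix x
  have "(\<Sum>i\<le>m. (if i \<le> n then c i else (\<lambda>_. 0)) x * t x ^ i) = (\<Sum>i\<le>n. c i x * t x ^ i)"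
    using assms by (intro sum.mono_neutral_cong_right) auto
  then show "upoly c n t x = upoly (\<lambda>i. if i \<le> n then c i else (\<lambda>_. 0)) m t x"
    by (simp add: upoly_def)
qed

lemma adjoin_add:
  assumes A: "fun_ring A" and "f \<in> adjoin A t" "g \<in> adjoin A t"
  shows "(\<lambda>x. f x + g x) \<in> adjoin A t"
proof -
  obtain c n d m where f: "f = upoly c n t" "range c \<subseteq> A" and g: "g = upoly d m t" "range d \<subseteq> A"
    using assms(2,3) by (auto simp: adjoin_def)
  define c' where "c' = (\<lambda>i. if i \<le> n then c i else (\<lambda>_. 0))"
  define d' where "d' = (\<lambda>i. if i \<le> m then d i else (\<lambda>_. 0))"
  have 1: "f = upoly c' (max n m) t" "g = upoly d' (max n m) t"
    unfolding f g c'_def d'_def by (intro upoly_pad; simp)+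
  have "(\<lambda>x. f x + g x) = upoly (\<lambda>i x. c' i x + d' i x) (max n m) t"
    unfolding 1 by (simp add: upoly_def sum.distrib distrib_right)
  moreover have "range (\<lambda>i x. c' i x + d' i x) \<subseteq> A"
    using f(2) g(2) by (auto simp: c'_def d'_def intro!: fun_ringD[OF A])
  ultimately show ?thesis unfolding adjoin_def by blast
qed

lemma adjoin_smult:
  assumes A: "fun_ring A" and "a \<in> A" "f \<in> adjoin A t"
  shows "(\<lambda>x. a x * f x) \<in> adjoin A t"
proof -
  obtain c n where f: "f = upoly c n t" "range c \<subseteq> A"
    using assms by (auto simp: adjoin_def)
  have "(\<lambda>x. a x * f x) = upoly (\<lambda>i x. a x * c i x) n t"
    unfolding f by (simp add: upoly_def sum_distrib_left mult.assoc)
  moreover have "range (\<lambda>i x. a x * c i x) \<subseteq> A"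
    using f(2) assms(2) by (auto intro!: fun_ringD[OF A])
  ultimately show ?thesis unfolding adjoin_def by blast
qed

lemma adjoin_tmult:
  assumes A: "fun_ring A" and "f \<in> adjoin A t"
  shows "(\<lambda>x. t x * f x) \<in> adjoin A t"
proof -
  obtain c n where f: "f = upoly c n t" "range c \<subseteq> A"
    using assms by (auto simp: adjoin_def)
  have "(\<lambda>x. t x * f x) = upoly (\<lambda>i. case i of 0 \<Rightarrow> (\<lambda>_. 0) | Suc j \<Rightarrow> c j) (Suc n) t"
    unfolding f
    by (rule ext, simp add: upoly_def sum.atMost_Suc_shift sum_distrib_left mult_ac del: sum.atMost_Suc)
  moreover have "range (\<lambda>i. case i of 0 \<Rightarrow> (\<lambda>_. 0) | Suc j \<Rightarrow> c j) \<subseteq> A"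
  proof safe
    fix i show "(case i of 0 \<Rightarrow> (\<lambda>_. 0) | Suc j \<Rightarrow> c j) \<in> A"
      using f(2) fun_ringD(1)[OF A, of 0] by (cases i) (simp_all add: image_subset_iff)
  qed
  ultimately show ?thesis unfolding adjoin_def by blast
qed

lemma adjoin_base:
  assumes A: "fun_ring A" and "f \<in> A"
  shows "f \<in> adjoin A t"
proof -
  have "f = upoly (\<lambda>_. f) 0 t" by (simp add: upoly_def)
  then show ?thesis using assms unfolding adjoin_def by blast
qed

lemma adjoin_self:
  assumes A: "fun_ring A"
  shows "t \<in> adjoin A t"
  using adjoin_tmult[OF A adjoin_base[OF A fun_ringD(1)[OF A, of 1]]] by simp

lemma adjoin_mult:
  assumes A: "fun_ring A" and "f \<in> adjoin A t" and g: "g \<in> adjoin A t"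
  shows "(\<lambda>x. f x * g x) \<in> adjoin A t"
proof -
  obtain c n where f: "f = upoly c n t" "range c \<subseteq> A"
    using assms by (auto simp: adjoin_def)
  have tg: "(\<lambda>x. t x ^ i * g x) \<in> adjoin A t" for i
  proof (induction i)
    case (Suc i)
    then show ?case using adjoin_tmult[OF A Suc] by (simp add: mult.assoc)
  qed (simp add: g)
  have "(\<lambda>x. \<Sum>i\<le>n. c i x * (t x ^ i * g x)) \<in> adjoin A t"
  proof (induction n)
    case 0
    show ?case using adjoin_smult[OF A _ tg[of 0], of "c 0"] f(2) by auto
  next
    case (Suc n)
    show ?case using adjoin_add[OF A Suc adjoin_smult[OF A _ tg[of "Suc n"], of "c (Suc n)"]] f(2)
      by auto
  qed
  then show ?thesis unfolding f(1) upoly_def by (simp add: sum_distrib_right mult.assoc)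
qed

lemma fun_ring_adjoin: "fun_ring A \<Longrightarrow> fun_ring (adjoin A t)"
  unfolding fun_ring_def[of "adjoin A t"]
  by (auto intro: adjoin_add adjoin_mult adjoin_base fun_ringD)

lemma fun_ring_gen: "fun_ring (gen gs)"
  by (induction gs) (auto intro: fun_ring_adjoin, auto simp: fun_ring_def)

lemma adjoin_least:
  assumes "fun_ring R" "A \<subseteq> R" "t \<in> R"
  shows "adjoin A t \<subseteq> R"
  using assms by (auto simp: adjoin_def intro!: upoly_in_ring)

text \<open>The transfer principle for rings of functions: it is applied to the polynomials, the
  regular functions, the functions stationary in a given direction and the functions with equal
  values at two given points.\<close>

lemma gen_least:
  assumes R: "fun_ring R" and "set gs \<subseteq> R"
  shows "gen gs \<subseteq> R"
  using assms(2) by (induction gs) (auto intro: fun_ringD[OF R] dest: adjoin_least[OF R])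

lemma gen_mem: "g \<in> set gs \<Longrightarrow> g \<in> gen gs"
  by (induction gs) (auto intro: adjoin_self adjoin_base fun_ring_gen)

lemma gen_ideal_mono: "S \<subseteq> S' \<Longrightarrow> f \<in> gen_ideal A S \<Longrightarrow> f \<in> gen_ideal A S'"
  by (rotate_tac 1, induction rule: gen_ideal.induct) (auto intro: gen_ideal.intros)

lemma gen_ideal_add:
  assumes "f \<in> gen_ideal A S" "g \<in> gen_ideal A S"
  shows "(\<lambda>x. f x + g x) \<in> gen_ideal A S"
  using assms
proof (induction rule: gen_ideal.induct)
  case (step c f h)
  then show ?case using gen_ideal.step[of c A f S "\<lambda>x. h x + g x"] by (simp add: add.assoc)
qed simp

lemma gen_ideal_mult:
  assumes A: "fun_ring A" and "f \<in> gen_ideal A S" "c \<in> A"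
  shows "(\<lambda>x. c x * f x) \<in> gen_ideal A S"
  using assms(2)
proof (induction rule: gen_ideal.induct)
  case (step d f h)
  have "(\<lambda>x. c x * d x) \<in> A" by (intro fun_ringD(3)[OF A] assms(3) step)
  then show ?case using gen_ideal.step[of "\<lambda>x. c x * d x" A f S "\<lambda>x. c x * h x"] step
    by (simp add: algebra_simps)
qed (simp add: gen_ideal.zero)

lemma gen_ideal_sum:
  assumes "\<And>i. i \<in> I \<Longrightarrow> f i \<in> gen_ideal A S"
  shows "(\<lambda>x. \<Sum>i\<in>I. f i x) \<in> gen_ideal A S"
proof (cases "finite I")
  case True
  then show ?thesis using assms
    by (induction I) (auto intro: gen_ideal.zero gen_ideal_add)
qed (simp add: gen_ideal.zero)

lemma gen_ideal_base:
  assumes A: "fun_ring A" and "f \<in> S"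
  shows "f \<in> gen_ideal A S"
  using gen_ideal.step[OF fun_ringD(1)[OF A, of 1] assms(2) gen_ideal.zero] by simp

lemma gen_ideal_trans:
  assumes A: "fun_ring A" and S: "S \<subseteq> gen_ideal A F" and "f \<in> gen_ideal A S"
  shows "f \<in> gen_ideal A F"
  using assms(3)
proof (induction rule: gen_ideal.induct)
  case (step c f g)
  then have "f \<in> gen_ideal A F" using S by blast
  then show ?case using step by (intro gen_ideal_add gen_ideal_mult[OF A])
qed (rule gen_ideal.zero)

lemma gen_ideal_finite:
  assumes "f \<in> gen_ideal A S"
  shows "\<exists>F\<subseteq>S. finite F \<and> f \<in> gen_ideal A F"
  using assms
proof (induction rule: gen_ideal.induct)
  case zero
  then show ?case by (intro exI[of _ "{}"]) (auto intro: gen_ideal.zero)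
next
  case (step c f g)
  then obtain F where "F \<subseteq> S" "finite F" "g \<in> gen_ideal A F" by blast
  then show ?case using step(1,2)
    by (intro exI[of _ "insert f F"]) (auto intro!: gen_ideal.step intro: gen_ideal_mono[of F])
qed

text \<open>An index may occur several times in the inductive derivation; its contributions are
  merged into the single coefficient \<open>d j\<close>.\<close>

lemma gen_ideal_image_coeffs:
  assumes A: "fun_ring A" and "g \<in> gen_ideal A (a ` {..<n::nat})"
  shows "\<exists>d. range d \<subseteq> A \<and> g = (\<lambda>x. \<Sum>i<n. d i x * a i x)"
  using assms(2)
proof (induction rule: gen_ideal.induct)
  case zero
  then show ?case by (intro exI[of _ "\<lambda>_ _. 0"]) (auto intro: fun_ringD[OF A])
next
  case (step c f g)
  then obtain d j where d: "range d \<subseteq> A" "g = (\<lambda>x. \<Sum>i<n. d i x * a i x)"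
    and j: "j < n" "f = a j" by auto
  define d' where "d' = d(j := \<lambda>x. c x + d j x)"
  have "range d' \<subseteq> A"
    using d(1) step(1) by (auto simp: d'_def intro!: fun_ringD[OF A])
  moreover have "(\<lambda>x. c x * f x + g x) = (\<lambda>x. \<Sum>i<n. d' i x * a i x)"
  proof
    fix x
    have "(\<Sum>i<n. d' i x * a i x) = d' j x * a j x + (\<Sum>i\<in>{..<n}-{j}. d' i x * a i x)"
      using j by (intro sum.remove) auto
    also have "(\<Sum>i\<in>{..<n}-{j}. d' i x * a i x) = (\<Sum>i\<in>{..<n}-{j}. d i x * a i x)"
      by (intro sum.cong) (auto simp: d'_def)
    also have "d' j x * a j x + \<dots> = c x * a j x + (d j x * a j x + \<dots>)"
      by (simp add: d'_def algebra_simps)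
    also have "d j x * a j x + (\<Sum>i\<in>{..<n}-{j}. d i x * a i x) = g x"
      unfolding d(2) using j by (intro sum.remove[symmetric]) auto
    finally show "c x * f x + g x = (\<Sum>i<n. d' i x * a i x)" by (simp add: j)
  qed
  ultimately show ?case by blast
qed

text \<open>The ascending chain condition in the form that Hilbert's argument needs: finitely many
  generators of the range already occur among the first terms.\<close>

lemma noetherian_sequence:
  assumes "noetherian A" "range a \<subseteq> A"
  shows "\<exists>n::nat. a n \<in> gen_ideal A (a ` {..<n})"
proof -
  obtain F where F: "F \<subseteq> range a" "finite F" "range a \<subseteq> gen_ideal A F"
    using assms(1)[unfolded noetherian_def, rule_format, OF assms(2)] by (elim exE conjE)
  obtain N where N: "finite N" "F = a ` N"
    using finite_subset_image[OF F(2,1)] by auto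
  obtain n where "N \<subseteq> {..<n}" using finite_nat_bounded[OF N(1)] by auto
  then have "F \<subseteq> a ` {..<n}" using N by auto
  then have "gen_ideal A F \<subseteq> gen_ideal A (a ` {..<n})" by (intro subsetI) (rule gen_ideal_mono)
  moreover have "a n \<in> gen_ideal A F" using F(3) by auto
  ultimately show ?thesis by (intro exI[of _ n]) (rule subsetD)
qed

text \<open>If an ideal were not finitely generated, one could pick elements of least degree outside
  the ideal of those already picked. Some leading coefficient is then a combination of the earlier
  ones, and subtracting the corresponding multiples lowers the degree, against minimality.\<close>

theorem hilbert_basis:
  assumes A: "fun_ring A" and noeth: "noetherian A"
  shows "noetherian (adjoin A t)"
  unfolding noetherian_def
proof (intro allI impI)
  fix S assume S: "S \<subseteq> adjoin A t"
  let ?B = "adjoin A t"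
  have B: "fun_ring ?B" by (rule fun_ring_adjoin[OF A])
  define I where "I = gen_ideal ?B S"
  have I_add: "(\<lambda>x. f x + g x) \<in> I" if "f \<in> I" "g \<in> I" for f g
    using gen_ideal_add that by (auto simp: I_def)
  have I_mult: "(\<lambda>x. c x * f x) \<in> I" if "c \<in> ?B" "f \<in> I" for c f
    using gen_ideal_mult[OF B] that by (auto simp: I_def)
  have IB: "I \<subseteq> ?B"
  proof
    fix f assume "f \<in> I"
    then show "f \<in> ?B" unfolding I_def
      by (induction rule: gen_ideal.induct) (use S in \<open>auto intro!: fun_ringD[OF B]\<close>)
  qed
  have "\<exists>F\<subseteq>I. finite F \<and> I \<subseteq> gen_ideal ?B F"
  proof (rule ccontr)
    assume neg: "\<not> ?thesis"
    \<comment> \<open>The degree belongs to the pair of coefficients and bound, not to the function,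
      so minimality is imposed on representations.\<close>
    define good where "good F p \<longleftrightarrow> range (fst p) \<subseteq> A \<and>
        upoly (fst p) (snd p) t \<in> I - gen_ideal ?B F" for F and p :: "(nat \<Rightarrow> 'a \<Rightarrow> real) \<times> nat"
    define pick where "pick F = (SOME p. good F p \<and> (\<forall>q. good F q \<longrightarrow> snd p \<le> snd q))" for F
    have pick: "good F (pick F) \<and> (\<forall>q. good F q \<longrightarrow> snd (pick F) \<le> snd q)"
      if "F \<subseteq> I" "finite F" for F
    proof -
      have "\<not> I \<subseteq> gen_ideal ?B F"
      proof
        assume "I \<subseteq> gen_ideal ?B F"
        with that have "\<exists>F\<subseteq>I. finite F \<and> I \<subseteq> gen_ideal ?B F" by (intro exI[of _ F] conjI)
        with neg show False by (rule notE)
      qed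
      then obtain f where f: "f \<in> I" "f \<notin> gen_ideal ?B F" by (auto simp only: subset_iff not_all not_imp)
      then obtain c n where "f = upoly c n t" "range c \<subseteq> A" using IB by (auto simp: adjoin_def)
      then have "good F (c, n)" using f by (auto simp: good_def)
      from someI_ex[OF ex_has_least_nat[of "good F" _ snd, OF this]]
      show ?thesis unfolding pick_def by auto
    qed
    define fn where "fn p = upoly (fst p) (snd p) t" for p :: "(nat \<Rightarrow> 'a \<Rightarrow> real) \<times> nat"
    define G where "G = rec_nat {} (\<lambda>_ G. insert (fn (pick G)) G)"
    have G0: "G 0 = {}" and GS: "G (Suc k) = insert (fn (pick (G k))) (G k)" for k
      by (auto simp: G_def)
    have G: "G k \<subseteq> I \<and> finite (G k)" for k
    proof (induction k)
      case (Suc k)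
      then show ?case using pick[of "G k"] by (auto simp: GS good_def fn_def)
    qed (simp add: G0)
    have Gmono: "G j \<subseteq> G k" if "j \<le> k" for j k
      using that by (induction k) (auto simp: GS le_Suc_eq)
    have Gin: "fn (pick (G j)) \<in> G k" if "j < k" for j k
      using Gmono[of "Suc j" k] that by (auto simp: GS)
    define s where "s k = pick (G k)" for k
    have s: "good (G k) (s k)" "good (G k) q \<Longrightarrow> snd (s k) \<le> snd q" for k q
      using pick[of "G k"] G[of k] unfolding s_def by blast+
    \<comment> \<open>The excluded ideals grow with the index, hence the minimal degrees do not
      decrease and the exponents \<open>sh i\<close> below are true differences.\<close>
    have smono: "snd (s j) \<le> snd (s k)" if "j \<le> k" for j k
    proof (rule s(2))
      show "good (G j) (s k)"
        using s(1)[of k] gen_ideal_mono[OF Gmono[OF that], of _ ?B] unfolding good_def by blast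
    qed
    define a where "a k = fst (s k) (snd (s k))" for k
    have cA: "fst (s k) i \<in> A" for k i using s(1)[of k] by (auto simp: good_def)
    have "range a \<subseteq> A" using cA by (auto simp: a_def)
    from noetherian_sequence[OF noeth this] obtain k where "a k \<in> gen_ideal A (a ` {..<k})" by blast
    from gen_ideal_image_coeffs[OF A this] obtain d where
      d: "range d \<subseteq> A" "a k = (\<lambda>x. \<Sum>i<k. d i x * a i x)" by blast
    define N where "N = snd (s k)"
    define sh where "sh i = N - snd (s i)" for i
    have shN: "sh i + snd (s i) = N" if "i < k" for i
      using smono[of i k] that by (simp add: sh_def N_def)
    \<comment> \<open>The shifts by powers of \<open>t\<close> align all leading terms at degree
      \<open>N\<close>, where they cancel because of the relation between the leading
      coefficients.\<close>
    define g where "g x = fn (s k) x - (\<Sum>i<k. (d i x * t x ^ sh i) * fn (s i) x)" for x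
    have dt: "(\<lambda>x. d i x * t x ^ j) \<in> ?B" for i j
      using d(1) by (intro fun_ringD(3)[OF B] adjoin_base[OF A] fun_ring_power[OF B] adjoin_self[OF A]) auto
    have sum_in: "(\<lambda>x. \<Sum>i<k. (d i x * t x ^ sh i) * fn (s i) x) \<in> gen_ideal ?B (G k)"
      using Gin dt by (intro gen_ideal_sum gen_ideal_mult[OF B] gen_ideal_base[OF B]) (auto simp: s_def)
    have fnI: "fn (s i) \<in> I" for i using s(1)[of i] by (auto simp: good_def fn_def)
    have gI: "g \<in> I"
    proof -
      have "(\<lambda>x. fn (s k) x + (-1) * (\<Sum>i<k. (d i x * t x ^ sh i) * fn (s i) x)) \<in> I"
      proof (rule I_add[OF fnI I_mult[OF fun_ringD(1)[OF B]]])
        show "(\<lambda>x. \<Sum>i<k. (d i x * t x ^ sh i) * fn (s i) x) \<in> I"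
          unfolding I_def by (intro gen_ideal_sum gen_ideal_mult[OF B] dt fnI[unfolded I_def])
      qed
      then show ?thesis by (simp add: g_def[abs_def])
    qed
    have gG: "g \<notin> gen_ideal ?B (G k)"
    proof
      assume "g \<in> gen_ideal ?B (G k)"
      from gen_ideal_add[OF this sum_in] have "fn (s k) \<in> gen_ideal ?B (G k)"
        by (simp add: g_def)
      then show False using s(1)[of k] by (simp add: good_def fn_def)
    qed
    \<comment> \<open>The coefficients of \<open>g\<close> in degree \<open>l\<close>; the case
      distinction accounts for the shift by \<open>sh i\<close>.\<close>
    define e where "e l x = fst (s k) l x
      - (\<Sum>i<k. d i x * (if sh i \<le> l then fst (s i) (l - sh i) x else 0))" for l x
    have eA: "range e \<subseteq> A"
    proof -
      have "(\<lambda>x. d i x * (if sh i \<le> l then fst (s i) (l - sh i) x else 0)) \<in> A" for i l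
        using d(1) cA by (cases "sh i \<le> l") (auto intro!: fun_ringD[OF A])
      then have "e l \<in> A" for l
        unfolding e_def[abs_def] by (intro fun_ring_diff[OF A] cA fun_ring_sum[OF A])
      then show ?thesis by auto
    qed
    have g_e: "g = upoly e N t"
    proof
      fix x
      have sum_i: "(d i x * t x ^ sh i) * fn (s i) x
        = (\<Sum>l\<le>N. d i x * (if sh i \<le> l then fst (s i) (l - sh i) x else 0) * t x ^ l)"
        if "i < k" for i
      proof -
        have "(\<Sum>l\<le>N. d i x * (if sh i \<le> l then fst (s i) (l - sh i) x else 0) * t x ^ l)
          = (\<Sum>l\<in>{sh i..N}. d i x * fst (s i) (l - sh i) x * t x ^ l)"
          by (rule sum.mono_neutral_cong_right) auto
        also have "\<dots> = (\<Sum>l\<le>snd (s i). d i x * fst (s i) l x * t x ^ (l + sh i))"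
          by (rule sum.reindex_bij_witness[of _ "\<lambda>l. l + sh i" "\<lambda>l. l - sh i"])
             (use shN[OF that] in auto)
        also have "\<dots> = (d i x * t x ^ sh i) * fn (s i) x"
          by (simp add: fn_def upoly_def sum_distrib_left power_add mult_ac)
        finally show ?thesis by simp
      qed
      have "upoly e N t x = (\<Sum>l\<le>N. fst (s k) l x * t x ^ l)
        - (\<Sum>l\<le>N. \<Sum>i<k. d i x * (if sh i \<le> l then fst (s i) (l - sh i) x else 0) * t x ^ l)"
        by (simp add: upoly_def e_def left_diff_distrib sum_subtractf sum_distrib_right)
      also have "(\<Sum>l\<le>N. fst (s k) l x * t x ^ l) = fn (s k) x"
        by (simp add: fn_def upoly_def N_def)
      also have "(\<Sum>l\<le>N. \<Sum>i<k. d i x * (if sh i \<le> l then fst (s i) (l - sh i) x else 0) * t x ^ l)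
        = (\<Sum>i<k. \<Sum>l\<le>N. d i x * (if sh i \<le> l then fst (s i) (l - sh i) x else 0) * t x ^ l)"
        by (rule sum.swap)
      also have "\<dots> = (\<Sum>i<k. (d i x * t x ^ sh i) * fn (s i) x)"
        by (intro sum.cong refl) (simp add: sum_i)
      finally show "g x = upoly e N t x" by (simp add: g_def)
    qed
    have eN: "e N x = 0" for x
    proof -
      have "(\<Sum>i<k. d i x * (if sh i \<le> N then fst (s i) (N - sh i) x else 0)) = (\<Sum>i<k. d i x * a i x)"
      proof (intro sum.cong refl)
        fix i assume "i \<in> {..<k}"
        then have "N - sh i = snd (s i)" "sh i \<le> N" using shN[of i] by auto
        then show "d i x * (if sh i \<le> N then fst (s i) (N - sh i) x else 0) = d i x * a i x"
          by (simp add: a_def)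
      qed
      also have "\<dots> = a k x" by (simp add: d(2))
      finally show ?thesis by (simp add: e_def a_def flip: N_def)
    qed
    show False
    proof (cases N)
      case 0
      then have "g = (\<lambda>_. 0)" using eN by (auto simp: g_e upoly_def)
      then show False using gG gen_ideal.zero by metis
    next
      case (Suc N')
      have "g = upoly e N' t" using eN by (auto simp: g_e upoly_def Suc)
      then have "good (G k) (e, N')" using gI gG eA by (auto simp: good_def)
      from s(2)[OF this] show False using Suc by (simp add: N_def)
    qed
  qed
  then obtain F where F: "F \<subseteq> I" "finite F" "I \<subseteq> gen_ideal ?B F" by blast
  \<comment> \<open>The finite set \<open>F\<close> generates the ideal of \<open>S\<close> but need
    not lie in \<open>S\<close>. Each of its members uses only finitely many elements of
    \<open>S\<close>.\<close>
  have "\<forall>f\<in>F. \<exists>F'. F' \<subseteq> S \<and> finite F' \<and> f \<in> gen_ideal ?B F'"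
  proof
    fix f assume "f \<in> F"
    then have "f \<in> gen_ideal ?B S" using F(1) by (auto simp: I_def)
    from gen_ideal_finite[OF this] show "\<exists>F'. F' \<subseteq> S \<and> finite F' \<and> f \<in> gen_ideal ?B F'" .
  qed
  then obtain h where h: "\<And>f. f \<in> F \<Longrightarrow> h f \<subseteq> S \<and> finite (h f) \<and> f \<in> gen_ideal ?B (h f)" by metis
  let ?S0 = "\<Union>f\<in>F. h f"
  have "f \<in> gen_ideal ?B ?S0" if "f \<in> F" for f
    by (rule gen_ideal_mono[of "h f"]) (use h that in auto)
  then have "F \<subseteq> gen_ideal ?B ?S0" ..
  moreover have "S \<subseteq> I" using gen_ideal_base[OF B, of _ S] by (auto simp: I_def)
  ultimately have "S \<subseteq> gen_ideal ?B ?S0"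
    using F(3) gen_ideal_trans[OF B, of F ?S0] by (metis subset_iff)
  then show "\<exists>F\<subseteq>S. finite F \<and> S \<subseteq> gen_ideal ?B F"
    using h F(2) by (intro exI[of _ ?S0]) auto
qed

text \<open>The constants form a field, so any nonzero constant generates everything; each further
  generator is an application of Hilbert's theorem.\<close>

lemma noetherian_gen: "noetherian (gen gs)"
proof (induction gs)
  case Nil
  have "\<exists>F\<subseteq>S. finite F \<and> S \<subseteq> gen_ideal (range (\<lambda>r _. r)) F"
    if S: "S \<subseteq> range (\<lambda>r (_::'a). r::real)" for S
  proof (cases "S \<subseteq> {\<lambda>_. 0}")
    case True
    then show ?thesis by (intro exI[of _ "{}"]) (auto intro: gen_ideal.zero)
  next
    case False
    then obtain r where r: "(\<lambda>_. r) \<in> S" "r \<noteq> 0" using S by auto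
    have "(\<lambda>_. q) \<in> gen_ideal (range (\<lambda>r _. r)) {\<lambda>_::'a. r}" for q :: real
      using gen_ideal.step[of "\<lambda>_. q / r" "range (\<lambda>r _. r)" "\<lambda>_::'a. r" "{\<lambda>_. r}", OF _ _ gen_ideal.zero] r(2)
      by auto
    then show ?thesis using r S by (intro exI[of _ "{\<lambda>_. r}"]) auto
  qed
  then show ?case by (simp add: noetherian_def)
qed (simp add: hilbert_basis fun_ring_gen)

lemma fun_ring_polynomials: "fun_ring {p :: 'a::real_normed_vector \<Rightarrow> real. real_polynomial_function p}"
  by (auto simp: fun_ring_def)

lemma real_polynomial_function_inner: "real_polynomial_function (\<lambda>x. x \<bullet> b)"
  by (intro real_polynomial_function.intros(1) bounded_linear_inner_left)

lemma polynomials_eq_gen: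
  assumes "set bs = (Basis :: 'a::euclidean_space set)"
  shows "{p. real_polynomial_function p} = gen (map (\<lambda>b x. x \<bullet> b) bs)"
proof
  show "gen (map (\<lambda>b x. x \<bullet> b) bs) \<subseteq> {p :: 'a \<Rightarrow> real. real_polynomial_function p}"
    by (intro gen_least fun_ring_polynomials) (auto intro: real_polynomial_function_inner)
  have R: "fun_ring (gen (map (\<lambda>b (x::'a). x \<bullet> b) bs))" by (rule fun_ring_gen)
  show "{p. real_polynomial_function p} \<subseteq> gen (map (\<lambda>b (x::'a). x \<bullet> b) bs)"
  proof safe
    fix p :: "'a \<Rightarrow> real" assume "real_polynomial_function p"
    then show "p \<in> gen (map (\<lambda>b x. x \<bullet> b) bs)"
    proof (induction rule: real_polynomial_function.induct)
      case (linear f)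
      then interpret bounded_linear f .
      have "f x = (\<Sum>b\<in>Basis. f b * (x \<bullet> b))" for x
      proof -
        have "f x = f (\<Sum>b\<in>Basis. (x \<bullet> b) *\<^sub>R b)" by (simp add: euclidean_representation)
        also have "\<dots> = (\<Sum>b\<in>Basis. f b * (x \<bullet> b))" by (simp add: sum scaleR mult.commute)
        finally show ?thesis .
      qed
      then have "f = (\<lambda>x. \<Sum>b\<in>Basis. f b * (x \<bullet> b))" by (rule ext)
      also have "\<dots> \<in> gen (map (\<lambda>b x. x \<bullet> b) bs)"
        by (intro fun_ring_sum[OF R] fun_ringD[OF R] gen_mem) (use assms in auto)
      finally show ?case .
    qed (auto intro: fun_ringD[OF R])
  qed
qed

lemma noetherian_polynomials: "noetherian {p :: 'a::euclidean_space \<Rightarrow> real. real_polynomial_function p}"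
proof -
  obtain bs where "set bs = (Basis :: 'a set)" using finite_list[OF finite_Basis] by blast
  then show ?thesis by (simp add: polynomials_eq_gen noetherian_gen)
qed

section \<open>Algebraic sets and the Zariski closure\<close>

definition vanishing :: "'a::real_normed_vector set \<Rightarrow> ('a \<Rightarrow> real) set" where
  "vanishing S = {p. real_polynomial_function p \<and> (\<forall>x\<in>S. p x = 0)}"

text \<open>Finitely many members of \<open>I\<close> generate an ideal containing \<open>I\<close>,
  and a common zero of generators is a zero of the whole ideal.\<close>

lemma algebraic_set_zeros:
  fixes I :: "('a::euclidean_space \<Rightarrow> real) set"
  assumes "I \<subseteq> {p. real_polynomial_function p}"
  shows "algebraic_set {x. \<forall>p\<in>I. p x = 0}"
proof -
  obtain F where F: "F \<subseteq> I" "finite F" "I \<subseteq> gen_ideal {p. real_polynomial_function p} F"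
    using noetherian_polynomials assms unfolding noetherian_def by metis
  have "p x = 0" if "p \<in> gen_ideal {p. real_polynomial_function p} F" "\<forall>p\<in>F. p x = 0" for p and x :: 'a
    using that by (induction rule: gen_ideal.induct) auto
  then have "{x. \<forall>p\<in>I. p x = 0} = {x. \<forall>p\<in>F. p x = 0}"
    using F(1,3) by (intro Collect_cong) (meson subset_iff)
  moreover have "\<forall>p\<in>F. real_polynomial_function p" using F(1) assms by auto
  ultimately show ?thesis unfolding algebraic_set_def using F(2) by (intro exI[of _ F] conjI)
qed

lemma zariski_closure_eq:
  "zariski_closure S = {x. \<forall>p\<in>vanishing S. p x = 0}"
proof
  have "S \<subseteq> {x. \<forall>p\<in>vanishing S. p x = 0}" by (auto simp: vanishing_def)
  moreover have "algebraic_set {x. \<forall>p\<in>vanishing S. p x = 0}"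
    by (intro algebraic_set_zeros) (auto simp: vanishing_def)
  ultimately show "zariski_closure S \<subseteq> {x. \<forall>p\<in>vanishing S. p x = 0}"
    unfolding zariski_closure_def by (rule hull_minimal)
  show "{x. \<forall>p\<in>vanishing S. p x = 0} \<subseteq> zariski_closure S"
    unfolding zariski_closure_def hull_def
    by (auto simp: algebraic_set_def vanishing_def subset_iff)
qed

section \<open>Algebraic independence modulo a vanishing set\<close>

text \<open>The formal derivative in \<open>t\<close>, with the coefficients treated as constants;
  it differs in general from the derivative of the function \<open>upoly c n t\<close>.\<close>

definition upoly_deriv :: "(nat \<Rightarrow> 'x \<Rightarrow> real) \<Rightarrow> nat \<Rightarrow> ('x \<Rightarrow> real) \<Rightarrow> 'x \<Rightarrow> real" where
  "upoly_deriv c n t = (\<lambda>x. \<Sum>i\<le>n. real i * c i x * t x ^ (i - 1))"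

text \<open>\<open>t\<close> is algebraic over \<open>A\<close> modulo the functions vanishing on \<open>S\<close>.\<close>

definition alg :: "'x set \<Rightarrow> ('x \<Rightarrow> real) set \<Rightarrow> ('x \<Rightarrow> real) \<Rightarrow> bool" where
  "alg S A t \<longleftrightarrow> (\<exists>c n. range c \<subseteq> A \<and> (\<forall>x\<in>S. upoly c n t x = 0) \<and> (\<exists>x\<in>S. c n x \<noteq> 0))"

text \<open>Algebraic independence built up from the tail. \<open>indep_vanish\<close> recovers the
  usual meaning: no nonzero element of the generated ring vanishes on the set.\<close>

fun indep :: "'x set \<Rightarrow> ('x \<Rightarrow> real) list \<Rightarrow> bool" where
  "indep S [] \<longleftrightarrow> True"
| "indep S (g # gs) \<longleftrightarrow> indep S gs \<and> \<not> alg S (gen gs) g"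

lemma alg_minimal:
  assumes "alg S A t"
  obtains c n where "range c \<subseteq> A" "\<forall>x\<in>S. upoly c n t x = 0" "\<exists>x\<in>S. c n x \<noteq> 0"
    "\<And>d m. range d \<subseteq> A \<Longrightarrow> \<forall>x\<in>S. upoly d m t x = 0 \<Longrightarrow> \<exists>x\<in>S. d m x \<noteq> 0 \<Longrightarrow> n \<le> m"
proof -
  let ?P = "\<lambda>n. \<exists>c. range c \<subseteq> A \<and> (\<forall>x\<in>S. upoly c n t x = 0) \<and> (\<exists>x\<in>S. c n x \<noteq> 0)"
  obtain n where "?P n" using assms unfolding alg_def by metis
  then have "?P (LEAST n. ?P n)" by (rule LeastI)
  then obtain c where c: "range c \<subseteq> A" "\<forall>x\<in>S. upoly c (LEAST n. ?P n) t x = 0"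
    "\<exists>x\<in>S. c (LEAST n. ?P n) x \<noteq> 0" by (elim exE conjE)
  show ?thesis
  proof (rule that[OF c])
    fix d m assume d: "range d \<subseteq> A" "\<forall>x\<in>S. upoly d m t x = 0" "\<exists>x\<in>S. d m x \<noteq> 0"
    then have "?P m" by (intro exI[of _ d] conjI)
    then show "(LEAST n. ?P n) \<le> m" by (rule Least_le)
  qed
qed

text \<open>Separability in characteristic zero: the formal derivative of a relation of minimal
  degree has smaller degree and leading coefficient \<open>n * c n\<close>, so it cannot vanish on
  \<open>S\<close> as well.\<close>

lemma alg_deriv:
  assumes A: "fun_ring A" and "alg S A t"
  obtains c n x where "range c \<subseteq> A" "\<forall>x\<in>S. upoly c n t x = 0" "x \<in> S" "upoly_deriv c n t x \<noteq> 0"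
proof -
  from assms(2) obtain c n where c: "range c \<subseteq> A" "\<forall>x\<in>S. upoly c n t x = 0" "\<exists>x\<in>S. c n x \<noteq> 0"
    and min: "\<And>d m. range d \<subseteq> A \<Longrightarrow> \<forall>x\<in>S. upoly d m t x = 0 \<Longrightarrow> \<exists>x\<in>S. d m x \<noteq> 0 \<Longrightarrow> n \<le> m"
    by (rule alg_minimal) blast
  have "n \<noteq> 0"
  proof
    assume "n = 0"
    then show False using c(2,3) by (auto simp: upoly_def)
  qed
  then obtain m where n: "n = Suc m" by (cases n) auto
  define d where "d i = (\<lambda>x. real (Suc i) * c (Suc i) x)" for i
  have d: "range d \<subseteq> A"
  proof safe
    fix i
    have "c (Suc i) \<in> A" using c(1) by auto
    then show "d i \<in> A" unfolding d_def by (intro fun_ringD(3)[OF A] fun_ringD(1)[OF A])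
  qed
  have eq: "upoly_deriv c n t = upoly d m t"
    unfolding upoly_deriv_def upoly_def n d_def
    by (rule ext, simp add: sum.atMost_Suc_shift del: sum.atMost_Suc)
  have "\<exists>x\<in>S. d m x \<noteq> 0" using c(3) by (auto simp: d_def n)
  have "\<not> (\<forall>x\<in>S. upoly d m t x = 0)"
  proof
    assume "\<forall>x\<in>S. upoly d m t x = 0"
    from min[OF d this \<open>\<exists>x\<in>S. d m x \<noteq> 0\<close>] show False using n by simp
  qed
  then show ?thesis using that[OF c(1,2)] eq by auto
qed

text \<open>If the constant coefficient of a minimal relation vanished on \<open>S\<close>, a factor
  \<open>t\<close> would split off, and by primality the quotient would be a relation of smaller
  degree.\<close>

lemma alg_const_coeff:
  assumes A: "fun_ring A" and "alg S A t" and t: "\<exists>x\<in>S. t x \<noteq> 0"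
    and prime: "\<And>f. f \<in> adjoin A t \<Longrightarrow> \<forall>x\<in>S. t x * f x = 0 \<Longrightarrow> \<forall>x\<in>S. f x = 0"
  obtains c n x where "range c \<subseteq> A" "\<forall>x\<in>S. upoly c n t x = 0" "x \<in> S" "c 0 x \<noteq> 0"
proof -
  from assms(2) obtain c n where c: "range c \<subseteq> A" "\<forall>x\<in>S. upoly c n t x = 0" "\<exists>x\<in>S. c n x \<noteq> 0"
    and min: "\<And>d m. range d \<subseteq> A \<Longrightarrow> \<forall>x\<in>S. upoly d m t x = 0 \<Longrightarrow> \<exists>x\<in>S. d m x \<noteq> 0 \<Longrightarrow> n \<le> m"
    by (rule alg_minimal) blast
  have "\<exists>x\<in>S. c 0 x \<noteq> 0"
  proof (rule ccontr)
    assume c0: "\<not> ?thesis"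
    then have "n \<noteq> 0" using c(3) by (cases n) auto
    then obtain m where n: "n = Suc m" by (cases n) auto
    define d where "d i = c (Suc i)" for i
    have d: "range d \<subseteq> A" using c(1) by (auto simp: d_def)
    have "upoly c n t x = c 0 x + t x * upoly d m t x" for x
      by (simp add: upoly_def n d_def sum.atMost_Suc_shift sum_distrib_left mult_ac del: sum.atMost_Suc)
    then have "\<forall>x\<in>S. t x * upoly d m t x = 0" using c(2) c0 by auto
    moreover have "upoly d m t \<in> adjoin A t" using d by (auto simp: adjoin_def)
    ultimately have "\<forall>x\<in>S. upoly d m t x = 0" using prime by simp
    from min[OF d this] c(3) show False by (auto simp: n d_def)
  qed
  then show ?thesis using that[OF c(1,2)] by auto
qed

text \<open>The top coefficient must vanish on \<open>S\<close>, since otherwise \<open>t\<close>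
  would be algebraic. Dropping it gives a shorter relation, and one descends.\<close>

lemma not_alg_coeffs:
  assumes "\<not> alg S A t" "range c \<subseteq> A" "\<forall>x\<in>S. upoly c n t x = 0" "i \<le> n" "x \<in> S"
  shows "c i x = 0"
  using assms(3,4)
proof (induction n)
  case 0
  then show ?case using assms by (auto simp: upoly_def)
next
  case (Suc n)
  have top: "\<forall>x\<in>S. c (Suc n) x = 0"
    using assms(1,2) Suc.prems(1) unfolding alg_def by blast
  then have "\<forall>x\<in>S. upoly c n t x = 0" using Suc.prems(1) by (auto simp: upoly_def)
  then show ?case using Suc.IH Suc.prems(2) top assms(5) by (cases "i = Suc n") auto
qed

text \<open>Coefficients of a vanishing polynomial vanish on \<open>S\<close> by
  \<open>not_alg_coeffs\<close>, hence everywhere by induction. Nonemptiness of \<open>S\<close>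
  settles the constants.\<close>

lemma indep_vanish:
  assumes "S \<noteq> {}" "indep S gs" "q \<in> gen gs" "\<forall>x\<in>S. q x = 0"
  shows "q x = 0"
  using assms(2-)
proof (induction gs arbitrary: q)
  case Nil
  then show ?case using assms(1) by auto
next
  case (Cons g gs)
  then obtain c n where q: "q = upoly c n g" "range c \<subseteq> gen gs" by (auto simp: adjoin_def)
  have "c i x = 0" if "i \<le> n" for i
  proof (rule Cons.IH)
    show "\<forall>x\<in>S. c i x = 0"
      using not_alg_coeffs[of S "gen gs" g c n i] Cons.prems q that by auto
  qed (use Cons.prems q in auto)
  then show ?case by (simp add: q upoly_def)
qed

text \<open>A leading coefficient could be nonzero only outside the smaller set \<open>S\<close>,
  but \<open>indep_vanish\<close> shows that a coefficient vanishing on \<open>S\<close> is zero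
  everywhere.\<close>

lemma indep_mono:
  assumes "S \<noteq> {}" "S \<subseteq> S'" "indep S gs"
  shows "indep S' gs"
  using assms(3)
proof (induction gs)
  case (Cons g gs)
  have "\<not> alg S' (gen gs) g"
  proof
    assume "alg S' (gen gs) g"
    then obtain c n where c: "range c \<subseteq> gen gs" "\<forall>x\<in>S'. upoly c n g x = 0" "\<exists>x\<in>S'. c n x \<noteq> 0"
      unfolding alg_def by (elim exE conjE)
    have "\<forall>x\<in>S. c n x = 0"
      using not_alg_coeffs[of S "gen gs" g c n n] Cons.prems c(1,2) assms(2) by auto
    then have "c n x = 0" for x
      by (intro indep_vanish[OF assms(1), of gs]) (use Cons.prems c(1) in auto)
    then show False using c(3) by simp
  qed
  then show ?case using Cons by simp
qed simp

lemma gen_comp: "gen (map (\<lambda>g x. g (h x)) gs) = (\<lambda>f x. f (h x)) ` gen gs"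
proof (induction gs)
  case (Cons g gs)
  show ?case
  proof safe
    fix f assume "f \<in> gen (map (\<lambda>g x. g (h x)) (g # gs))"
    then obtain c n where f: "f = upoly c n (\<lambda>x. g (h x))" "range c \<subseteq> (\<lambda>f x. f (h x)) ` gen gs"
      using Cons by (auto simp: adjoin_def)
    then have "\<forall>i. \<exists>d. d \<in> gen gs \<and> c i = (\<lambda>x. d (h x))" by auto
    then obtain d where d: "\<And>i. d i \<in> gen gs" "\<And>i. c i = (\<lambda>x. d i (h x))" by metis
    have "f = (\<lambda>x. upoly d n g (h x))" by (auto simp: f(1) upoly_def d(2))
    moreover have "upoly d n g \<in> gen (g # gs)" using d(1) by (auto simp: adjoin_def)
    ultimately show "f \<in> (\<lambda>f x. f (h x)) ` gen (g # gs)" by blast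
  next
    fix f assume "f \<in> gen (g # gs)"
    then obtain c n where f: "f = upoly c n g" "range c \<subseteq> gen gs" by (auto simp: adjoin_def)
    have "(\<lambda>x. f (h x)) = upoly (\<lambda>i x. c i (h x)) n (\<lambda>x. g (h x))" by (auto simp: f(1) upoly_def)
    moreover have "range (\<lambda>i x. c i (h x)) \<subseteq> gen (map (\<lambda>g x. g (h x)) gs)" using f(2) Cons by auto
    ultimately show "(\<lambda>x. f (h x)) \<in> gen (map (\<lambda>g x. g (h x)) (g # gs))" by (auto simp: adjoin_def)
  qed
qed auto

text \<open>Relations pull back along \<open>h\<close>: by \<open>gen_comp\<close> every coefficient
  on the source is a coefficient on the image composed with \<open>h\<close>.\<close>

lemma indep_comp:
  assumes "indep (h ` S) gs"
  shows "indep S (map (\<lambda>g x. g (h x)) gs)"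
  using assms
proof (induction gs)
  case (Cons g gs)
  have "\<not> alg S (gen (map (\<lambda>g x. g (h x)) gs)) (\<lambda>x. g (h x))"
  proof
    assume "alg S (gen (map (\<lambda>g x. g (h x)) gs)) (\<lambda>x. g (h x))"
    then obtain c n where c: "range c \<subseteq> (\<lambda>f x. f (h x)) ` gen gs"
      "\<forall>x\<in>S. upoly c n (\<lambda>x. g (h x)) x = 0" "\<exists>x\<in>S. c n x \<noteq> 0"
      unfolding alg_def gen_comp by (elim exE conjE)
    from c(1) have "\<forall>i. \<exists>d. d \<in> gen gs \<and> c i = (\<lambda>x. d (h x))" by auto
    then obtain d where d: "\<And>i. d i \<in> gen gs" "\<And>i. c i = (\<lambda>x. d i (h x))" by metis
    have "range d \<subseteq> gen gs" "\<forall>x\<in>h ` S. upoly d n g x = 0" "\<exists>x\<in>h ` S. d n x \<noteq> 0"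
      using c(2,3) d by (auto simp: upoly_def)
    then have "alg (h ` S) (gen gs) g" unfolding alg_def by blast
    then show False using Cons.prems by simp
  qed
  then show ?case using Cons by simp
qed simp

section \<open>The dimension bound by counting monomials\<close>

fun mon :: "('x \<Rightarrow> real) list \<Rightarrow> nat list \<Rightarrow> 'x \<Rightarrow> real" where
  "mon (g # gs) (a # as) x = g x ^ a * mon gs as x"
| "mon _ _ x = 1"

definition exps :: "nat \<Rightarrow> nat \<Rightarrow> nat list set" where
  "exps e D = {as. set as \<subseteq> {..D} \<and> length as = e}"

lemma exps_0: "exps 0 D = {[]}" by (auto simp: exps_def)

lemma exps_Suc: "exps (Suc e) D = (\<Union>a\<in>{..D}. (#) a ` exps e D)"
  by (auto simp: exps_def length_Suc_conv)

lemma finite_exps: "finite (exps e D)"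
  by (simp add: exps_def finite_lists_length_eq)

lemma card_exps: "card (exps e D) = (D + 1) ^ e"
  by (simp add: exps_def card_lists_length_eq)

lemma sum_exps_Suc: "(\<Sum>as\<in>exps (Suc e) D. f as) = (\<Sum>a\<le>D. \<Sum>as\<in>exps e D. f (a # as))"
  for f :: "nat list \<Rightarrow> real"
proof -
  have "(\<Sum>as\<in>exps (Suc e) D. f as) = (\<Sum>a\<le>D. \<Sum>as\<in>(#) a ` exps e D. f as)"
    unfolding exps_Suc by (rule sum.UNION_disjoint) (auto simp: finite_exps)
  also have "\<dots> = (\<Sum>a\<le>D. \<Sum>as\<in>exps e D. f (a # as))"
    by (rule sum.cong[OF refl], subst sum.reindex) auto
  finally show ?thesis .
qed

lemma mon_in_gen: "mon gs as \<in> gen (gs :: ('x \<Rightarrow> real) list)"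
proof (induction gs arbitrary: as)
  case Nil
  have "mon [] as = (\<lambda>_ :: 'x. 1)" by (rule ext) (cases as; simp)
  then show ?case using fun_ringD(1)[OF fun_ring_gen, of 1 "[] :: ('x \<Rightarrow> real) list"] by (simp only:)
next
  case (Cons g gs)
  note IH = Cons.IH
  have A: "fun_ring (gen (g # gs))" by (rule fun_ring_gen)
  show ?case
  proof (cases as)
    case Nil
    then have "mon (g # gs) as = (\<lambda>_. 1)" by auto
    then show ?thesis using fun_ringD(1)[OF A, of 1] by (simp only:)
  next
    case (Cons a bs)
    have "mon gs bs \<in> gen (g # gs)" using IH[of bs] adjoin_base[OF fun_ring_gen] by simp
    moreover have "(\<lambda>x. g x ^ a) \<in> gen (g # gs)" by (intro fun_ring_power[OF A] gen_mem) simp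
    ultimately have "(\<lambda>x. g x ^ a * mon gs bs x) \<in> gen (g # gs)" by (intro fun_ringD(3)[OF A])
    moreover have "mon (g # gs) as = (\<lambda>x. g x ^ a * mon gs bs x)" using Cons by auto
    ultimately show ?thesis by simp
  qed
qed

text \<open>Sorted by powers of the first generator, the sum becomes a polynomial in it whose
  coefficients must vanish on \<open>S\<close>; induction treats these coefficients.\<close>

lemma mon_independent:
  assumes "S \<noteq> {}" "indep S gs" "\<forall>x\<in>S. (\<Sum>as\<in>exps (length gs) D. c as * mon gs as x) = 0"
    and "as \<in> exps (length gs) D"
  shows "c as = 0"
  using assms(2-)
proof (induction gs arbitrary: c as)
  case Nil
  then show ?case using assms(1) by (auto simp: exps_0)
next
  case (Cons g gs)
  define d where "d a = (\<lambda>x. \<Sum>as\<in>exps (length gs) D. c (a # as) * mon gs as x)" for a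
  have "d a \<in> gen gs" for a
    unfolding d_def by (intro fun_ring_sum fun_ringD(3) fun_ringD(1) fun_ring_gen mon_in_gen)
  then have d: "range d \<subseteq> gen gs" by auto
  have "(\<Sum>as\<in>exps (length (g # gs)) D. c as * mon (g # gs) as x) = upoly d D g x" for x
    by (simp add: sum_exps_Suc upoly_def d_def sum_distrib_left sum_distrib_right mult_ac)
  then have v: "\<forall>x\<in>S. upoly d D g x = 0" using Cons.prems(2) by simp
  obtain a bs where as: "as = a # bs" "a \<le> D" "bs \<in> exps (length gs) D"
    using Cons.prems(3) by (auto simp: exps_Suc)
  have "\<forall>x\<in>S. d a x = 0"
    using not_alg_coeffs[of S "gen gs" g d D a] Cons.prems(1) d v as(2) by auto
  then show ?case unfolding as(1) using Cons.prems(1) as(3)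
    by (intro Cons.IH[of "\<lambda>bs. c (a # bs)"]) (auto simp: d_def)
qed

interpretation fun_space: vector_space "\<lambda>(r::real) (f::'x \<Rightarrow> real) x. r * f x"
  by unfold_locales (auto simp: fun_eq_iff algebra_simps)

lemma sum_fun_apply: "(\<Sum>i\<in>I. f i) x = (\<Sum>i\<in>I. f i x :: real)"
  by (induction I rule: infinite_finite_induct) auto

definition boxmon :: "('a::euclidean_space \<Rightarrow> nat) \<Rightarrow> 'a \<Rightarrow> real" where
  "boxmon \<beta> x = (\<Prod>b\<in>Basis. (x \<bullet> b) ^ \<beta> b)"

text \<open>The degree is bounded in each coordinate separately. Such bounds add under
  multiplication, and the number of monomials is a plain power.\<close>

definition boxmons :: "nat \<Rightarrow> ('a::euclidean_space \<Rightarrow> real) set" where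
  "boxmons L = boxmon ` (Basis \<rightarrow>\<^sub>E {..L})"

lemma finite_boxmons: "finite (boxmons L)"
  by (simp add: boxmons_def finite_PiE)

lemma card_boxmons: "card (boxmons L :: ('a::euclidean_space \<Rightarrow> real) set) \<le> (L + 1) ^ DIM('a)"
proof -
  have "card (boxmons L :: ('a \<Rightarrow> real) set) \<le> card ((Basis :: 'a set) \<rightarrow>\<^sub>E {..L})"
    unfolding boxmons_def by (rule card_image_le) (simp add: finite_PiE)
  also have "\<dots> = (L + 1) ^ DIM('a)" by (simp add: card_PiE)
  finally show ?thesis .
qed

abbreviation box_poly :: "nat \<Rightarrow> ('a::euclidean_space \<Rightarrow> real) set" where
  "box_poly L \<equiv> fun_space.span (boxmons L)"

lemma boxmon_in: "\<forall>b\<in>Basis. \<beta> b \<le> L \<Longrightarrow> boxmon \<beta> \<in> box_poly L"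
proof -
  assume "\<forall>b\<in>Basis. \<beta> b \<le> L"
  then have "restrict \<beta> Basis \<in> Basis \<rightarrow>\<^sub>E {..L}" by auto
  moreover have "boxmon \<beta> = boxmon (restrict \<beta> Basis)" by (auto simp: boxmon_def)
  ultimately have "boxmon \<beta> \<in> boxmons L" unfolding boxmons_def by blast
  then show ?thesis by (rule fun_space.span_base)
qed

lemma boxmon_mult: "boxmon \<beta> x * boxmon \<gamma> x = boxmon (\<lambda>b. \<beta> b + \<gamma> b) x"
  by (simp add: boxmon_def power_add prod.distrib)

lemma box_poly_mono: "L \<le> L' \<Longrightarrow> box_poly L \<subseteq> box_poly L'"
  unfolding boxmons_def by (intro fun_space.span_mono image_mono PiE_mono) auto

lemma box_poly_mult:
  assumes f: "f \<in> box_poly L" and g: "g \<in> box_poly L'"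
  shows "(\<lambda>x. f x * g x) \<in> box_poly (L + L')"
  using f
proof (induction rule: fun_space.span_induct)
  case base
  have "(\<lambda>x. (f + h) x * g x) = (\<lambda>x. f x * g x) + (\<lambda>x. h x * g x)"
    "(\<lambda>x. (r * f x) * g x) = (\<lambda>x. r * (f x * g x))" for f h r
    by (auto simp: fun_eq_iff algebra_simps)
  then show ?case
    by (auto simp: fun_space.subspace_def fun_space.span_add fun_space.span_zero zero_fun_def[symmetric]
        intro!: fun_space.span_scale)
next
  case (step f)
  then obtain \<beta> where \<beta>: "f = boxmon \<beta>" "\<forall>b\<in>Basis. \<beta> b \<le> L" by (auto simp: boxmons_def)
  show ?case using g
  proof (induction rule: fun_space.span_induct)
    case base
    have "(\<lambda>x. f x * (g + h) x) = (\<lambda>x. f x * g x) + (\<lambda>x. f x * h x)"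
      "(\<lambda>x. f x * (r * g x)) = (\<lambda>x. r * (f x * g x))" for g h r
      by (auto simp: fun_eq_iff algebra_simps)
    then show ?case
      by (auto simp: fun_space.subspace_def fun_space.span_add fun_space.span_zero zero_fun_def[symmetric]
          intro!: fun_space.span_scale)
  next
    case (step g)
    then obtain \<gamma> where \<gamma>: "g = boxmon \<gamma>" "\<forall>b\<in>Basis. \<gamma> b \<le> L'" by (auto simp: boxmons_def)
    have "boxmon (\<lambda>b. \<beta> b + \<gamma> b) \<in> box_poly (L + L')"
      by (rule boxmon_in) (use \<beta> \<gamma> in \<open>auto intro: add_mono\<close>)
    then show ?case unfolding \<beta>(1) \<gamma>(1) boxmon_mult .
  qed
qed

lemma box_poly_const: "(\<lambda>_. r) \<in> box_poly L"
proof -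
  have "boxmon (\<lambda>_. 0) \<in> (box_poly L :: ('a \<Rightarrow> real) set)" by (rule boxmon_in) simp
  from fun_space.span_scale[OF this, of r] show ?thesis by (simp add: boxmon_def)
qed

lemma box_poly_power:
  assumes "f \<in> box_poly L"
  shows "(\<lambda>x. f x ^ n) \<in> box_poly (n * L)"
  by (induction n) (auto simp: box_poly_const intro: box_poly_mult[OF assms])

lemma polynomial_box_poly:
  assumes "real_polynomial_function (p :: 'a::euclidean_space \<Rightarrow> real)"
  shows "\<exists>L. p \<in> box_poly L"
  using assms
proof (induction rule: real_polynomial_function.induct)
  case (linear f)
  then interpret bounded_linear f .
  have inner: "(\<lambda>x. f b * (x \<bullet> b)) \<in> box_poly 1" if "b \<in> Basis" for b :: 'a
  proof -
    have "boxmon (\<lambda>c. if c = b then 1 else 0) \<in> (box_poly 1 :: ('a \<Rightarrow> real) set)"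
      by (rule boxmon_in) auto
    moreover have "boxmon (\<lambda>c. if c = b then 1 else 0) = (\<lambda>x. x \<bullet> b)"
    proof
      fix x
      have "boxmon (\<lambda>c. if c = b then 1 else 0) x = (\<Prod>c\<in>Basis. if c = b then x \<bullet> b else 1)"
        unfolding boxmon_def by (intro prod.cong) auto
      then show "boxmon (\<lambda>c. if c = b then 1 else 0) x = x \<bullet> b" using that by simp
    qed
    ultimately show ?thesis using fun_space.span_scale[of "\<lambda>x. x \<bullet> b" _ "f b"] by simp
  qed
  have "f = (\<Sum>b\<in>Basis. (\<lambda>x. f b * (x \<bullet> b)))"
  proof
    fix x
    have "f x = f (\<Sum>b\<in>Basis. (x \<bullet> b) *\<^sub>R b)" by (simp add: euclidean_representation)
    also have "\<dots> = (\<Sum>b\<in>Basis. f b * (x \<bullet> b))" by (simp add: sum scaleR mult.commute)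
    finally show "f x = (\<Sum>b\<in>Basis. (\<lambda>x. f b * (x \<bullet> b))) x" by (simp add: sum_fun_apply)
  qed
  also have "\<dots> \<in> box_poly 1" by (intro fun_space.span_sum inner)
  finally show ?case by blast
next
  case (const c)
  then show ?case using box_poly_const by blast
next
  case (add f g)
  then obtain L L' where "f \<in> box_poly L" "g \<in> box_poly L'" by blast
  then have "f \<in> box_poly (max L L')" "g \<in> box_poly (max L L')"
    using box_poly_mono[of L "max L L'"] box_poly_mono[of L' "max L L'"] by auto
  from fun_space.span_add[OF this] have "(\<lambda>x. f x + g x) \<in> box_poly (max L L')"
    by (simp add: plus_fun_def)
  then show ?case by blast
next
  case (mult f g)
  then show ?case using box_poly_mult by blast
qed

text \<open>Denominators have no zeros on the whole space, so no domains of definition occur and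
  zero sets are those of the numerators.\<close>

definition regular_functions :: "('a::real_normed_vector \<Rightarrow> real) set" where
  "regular_functions = {f. \<exists>P Q. real_polynomial_function P \<and> real_polynomial_function Q \<and>
     (\<forall>x. Q x \<noteq> 0) \<and> f = (\<lambda>x. P x / Q x)}"

lemma fun_ring_regular: "fun_ring regular_functions"
  unfolding fun_ring_def
proof (intro conjI allI ballI)
  fix r :: real show "(\<lambda>_::'a. r) \<in> regular_functions"
    unfolding regular_functions_def
    by (intro CollectI exI[of _ "\<lambda>_. r"] exI[of _ "\<lambda>_. 1"]) auto
next
  fix f g :: "'a \<Rightarrow> real" assume "f \<in> regular_functions" "g \<in> regular_functions"
  then obtain P Q P' Q' where *: "real_polynomial_function P" "real_polynomial_function Q"
    "\<forall>x. Q x \<noteq> 0" "f = (\<lambda>x. P x / Q x)" "real_polynomial_function P'" "real_polynomial_function Q'"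
    "\<forall>x. Q' x \<noteq> 0" "g = (\<lambda>x. P' x / Q' x)" unfolding regular_functions_def by blast
  show "(\<lambda>x. f x + g x) \<in> regular_functions"
    unfolding regular_functions_def using *
    by (intro CollectI exI[of _ "\<lambda>x. P x * Q' x + P' x * Q x"] exI[of _ "\<lambda>x. Q x * Q' x"])
       (auto simp: fun_eq_iff field_simps)
  show "(\<lambda>x. f x * g x) \<in> regular_functions"
    unfolding regular_functions_def using *
    by (intro CollectI exI[of _ "\<lambda>x. P x * P' x"] exI[of _ "\<lambda>x. Q x * Q' x"]) auto
qed

text \<open>The \<open>D\<close>-th power of every denominator clears all monomials with exponents
  up to \<open>D\<close> at the same time, at a cost in degree that is linear in
  \<open>D\<close>.\<close>

lemma mon_common_denominator:
  assumes "\<forall>g\<in>set gs. \<exists>P Q. P \<in> box_poly L \<and> Q \<in> box_poly L \<and> (\<forall>x. Q x \<noteq> 0) \<and> g = (\<lambda>x. P x / Q x)"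
  shows "\<exists>q. (\<forall>x. q x \<noteq> 0) \<and>
    (\<forall>as\<in>exps (length gs) D. (\<lambda>x. q x * mon gs as x) \<in> box_poly (length gs * (D * L)))"
  using assms
proof (induction gs)
  case Nil
  then show ?case by (intro exI[of _ "\<lambda>_. 1"]) (auto simp: exps_0 box_poly_const)
next
  case (Cons g gs)
  then obtain q where q: "\<forall>x. q x \<noteq> 0"
    "\<forall>as\<in>exps (length gs) D. (\<lambda>x. q x * mon gs as x) \<in> box_poly (length gs * (D * L))" by auto
  obtain P Q where PQ: "P \<in> box_poly L" "Q \<in> box_poly L" "\<forall>x. Q x \<noteq> 0" "g = (\<lambda>x. P x / Q x)"
    using Cons.prems by auto
  show ?case
  proof (intro exI[of _ "\<lambda>x. Q x ^ D * q x"] conjI ballI)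
    fix as assume "as \<in> exps (length (g # gs)) D"
    then obtain a bs where as: "as = a # bs" "a \<le> D" "bs \<in> exps (length gs) D"
      by (auto simp: exps_Suc)
    have "(\<lambda>x. P x ^ a * Q x ^ (D - a)) \<in> box_poly (a * L + (D - a) * L)"
      by (intro box_poly_mult box_poly_power PQ)
    also have "a * L + (D - a) * L = D * L" using as(2) by (simp flip: distrib_right)
    finally have "(\<lambda>x. (P x ^ a * Q x ^ (D - a)) * (q x * mon gs bs x))
        \<in> box_poly (D * L + length gs * (D * L))"
      using q(2) as(3) by (intro box_poly_mult) auto
    moreover have "(P x ^ a * Q x ^ (D - a)) * (q x * mon gs bs x) = Q x ^ D * q x * mon (g # gs) as x" for x
    proof -
      have "Q x ^ D = Q x ^ (D - a) * Q x ^ a" using as(2) by (simp flip: power_add)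
      then show ?thesis using PQ(3) by (simp add: as(1) PQ(4) power_divide field_simps)
    qed
    ultimately show "(\<lambda>x. Q x ^ D * q x * mon (g # gs) as x) \<in> box_poly (length (g # gs) * (D * L))"
      by simp
  qed (use PQ(3) q(1) in simp)
qed

text \<open>With \<open>e\<close> independent functions there are \<open>(D + 1) ^ e\<close>
  independent monomials. After multiplication by a common denominator they lie in a space of
  dimension of order \<open>D ^ N\<close>, which is impossible for \<open>e > N\<close> and large
  \<open>D\<close>.\<close>

theorem indep_length_le_DIM:
  fixes gs :: "('a::euclidean_space \<Rightarrow> real) list"
  assumes ind: "indep UNIV gs" and reg: "set gs \<subseteq> regular_functions"
  shows "length gs \<le> DIM('a)"
proof (rule ccontr)
  assume neg: "\<not> ?thesis"
  define e where "e = length gs"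
  define N where "N = DIM('a)"
  have e: "N < e" using neg by (simp add: e_def N_def)
  have "\<forall>g\<in>set gs. \<exists>L P Q. P \<in> box_poly L \<and> Q \<in> box_poly L \<and> (\<forall>x. Q x \<noteq> 0) \<and> g = (\<lambda>x. P x / Q x)"
  proof
    fix g assume "g \<in> set gs"
    then obtain P Q where PQ: "real_polynomial_function P" "real_polynomial_function Q"
      "\<forall>x. Q x \<noteq> 0" "g = (\<lambda>x. P x / Q x)" using reg unfolding regular_functions_def by blast
    obtain L L' where "P \<in> box_poly L" "Q \<in> box_poly L'" using PQ polynomial_box_poly by metis
    then have "P \<in> box_poly (max L L')" "Q \<in> box_poly (max L L')"
      using box_poly_mono[of L "max L L'"] box_poly_mono[of L' "max L L'"] by auto
    then show "\<exists>L P Q. P \<in> box_poly L \<and> Q \<in> box_poly L \<and> (\<forall>x. Q x \<noteq> 0) \<and> g = (\<lambda>x. P x / Q x)"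
      using PQ by blast
  qed
  from bchoice[OF this] obtain Lf where Lf: "\<forall>g\<in>set gs. \<exists>P Q. P \<in> box_poly (Lf g) \<and>
    Q \<in> box_poly (Lf g) \<and> (\<forall>x. Q x \<noteq> 0) \<and> g = (\<lambda>x. P x / Q x)" ..
  define L where "L = (\<Sum>g\<in>set gs. Lf g)"
  have L: "\<forall>g\<in>set gs. \<exists>P Q. P \<in> box_poly L \<and> Q \<in> box_poly L \<and> (\<forall>x. Q x \<noteq> 0) \<and> g = (\<lambda>x. P x / Q x)"
  proof
    fix g assume g: "g \<in> set gs"
    then have "Lf g \<le> L" unfolding L_def by (intro member_le_sum) auto
    then have "box_poly (Lf g) \<subseteq> (box_poly L :: ('a \<Rightarrow> real) set)" by (rule box_poly_mono)
    then show "\<exists>P Q. P \<in> box_poly L \<and> Q \<in> box_poly L \<and> (\<forall>x. Q x \<noteq> 0) \<and> g = (\<lambda>x. P x / Q x)"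
      using Lf[rule_format, OF g] by blast
  qed
  have bound: "(D + 1) ^ e \<le> (e * (D * L) + 1) ^ N" for D
  proof -
    obtain q where q: "\<forall>x. q x \<noteq> 0"
      "\<forall>as\<in>exps e D. (\<lambda>x. q x * mon gs as x) \<in> box_poly (e * (D * L))"
      using mon_common_denominator[OF L, of D] unfolding e_def by (elim exE conjE)
    define v where "v as = (\<lambda>x. q x * mon gs as x)" for as
    have zero: "c as = 0" if "\<forall>x. (\<Sum>as\<in>exps e D. c as * v as x) = 0" "as \<in> exps e D" for c as
    proof (rule mon_independent[OF _ ind, where D = D and c = c])
      have "(\<Sum>as\<in>exps e D. c as * v as x) = q x * (\<Sum>as\<in>exps e D. c as * mon gs as x)" for x
        by (simp add: v_def sum_distrib_left mult_ac)
      then show "\<forall>x\<in>UNIV. (\<Sum>as\<in>exps (length gs) D. c as * mon gs as x) = 0"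
        using that(1) q(1) by (auto simp: e_def)
    qed (use that in \<open>auto simp: e_def\<close>)
    have inj: "inj_on v (exps e D)"
    proof
      fix as bs assume *: "as \<in> exps e D" "bs \<in> exps e D" "v as = v bs"
      show "as = bs"
      proof (rule ccontr)
        assume "as \<noteq> bs"
        define c where "c l = (if l = as then 1 else if l = bs then -1 else (0::real))" for l
        have "(\<Sum>l\<in>exps e D. c l * v l x) = (\<Sum>l\<in>{as, bs}. c l * v l x)" for x
          using * by (intro sum.mono_neutral_cong_right) (auto simp: finite_exps c_def)
        also have "\<dots> x = 0" for x using \<open>as \<noteq> bs\<close> *(3) by (simp add: c_def)
        finally have "\<forall>x. (\<Sum>l\<in>exps e D. c l * v l x) = 0" by simp
        from zero[OF this *(1)] show False by (simp add: c_def)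
      qed
    qed
    have "fun_space.independent (v ` exps e D)"
    proof (rule fun_space.independent_if_scalars_zero)
      fix u w assume u: "(\<Sum>w\<in>v ` exps e D. (\<lambda>x. u w * w x)) = 0" and "w \<in> v ` exps e D"
      then obtain as where as: "as \<in> exps e D" "w = v as" by auto
      have "(\<Sum>as\<in>exps e D. u (v as) * v as x) = 0" for x
      proof -
        have "(\<Sum>w\<in>v ` exps e D. (\<lambda>x. u w * w x)) x = 0" using u by simp
        then show ?thesis by (simp add: sum_fun_apply sum.reindex[OF inj])
      qed
      then show "u w = 0" using zero[of "\<lambda>as. u (v as)" as] as by simp
    qed (simp add: finite_exps)
    moreover have "v ` exps e D \<subseteq> box_poly (e * (D * L))" using q(2) by (auto simp: v_def)
    ultimately have "card (v ` exps e D) \<le> card (boxmons (e * (D * L)) :: ('a \<Rightarrow> real) set)"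
      using fun_space.independent_span_bound[OF finite_boxmons] by blast
    also have "\<dots> \<le> (e * (D * L) + 1) ^ N" unfolding N_def by (rule card_boxmons)
    finally show ?thesis by (simp add: card_image[OF inj] card_exps)
  qed
  \<comment> \<open>With this \<open>D\<close> the counting bound reads
    \<open>(D + 1) ^ N * (D + 1) \<le> (D + 1) ^ N * D\<close>.\<close>
  define D where "D = (e * L + 1) ^ N"
  have "(D + 1) ^ N * (D + 1) \<le> (D + 1) ^ N * (D + 1) ^ (e - N)"
    using e by (intro mult_left_mono) (auto intro: self_le_power)
  also have "\<dots> = (D + 1) ^ e" using e by (simp flip: power_add)
  also have "\<dots> \<le> (e * (D * L) + 1) ^ N" by (rule bound)
  also have "\<dots> \<le> ((e * L + 1) * (D + 1)) ^ N"
    by (intro power_mono) (auto simp: algebra_simps)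
  also have "\<dots> = (D + 1) ^ N * (e * L + 1) ^ N" by (simp only: power_mult_distrib mult.commute)
  also have "(e * L + 1) ^ N = D" by (simp only: D_def)
  finally show False by simp
qed

section \<open>Regular functions and maps\<close>

definition regular_map :: "('a::real_normed_vector \<Rightarrow> 'b::euclidean_space) \<Rightarrow> bool" where
  "regular_map g \<longleftrightarrow> (\<forall>b\<in>Basis. (\<lambda>x. g x \<bullet> b) \<in> regular_functions)"

lemma polynomial_regular: "real_polynomial_function p \<Longrightarrow> p \<in> regular_functions"
  unfolding regular_functions_def by (intro CollectI exI[of _ p] exI[of _ "\<lambda>_. 1"]) auto

text \<open>Reduces statements about zeros of regular functions to polynomials, for which the
  Zariski closure is defined.\<close>

lemma regular_numerator:
  assumes "f \<in> regular_functions"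
  shows "\<exists>P. real_polynomial_function P \<and> (\<forall>x. P x = 0 \<longleftrightarrow> f x = 0)"
  using assms unfolding regular_functions_def by fastforce

lemma regular_divide:
  assumes "f \<in> regular_functions" "g \<in> regular_functions" "\<And>x. g x \<noteq> 0"
  shows "(\<lambda>x. f x / g x) \<in> regular_functions"
proof -
  obtain P Q P' Q' where *: "real_polynomial_function P" "real_polynomial_function Q"
    "\<forall>x. Q x \<noteq> 0" "f = (\<lambda>x. P x / Q x)" "real_polynomial_function P'" "real_polynomial_function Q'"
    "\<forall>x. Q' x \<noteq> 0" "g = (\<lambda>x. P' x / Q' x)" using assms(1,2) unfolding regular_functions_def by blast
  moreover have "\<forall>x. P' x \<noteq> 0" using assms(3) *(8) by auto
  ultimately show ?thesis unfolding regular_functions_def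
    by (intro CollectI exI[of _ "\<lambda>x. P x * Q' x"] exI[of _ "\<lambda>x. Q x * P' x"]) auto
qed

lemma polynomial_compose_regular:
  assumes g: "regular_map (g :: 'a::real_normed_vector \<Rightarrow> 'b::euclidean_space)" and p: "real_polynomial_function p"
  shows "(\<lambda>x. p (g x)) \<in> regular_functions"
  using p
proof (induction rule: real_polynomial_function.induct)
  case (linear f)
  then interpret bounded_linear f .
  have "f (g x) = (\<Sum>b\<in>Basis. f b * (g x \<bullet> b))" for x
  proof -
    have "f (g x) = f (\<Sum>b\<in>Basis. (g x \<bullet> b) *\<^sub>R b)" by (simp add: euclidean_representation)
    also have "\<dots> = (\<Sum>b\<in>Basis. f b * (g x \<bullet> b))" by (simp add: sum scaleR mult.commute)
    finally show ?thesis .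
  qed
  then have "(\<lambda>x. f (g x)) = (\<lambda>x. \<Sum>b\<in>Basis. f b * (g x \<bullet> b))" by (rule ext)
  also have "\<dots> \<in> regular_functions"
    using g unfolding regular_map_def
    by (intro fun_ring_sum[OF fun_ring_regular] fun_ringD(3)[OF fun_ring_regular]
        fun_ringD(1)[OF fun_ring_regular]) auto
  finally show ?case .
qed (auto intro: fun_ringD[OF fun_ring_regular])

lemma regular_compose:
  assumes g: "regular_map (g :: 'a::real_normed_vector \<Rightarrow> 'b::euclidean_space)" and f: "f \<in> regular_functions"
  shows "(\<lambda>x. f (g x)) \<in> regular_functions"
proof -
  obtain P Q where *: "real_polynomial_function P" "real_polynomial_function Q"
    "\<forall>x. Q x \<noteq> 0" "f = (\<lambda>x. P x / Q x)" using f unfolding regular_functions_def by blast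
  have "(\<lambda>x. P (g x) / Q (g x)) \<in> regular_functions"
    by (intro regular_divide polynomial_compose_regular[OF g] *) (use *(3) in auto)
  then show ?thesis by (simp add: *(4))
qed

lemma regular_map_compose:
  "regular_map g \<Longrightarrow> regular_map h \<Longrightarrow> regular_map (\<lambda>x. h (g x))"
  unfolding regular_map_def[of h] regular_map_def[of "\<lambda>x. h (g x)"]
  using regular_compose by blast

lemma regular_map_Pair:
  assumes "regular_map g" "regular_map h"
  shows "regular_map (\<lambda>x. (g x, h x))"
  using assms by (auto simp: regular_map_def Basis_prod_def)

lemma regular_map_const: "regular_map (\<lambda>_. c)"
  by (simp add: regular_map_def fun_ringD(1)[OF fun_ring_regular])

lemma regular_map_linear:
  assumes "bounded_linear g" shows "regular_map g"
  unfolding regular_map_def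
proof
  fix b show "(\<lambda>x. g x \<bullet> b) \<in> regular_functions"
    by (intro polynomial_regular real_polynomial_function.intros(1)
        bounded_linear_compose[OF bounded_linear_inner_left assms])
qed

lemma regular_map_add:
  assumes "regular_map g" "regular_map h"
  shows "regular_map (\<lambda>x. g x + h x)"
  using assms by (auto simp: regular_map_def inner_add_left intro: fun_ringD(2)[OF fun_ring_regular])

lemma regular_on_UNIV_map:
  assumes "regular_on UNIV (g :: 'a::euclidean_space \<Rightarrow> real ^ 'n)"
  shows "regular_map g"
  unfolding regular_map_def
proof
  fix b :: "real ^ 'n" assume "b \<in> Basis"
  then obtain i where b: "b = axis i 1" by (auto simp: Basis_vec_def)
  obtain P Q where "real_polynomial_function P" "real_polynomial_function Q"
    "\<forall>x\<in>UNIV. Q x \<noteq> 0 \<and> g x $ i = P x / Q x"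
    using assms unfolding regular_on_def by (elim allE[of _ i] exE conjE)
  moreover from this have "(\<lambda>x. g x \<bullet> b) = (\<lambda>x. P x / Q x)" by (simp add: b inner_axis)
  ultimately show "(\<lambda>x. g x \<bullet> b) \<in> regular_functions" unfolding regular_functions_def by blast
qed

lemma regular_continuous:
  assumes "f \<in> regular_functions" shows "continuous_on S f"
proof -
  obtain P Q where *: "real_polynomial_function P" "real_polynomial_function Q"
    "\<forall>x. Q x \<noteq> 0" "f = (\<lambda>x. P x / Q x)" using assms unfolding regular_functions_def by blast
  then show ?thesis
    unfolding *(4) real_polynomial_function_eq
    by (intro continuous_on_divide continuous_on_polymonial_function) auto
qed

lemma regular_real_zero:
  fixes f :: "real \<Rightarrow> real"
  assumes "f \<in> regular_functions" "infinite {t. f t = 0}"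
  shows "f t = 0"
proof -
  obtain P where P: "real_polynomial_function P" "\<forall>x. P x = 0 \<longleftrightarrow> f x = 0"
    using regular_numerator[OF assms(1)] by (elim exE conjE)
  obtain c n where c: "P = (\<lambda>x. \<Sum>i\<le>n. c i * x ^ i)"
    using P(1) unfolding real_polynomial_function_iff_sum by (elim exE)
  have "infinite {x. (\<Sum>i\<le>n. c i * x ^ i) = 0}" using assms(2) P(2) by (simp add: c)
  then have "\<forall>i\<le>n. c i = 0" by (simp add: Transcendental.polyfun_finite_roots)
  then show ?thesis using P(2) by (simp add: c)
qed

lemma regular_map_line: "regular_map (\<lambda>t::real. x + t *\<^sub>R v)"
  by (intro regular_map_add regular_map_const regular_map_linear bounded_linear_intros)

text \<open>On the line from a point of \<open>S\<close> to \<open>y\<close> the function is a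
  regular function of one real variable with infinitely many zeros.\<close>

lemma regular_eq_0_open:
  fixes f :: "'a::euclidean_space \<Rightarrow> real"
  assumes f: "f \<in> regular_functions" and S: "open S" "S \<noteq> {}" and zero: "\<And>x. x \<in> S \<Longrightarrow> f x = 0"
  shows "f y = 0"
proof -
  obtain x where "x \<in> S" using S by auto
  have g: "(\<lambda>t. f (x + t *\<^sub>R (y - x))) \<in> regular_functions"
    by (rule regular_compose[OF regular_map_line f])
  have "open ((\<lambda>t. x + t *\<^sub>R (y - x)) -` S)"
    by (intro open_vimage S(1) continuous_intros)
  moreover have "0 \<in> (\<lambda>t. x + t *\<^sub>R (y - x)) -` S" using \<open>x \<in> S\<close> by simp
  ultimately have "infinite ((\<lambda>t. x + t *\<^sub>R (y - x)) -` S)"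
    by (metis finite_imp_not_open empty_iff)
  moreover have "(\<lambda>t. x + t *\<^sub>R (y - x)) -` S \<subseteq> {t. f (x + t *\<^sub>R (y - x)) = 0}"
    using zero by auto
  ultimately have "infinite {t. f (x + t *\<^sub>R (y - x)) = 0}" using finite_subset by blast
  from regular_real_zero[OF g this, of 1] show ?thesis by simp
qed

text \<open>Generic points: the zero set of a nonzero regular function has no interior, so finitely
  many of them can be avoided one after the other within an open set.\<close>

lemma regular_nonzero_point:
  fixes f :: "'i \<Rightarrow> 'a::euclidean_space \<Rightarrow> real"
  assumes "finite I" and f: "\<And>i. i \<in> I \<Longrightarrow> f i \<in> regular_functions"
    and nz: "\<And>i. i \<in> I \<Longrightarrow> \<exists>x. f i x \<noteq> 0" and S: "open S" "S \<noteq> {}"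
  shows "\<exists>x\<in>S. \<forall>i\<in>I. f i x \<noteq> 0"
  using assms(1) f nz
proof (induction I)
  case empty
  then show ?case using S by auto
next
  case (insert j I)
  let ?O = "S \<inter> (\<Inter>i\<in>I. f i -` (- {0}))"
  have "open ?O" using insert.hyps(1) S(1)
    by (intro open_Int open_INT ballI open_vimage regular_continuous insert.prems) auto
  moreover have "?O \<noteq> {}" using insert.IH insert.prems by auto
  ultimately have "\<exists>x\<in>?O. f j x \<noteq> 0"
    using regular_eq_0_open[of "f j" ?O] insert.prems(1,2)[of j] by (metis insertI1)
  then show ?case by auto
qed

lemma regular_domain:
  fixes f g :: "'a::euclidean_space \<Rightarrow> real"
  assumes f: "f \<in> regular_functions" and g: "g \<in> regular_functions" and "\<And>x. f x * g x = 0"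
  shows "(\<forall>x. f x = 0) \<or> (\<forall>x. g x = 0)"
proof (rule ccontr)
  assume "\<not> ?thesis"
  then have "\<exists>x\<in>UNIV. \<forall>i\<in>{True, False}. (if i then f else g) x \<noteq> 0"
    using f g by (intro regular_nonzero_point) auto
  then show False using assms(3) by auto
qed

lemma trajectory_regular:
  fixes \<phi> :: "'a::euclidean_space \<times> 'b::euclidean_space \<Rightarrow> 'a"
  assumes "regular_map \<phi>" "\<And>i. i < k \<Longrightarrow> regular_map (\<lambda>x. w x i)" "regular_map z"
  shows "regular_map (\<lambda>x. trajectory \<phi> (z x) (w x) k)"
  using assms(2,3)
proof (induction k)
  case (Suc k)
  then have "regular_map (\<lambda>x. (trajectory \<phi> (z x) (w x) k, w x k))"
    by (intro regular_map_Pair) auto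
  from regular_map_compose[OF this assms(1)] show ?case by simp
qed simp

lemma trajectory_Suc_shift:
  "trajectory F z y (Suc k) = trajectory F (F (z, y 0)) (\<lambda>i. y (Suc i)) k"
  by (induction k) auto

lemma trajectory_cong:
  "(\<And>i. i < k \<Longrightarrow> y i = y' i) \<Longrightarrow> trajectory F z y k = trajectory F z y' k"
  by (induction k) auto

lemma C1_on_continuous: "C1_on S f \<Longrightarrow> continuous_on S f"
  unfolding C1_on_def
  by (auto intro!: continuous_at_imp_continuous_on dest: has_derivative_continuous)

section \<open>The orbit of an attracting point\<close>

locale attracting_system =
  fixes V U :: "(real ^ 'n) set" and F :: "(real ^ 'n) \<times> (real ^ 'm) \<Rightarrow> real ^ 'n"
    and f :: "(real ^ 'n) \<times> (real ^ 'm) \<Rightarrow> real ^ 'm"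
    and \<phi> :: "(real ^ 'n) \<times> (real ^ 'm) \<Rightarrow> real ^ 'n"
    and E :: "(real ^ 'm) set" and a :: "real ^ 'm" and T :: "real ^ 'n"
  assumes V: "algebraic_variety V" and U: "open U" and F_U: "F ` (U \<times> UNIV) \<subseteq> U"
    and F_C1: "C1_on (U \<times> UNIV) F" and f_C1: "C1_on (U \<times> UNIV) f"
    and F_eq: "\<And>z y. z \<in> U \<Longrightarrow> F (z, y) = \<phi> (z, f (z, y))"
    and \<phi>_VU: "\<phi> ` ((V \<inter> U) \<times> UNIV) \<subseteq> V \<inter> U"
    and \<phi>: "regular_on UNIV \<phi>"
    and diffeo: "\<And>z. z \<in> U \<Longrightarrow> C1_diffeomorphism (\<lambda>y. f (z, y))"
    and inv_cont: "continuous_on (U \<times> UNIV) (\<lambda>(z, y). inv (\<lambda>u. f (z, u)) y)"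
    and a: "a \<in> interior E" and T: "T \<in> V \<inter> U"
    and attracting: "\<And>z. z \<in> V \<inter> U \<Longrightarrow> (\<lambda>t. trajectory F z (\<lambda>_. a) t) \<longlonglongrightarrow> T"
begin

text \<open>In the inputs \<open>u\<^sub>i = f(z\<^sub>i, y\<^sub>i)\<close> the system is the regular map \<open>\<phi>\<close>, and every input sequence
  is admissible; this is the orbit after \<open>k\<close> steps without the restriction of the noise to \<open>E\<close>.\<close>

definition S :: "nat \<Rightarrow> (real ^ 'n) set" where
  "S k = range (\<lambda>u. trajectory \<phi> T u k)"

definition W :: "(real ^ 'n) set" where
  "W = zariski_closure (orbit F E T)"

lemma \<phi>_regular: "regular_map \<phi>"
  by (rule regular_on_UNIV_map[OF \<phi>])

lemma F_cont: "continuous_on (U \<times> UNIV) F" and f_cont: "continuous_on (U \<times> UNIV) f"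
  using F_C1 f_C1 C1_on_continuous by blast+

text \<open>The limit of an iteration of a continuous map is a fixed point.\<close>

lemma F_T: "F (T, a) = T"
proof -
  let ?x = "\<lambda>t. trajectory F T (\<lambda>_. a) t"
  have lim: "?x \<longlonglongrightarrow> T" by (rule attracting[OF T])
  have "isCont F (T, a)"
    using F_cont continuous_on_eq_continuous_at[of "U \<times> (UNIV :: (real ^ 'm) set)" F] U T
    by (auto simp: open_Times)
  then have "(\<lambda>t. F (?x t, a)) \<longlonglongrightarrow> F (T, a)"
    by (rule isCont_tendsto_compose) (intro tendsto_intros lim)
  moreover have "(\<lambda>t. F (?x t, a)) \<longlonglongrightarrow> T" using LIMSEQ_Suc[OF lim] by simp
  ultimately show ?thesis by (rule LIMSEQ_unique)
qed

lemma F_VU: "z \<in> V \<inter> U \<Longrightarrow> F (z, y) \<in> V \<inter> U"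
  using \<phi>_VU F_eq[of z y] by auto

lemma trajectory_U: "z \<in> U \<Longrightarrow> trajectory F z y k \<in> U"
  using F_U by (induction k) auto

lemma trajectory_VU: "z \<in> V \<inter> U \<Longrightarrow> trajectory F z y k \<in> V \<inter> U"
  using F_VU by (induction k) auto

lemma trajectory_F_eq:
  "z \<in> U \<Longrightarrow> trajectory F z y k = trajectory \<phi> z (\<lambda>i. f (trajectory F z y i, y i)) k"
proof (induction k)
  case (Suc k)
  then show ?case using F_eq[OF trajectory_U[of z y k], of "y k"] by simp
qed simp

lemma S_VU: "S k \<subseteq> V \<inter> U"
proof -
  have "trajectory \<phi> T u k \<in> V \<inter> U" for u
    by (induction k) (use T \<phi>_VU in auto)
  then show ?thesis by (auto simp: S_def)
qed

lemma f_inv: "z \<in> U \<Longrightarrow> f (z, inv (\<lambda>y. f (z, y)) u) = u"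
  using diffeo[of z] unfolding C1_diffeomorphism_def
  by (auto dest!: bij_is_surj intro: surj_f_inv_f[of "\<lambda>y. f (z, y)"])

lemma inv_f: "z \<in> U \<Longrightarrow> inv (\<lambda>y. f (z, y)) (f (z, y)) = y"
  using diffeo[of z] unfolding C1_diffeomorphism_def
  by (auto dest!: bij_is_inj intro: inv_f_f[of "\<lambda>y. f (z, y)"])

lemma trajectory_S: "z \<in> U \<Longrightarrow> trajectory F T y k \<in> S k"
  using T trajectory_F_eq[of T y k] by (auto simp: S_def)

text \<open>The inputs are freed one at a time, beginning with the last. For a fixed past, noise
  from the interior of \<open>E\<close> yields a nonempty open set of inputs, and a regular function
  vanishing on that set vanishes identically.\<close>

lemma regular_vanish_S:
  assumes "p \<in> regular_functions" "\<And>y. (\<forall>i<k. y i \<in> E) \<Longrightarrow> p (trajectory F T y k) = 0" "z \<in> S k"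
  shows "p z = 0"
  using assms
proof (induction k arbitrary: p z)
  case (Suc k)
  have zero: "p (\<phi> (trajectory F T y k, u)) = 0" if y: "\<forall>i<k. y i \<in> E" for y u
  proof -
    let ?z = "trajectory F T y k"
    have z: "?z \<in> U" using trajectory_U T by auto
    have reg: "(\<lambda>u. p (\<phi> (?z, u))) \<in> regular_functions"
      by (intro regular_compose[OF _ Suc.prems(1)] regular_map_compose[OF _ \<phi>_regular]
          regular_map_Pair regular_map_const regular_map_linear bounded_linear_ident)
    \<comment> \<open>The inputs that are realised by noise in the interior of \<open>E\<close>, at
      the current state.\<close>
    let ?O = "inv (\<lambda>y. f (?z, y)) -` interior E"
    have "continuous_on UNIV (inv (\<lambda>y. f (?z, y)))"
      using diffeo[OF z] by (auto simp: C1_diffeomorphism_def intro: C1_on_continuous)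
    then have "open ?O" by (intro open_vimage) auto
    moreover have "f (?z, a) \<in> ?O" using inv_f[OF z] a by simp
    moreover have "p (\<phi> (?z, v)) = 0" if "v \<in> ?O" for v
    proof -
      let ?y = "inv (\<lambda>y. f (?z, y)) v"
      define y' where "y' = y(k := ?y)"
      have "trajectory F T y' k = ?z" by (rule trajectory_cong) (auto simp: y'_def)
      then have "trajectory F T y' (Suc k) = \<phi> (?z, v)"
        using F_eq[OF z, of ?y] f_inv[OF z] by (simp add: y'_def)
      moreover have "\<forall>i<Suc k. y' i \<in> E"
        using y that interior_subset[of E] by (auto simp: less_Suc_eq y'_def)
      ultimately show ?thesis using Suc.prems(2)[of y'] by (simp only:)
    qed
    ultimately show ?thesis using regular_eq_0_open[OF reg, of ?O u] by blast
  qed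
  obtain u where u: "z = \<phi> (trajectory \<phi> T u k, u k)" using Suc.prems(3) by (auto simp: S_def)
  have "(\<lambda>z. p (\<phi> (z, u k))) \<in> regular_functions"
    by (intro regular_compose[OF _ Suc.prems(1)] regular_map_compose[OF _ \<phi>_regular]
        regular_map_Pair regular_map_const regular_map_linear bounded_linear_ident)
  from Suc.IH[OF this zero, of "trajectory \<phi> T u k"] show ?case by (simp add: u S_def)
qed (auto simp: S_def)

text \<open>\<open>T\<close> is fixed under the input \<open>f (T, a)\<close>, so this input can be
  prepended to any sequence.\<close>

lemma S_Suc: "S k \<subseteq> S (Suc k)"
proof
  fix z assume "z \<in> S k"
  then obtain u where u: "z = trajectory \<phi> T u k" by (auto simp: S_def)
  have "\<phi> (T, f (T, a)) = T" using F_T F_eq[of T a] T by simp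
  then have "trajectory \<phi> T (case_nat (f (T, a)) u) (Suc k) = z"
    by (simp add: trajectory_Suc_shift u del: trajectory.simps)
  then show "z \<in> S (Suc k)" unfolding S_def by blast
qed

lemma S_mono: "j \<le> k \<Longrightarrow> S j \<subseteq> S k"
  by (rule lift_Suc_mono_le[of S, OF S_Suc])

lemma regular_vanish_orbit:
  assumes p: "p \<in> regular_functions"
  shows "(\<forall>z\<in>orbit F E T. p z = 0) \<longleftrightarrow> (\<forall>k. \<forall>z\<in>S k. p z = 0)"
proof
  assume orb: "\<forall>z\<in>orbit F E T. p z = 0"
  \<comment> \<open>The orbit begins at time 1 while \<open>S 0\<close> is \<open>{T}\<close>; the
    inclusion \<open>S 0 \<subseteq> S 1\<close> bridges the gap.\<close>
  have "p z = 0" if "z \<in> S (Suc k)" for k z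
  proof (rule regular_vanish_S[OF p _ that])
    fix y assume "\<forall>i<Suc k. y i \<in> E"
    then have "trajectory F T y (Suc k) \<in> orbit F E T" unfolding orbit_def by force
    then show "p (trajectory F T y (Suc k)) = 0" using orb by blast
  qed
  then show "\<forall>k. \<forall>z\<in>S k. p z = 0" using S_Suc by blast
next
  assume *: "\<forall>k. \<forall>z\<in>S k. p z = 0"
  show "\<forall>z\<in>orbit F E T. p z = 0"
  proof
    fix z assume "z \<in> orbit F E T"
    then obtain k y where "z = trajectory F T y k" by (auto simp: orbit_def)
    then have "z \<in> S k" using trajectory_S T by auto
    then show "p z = 0" using * by blast
  qed
qed

text \<open>Two points of \<open>S k\<close> where \<open>p\<close> and \<open>q\<close>,
  respectively, do not vanish come from two input sequences. On the line joining these sequences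
  \<open>p\<close> and \<open>q\<close> become regular functions of one variable, which form a
  domain.\<close>

lemma S_prime:
  assumes p: "p \<in> regular_functions" and q: "q \<in> regular_functions"
    and pq: "\<And>z. z \<in> S k \<Longrightarrow> p z * q z = 0"
  shows "(\<forall>z\<in>S k. p z = 0) \<or> (\<forall>z\<in>S k. q z = 0)"
proof (rule ccontr)
  assume "\<not> ?thesis"
  then obtain u v where u: "p (trajectory \<phi> T u k) \<noteq> 0" and v: "q (trajectory \<phi> T v k) \<noteq> 0"
    by (auto simp: S_def)
  define w where "w t i = u i + t *\<^sub>R (v i - u i)" for t :: real and i
  have w: "regular_map (\<lambda>t. trajectory \<phi> T (w t) k)"
    unfolding w_def by (intro trajectory_regular \<phi>_regular regular_map_line regular_map_const)
  have "p (trajectory \<phi> T (w t) k) * q (trajectory \<phi> T (w t) k) = 0" for t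
    by (rule pq) (auto simp: S_def)
  from regular_domain[OF regular_compose[OF w p] regular_compose[OF w q] this]
  have "p (trajectory \<phi> T (w 0) k) = 0 \<or> q (trajectory \<phi> T (w 1) k) = 0" by auto
  moreover have "w 0 = u" "w 1 = v" by (auto simp: w_def)
  ultimately show False using u v by simp
qed

section \<open>The variety \<open>W\<close> and its invariance\<close>

lemma W_iff: "z \<in> W \<longleftrightarrow> (\<forall>p. real_polynomial_function p \<longrightarrow> (\<forall>k. \<forall>x\<in>S k. p x = 0) \<longrightarrow> p z = 0)"
  unfolding W_def zariski_closure_eq vanishing_def
  using regular_vanish_orbit[OF polynomial_regular] by blast

lemma S_W: "S k \<subseteq> W"
  using W_iff by blast

lemma regular_vanish_W:
  assumes "p \<in> regular_functions" "\<And>k z. z \<in> S k \<Longrightarrow> p z = 0" "z \<in> W"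
  shows "p z = 0"
proof -
  obtain P where "real_polynomial_function P" "\<forall>x. P x = 0 \<longleftrightarrow> p x = 0"
    using regular_numerator[OF assms(1)] by (elim exE conjE)
  then show ?thesis using assms(2,3) W_iff by blast
qed

lemma algebraic_set_W: "algebraic_set W"
  unfolding W_def zariski_closure_eq
  by (rule algebraic_set_zeros) (auto simp: vanishing_def)

text \<open>A proper algebraic subset misses part of some \<open>S k\<close>. For two such subsets
  covering \<open>W\<close>, the product of the separating polynomials would vanish on the larger of
  the two reachable sets, against \<open>S_prime\<close>.\<close>

theorem W_variety: "algebraic_variety W"
  unfolding algebraic_variety_def
proof (intro conjI notI algebraic_set_W, elim exE conjE)
  fix A B assume A: "algebraic_set A" "A \<subset> W" and B: "algebraic_set B" "B \<subset> W" and AB: "W = A \<union> B"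
  have *: "\<exists>p k. real_polynomial_function p \<and> (\<forall>x\<in>A. p x = 0) \<and> \<not> (\<forall>x\<in>S k. p x = 0)"
    if A: "algebraic_set A" "A \<subset> W" for A
  proof -
    obtain P where P: "\<forall>p\<in>P. real_polynomial_function p" "A = {x. \<forall>p\<in>P. p x = 0}"
      using A(1) unfolding algebraic_set_def by (elim exE conjE)
    obtain x where x: "x \<in> W" "x \<notin> A" using A(2) by auto
    then obtain p where p: "p \<in> P" "p x \<noteq> 0" using P(2) by auto
    have "real_polynomial_function p" using P(1) p(1) by blast
    moreover have "\<forall>x\<in>A. p x = 0" using P(2) p(1) by auto
    moreover have "\<exists>k. \<not> (\<forall>x\<in>S k. p x = 0)"
      using W_iff[THEN iffD1, OF x(1), rule_format, OF \<open>real_polynomial_function p\<close>] p(2) by auto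
    ultimately show ?thesis by (elim exE) (intro exI conjI)
  qed
  obtain p j where p: "real_polynomial_function p" "\<forall>x\<in>A. p x = 0" "\<not> (\<forall>x\<in>S j. p x = 0)"
    using *[OF A] by blast
  obtain q k where q: "real_polynomial_function q" "\<forall>x\<in>B. q x = 0" "\<not> (\<forall>x\<in>S k. q x = 0)"
    using *[OF B] by blast
  have "p z * q z = 0" if z: "z \<in> S (max j k)" for z
  proof -
    have "z \<in> A \<union> B" using z S_W AB by blast
    then show ?thesis using p(2) q(2) by auto
  qed
  from S_prime[OF polynomial_regular[OF p(1)] polynomial_regular[OF q(1)] this]
  show False using p(3) q(3) S_mono[of j "max j k"] S_mono[of k "max j k"] by (meson max.cobounded1 max.cobounded2 subsetD)
qed

text \<open>For a fixed input, a polynomial vanishing on every \<open>S k\<close> stays so after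
  composition with \<open>\<phi>\<close>, because one more step leads from \<open>S k\<close> to
  \<open>S (Suc k)\<close>.\<close>

lemma \<phi>_W: "z \<in> W \<Longrightarrow> \<phi> (z, u) \<in> W"
proof -
  assume z: "z \<in> W"
  have "p (\<phi> (z, u)) = 0" if p: "real_polynomial_function p" "\<forall>k. \<forall>x\<in>S k. p x = 0" for p
  proof (rule regular_vanish_W[OF _ _ z])
    show "(\<lambda>z. p (\<phi> (z, u))) \<in> regular_functions"
      by (intro regular_compose[OF _ polynomial_regular[OF p(1)]] regular_map_compose[OF _ \<phi>_regular]
          regular_map_Pair regular_map_const regular_map_linear bounded_linear_ident)
    fix k x assume "x \<in> S k"
    then obtain v where "x = trajectory \<phi> T v k" by (auto simp: S_def)
    then have "\<phi> (x, u) = trajectory \<phi> T (v(k := u)) (Suc k)"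
      by (simp add: trajectory_cong[of k "v(k := u)" v])
    then show "p (\<phi> (x, u)) = 0" using p(2) unfolding S_def by blast
  qed
  then show ?thesis using W_iff by blast
qed

theorem F_W: "F ` ((W \<inter> U) \<times> UNIV) \<subseteq> W \<inter> U"
  using \<phi>_W F_eq F_U by auto

lemma algebraic_set_closed: "algebraic_set A \<Longrightarrow> closed A"
proof -
  assume "algebraic_set A"
  then obtain P where P: "\<forall>p\<in>P. real_polynomial_function p" "A = {x. \<forall>p\<in>P. p x = 0}"
    unfolding algebraic_set_def by blast
  have "A = (\<Inter>p\<in>P. p -` {0})" using P(2) by auto
  also have "closed \<dots>"
    using P(1) by (intro closed_INT ballI closed_vimage regular_continuous polynomial_regular) auto
  finally show ?thesis .
qed

lemma closed_W: "closed W"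
  by (rule algebraic_set_closed[OF algebraic_set_W])

lemma T_W: "T \<in> W \<inter> U"
  using S_W[of 0] T by (auto simp: S_def)

lemma W_V: "W \<subseteq> V"
proof -
  have "orbit F E T \<subseteq> V"
    using trajectory_VU[OF T] by (auto simp: orbit_def)
  then show ?thesis unfolding W_def zariski_closure_def
    using V by (intro hull_minimal) (auto simp: algebraic_variety_def)
qed

lemma polynomials_regular: "{p. real_polynomial_function p} \<subseteq> regular_functions"
  using polynomial_regular by auto

lemma S_nonempty: "S k \<noteq> {}" by (auto simp: S_def)

section \<open>Transcendence degree of the reachable sets\<close>

definition rank :: "nat \<Rightarrow> nat" where
  "rank k = Max {length gs | gs. set gs \<subseteq> {p. real_polynomial_function p} \<and> indep (S k) gs}"

text \<open>Independence on \<open>S k\<close> implies independence on the whole space, where the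
  length is bounded by the dimension; this makes the maximum in \<open>rank\<close>
  meaningful.\<close>

lemma rank_set:
  "finite {length gs | gs. set gs \<subseteq> {p. real_polynomial_function p} \<and> indep (S k) gs}"
  "{length gs | gs. set gs \<subseteq> {p. real_polynomial_function p} \<and> indep (S k) gs} \<noteq> {}"
  "{length gs | gs. set gs \<subseteq> {p. real_polynomial_function p} \<and> indep (S k) gs} \<subseteq> {..CARD('n)}"
proof -
  have "length gs \<le> CARD('n)" if "set gs \<subseteq> {p. real_polynomial_function p}" "indep (S k) gs"
    for gs :: "(real ^ 'n \<Rightarrow> real) list"
    using indep_length_le_DIM[of gs] indep_mono[OF S_nonempty _ that(2), of UNIV] that(1) polynomials_regular
    by auto
  then show 3: "{length gs | gs. set gs \<subseteq> {p. real_polynomial_function p} \<and> indep (S k) gs} \<subseteq> {..CARD('n)}"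
    by auto
  show "finite {length gs | gs. set gs \<subseteq> {p. real_polynomial_function p} \<and> indep (S k) gs}"
    by (rule finite_subset[OF 3]) simp
  show "{length gs | gs. set gs \<subseteq> {p. real_polynomial_function p} \<and> indep (S k) gs} \<noteq> {}"
    by (auto intro!: exI[of _ "[]"])
qed

lemma rank_ge:
  "set gs \<subseteq> {p. real_polynomial_function p} \<Longrightarrow> indep (S k) gs \<Longrightarrow> length gs \<le> rank k"
  unfolding rank_def using rank_set(1)[of k] by (intro Max_ge) auto

lemma rank_le: "rank k \<le> CARD('n)"
  using Max_in[OF rank_set(1,2)[of k]] rank_set(3)[of k] unfolding rank_def by auto

lemma rank_basis:
  obtains gs where "set gs \<subseteq> {p. real_polynomial_function p}" "indep (S k) gs" "length gs = rank k"
  using Max_in[OF rank_set(1,2)[of k]] unfolding rank_def by auto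

lemma rank_mono: "j \<le> k \<Longrightarrow> rank j \<le> rank k"
  using rank_basis[of j] rank_ge[of _ k] indep_mono[OF S_nonempty S_mono] by metis

lemma basis_alg:
  assumes "set gs \<subseteq> {p. real_polynomial_function p}" "indep (S k) gs" "length gs = rank k"
    and "real_polynomial_function p"
  shows "alg (S k) (gen gs) p"
  using rank_ge[of "p # gs" k] assms by auto

text \<open>If the rank does not grow, a polynomial vanishing on \<open>S k\<close> but not on \<open>S (Suc k)\<close> would
  satisfy an algebraic relation whose constant coefficient vanishes on \<open>S k\<close>.\<close>

lemma rank_stable:
  assumes rank: "rank (Suc k) = rank k" and p: "real_polynomial_function p" "\<And>z. z \<in> S k \<Longrightarrow> p z = 0"
    and z: "z \<in> S (Suc k)"
  shows "p z = 0"
proof (rule ccontr)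
  assume nz: "p z \<noteq> 0"
  obtain gs where gs: "set gs \<subseteq> {p. real_polynomial_function p}" "indep (S k) gs" "length gs = rank k"
    by (rule rank_basis)
  have poly: "gen gs \<subseteq> {p. real_polynomial_function p}" by (rule gen_least[OF fun_ring_polynomials gs(1)])
  have ind: "indep (S (Suc k)) gs" by (rule indep_mono[OF S_nonempty S_Suc gs(2)])
  have al: "alg (S (Suc k)) (gen gs) p" using basis_alg[OF gs(1) ind _ p(1)] gs(3) rank by simp
  have prime: "\<forall>x\<in>S (Suc k). h x = 0" if "h \<in> adjoin (gen gs) p" "\<forall>x\<in>S (Suc k). p x * h x = 0" for h
  proof -
    have "h \<in> {p. real_polynomial_function p}"
      using adjoin_least[OF fun_ring_polynomials poly] p(1) that(1) by blast
    then show ?thesis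
      using S_prime[of p h "Suc k"] polynomial_regular p(1) that(2) nz z by auto
  qed
  obtain c n x where c: "range c \<subseteq> gen gs" "\<forall>x\<in>S (Suc k). upoly c n p x = 0" "x \<in> S (Suc k)" "c 0 x \<noteq> 0"
    by (rule alg_const_coeff[OF fun_ring_gen al _ prime]) (use nz z in auto)
  have "\<forall>x\<in>S k. c 0 x = 0"
  proof
    fix x assume x: "x \<in> S k"
    have "upoly c n p x = (\<Sum>i\<le>n. if i = 0 then c 0 x else 0)"
      unfolding upoly_def using p(2)[OF x] by (intro sum.cong) auto
    moreover have "x \<in> S (Suc k)" using x S_Suc by blast
    ultimately show "c 0 x = 0" using c(2) by auto
  qed
  then have "c 0 x = 0" by (intro indep_vanish[OF S_nonempty gs(2)]) (use c(1) in auto)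
  then show False using c(4) by simp
qed

text \<open>Density of \<open>S k\<close> in the next set passes on by one step: apply it to the
  numerator of \<open>p\<close> composed with \<open>\<phi>\<close> at the last input.\<close>

lemma vanish_propagate:
  assumes *: "\<And>p z. real_polynomial_function p \<Longrightarrow> (\<And>z. z \<in> S k \<Longrightarrow> p z = 0) \<Longrightarrow> z \<in> S (Suc k) \<Longrightarrow> p z = 0"
    and p: "real_polynomial_function p" "\<And>z. z \<in> S (Suc k) \<Longrightarrow> p z = 0" and z: "z \<in> S (Suc (Suc k))"
  shows "p z = 0"
proof -
  obtain u where u: "z = \<phi> (trajectory \<phi> T u (Suc k), u (Suc k))" using z by (auto simp: S_def)
  have "(\<lambda>z. p (\<phi> (z, u (Suc k)))) \<in> regular_functions"
    by (intro regular_compose[OF _ polynomial_regular[OF p(1)]] regular_map_compose[OF _ \<phi>_regular]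
        regular_map_Pair regular_map_const regular_map_linear bounded_linear_ident)
  from regular_numerator[OF this] obtain q
    where q: "real_polynomial_function q" "\<forall>z. q z = 0 \<longleftrightarrow> p (\<phi> (z, u (Suc k))) = 0"
    by (elim exE conjE)
  have "q x = 0" if x: "x \<in> S k" for x
  proof -
    obtain v where "x = trajectory \<phi> T v k" using x by (auto simp: S_def)
    then have "\<phi> (x, u (Suc k)) = trajectory \<phi> T (v(k := u (Suc k))) (Suc k)"
      by (simp add: trajectory_cong[of k "v(k := u (Suc k))" v])
    then have "\<phi> (x, u (Suc k)) \<in> S (Suc k)" unfolding S_def by blast
    then show ?thesis using q(2) p(2) by blast
  qed
  from *[OF q(1) this, of "trajectory \<phi> T u (Suc k)"] show ?thesis using q(2) u by (auto simp: S_def)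
qed

text \<open>The rank is monotone and at most \<open>CARD('n)\<close>, so it must stand still once.
  From then on no new equation distinguishes later sets, and \<open>S (CARD('n))\<close> is Zariski
  dense in \<open>W\<close>.\<close>

theorem vanish_S_card:
  assumes "real_polynomial_function p" "\<And>z. z \<in> S (CARD('n)) \<Longrightarrow> p z = 0" "z \<in> W"
  shows "p z = 0"
proof -
  \<comment> \<open>Strict growth at all of \<open>0, \<dots>, CARD('n)\<close> would give
    \<open>rank (Suc CARD('n)) > CARD('n)\<close>.\<close>
  have "\<exists>k\<le>CARD('n). rank (Suc k) = rank k"
  proof (rule ccontr)
    assume "\<not> ?thesis"
    then have lt: "rank k < rank (Suc k)" if "k \<le> CARD('n)" for k
      using that rank_mono[of k "Suc k"] by (auto simp: order.strict_iff_order)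
    have "k \<le> rank k" if "k \<le> Suc (CARD('n))" for k
      using that
    proof (induction k)
      case (Suc k)
      then show ?case using lt[of k] by simp
    qed simp
    from this[of "Suc (CARD('n))"] rank_le[of "Suc (CARD('n))"] show False by simp
  qed
  then obtain k where k: "k \<le> CARD('n)" "rank (Suc k) = rank k" by blast
  have step: "q z = 0" if "real_polynomial_function q" "\<And>z. z \<in> S (k + j) \<Longrightarrow> q z = 0" "z \<in> S (Suc (k + j))"
    for j q z using that
  proof (induction j arbitrary: q z)
    case 0
    then show ?case using rank_stable[OF k(2), of q z] by simp
  next
    case (Suc j)
    show ?case by (rule vanish_propagate[of "k + j" q z]) (use Suc in auto)
  qed
  have "\<forall>z\<in>S (CARD('n) + j). p z = 0" for j
  proof (induction j)
    case (Suc j)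
    then show ?case using step[of p "CARD('n) + j - k"] assms(1) k(1) by auto
  qed (use assms(2) in simp)
  then have "\<forall>z\<in>S j. p z = 0" for j using S_mono[of j "CARD('n) + j"] by auto
  then show ?thesis using assms(1,3) W_iff by blast
qed

end

section \<open>Strict derivatives\<close>

text \<open>The estimate compares two arbitrary points near \<open>x\<close>. For a map of state and
  noise it therefore controls all sections with nearby states by the derivative at the one point
  \<open>x\<close>.\<close>

definition strict_derivative ::
    "('a::real_normed_vector \<Rightarrow> 'b::real_normed_vector) \<Rightarrow> ('a \<Rightarrow> 'b) \<Rightarrow> 'a \<Rightarrow> bool" where
  "strict_derivative f D x \<longleftrightarrow> bounded_linear D \<and>
     (\<forall>e>0. \<exists>d>0. \<forall>y\<in>ball x d. \<forall>y'\<in>ball x d. norm (f y - f y' - D (y - y')) \<le> e * norm (y - y'))"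

lemma strict_derivative_bounded_linear: "strict_derivative f D x \<Longrightarrow> bounded_linear D"
  by (simp add: strict_derivative_def)

lemma strict_derivativeD:
  assumes "strict_derivative f D x" "e > 0"
  obtains d where "d > 0"
    "\<And>y y'. y \<in> ball x d \<Longrightarrow> y' \<in> ball x d \<Longrightarrow> norm (f y - f y' - D (y - y')) \<le> e * norm (y - y')"
  using assms unfolding strict_derivative_def by meson

lemma strict_derivativeI:
  assumes "bounded_linear D"
    and "\<And>e. e > 0 \<Longrightarrow> \<exists>d>0. \<forall>y\<in>ball x d. \<forall>y'\<in>ball x d. norm (f y - f y' - D (y - y')) \<le> e * norm (y - y')"
  shows "strict_derivative f D x"
  using assms by (simp add: strict_derivative_def)

lemma strict_derivative_has_derivative:
  assumes "strict_derivative f D x"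
  shows "(f has_derivative D) (at x)"
  unfolding has_derivative_within_alt
proof (intro conjI allI impI strict_derivative_bounded_linear[OF assms])
  fix e :: real assume "e > 0"
  obtain d where d: "d > 0"
    "\<And>y y'. y \<in> ball x d \<Longrightarrow> y' \<in> ball x d \<Longrightarrow> norm (f y - f y' - D (y - y')) \<le> e * norm (y - y')"
    by (rule strict_derivativeD[OF assms \<open>e > 0\<close>]) blast
  then show "\<exists>d>0. \<forall>y\<in>UNIV. norm (y - x) < d \<longrightarrow> norm (f y - f x - D (y - x)) \<le> e * norm (y - x)"
    by (intro exI[of _ d]) (auto simp: dist_norm norm_minus_commute)
qed

lemma strict_derivative_lipschitz:
  assumes "strict_derivative f D x"
  obtains d B where "d > 0" "B > 0"
    "\<And>y y'. y \<in> ball x d \<Longrightarrow> y' \<in> ball x d \<Longrightarrow> norm (f y - f y') \<le> B * norm (y - y')"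
proof -
  obtain d where d: "d > 0"
    "\<And>y y'. y \<in> ball x d \<Longrightarrow> y' \<in> ball x d \<Longrightarrow> norm (f y - f y' - D (y - y')) \<le> 1 * norm (y - y')"
    by (rule strict_derivativeD[OF assms zero_less_one]) blast
  obtain K where K: "K > 0" "\<And>v. norm (D v) \<le> norm v * K"
    using bounded_linear.pos_bounded[OF strict_derivative_bounded_linear[OF assms]] by blast
  have "norm (f y - f y') \<le> (1 + K) * norm (y - y')" if "y \<in> ball x d" "y' \<in> ball x d" for y y'
    using norm_triangle_sub[of "f y - f y'" "D (y - y')"] d(2)[OF that] K(2)[of "y - y'"]
    by (simp add: algebra_simps)
  then show ?thesis using that[of d "1 + K"] d(1) K(1) by simp
qed

lemma strict_derivative_linear:
  assumes "bounded_linear f" shows "strict_derivative f f x"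
  using assms by (intro strict_derivativeI)
    (auto intro!: exI[of _ 1] simp: linear_diff[OF bounded_linear.linear])

lemma strict_derivative_const: "strict_derivative (\<lambda>_. c) (\<lambda>_. 0) x"
  by (intro strict_derivativeI) (auto intro!: exI[of _ 1])

lemma strict_derivative_Pair:
  assumes f: "strict_derivative f D x" and g: "strict_derivative g D' x"
  shows "strict_derivative (\<lambda>x. (f x, g x)) (\<lambda>h. (D h, D' h)) x"
proof (rule strict_derivativeI)
  show "bounded_linear (\<lambda>h. (D h, D' h))"
    by (intro bounded_linear_Pair strict_derivative_bounded_linear[OF f] strict_derivative_bounded_linear[OF g])
  fix e :: real assume "e > 0"
  then have "e / 2 > 0" by simp
  obtain d where d: "d > 0" "\<And>y y'. y \<in> ball x d \<Longrightarrow> y' \<in> ball x d \<Longrightarrow>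
      norm (f y - f y' - D (y - y')) \<le> e / 2 * norm (y - y')"
    by (rule strict_derivativeD[OF f \<open>e / 2 > 0\<close>]) blast
  obtain d' where d': "d' > 0" "\<And>y y'. y \<in> ball x d' \<Longrightarrow> y' \<in> ball x d' \<Longrightarrow>
      norm (g y - g y' - D' (y - y')) \<le> e / 2 * norm (y - y')"
    by (rule strict_derivativeD[OF g \<open>e / 2 > 0\<close>]) blast
  have "norm ((f y, g y) - (f y', g y') - (D (y - y'), D' (y - y'))) \<le> e * norm (y - y')"
    if "y \<in> ball x (min d d')" "y' \<in> ball x (min d d')" for y y'
    using norm_Pair_le[of "f y - f y' - D (y - y')" "g y - g y' - D' (y - y')"]
      d(2)[of y y'] d'(2)[of y y'] that by auto
  then show "\<exists>d>0. \<forall>y\<in>ball x d. \<forall>y'\<in>ball x d.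
      norm ((f y, g y) - (f y', g y') - (D (y - y'), D' (y - y'))) \<le> e * norm (y - y')"
    using d(1) d'(1) by (intro exI[of _ "min d d'"]) auto
qed

text \<open>The error of \<open>f\<close> is amplified by the norm of \<open>D'\<close>, and the
  error of \<open>g\<close> by the Lipschitz constant of \<open>f\<close>; each gets half of
  \<open>e\<close>.\<close>

lemma strict_derivative_compose:
  assumes f: "strict_derivative f D x" and g: "strict_derivative g D' (f x)"
  shows "strict_derivative (\<lambda>x. g (f x)) (\<lambda>h. D' (D h)) x"
proof (rule strict_derivativeI)
  show "bounded_linear (\<lambda>h. D' (D h))"
    by (intro bounded_linear_compose[of D' D] strict_derivative_bounded_linear[OF f] strict_derivative_bounded_linear[OF g])
  fix e :: real assume "e > 0"
  obtain dl B where dl: "dl > 0" "B > 0"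
    "\<And>y y'. y \<in> ball x dl \<Longrightarrow> y' \<in> ball x dl \<Longrightarrow> norm (f y - f y') \<le> B * norm (y - y')"
    by (rule strict_derivative_lipschitz[OF f]) blast
  interpret D': bounded_linear D' by (rule strict_derivative_bounded_linear[OF g])
  obtain K where K: "K > 0" "\<And>v. norm (D' v) \<le> norm v * K" using D'.pos_bounded by blast
  have "e / (2 * B) > 0" "e / (2 * K) > 0" using \<open>e > 0\<close> dl(2) K(1) by auto
  obtain dg where dg: "dg > 0" "\<And>v v'. v \<in> ball (f x) dg \<Longrightarrow> v' \<in> ball (f x) dg \<Longrightarrow>
      norm (g v - g v' - D' (v - v')) \<le> e / (2 * B) * norm (v - v')"
    by (rule strict_derivativeD[OF g \<open>e / (2 * B) > 0\<close>]) blast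
  obtain df where df: "df > 0" "\<And>y y'. y \<in> ball x df \<Longrightarrow> y' \<in> ball x df \<Longrightarrow>
      norm (f y - f y' - D (y - y')) \<le> e / (2 * K) * norm (y - y')"
    by (rule strict_derivativeD[OF f \<open>e / (2 * K) > 0\<close>]) blast
  define d where "d = min (min dl df) (dg / B)"
  have "d > 0" using dl df dg by (simp add: d_def)
  moreover have "norm (g (f y) - g (f y') - D' (D (y - y'))) \<le> e * norm (y - y')"
    if y: "y \<in> ball x d" "y' \<in> ball x d" for y y'
  proof -
    have in_ball: "f v \<in> ball (f x) dg" if v: "v \<in> ball x d" for v
    proof -
      have "norm (f x - f v) \<le> B * norm (x - v)" using v dl(1) by (intro dl(3)) (auto simp: d_def)
      also have "\<dots> < B * (dg / B)" using v dl(2) by (intro mult_strict_left_mono) (auto simp: d_def dist_norm)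
      finally show ?thesis using dl(2) by (simp add: dist_norm)
    qed
    have "norm (g (f y) - g (f y') - D' (f y - f y')) \<le> e / (2 * B) * norm (f y - f y')"
      by (intro dg in_ball y)
    also have "\<dots> \<le> e / (2 * B) * (B * norm (y - y'))"
      using y \<open>e > 0\<close> dl(2) by (intro mult_left_mono dl(3)) (auto simp: d_def)
    also have "\<dots> = e / 2 * norm (y - y')" using dl(2) by simp
    finally have 1: "norm (g (f y) - g (f y') - D' (f y - f y')) \<le> e / 2 * norm (y - y')" .
    have "norm (D' (f y - f y') - D' (D (y - y'))) \<le> norm (f y - f y' - D (y - y')) * K"
      using K(2)[of "f y - f y' - D (y - y')"] by (simp add: D'.diff)
    also have "\<dots> \<le> e / (2 * K) * norm (y - y') * K"
      using y K(1) by (intro mult_right_mono df(2)) (auto simp: d_def)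
    also have "\<dots> = e / 2 * norm (y - y')" using K(1) by simp
    finally have 2: "norm (D' (f y - f y') - D' (D (y - y'))) \<le> e / 2 * norm (y - y')" .
    show ?thesis
      using norm_triangle_ineq[of "g (f y) - g (f y') - D' (f y - f y')" "D' (f y - f y') - D' (D (y - y'))"] 1 2
      by simp
  qed
  ultimately show "\<exists>d>0. \<forall>y\<in>ball x d. \<forall>y'\<in>ball x d.
      norm (g (f y) - g (f y') - D' (D (y - y'))) \<le> e * norm (y - y')" by blast
qed

lemma strict_derivative_add:
  assumes "strict_derivative f D x" "strict_derivative g D' x"
  shows "strict_derivative (\<lambda>x. f x + g x) (\<lambda>h. D h + D' h) x"
proof -
  have "bounded_linear (\<lambda>p :: 'b \<times> 'b. fst p + snd p)"
    by (intro bounded_linear_add bounded_linear_fst bounded_linear_snd)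
  from strict_derivative_compose[OF strict_derivative_Pair[OF assms] strict_derivative_linear[OF this]]
  show ?thesis by simp
qed

lemma strict_derivative_sum:
  assumes "\<And>i. i \<in> I \<Longrightarrow> strict_derivative (f i) (D i) x"
  shows "strict_derivative (\<lambda>x. \<Sum>i\<in>I. f i x) (\<lambda>h. \<Sum>i\<in>I. D i h) x"
proof (cases "finite I")
  case True
  then show ?thesis using assms
    by (induction I) (auto intro: strict_derivative_const strict_derivative_add)
qed (simp add: strict_derivative_const)

lemma strict_derivative_times:
  "strict_derivative (\<lambda>p :: real \<times> real. fst p * snd p) (\<lambda>h. fst h * b + a * snd h) (a, b)"
proof (rule strict_derivativeI)
  show "bounded_linear (\<lambda>h :: real \<times> real. fst h * b + a * snd h)"
    by (intro bounded_linear_add bounded_linear_mult_const bounded_linear_const_mult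
        bounded_linear_fst bounded_linear_snd)
  fix e :: real assume e: "e > 0"
  have "norm (fst y * snd y - fst y' * snd y' - (fst (y - y') * b + a * snd (y - y'))) \<le> e * norm (y - y')"
    if y: "y \<in> ball (a, b) (e / 2)" "y' \<in> ball (a, b) (e / 2)" for y y' :: "real \<times> real"
  proof -
    have "\<bar>fst y - a\<bar> \<le> e / 2" "\<bar>snd y' - b\<bar> \<le> e / 2"
      using y dist_fst_le[of "(a, b)" y] dist_snd_le[of "(a, b)" y']
      by (auto simp: dist_real_def abs_minus_commute)
    moreover have "\<bar>fst (y - y')\<bar> \<le> norm (y - y')" "\<bar>snd (y - y')\<bar> \<le> norm (y - y')"
      by (metis norm_fst_le norm_snd_le prod.collapse real_norm_def)+
    ultimately have "\<bar>fst y - a\<bar> * \<bar>snd (y - y')\<bar> + \<bar>snd y' - b\<bar> * \<bar>fst (y - y')\<bar>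
        \<le> e / 2 * norm (y - y') + e / 2 * norm (y - y')"
      using e by (intro add_mono mult_mono) auto
    moreover have "fst y * snd y - fst y' * snd y' - (fst (y - y') * b + a * snd (y - y'))
        = (fst y - a) * snd (y - y') + (snd y' - b) * fst (y - y')"
      by (simp add: algebra_simps)
    ultimately show ?thesis
      using abs_triangle_ineq[of "(fst y - a) * snd (y - y')" "(snd y' - b) * fst (y - y')"]
      by (simp add: abs_mult)
  qed
  then show "\<exists>d>0. \<forall>y\<in>ball (a, b) d. \<forall>y'\<in>ball (a, b) d.
      norm (fst y * snd y - fst y' * snd y' - (fst (y - y') * b + a * snd (y - y'))) \<le> e * norm (y - y')"
    using e by (intro exI[of _ "e / 2"]) auto
qed

lemma strict_derivative_polynomial:
  assumes "real_polynomial_function p"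
  shows "\<exists>D. strict_derivative p D x"
  using assms
proof (induction rule: real_polynomial_function.induct)
  case (linear f)
  then show ?case using strict_derivative_linear by blast
next
  case (const c)
  then show ?case using strict_derivative_const by blast
next
  case (add f g)
  then show ?case using strict_derivative_add by blast
next
  case (mult f g)
  then obtain D D' where "strict_derivative f D x" "strict_derivative g D' x" by blast
  from strict_derivative_compose[OF strict_derivative_Pair[OF this] strict_derivative_times]
  show ?case by auto
qed

text \<open>The mean value inequality for \<open>f\<close> minus its linearisation, on a ball where
  the derivative stays within \<open>e\<close> of its value at \<open>x\<close>.\<close>

lemma strict_derivative_C1:
  fixes f' :: "'a::real_normed_vector \<Rightarrow> 'a \<Rightarrow>\<^sub>L 'b::real_normed_vector"
  assumes S: "open S" "x \<in> S" and f': "\<And>y. y \<in> S \<Longrightarrow> (f has_derivative blinfun_apply (f' y)) (at y)"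
    and cont: "continuous_on S f'"
  shows "strict_derivative f (blinfun_apply (f' x)) x"
proof (rule strict_derivativeI)
  show "bounded_linear (blinfun_apply (f' x))" by (rule blinfun.bounded_linear_right)
  fix e :: real assume e: "e > 0"
  obtain d1 where d1: "d1 > 0" "ball x d1 \<subseteq> S" using S open_contains_ball by blast
  obtain d2 where d2: "d2 > 0" "\<And>y. y \<in> S \<Longrightarrow> dist y x < d2 \<Longrightarrow> dist (f' y) (f' x) < e"
    using cont S(2) e unfolding continuous_on_iff by meson
  let ?B = "ball x (min d1 d2)"
  have "norm (f y - f y' - f' x (y - y')) \<le> e * norm (y - y')" if y: "y \<in> ?B" "y' \<in> ?B" for y y'
  proof -
    have 1: "y' + t *\<^sub>R (y - y') \<in> ?B" if "t \<in> {0..1}" for t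
      using convexD_alt[OF convex_ball y(2,1), of t] that by (simp add: algebra_simps)
    have 2: "(f has_derivative blinfun_apply (f' z)) (at z within ?B)" if "z \<in> ?B" for z
      by (rule has_derivative_at_withinI[OF f']) (use that d1(2) in auto)
    have 3: "onorm (blinfun_apply (f' z) - blinfun_apply (f' x)) \<le> e" if "z \<in> ?B" for z
    proof -
      have "norm (f' z - f' x) \<le> e"
        using d2(2)[of z] that d1(2) by (auto simp: dist_norm norm_minus_commute)
      then show ?thesis by (simp add: norm_blinfun.rep_eq minus_blinfun.rep_eq fun_diff_def)
    qed
    have 4: "x \<in> ?B" using d1(1) d2(1) by simp
    from differentiable_bound_linearization[of y' y ?B f "\<lambda>z. blinfun_apply (f' z)" x e, OF 1 2 3 4]
    have "norm (f y - f y' - f' x (y - y')) \<le> norm (y - y') * e" by simp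
    then show ?thesis by (simp add: mult.commute)
  qed
  then show "\<exists>d>0. \<forall>y\<in>ball x d. \<forall>y'\<in>ball x d. norm (f y - f y' - f' x (y - y')) \<le> e * norm (y - y')"
    using d1(1) d2(1) by (intro exI[of _ "min d1 d2"]) auto
qed

lemma C1_on_strict_derivative:
  assumes "C1_on S f" "open S" "x \<in> S"
  shows "\<exists>D. strict_derivative f D x"
  using assms strict_derivative_C1 unfolding C1_on_def by blast

lemma regular_differentiable:
  assumes "f \<in> regular_functions" shows "\<exists>D. (f has_derivative D) (at x)"
proof -
  obtain P Q where *: "real_polynomial_function P" "real_polynomial_function Q"
    "\<forall>x. Q x \<noteq> 0" "f = (\<lambda>x. P x / Q x)" using assms unfolding regular_functions_def by blast
  obtain D where D: "(P has_derivative D) (at x)"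
    using strict_derivative_polynomial[OF *(1), of x] strict_derivative_has_derivative by blast
  obtain D' where D': "(Q has_derivative D') (at x)"
    using strict_derivative_polynomial[OF *(2), of x] strict_derivative_has_derivative by blast
  show ?thesis using has_derivative_divide[OF D D'] *(3,4) by auto
qed

text \<open>By the product rule the functions whose derivative at \<open>x\<close> kills
  \<open>w\<close> form a ring, so killing the generators is enough.\<close>

lemma fun_ring_stationary: "fun_ring {f. \<exists>D. (f has_derivative D) (at x) \<and> D w = (0::real)}"
  unfolding fun_ring_def
proof (intro conjI allI ballI)
  fix r :: real show "(\<lambda>_. r) \<in> {f. \<exists>D. (f has_derivative D) (at x) \<and> D w = 0}"
    by (auto intro!: exI[of _ "\<lambda>_. 0"])
next
  fix f g :: "'a \<Rightarrow> real" assume "f \<in> {f. \<exists>D. (f has_derivative D) (at x) \<and> D w = 0}"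
    "g \<in> {f. \<exists>D. (f has_derivative D) (at x) \<and> D w = 0}"
  then obtain D D' where *: "(f has_derivative D) (at x)" "D w = 0" "(g has_derivative D') (at x)" "D' w = 0"
    by blast
  show "(\<lambda>x. f x + g x) \<in> {f. \<exists>D. (f has_derivative D) (at x) \<and> D w = 0}"
    using has_derivative_add[OF *(1,3)] *(2,4) by force
  show "(\<lambda>x. f x * g x) \<in> {f. \<exists>D. (f has_derivative D) (at x) \<and> D w = 0}"
    using has_derivative_mult[OF *(1,3)] *(2,4) by force
qed

text \<open>When the coefficients are stationary along \<open>w\<close>, only the formal derivative
  contributes. If \<open>upoly c n t\<close> is identically zero and the formal derivative is not
  zero at \<open>x\<close>, then \<open>t\<close> is stationary along \<open>w\<close> as
  well.\<close>

lemma upoly_has_derivative: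
  assumes c: "\<And>i. \<exists>D. (c i has_derivative D) (at x) \<and> D w = 0" and t: "(t has_derivative D) (at x)"
  shows "\<exists>D'. (upoly c n t has_derivative D') (at x) \<and> D' w = upoly_deriv c n t x * D w"
proof -
  from c obtain C where C: "\<And>i. (c i has_derivative C i) (at x)" "\<And>i. C i w = 0" by metis
  have "((\<lambda>y. c i y * t y ^ i) has_derivative
      (\<lambda>h. c i x * (real i * t x ^ (i - 1) * D h) + C i h * t x ^ i)) (at x)" for i
    by (rule has_derivative_eq_rhs[OF has_derivative_mult[OF C(1) has_derivative_power[OF t]]])
       (simp add: mult_ac)
  then have "(upoly c n t has_derivative
      (\<lambda>h. \<Sum>i\<le>n. c i x * (real i * t x ^ (i - 1) * D h) + C i h * t x ^ i)) (at x)"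
    unfolding upoly_def by (intro has_derivative_sum)
  moreover have "(\<Sum>i\<le>n. c i x * (real i * t x ^ (i - 1) * D w) + C i w * t x ^ i) = upoly_deriv c n t x * D w"
    by (simp add: C(2) upoly_deriv_def sum_distrib_left mult_ac)
  ultimately show ?thesis by blast
qed

section \<open>Local coordinates at a generic point\<close>

text \<open>Two distinct roots of the same polynomial near \<open>t z\<close> would, by Rolle,
  enclose a zero of the formal derivative, which is nonzero near \<open>z\<close>.\<close>

lemma upoly_injective:
  fixes c :: "nat \<Rightarrow> 'a::metric_space \<Rightarrow> real"
  assumes c: "\<And>i. continuous_on UNIV (c i)" and t: "continuous_on UNIV t" and nz: "upoly_deriv c n t z \<noteq> 0"
  obtains e where "e > 0"
    "\<And>x x'. dist x z \<le> e \<Longrightarrow> dist x' z \<le> e \<Longrightarrow> (\<And>i. c i x = c i x') \<Longrightarrow>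
      upoly c n t x = 0 \<Longrightarrow> upoly c n t x' = 0 \<Longrightarrow> t x = t x'"
proof -
  define q where "q p = (\<Sum>i\<le>n. real i * c i (fst p) * snd p ^ (i - 1))" for p
  have cfst: "continuous_on UNIV (\<lambda>p :: 'a \<times> real. c i (fst p))" for i
    by (rule continuous_on_compose2[OF c continuous_on_fst[OF continuous_on_id]]) simp
  have "continuous_on UNIV q"
    unfolding q_def by (intro continuous_intros cfst)
  then have "open (q -` (- {0}))" by (intro open_vimage) auto
  moreover have "(z, t z) \<in> q -` (- {0})" using nz by (simp add: q_def upoly_deriv_def)
  ultimately obtain A B where AB: "open A" "open B" "z \<in> A" "t z \<in> B" "A \<times> B \<subseteq> q -` (- {0})"
    by (rule open_prod_elim) auto
  obtain e1 where e1: "e1 > 0" "ball z e1 \<subseteq> A" using AB(1,3) open_contains_ball by blast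
  obtain e2 where e2: "e2 > 0" "ball (t z) e2 \<subseteq> B" using AB(2,4) open_contains_ball by blast
  have "open (t -` ball (t z) e2)" by (intro open_vimage t) auto
  moreover have "z \<in> t -` ball (t z) e2" using e2(1) by simp
  ultimately obtain e3 where e3: "e3 > 0" "ball z e3 \<subseteq> t -` ball (t z) e2"
    using open_contains_ball by blast
  define e where "e = min e1 e3 / 2"
  have "e > 0" using e1 e3 by (simp add: e_def)
  moreover have "t x = t x'" if x: "dist x z \<le> e" "dist x' z \<le> e" and eq: "\<And>i. c i x = c i x'"
    and zero: "upoly c n t x = 0" "upoly c n t x' = 0" for x x'
  proof (rule ccontr)
    assume "t x \<noteq> t x'"
    have *: "False" if ab: "r < s" "r \<in> ball (t z) e2" "s \<in> ball (t z) e2"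
      "(\<Sum>i\<le>n. c i x * r ^ i) = 0" "(\<Sum>i\<le>n. c i x * s ^ i) = 0" for r s
    proof -
      have der: "((\<lambda>r. \<Sum>i\<le>n. c i x * r ^ i) has_real_derivative q (x, r)) (at r)" for r
        unfolding q_def by (auto intro!: derivative_eq_intros sum.cong simp: mult_ac)
      have "\<exists>l w. r < w \<and> w < s \<and> ((\<lambda>r. \<Sum>i\<le>n. c i x * r ^ i) has_real_derivative l) (at w) \<and>
          (\<Sum>i\<le>n. c i x * s ^ i) - (\<Sum>i\<le>n. c i x * r ^ i) = (s - r) * l"
        using ab(1) der
        by (intro MVT) (auto intro!: continuous_intros simp: real_differentiable_def)
      then obtain l w where w: "r < w" "w < s"
        "((\<lambda>r. \<Sum>i\<le>n. c i x * r ^ i) has_real_derivative l) (at w)" "(s - r) * l = 0"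
        using ab by auto
      have "q (x, w) = 0" using DERIV_unique[OF der w(3)] w(4) ab(1) by simp
      have "w \<in> ball (t z) e2" using ab(2,3) w by (auto simp: dist_real_def)
      moreover have "x \<in> ball z e1" using x(1) e1 e3 by (auto simp: e_def dist_commute)
      ultimately have "(x, w) \<in> A \<times> B" using e1(2) e2(2) by blast
      then show False using AB(5) \<open>q (x, w) = 0\<close> by blast
    qed
    have "x \<in> ball z e3" "x' \<in> ball z e3" using x e1(1) e3(1) by (auto simp: e_def dist_commute)
    then have tb: "t x \<in> ball (t z) e2" "t x' \<in> ball (t z) e2" using e3(2) by auto
    have zz: "(\<Sum>i\<le>n. c i x * t x ^ i) = 0" "(\<Sum>i\<le>n. c i x * t x' ^ i) = 0"
      using zero eq by (auto simp: upoly_def)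
    show False
      using *[OF _ tb zz] *[OF _ tb(2,1) zz(2,1)] \<open>t x \<noteq> t x'\<close> by (meson linorder_neqE_linordered_idom)
  qed
  ultimately show ?thesis using that by blast
qed

section \<open>Finite noise sequences as vectors\<close>

definition idx :: "nat \<Rightarrow> 'n::finite" where
  "idx = (SOME h. bij_betw h {0..<CARD('n)} UNIV)"

lemma idx_bij: "bij_betw (idx :: nat \<Rightarrow> 'n::finite) {0..<CARD('n)} UNIV"
  unfolding idx_def by (rule someI_ex[OF ex_bij_betw_nat_finite]) simp

definition pos :: "'n::finite \<Rightarrow> nat" where
  "pos j = inv_into {0..<CARD('n)} idx j"

lemma idx_pos [simp]: "idx (pos j) = j"
  using bij_betw_inv_into_right[OF idx_bij, of j] by (simp add: pos_def)

lemma pos_idx [simp]: "i < CARD('n) \<Longrightarrow> pos (idx i :: 'n::finite) = i"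
  using bij_betw_inv_into_left[OF idx_bij, of i] by (simp add: pos_def)

lemma pos_less [simp]: "pos (j :: 'n::finite) < CARD('n)"
  using bij_betwE[OF bij_betw_inv_into[OF idx_bij]] by (auto simp: pos_def)

text \<open>Noise sequences of length \<open>CARD('n)\<close> as points of a Euclidean space.\<close>

definition blocks :: "'b ^ 'n \<Rightarrow> nat \<Rightarrow> 'b" where
  "blocks y i = y $ idx i"

text \<open>Numbers the basis vectors so that \<open>N\<close> given functions can serve as the
  components along the first \<open>N\<close> of them.\<close>

lemma basis_functional_bound:
  fixes Df :: "nat \<Rightarrow> 'a::euclidean_space \<Rightarrow> real"
  assumes "N \<le> DIM('a)"
  obtains \<sigma> :: "'a \<Rightarrow> nat" where "bij_betw \<sigma> Basis {0..<DIM('a)}" "{0..<N} \<subseteq> \<sigma> ` Basis"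
proof -
  obtain \<sigma> :: "'a \<Rightarrow> nat" where "bij_betw \<sigma> Basis {0..<DIM('a)}"
    using ex_bij_betw_finite_nat[OF finite_Basis] by blast
  then show ?thesis using that[of \<sigma>] assms by (auto simp: bij_betw_def)
qed

context attracting_system
begin

section \<open>Noise coordinates and input coordinates\<close>

definition endpoint :: "(real ^ 'm) ^ 'n \<Rightarrow> real ^ 'n" where
  "endpoint u = trajectory \<phi> T (blocks u) CARD('n)"

lemma range_endpoint: "range endpoint = S (CARD('n))"
proof -
  have "trajectory \<phi> T w CARD('n) \<in> range endpoint" for w
  proof -
    have "trajectory \<phi> T w CARD('n) = endpoint (\<chi> j. w (pos j))"
      unfolding endpoint_def by (rule trajectory_cong) (simp add: blocks_def)
    then show ?thesis by simp
  qed
  then show ?thesis by (auto simp: S_def endpoint_def)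
qed

lemma regular_blocks: "regular_map (\<lambda>u. blocks u i)"
  unfolding blocks_def by (intro regular_map_linear bounded_linear_vec_nth)

lemma regular_partial: "regular_map (\<lambda>u. trajectory \<phi> T (blocks u) k)"
  by (intro trajectory_regular \<phi>_regular regular_blocks regular_map_const)

lemma regular_endpoint: "regular_map endpoint"
  unfolding endpoint_def by (rule regular_partial)

lemma regular_map_continuous: "regular_map g \<Longrightarrow> continuous_on A g"
  unfolding regular_map_def continuous_on_componentwise[of A g] using regular_continuous by blast

text \<open>The inputs \<open>u_i = f(z_i, y_i)\<close> produced by the noise \<open>y\<close> along
  the path from \<open>z\<close>. Component \<open>j\<close> depends only on the noise up to time
  \<open>pos j\<close>, so the map is triangular.\<close>

definition chart :: "(real ^ 'n) \<Rightarrow> (real ^ 'm) ^ 'n \<Rightarrow> (real ^ 'm) ^ 'n" where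
  "chart z y = (\<chi> j. f (trajectory F z (blocks y) (pos j), y $ j))"

lemma blocks_chart:
  "i < CARD('n) \<Longrightarrow> blocks (chart z y) i = f (trajectory F z (blocks y) i, blocks y i)"
  by (simp add: blocks_def chart_def)

lemma trajectory_chart:
  assumes "z \<in> U" "k \<le> CARD('n)"
  shows "trajectory F z (blocks y) k = trajectory \<phi> z (blocks (chart z y)) k"
proof -
  have "trajectory \<phi> z (\<lambda>i. f (trajectory F z (blocks y) i, blocks y i)) k
      = trajectory \<phi> z (blocks (chart z y)) k"
    using assms(2) by (intro trajectory_cong) (simp add: blocks_chart)
  then show ?thesis using trajectory_F_eq[OF assms(1), of "blocks y" k] by simp
qed

text \<open>Needed for the start \<open>T\<close> only. The states are computed from the inputs
  through \<open>\<phi>\<close>, so they depend on \<open>u\<close> alone and no recursion over the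
  noise is required.\<close>

definition inv_chart :: "(real ^ 'm) ^ 'n \<Rightarrow> (real ^ 'm) ^ 'n" where
  "inv_chart u = (\<chi> j. inv (\<lambda>v. f (trajectory \<phi> T (blocks u) (pos j), v)) (u $ j))"

lemma trajectory_\<phi>_U: "trajectory \<phi> T u k \<in> U"
  using S_VU[of k] by (auto simp: S_def)

lemma inv_chart_continuous: "continuous_on UNIV inv_chart"
proof -
  have "continuous_on UNIV (\<lambda>u :: (real ^ 'm) ^ 'n. (trajectory \<phi> T (blocks u) k, u $ j))" for k j
    by (intro continuous_on_Pair regular_map_continuous[OF regular_partial] continuous_on_component continuous_on_id)
  from continuous_on_compose2[OF inv_cont this]
  have "continuous_on UNIV (\<lambda>u :: (real ^ 'm) ^ 'n. inv (\<lambda>v. f (trajectory \<phi> T (blocks u) k, v)) (u $ j))" for k j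
    by (simp add: trajectory_\<phi>_U image_subset_iff)
  then show ?thesis unfolding inv_chart_def by (intro continuous_on_vec_lambda) auto
qed

lemma trajectory_inv_chart:
  "k \<le> CARD('n) \<Longrightarrow> trajectory F T (blocks (inv_chart u)) k = trajectory \<phi> T (blocks u) k"
proof (induction k)
  case (Suc k)
  have "f (trajectory \<phi> T (blocks u) k, blocks (inv_chart u) k) = blocks u k"
    using Suc.prems f_inv[OF trajectory_\<phi>_U, of "blocks u" k "u $ idx k"]
    by (simp add: blocks_def inv_chart_def)
  then show ?case using Suc F_eq[OF trajectory_\<phi>_U, of "blocks u" k] by simp
qed simp

lemma chart_inv_chart: "chart T (inv_chart u) = u"
proof -
  have "f (trajectory F T (blocks (inv_chart u)) (pos j), inv_chart u $ j) = u $ j" for j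
    using trajectory_inv_chart[of "pos j" u] f_inv[OF trajectory_\<phi>_U] pos_less[of j]
    by (simp add: inv_chart_def)
  then show ?thesis by (simp add: chart_def vec_eq_iff)
qed

text \<open>Provides a point in the open set of inputs whose noise lies in the interior of
  \<open>E\<close>.\<close>

lemma inv_chart_stationary: "inv_chart (\<chi> j. f (T, a)) = (\<chi> j. a)"
proof -
  have "trajectory \<phi> T (blocks (\<chi> j::'n. f (T, a))) k = T" for k
    by (induction k) (use F_T F_eq[of T a] T in \<open>auto simp: blocks_def\<close>)
  then show ?thesis using inv_f[of T a] T by (simp add: inv_chart_def)
qed

lemma open_noise: "open {u. \<forall>j. inv_chart u $ j \<in> interior E}"
proof -
  have "{u. \<forall>j. inv_chart u $ j \<in> interior E} = (\<Inter>j. (\<lambda>u. inv_chart u $ j) -` interior E)" by auto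
  also have "open \<dots>"
    by (intro open_INT ballI open_vimage open_interior continuous_on_component inv_chart_continuous) auto
  finally show ?thesis .
qed

text \<open>In the noise directions the derivative of \<open>chart\<close> is block triangular, and
  its diagonal blocks are injective because each \<open>f (z, \<cdot>)\<close> is a
  diffeomorphism.\<close>

lemma chart_strict_derivative:
  fixes y :: "(real ^ 'm) ^ 'n"
  obtains D where "strict_derivative (\<lambda>p. chart (fst p) (snd p)) D (T, y)"
    "\<And>\<eta>. D (0, \<eta>) = 0 \<Longrightarrow> \<eta> = 0"
    "\<exists>D. strict_derivative (\<lambda>p. trajectory F (fst p) (blocks (snd p)) CARD('n)) D (T, y)"
proof -
  have lin: "bounded_linear (\<lambda>p :: (real ^ 'n) \<times> ((real ^ 'm) ^ 'n). snd p $ j)" for j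
    by (intro bounded_linear_compose[OF bounded_linear_vec_nth bounded_linear_snd])
  have open_UU: "open (U \<times> (UNIV :: (real ^ 'm) set))" using U by (intro open_Times) auto
  \<comment> \<open>The triangular structure: the state at time \<open>k\<close> does not react to
    changes of the noise from time \<open>k\<close> on.\<close>
  have traj: "\<exists>D. strict_derivative (\<lambda>p. trajectory F (fst p) (blocks (snd p)) k) D (T, y) \<and>
    (\<forall>\<eta>. (\<forall>i<k. \<eta> $ idx i = 0) \<longrightarrow> D (0, \<eta>) = 0)" for k
  proof (induction k)
    case 0
    show ?case using strict_derivative_linear[OF bounded_linear_fst] by (intro exI[of _ fst]) auto
  next
    case (Suc k)
    then obtain D where D: "strict_derivative (\<lambda>p. trajectory F (fst p) (blocks (snd p)) k) D (T, y)"
      "\<And>\<eta>. \<forall>i<k. \<eta> $ idx i = 0 \<Longrightarrow> D (0, \<eta>) = 0" by blast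
    obtain DF where DF: "strict_derivative F DF (trajectory F T (blocks y) k, blocks y k)"
      using C1_on_strict_derivative[OF F_C1 open_UU] trajectory_U T by blast
    interpret DF: bounded_linear DF by (rule strict_derivative_bounded_linear[OF DF])
    have "strict_derivative (\<lambda>p. F (trajectory F (fst p) (blocks (snd p)) k, snd p $ idx k))
        (\<lambda>h. DF (D h, snd h $ idx k)) (T, y)"
      using strict_derivative_compose[OF strict_derivative_Pair[OF D(1) strict_derivative_linear[OF lin[of "idx k"]]], of F DF]
        DF by (simp add: blocks_def)
    moreover have "DF (D (0, \<eta>), snd (0, \<eta>) $ idx k) = 0" if "\<forall>i<Suc k. \<eta> $ idx i = 0" for \<eta>
      using D(2)[of \<eta>] that DF.zero by (simp add: zero_prod_def)
    ultimately show ?case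
      by (intro exI[of _ "\<lambda>h. DF (D h, snd h $ idx k)"]) (simp add: blocks_def[of _ k])
  qed
  let ?Q = "\<lambda>j A. strict_derivative (\<lambda>p. f (trajectory F (fst p) (blocks (snd p)) (pos j), snd p $ j)) A (T, y) \<and>
    (\<forall>\<eta>. (\<forall>i<pos j. \<eta> $ idx i = 0) \<longrightarrow> A (0, \<eta>) = 0 \<longrightarrow> \<eta> $ j = 0)"
  have "\<exists>A. ?Q j A" for j
  proof -
    obtain D where D: "strict_derivative (\<lambda>p. trajectory F (fst p) (blocks (snd p)) (pos j)) D (T, y)"
      "\<And>\<eta>. \<forall>i<pos j. \<eta> $ idx i = 0 \<Longrightarrow> D (0, \<eta>) = 0" using traj by blast
    let ?z = "trajectory F T (blocks y) (pos j)"
    have z: "?z \<in> U" using trajectory_U T by auto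
    obtain Df where Df: "strict_derivative f Df (?z, y $ j)"
      using C1_on_strict_derivative[OF f_C1 open_UU] z by blast
    \<comment> \<open>Differentiating the identity \<open>inv f (f y) = y\<close> gives a left
      inverse of the derivative of the diffeomorphism.\<close>
    have inj: "\<eta> = 0" if \<eta>: "Df (0, \<eta>) = 0" for \<eta>
    proof -
      have 1: "((\<lambda>v. f (?z, v)) has_derivative (\<lambda>h. Df (0, h))) (at (y $ j))"
        by (rule has_derivative_compose[of "\<lambda>v. (?z, v)" "\<lambda>h. (0, h)" _ _ f Df, simplified])
           (auto intro!: derivative_eq_intros strict_derivative_has_derivative[OF Df])
      have "C1_on UNIV (inv (\<lambda>v. f (?z, v)))" using diffeo[OF z] by (simp add: C1_diffeomorphism_def)
      then obtain G where 2: "(inv (\<lambda>v. f (?z, v)) has_derivative G) (at (f (?z, y $ j)))"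
        unfolding C1_on_def by blast
      have "((\<lambda>v. inv (\<lambda>v. f (?z, v)) (f (?z, v))) has_derivative (\<lambda>h. G (Df (0, h)))) (at (y $ j))"
        by (rule has_derivative_compose[OF 1 2])
      then have "((\<lambda>v. v) has_derivative (\<lambda>h. G (Df (0, h)))) (at (y $ j))"
        using inv_f[OF z] by simp
      then have "(\<lambda>h. G (Df (0, h))) = (\<lambda>h. h)"
        by (rule has_derivative_unique) (rule has_derivative_ident)
      then have "\<eta> = G 0" using \<eta> by metis
      also have "G 0 = 0" using has_derivative_linear[OF 2] by (rule linear_0)
      finally show ?thesis .
    qed
    have "strict_derivative (\<lambda>p. f (trajectory F (fst p) (blocks (snd p)) (pos j), snd p $ j))
        (\<lambda>h. Df (D h, snd h $ j)) (T, y)"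
      using strict_derivative_compose[OF strict_derivative_Pair[OF D(1) strict_derivative_linear[OF lin[of j]]], of f Df]
        Df by simp
    then show ?thesis using D(2) inj by (intro exI[of _ "\<lambda>h. Df (D h, snd h $ j)"]) auto
  qed
  then have "\<forall>j. \<exists>A. ?Q j A" by (intro allI)
  from choice[OF this] obtain A where A': "\<forall>j. ?Q j (A j)" by (rule exE)
  then have A: "strict_derivative (\<lambda>p. f (trajectory F (fst p) (blocks (snd p)) (pos j), snd p $ j)) (A j) (T, y)"
    "\<forall>i<pos j. \<eta> $ idx i = 0 \<Longrightarrow> A j (0, \<eta>) = 0 \<Longrightarrow> \<eta> $ j = 0" for j \<eta>
    by auto
  have axis_lin: "bounded_linear (\<lambda>v :: real ^ 'm. axis j v :: (real ^ 'm) ^ 'n)" for j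
    by (simp add: linear_conv_bounded_linear[symmetric] linear_iff axis_def vec_eq_iff)
  have sum_axis: "(\<Sum>j\<in>UNIV. axis j (v j)) = (\<chi> j. v j)" for v :: "'n \<Rightarrow> real ^ 'm"
    by (simp add: vec_eq_iff axis_def if_distrib cong: if_cong)
  define D where "D h = (\<chi> j. A j h)" for h
  \<comment> \<open>A vector is written as the sum of its axis parts, which reduces the claim to
    sums and linear maps.\<close>
  have "strict_derivative (\<lambda>p. \<Sum>j\<in>UNIV. axis j (f (trajectory F (fst p) (blocks (snd p)) (pos j), snd p $ j)))
      (\<lambda>h. \<Sum>j\<in>UNIV. axis j (A j h)) (T, y)"
    by (intro strict_derivative_sum strict_derivative_compose[OF A(1) strict_derivative_linear[OF axis_lin]])
  then have "strict_derivative (\<lambda>p. chart (fst p) (snd p)) D (T, y)"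
    by (simp add: sum_axis chart_def D_def[abs_def])
  moreover have "\<eta> = 0" if \<eta>: "D (0, \<eta>) = 0" for \<eta>
  proof -
    have "k < CARD('n) \<Longrightarrow> \<eta> $ idx k = 0" for k
    proof (induction k rule: less_induct)
      case (less k)
      then show ?case using A(2)[of "idx k" \<eta>] \<eta> by (auto simp: D_def vec_eq_iff)
    qed
    then have "\<eta> $ j = 0" for j using pos_less[of j] idx_pos[of j] by metis
    then show ?thesis by (simp add: vec_eq_iff)
  qed
  ultimately show ?thesis using that traj by blast
qed

end

context attracting_system
begin

abbreviation polynomials :: "((real ^ 'n) \<Rightarrow> real) set" where
  "polynomials \<equiv> {p. real_polynomial_function p}"

text \<open>\<open>H\<close> takes values in a space of the dimension of the noise and is
  nondegenerate in the noise at \<open>T\<close>. Its part \<open>pr (H (z, y))\<close> is a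
  function \<open>G\<close> of the endpoint which is injective on \<open>W\<close> near the generic
  endpoint. Events about the endpoint thus become events about \<open>H\<close>, to which a change
  of variables applies.\<close>

theorem local_coordinates:
  obtains H :: "(real ^ 'n) \<times> ((real ^ 'm) ^ 'n) \<Rightarrow> (real ^ 'm) ^ 'n"
    and G :: "real ^ 'n \<Rightarrow> (real ^ 'm) ^ 'n"
    and pr :: "(real ^ 'm) ^ 'n \<Rightarrow> (real ^ 'm) ^ 'n" and D y e
  where "\<And>j. y $ j \<in> interior E"
    and "strict_derivative H D (T, y)" "\<And>\<eta>. D (0, \<eta>) = 0 \<Longrightarrow> \<eta> = 0"
    and "bounded_linear pr" "continuous_on UNIV G"
    and "\<And>z y. z \<in> U \<Longrightarrow> pr (H (z, y)) = G (trajectory F z (blocks y) CARD('n))"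
    and "e > 0" "inj_on G (W \<inter> cball (trajectory F T (blocks y) CARD('n)) e)"
proof -
  let ?K = "CARD('n)"
  obtain gs where gs: "set gs \<subseteq> polynomials" "indep (S ?K) gs" "length gs = rank ?K"
    by (rule rank_basis)
  define Gs where "Gs = map (\<lambda>g u. g (endpoint u)) gs"
  have Gs_reg: "set Gs \<subseteq> regular_functions"
    using gs(1) regular_compose[OF regular_endpoint polynomial_regular] by (auto simp: Gs_def)
  have "indep UNIV Gs"
    unfolding Gs_def by (rule indep_comp) (simp add: range_endpoint gs(2))
  \<comment> \<open>Completing the \<open>Gs\<close> by a maximal number of linear coordinates makes every coordinate algebraic
    over the resulting list, so its derivative is injective at a generic point.\<close>
  define coords where "coords bs = map (\<lambda>b u. u \<bullet> b) bs" for bs :: "((real ^ 'm) ^ 'n) list"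
  have coords_reg: "set (coords bs @ Gs) \<subseteq> regular_functions" for bs
    using Gs_reg polynomial_regular[OF real_polynomial_function_inner] by (auto simp: coords_def)
  define L where "L = {length bs | bs. indep UNIV (coords bs @ Gs)}"
  have "l \<le> DIM((real ^ 'm) ^ 'n)" if "l \<in> L" for l
    using that indep_length_le_DIM[OF _ coords_reg] by (fastforce simp: L_def coords_def)
  then have "finite L" by (meson finite_atMost finite_subset atMost_iff subsetI)
  moreover have "0 \<in> L" using \<open>indep UNIV Gs\<close> by (auto simp: L_def coords_def intro!: exI[of _ "[]"])
  ultimately have "Max L \<in> L" and Lmax: "\<And>l. l \<in> L \<Longrightarrow> l \<le> Max L" by (auto intro: Max_in)
  then obtain bs where bs: "length bs = Max L" "indep UNIV (coords bs @ Gs)" by (auto simp: L_def)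
  define hs where "hs = coords bs @ Gs"
  have hs_reg: "set hs \<subseteq> regular_functions" unfolding hs_def by (rule coords_reg)
  have alg_b: "alg UNIV (gen hs) (\<lambda>u. u \<bullet> b)" for b :: "(real ^ 'm) ^ 'n"
  proof (rule ccontr)
    assume "\<not> ?thesis"
    then have "indep UNIV (coords (b # bs) @ Gs)" using bs(2) by (simp add: coords_def hs_def)
    then have "length (b # bs) \<in> L" unfolding L_def by blast
    then show False using Lmax bs(1) by force
  qed
  \<comment> \<open>Every coordinate of the input space satisfies a relation over \<open>hs\<close>
    with formal derivative not identically zero; this will make the derivative of \<open>hs\<close>
    injective.\<close>
  have "\<exists>c n. range c \<subseteq> gen hs \<and> (\<forall>u. upoly c n (\<lambda>u. u \<bullet> b) u = 0) \<and>
      (\<exists>u. upoly_deriv c n (\<lambda>u. u \<bullet> b) u \<noteq> 0)" for b :: "(real ^ 'm) ^ 'n"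
    by (rule alg_deriv[OF fun_ring_gen alg_b[of b]]) blast
  then obtain cb nb where cb: "\<And>b. range (cb b) \<subseteq> gen hs" "\<And>b u. upoly (cb b) (nb b) (\<lambda>u. u \<bullet> b) u = 0"
    "\<And>b. \<exists>u. upoly_deriv (cb b) (nb b) (\<lambda>u. u \<bullet> b) u \<noteq> 0" by metis
  have poly_j: "real_polynomial_function (\<lambda>x :: real ^ 'n. x $ j)" for j
    by (intro real_polynomial_function.intros(1) bounded_linear_vec_nth)
  \<comment> \<open>The same for the coordinates of the state over \<open>gs\<close>; this will make
    the state recoverable from \<open>gs\<close> near the endpoint.\<close>
  have "\<exists>c n. range c \<subseteq> gen gs \<and> (\<forall>x\<in>S ?K. upoly c n (\<lambda>x. x $ j) x = 0) \<and>
      (\<exists>x\<in>S ?K. upoly_deriv c n (\<lambda>x. x $ j) x \<noteq> 0)" for j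
    by (rule alg_deriv[OF fun_ring_gen basis_alg[OF gs poly_j[of j]]]) blast
  then obtain cj nj where cj: "\<And>j. range (cj j) \<subseteq> gen gs"
    "\<And>j. \<forall>x\<in>S ?K. upoly (cj j) (nj j) (\<lambda>x. x $ j) x = 0"
    "\<And>j. \<exists>x\<in>S ?K. upoly_deriv (cj j) (nj j) (\<lambda>x. x $ j) x \<noteq> 0" by metis
  have gen_gs: "gen gs \<subseteq> polynomials" by (rule gen_least[OF fun_ring_polynomials gs(1)])
  have gen_hs: "gen hs \<subseteq> regular_functions" by (rule gen_least[OF fun_ring_regular hs_reg])
  have deriv_ring: "upoly_deriv c n t \<in> R" if "fun_ring R" "range c \<subseteq> R" "t \<in> R"
    for R and c :: "nat \<Rightarrow> 'x \<Rightarrow> real" and n t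
    unfolding upoly_deriv_def using that
    by (intro fun_ring_sum fun_ringD(3) fun_ring_power fun_ringD(1)) auto
  define I where "I = Inl ` (Basis :: ((real ^ 'm) ^ 'n) set) \<union> range (Inr :: 'n \<Rightarrow> _)"
  define dd where "dd i = (case i of Inl b \<Rightarrow> upoly_deriv (cb b) (nb b) (\<lambda>u. u \<bullet> b)
    | Inr j \<Rightarrow> (\<lambda>u. upoly_deriv (cj j) (nj j) (\<lambda>x. x $ j) (endpoint u)))" for i
  \<comment> \<open>One generic input sequence at which all these formal derivatives are nonzero and
    whose noise lies in the interior of \<open>E\<close>.\<close>
  have "\<exists>u\<in>{u. \<forall>j. inv_chart u $ j \<in> interior E}. \<forall>i\<in>I. dd i u \<noteq> 0"
  proof (rule regular_nonzero_point)
    show "finite I" by (simp add: I_def)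
    show "dd i \<in> regular_functions" if "i \<in> I" for i
    proof (cases i)
      case (Inl b)
      then show ?thesis unfolding dd_def using cb(1) gen_hs
        by (auto intro!: deriv_ring[OF fun_ring_regular] polynomial_regular[OF real_polynomial_function_inner])
    next
      case (Inr j)
      have "upoly_deriv (cj j) (nj j) (\<lambda>x. x $ j) \<in> polynomials"
        using cj(1) gen_gs poly_j by (intro deriv_ring[OF fun_ring_polynomials]) auto
      then have "(\<lambda>u. upoly_deriv (cj j) (nj j) (\<lambda>x. x $ j) (endpoint u)) \<in> regular_functions"
        by (intro regular_compose[OF regular_endpoint] polynomial_regular) simp
      then show ?thesis using Inr by (simp add: dd_def)
    qed
    show "\<exists>u. dd i u \<noteq> 0" if "i \<in> I" for i
    proof (cases i)
      case (Inl b)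
      then show ?thesis using cb(3) by (simp add: dd_def)
    next
      case (Inr j)
      then show ?thesis using cj(3)[of j] unfolding range_endpoint[symmetric] by (auto simp: dd_def)
    qed
    show "open {u. \<forall>j. inv_chart u $ j \<in> interior E}" by (rule open_noise)
    have "(\<chi> j. f (T, a)) \<in> {u. \<forall>j. inv_chart u $ j \<in> interior E}"
      using a by (simp add: inv_chart_stationary)
    then show "{u. \<forall>j. inv_chart u $ j \<in> interior E} \<noteq> {}" by blast
  qed
  then obtain u0 where u0: "\<forall>j. inv_chart u0 $ j \<in> interior E" "\<forall>i\<in>I. dd i u0 \<noteq> 0" by auto
  define y0 where "y0 = inv_chart u0"
  have chart_y0: "chart T y0 = u0" unfolding y0_def by (rule chart_inv_chart)
  have "length hs \<le> DIM((real ^ 'm) ^ 'n)"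
    using indep_length_le_DIM[of hs] bs(2) hs_reg by (simp add: hs_def)
  from basis_functional_bound[OF this] obtain \<sigma> :: "(real ^ 'm) ^ 'n \<Rightarrow> nat"
    where \<sigma>: "bij_betw \<sigma> Basis {0..<DIM((real ^ 'm) ^ 'n)}" "{0..<length hs} \<subseteq> \<sigma> ` Basis" by blast
  let ?q = "length bs"
  \<comment> \<open>\<open>B1\<close> carries the linear coordinates of the inputs and
    \<open>B2\<close> the functions of the endpoint. Basis vectors numbered from
    \<open>length hs\<close> on receive the component zero.\<close>
  define B1 where "B1 = {b\<in>Basis. \<sigma> b < ?q}"
  define B2 where "B2 = {b\<in>Basis. ?q \<le> \<sigma> b \<and> \<sigma> b < length hs}"
  have fin: "finite B1" "finite B2" "B1 \<inter> B2 = {}" by (auto simp: B1_def B2_def)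
  define g where "g b = gs ! (\<sigma> b - ?q)" for b
  have len: "length hs = ?q + length gs" by (simp add: hs_def coords_def Gs_def)
  have g_poly: "real_polynomial_function (g b)" if "b \<in> B2" for b
  proof -
    have "\<sigma> b - ?q < length gs" using that len by (auto simp: B2_def)
    then have "g b \<in> set gs" by (simp add: g_def)
    then show ?thesis using gs(1) by blast
  qed
  define H where "H p = (\<Sum>b\<in>B1. (chart (fst p) (snd p) \<bullet> bs ! \<sigma> b) *\<^sub>R b)
      + (\<Sum>b\<in>B2. g b (trajectory F (fst p) (blocks (snd p)) ?K) *\<^sub>R b)" for p
  define G where "G x = (\<Sum>b\<in>B2. g b x *\<^sub>R b)" for x
  define pr where "pr v = (\<Sum>b\<in>B2. (v \<bullet> b) *\<^sub>R b)" for v :: "(real ^ 'm) ^ 'n"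
  have inner_G: "G x \<bullet> b = g b x" if "b \<in> B2" for x b
    using that fin(2) by (subst G_def) (auto simp: inner_sum_left inner_Basis B2_def if_distrib sum.delta cong: if_cong)
  have pr: "bounded_linear pr"
    unfolding pr_def by (intro bounded_linear_sum bounded_linear_scaleR_const bounded_linear_inner_left)
  have inner_sum: "(\<Sum>b\<in>B. h b *\<^sub>R b) \<bullet> b' = (if b' \<in> B then h b' else 0)"
    if "B \<subseteq> Basis" "b' \<in> Basis" for B and h :: "(real ^ 'm) ^ 'n \<Rightarrow> real" and b'
  proof -
    have "finite B" using that(1) finite_Basis finite_subset by blast
    have "(\<Sum>b\<in>B. h b *\<^sub>R b) \<bullet> b' = (\<Sum>b\<in>B. if b = b' then h b else 0)"
      unfolding inner_sum_left using that by (intro sum.cong) (auto simp: inner_Basis)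
    then show ?thesis using \<open>finite B\<close> by simp
  qed
  have pr_H: "pr (H p) = G (trajectory F (fst p) (blocks (snd p)) ?K)" for p
  proof -
    have "H p \<bullet> b = g b (trajectory F (fst p) (blocks (snd p)) ?K)" if b: "b \<in> B2" for b
    proof -
      have "b \<in> Basis" "b \<notin> B1" "B1 \<subseteq> Basis" "B2 \<subseteq> Basis" using b by (auto simp: B1_def B2_def)
      then show ?thesis using b by (simp add: H_def inner_add_left inner_sum)
    qed
    then show ?thesis by (simp add: pr_def G_def)
  qed
  obtain Dc where Dc: "strict_derivative (\<lambda>p. chart (fst p) (snd p)) Dc (T, y0)"
    "\<And>\<eta>. Dc (0, \<eta>) = 0 \<Longrightarrow> \<eta> = 0"
    "\<exists>D. strict_derivative (\<lambda>p. trajectory F (fst p) (blocks (snd p)) ?K) D (T, y0)"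
    by (rule chart_strict_derivative[of y0]) blast
  then obtain Dt where Dt: "strict_derivative (\<lambda>p. trajectory F (fst p) (blocks (snd p)) ?K) Dt (T, y0)" by blast
  have "\<exists>D. strict_derivative H D (T, y0)"
  proof -
    have "\<forall>b\<in>B2. \<exists>D. strict_derivative (g b) D (trajectory F T (blocks y0) ?K)"
      using strict_derivative_polynomial[OF g_poly] by blast
    then obtain Dg where Dg: "\<And>b. b \<in> B2 \<Longrightarrow> strict_derivative (g b) (Dg b) (trajectory F T (blocks y0) ?K)"
      by metis
    have 1: "strict_derivative (\<lambda>p. \<Sum>b\<in>B1. (chart (fst p) (snd p) \<bullet> bs ! \<sigma> b) *\<^sub>R b)
        (\<lambda>h. \<Sum>b\<in>B1. (Dc h \<bullet> bs ! \<sigma> b) *\<^sub>R b) (T, y0)"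
      by (intro strict_derivative_sum strict_derivative_compose[OF Dc(1),
            of "\<lambda>v. (v \<bullet> bs ! \<sigma> b) *\<^sub>R b" for b] strict_derivative_linear
          bounded_linear_scaleR_const bounded_linear_inner_left)
    have 2: "strict_derivative (\<lambda>p. \<Sum>b\<in>B2. g b (trajectory F (fst p) (blocks (snd p)) ?K) *\<^sub>R b)
        (\<lambda>h. \<Sum>b\<in>B2. Dg b (Dt h) *\<^sub>R b) (T, y0)"
    proof (rule strict_derivative_sum)
      fix b assume b: "b \<in> B2"
      have "strict_derivative (\<lambda>p. g b (trajectory F (fst p) (blocks (snd p)) ?K)) (\<lambda>h. Dg b (Dt h)) (T, y0)"
        by (rule strict_derivative_compose[OF Dt]) (simp add: Dg b)
      from strict_derivative_compose[OF this strict_derivative_linear[OF bounded_linear_scaleR_left]]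
      show "strict_derivative (\<lambda>p. g b (trajectory F (fst p) (blocks (snd p)) ?K) *\<^sub>R b)
        (\<lambda>h. Dg b (Dt h) *\<^sub>R b) (T, y0)" .
    qed
    show ?thesis using strict_derivative_add[OF 1 2] by (auto simp: H_def[abs_def])
  qed
  then obtain D where D: "strict_derivative H D (T, y0)" by blast
  \<comment> \<open>For start \<open>T\<close>, \<open>H\<close> is \<open>hs\<close> composed with
    \<open>chart\<close>. A kernel vector gives a direction \<open>w\<close> along which all of
    \<open>hs\<close> is stationary, hence all of \<open>gen hs\<close>, hence every coordinate; so
    \<open>w = 0\<close>, and the injective derivative of \<open>chart\<close> concludes.\<close>
  have D_inj: "\<eta> = 0" if \<eta>: "D (0, \<eta>) = 0" for \<eta>
  proof -
    define h where "h u = (\<Sum>b\<in>B1 \<union> B2. (hs ! \<sigma> b) u *\<^sub>R b)" for u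
    have hs_nth: "hs ! \<sigma> b \<in> set hs" if "b \<in> B1 \<union> B2" for b
      using that len by (intro nth_mem) (auto simp: B1_def B2_def)
    have h_chart: "H (T, y) = h (chart T y)" for y
    proof -
      have 1: "(\<Sum>b\<in>B1. (hs ! \<sigma> b) (chart T y) *\<^sub>R b) = (\<Sum>b\<in>B1. (chart T y \<bullet> bs ! \<sigma> b) *\<^sub>R b)"
        by (intro sum.cong) (auto simp: hs_def coords_def B1_def nth_append)
      have 2: "(\<Sum>b\<in>B2. (hs ! \<sigma> b) (chart T y) *\<^sub>R b) = (\<Sum>b\<in>B2. g b (trajectory F T (blocks y) ?K) *\<^sub>R b)"
        using trajectory_chart[of T ?K y] T len
        by (intro sum.cong) (auto simp: hs_def coords_def Gs_def B2_def nth_append g_def endpoint_def)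
      show ?thesis using fin by (simp add: h_def sum.union_disjoint 1 2 H_def)
    qed
    have "\<forall>b\<in>B1 \<union> B2. \<exists>D. ((hs ! \<sigma> b) has_derivative D) (at u0)"
      using hs_nth hs_reg regular_differentiable by blast
    then obtain Dh where Dh: "\<And>b. b \<in> B1 \<union> B2 \<Longrightarrow> ((hs ! \<sigma> b) has_derivative Dh b) (at u0)" by metis
    define w where "w = Dc (0, \<eta>)"
    have der_h: "(h has_derivative (\<lambda>v. \<Sum>b\<in>B1 \<union> B2. Dh b v *\<^sub>R b)) (at (chart T y0))"
      unfolding h_def chart_y0 by (intro has_derivative_sum has_derivative_scaleR_left Dh)
    have der_pair: "((\<lambda>y. (T, y)) has_derivative (\<lambda>\<eta>. (0, \<eta>))) (at y0)"
      by (auto intro!: derivative_eq_intros)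
    have der_c: "((\<lambda>y. chart T y) has_derivative (\<lambda>\<eta>. Dc (0, \<eta>))) (at y0)"
      using has_derivative_compose[OF der_pair, of "\<lambda>p. chart (fst p) (snd p)" Dc]
        strict_derivative_has_derivative[OF Dc(1)] by simp
    have der_H: "((\<lambda>y. H (T, y)) has_derivative (\<lambda>\<eta>. D (0, \<eta>))) (at y0)"
      by (rule has_derivative_compose[OF der_pair strict_derivative_has_derivative[OF D]])
    have "((\<lambda>y. H (T, y)) has_derivative (\<lambda>\<eta>. \<Sum>b\<in>B1 \<union> B2. Dh b (Dc (0, \<eta>)) *\<^sub>R b)) (at y0)"
      unfolding h_chart by (rule has_derivative_compose[OF der_c der_h])
    from has_derivative_unique[OF der_H this]
    have sum0: "(\<Sum>b\<in>B1 \<union> B2. Dh b w *\<^sub>R b) = 0" using \<eta> unfolding w_def by metis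
    have Dh0: "Dh b w = 0" if b: "b \<in> B1 \<union> B2" for b
    proof -
      have "(\<Sum>b\<in>B1 \<union> B2. Dh b w *\<^sub>R b) \<bullet> b = Dh b w"
        using b by (subst inner_sum) (auto simp: B1_def B2_def)
      then show ?thesis using sum0 by simp
    qed
    let ?R = "{f. \<exists>D. (f has_derivative D) (at u0) \<and> D w = (0::real)}"
    have "set hs \<subseteq> ?R"
    proof
      fix k assume "k \<in> set hs"
      then obtain l where l: "l < length hs" "k = hs ! l" by (auto simp: in_set_conv_nth)
      then obtain b where b: "b \<in> Basis" "\<sigma> b = l" using \<sigma>(2) by force
      then have "b \<in> B1 \<union> B2" using l by (auto simp: B1_def B2_def)
      then show "k \<in> ?R" using Dh Dh0 b l by blast
    qed
    then have gen_R: "gen hs \<subseteq> ?R" by (rule gen_least[OF fun_ring_stationary])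
    have "w \<bullet> b = 0" if b: "b \<in> Basis" for b
    proof -
      have "cb b i \<in> ?R" for i using cb(1)[of b] gen_R by blast
      then have *: "\<exists>D. (cb b i has_derivative D) (at u0) \<and> D w = 0" for i by simp
      have "((\<lambda>u. u \<bullet> b) has_derivative (\<lambda>u. u \<bullet> b)) (at u0)"
        by (intro bounded_linear_imp_has_derivative bounded_linear_inner_left)
      from upoly_has_derivative[where c = "cb b" and n = "nb b", OF * this] obtain D' where
        D': "(upoly (cb b) (nb b) (\<lambda>u. u \<bullet> b) has_derivative D') (at u0)"
        "D' w = upoly_deriv (cb b) (nb b) (\<lambda>u. u \<bullet> b) u0 * (w \<bullet> b)" by blast
      have "upoly (cb b) (nb b) (\<lambda>u. u \<bullet> b) = (\<lambda>_. 0)" using cb(2) by (rule ext)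
      then have "D' = (\<lambda>_. 0)" using has_derivative_unique[OF D'(1)] by simp
      moreover have "upoly_deriv (cb b) (nb b) (\<lambda>u. u \<bullet> b) u0 \<noteq> 0"
        using u0(2)[rule_format, of "Inl b"] b by (simp add: I_def dd_def)
      ultimately show ?thesis using D'(2) by simp
    qed
    then have "w = 0" using euclidean_all_zero_iff[of w] by blast
    then show ?thesis using Dc(2) by (simp add: w_def)
  qed
  define z0 where "z0 = trajectory F T (blocks y0) ?K"
  have z0: "z0 = endpoint u0"
    using trajectory_chart[of T ?K y0] T by (simp add: z0_def endpoint_def chart_y0)
  have G_cont: "continuous_on UNIV G"
    unfolding G_def using g_poly
    by (intro continuous_on_sum continuous_on_scaleR continuous_on_const regular_continuous polynomial_regular)
  have "\<exists>e>0. \<forall>x x'. dist x z0 \<le> e \<longrightarrow> dist x' z0 \<le> e \<longrightarrow> (\<forall>i. cj j i x = cj j i x') \<longrightarrow>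
      upoly (cj j) (nj j) (\<lambda>x. x $ j) x = 0 \<longrightarrow> upoly (cj j) (nj j) (\<lambda>x. x $ j) x' = 0 \<longrightarrow> x $ j = x' $ j" for j
  proof -
    have "continuous_on UNIV (cj j i)" for i
      using cj(1)[of j] gen_gs by (intro regular_continuous polynomial_regular) auto
    moreover have "upoly_deriv (cj j) (nj j) (\<lambda>x. x $ j) z0 \<noteq> 0"
      using u0(2)[rule_format, of "Inr j"] by (simp add: I_def dd_def z0)
    moreover have "continuous_on UNIV (\<lambda>x :: real ^ 'n. x $ j)"
      by (intro continuous_on_component continuous_on_id)
    ultimately show ?thesis
      using upoly_injective[of "cj j" "\<lambda>x. x $ j" "nj j" z0] by metis
  qed
  then obtain ej where ej: "\<And>j. ej j > 0"
    "\<And>j x x'. dist x z0 \<le> ej j \<Longrightarrow> dist x' z0 \<le> ej j \<Longrightarrow> \<forall>i. cj j i x = cj j i x' \<Longrightarrow>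
      upoly (cj j) (nj j) (\<lambda>x. x $ j) x = 0 \<Longrightarrow> upoly (cj j) (nj j) (\<lambda>x. x $ j) x' = 0 \<Longrightarrow> x $ j = x' $ j"
    by metis
  define e where "e = Min (range ej)"
  have "e > 0" using ej(1) by (simp add: e_def)
  have e_le: "e \<le> ej j" for j by (simp add: e_def)
  \<comment> \<open>Equal values of \<open>G\<close> mean equal values of \<open>gs\<close>, hence
    equal coefficients \<open>cj\<close>. Both points are then roots of the same polynomials near
    \<open>z0\<close>.\<close>
  have "inj_on G (W \<inter> cball z0 e)"
  proof
    fix x x' assume x: "x \<in> W \<inter> cball z0 e" "x' \<in> W \<inter> cball z0 e" and eq: "G x = G x'"
    have "set gs \<subseteq> {f. f x = f x'}"
    proof
      fix k assume "k \<in> set gs"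
      then obtain l where l: "l < length gs" "k = gs ! l" by (auto simp: in_set_conv_nth)
      then have "?q + l < length hs" using len by simp
      then obtain b where b: "b \<in> Basis" "\<sigma> b = ?q + l" using \<sigma>(2) by force
      then have "b \<in> B2" "g b = k" using l len by (auto simp: B2_def g_def)
      then show "k \<in> {f. f x = f x'}" using inner_G[of b x] inner_G[of b x'] eq by simp
    qed
    moreover have "fun_ring {f :: real ^ 'n \<Rightarrow> real. f x = f x'}" by (auto simp: fun_ring_def)
    ultimately have "gen gs \<subseteq> {f. f x = f x'}" by (intro gen_least)
    then have "cj j i x = cj j i x'" for j i using cj(1)[of j] by blast
    \<comment> \<open>The relations were found on \<open>S ?K\<close>; being polynomial, they extend
      to all of \<open>W\<close>.\<close>
    moreover have "upoly (cj j) (nj j) (\<lambda>x. x $ j) v = 0" if "v \<in> W" for v j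
    proof (rule vanish_S_card[OF _ _ that])
      show "real_polynomial_function (upoly (cj j) (nj j) (\<lambda>x. x $ j))"
        using upoly_in_ring[OF fun_ring_polynomials, of "cj j" "\<lambda>x. x $ j" "nj j"] cj(1) gen_gs poly_j
        by blast
    qed (use cj(2) in blast)
    moreover have "dist x z0 \<le> ej j" "dist x' z0 \<le> ej j" for j
      using x e_le[of j] by (auto simp: dist_commute)
    ultimately have "x $ j = x' $ j" for j using ej(2)[of x j x'] x by blast
    then show "x = x'" by (simp add: vec_eq_iff)
  qed
  then show ?thesis
    using that[of y0 H D pr G e] u0(1) D D_inj pr G_cont pr_H \<open>e > 0\<close> unfolding y0_def z0_def by simp
qed

end

section \<open>Overlap of the images of a density under nearby maps\<close>

text \<open>Vitali: up to a negligible set, \<open>S\<close> is covered by disjoint balls inside an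
  open set of almost the same measure. Each image lies in a ball enlarged by the factor
  \<open>C\<close>, and the Lipschitz image of the exceptional set is negligible.\<close>

lemma lipschitz_image_measure:
  fixes h :: "'a::euclidean_space \<Rightarrow> 'a"
  assumes S: "S \<in> lmeasurable" and X: "open X" "S \<subseteq> X" and C: "C > 0"
    and lip: "\<And>x y. x \<in> X \<Longrightarrow> y \<in> X \<Longrightarrow> norm (h x - h y) \<le> C * norm (x - y)"
    and hS: "h ` S \<in> lmeasurable"
  shows "measure lebesgue (h ` S) \<le> C ^ DIM('a) * measure lebesgue S"
proof (rule field_le_epsilon)
  fix e :: real assume e: "e > 0"
  let ?N = "DIM('a)"
  \<comment> \<open>The excess is multiplied by \<open>C ^ ?N\<close> in the end.\<close>
  define e' where "e' = e / C ^ ?N"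
  have e': "e' > 0" using e C by (simp add: e'_def)
  obtain O1 where O1: "open O1" "S \<subseteq> O1" "O1 - S \<in> lmeasurable" "emeasure lebesgue (O1 - S) < ennreal e'"
    using sets_lebesgue_outer_open[OF fmeasurableD[OF S] e'] by blast
  define Q where "Q = O1 \<inter> X"
  have Q: "open Q" "S \<subseteq> Q" "Q \<subseteq> X" using O1 X by (auto simp: Q_def)
  have "Q \<in> sets lebesgue" using Q(1) by simp
  then have diff: "Q - S \<in> lmeasurable"
    using fmeasurableD[OF S] by (intro fmeasurableI2[OF O1(3)] sets.Diff) (auto simp: Q_def)
  have Q_eq: "Q = S \<union> (Q - S)" using Q(2) by auto
  have Q_lm: "Q \<in> lmeasurable" by (subst Q_eq) (intro fmeasurable.Un S diff)
  have "measure lebesgue (Q - S) \<le> measure lebesgue (O1 - S)"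
    using diff O1(3) by (intro measure_mono_fmeasurable) (auto simp: Q_def fmeasurableD)
  also have "\<dots> \<le> e'"
    using O1(3,4) e' by (simp add: emeasure_eq_measure2 fmeasurableD2 emeasure_eq_ennreal_measure ennreal_less_iff)
  finally have mQ: "measure lebesgue Q \<le> measure lebesgue S + e'"
    using measure_Un_le[of S lebesgue "Q - S"] S diff Q_eq by (simp add: fmeasurableD)
  define K where "K = {(x, s). 0 < s \<and> ball x s \<subseteq> Q}"
  have "\<exists>i. i \<in> K \<and> x \<in> ball (fst i) (snd i) \<and> snd i < d" if xd: "x \<in> S" "d > 0" for x d
  proof -
    obtain s where s: "s > 0" "ball x s \<subseteq> Q" using Q(1,2) xd(1) open_contains_ball by blast
    have "(x, min s (d / 2)) \<in> K" using s xd(2) by (auto simp: K_def)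
    then show ?thesis using s xd(2) by (intro exI[of _ "(x, min s (d / 2))"]) auto
  qed
  from Vitali_covering_theorem_balls[where a = fst and r = snd, OF this]
  obtain I where I: "countable I" "I \<subseteq> K"
    "pairwise (\<lambda>i j. disjnt (ball (fst i) (snd i)) (ball (fst j) (snd j))) I"
    "negligible (S - (\<Union>i\<in>I. ball (fst i) (snd i)))"
    by blast
  let ?R = "S - (\<Union>i\<in>I. ball (fst i) (snd i))"
  let ?c = "\<lambda>i. cball (h (fst i)) (C * snd i)"
  have pos: "snd i > 0" "ball (fst i) (snd i) \<subseteq> Q" if "i \<in> I" for i using subsetD[OF I(2) that] by (simp_all add: K_def case_prod_beta)
  have neg: "negligible (h ` ?R)"
  proof (rule negligible_locally_Lipschitz_image[OF _ I(4)])
    fix x assume "x \<in> ?R"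
    then show "\<exists>T B. open T \<and> x \<in> T \<and> (\<forall>y\<in>?R \<inter> T. norm (h y - h x) \<le> B * norm (y - x))"
      using X lip by (intro exI[of _ X] exI[of _ C]) auto
  qed simp
  have meas: "measure lebesgue (?c i) = C ^ ?N * measure lebesgue (ball (fst i) (snd i))" if "i \<in> I" for i
    using pos[OF that] C by (simp add: content_ball content_cball power_mult_distrib)
  have bound: "measure lebesgue (\<Union>i\<in>J. ?c i) \<le> C ^ ?N * (measure lebesgue S + e')" if J: "J \<subseteq> I" "finite J" for J
  proof -
    have "measure lebesgue (\<Union>i\<in>J. ?c i) \<le> (\<Sum>i\<in>J. measure lebesgue (?c i))"
      using J by (intro measure_UNION_le) auto
    also have "\<dots> = C ^ ?N * (\<Sum>i\<in>J. measure lebesgue (ball (fst i) (snd i)))"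
      using J meas by (subst sum_distrib_left) (intro sum.cong, auto)
    also have "(\<Sum>i\<in>J. measure lebesgue (ball (fst i) (snd i))) = measure lebesgue (\<Union>i\<in>J. ball (fst i) (snd i))"
      using J(2) pairwise_subset[OF I(3) J(1)] by (intro measure_UNION'[symmetric]) auto
    also have "\<dots> \<le> measure lebesgue Q"
    proof (intro measure_mono_fmeasurable Q_lm)
      show "(\<Union>i\<in>J. ball (fst i) (snd i)) \<subseteq> Q" using J(1) pos(2) by blast
      show "(\<Union>i\<in>J. ball (fst i) (snd i)) \<in> sets lebesgue" using J(2) by (intro sets.finite_UN) auto
    qed
    also have "\<dots> \<le> measure lebesgue S + e'" by (rule mQ)
    finally show ?thesis using C by simp
  qed
  have UN: "(\<Union>i\<in>I. ?c i) \<in> lmeasurable" "measure lebesgue (\<Union>i\<in>I. ?c i) \<le> C ^ ?N * (measure lebesgue S + e')"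
    using bound by (auto intro!: fmeasurable_UN_bound[OF I(1)] measure_UN_bound[OF I(1)])
  have sub: "h ` S \<subseteq> h ` ?R \<union> (\<Union>i\<in>I. ?c i)"
  proof
    fix v assume "v \<in> h ` S"
    then obtain x where x: "x \<in> S" "v = h x" by auto
    show "v \<in> h ` ?R \<union> (\<Union>i\<in>I. ?c i)"
    proof (cases "x \<in> ?R")
      case False
      then obtain i where i: "i \<in> I" "x \<in> ball (fst i) (snd i)" using x by auto
      have "fst i \<in> X" using pos[OF i(1)] Q(3) by (auto simp: subset_iff)
      then have "norm (h (fst i) - h x) \<le> C * norm (fst i - x)" using x X(2) by (intro lip) auto
      also have "\<dots> \<le> C * snd i" using i(2) C by (simp add: dist_norm)
      finally have "v \<in> ?c i" by (simp add: x(2) dist_norm)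
      then show ?thesis using i(1) by blast
    qed (use x in blast)
  qed
  have "measure lebesgue (h ` S) \<le> measure lebesgue (h ` ?R \<union> (\<Union>i\<in>I. ?c i))"
    using neg UN(1) hS by (intro measure_mono_fmeasurable[OF sub] fmeasurable.Un) (auto simp: fmeasurableD negligible_imp_measurable)
  also have "\<dots> \<le> measure lebesgue (h ` ?R) + measure lebesgue (\<Union>i\<in>I. ?c i)"
    using neg UN(1) by (intro measure_Un_le) (auto simp: fmeasurableD negligible_imp_measurable)
  also have "\<dots> \<le> C ^ ?N * (measure lebesgue S + e')"
    using neg UN(2) by (simp add: negligible_imp_measure0)
  also have "\<dots> = C ^ ?N * measure lebesgue S + e"
    using C by (simp add: e'_def distrib_left)
  finally show "measure lebesgue (h ` S) \<le> C ^ ?N * measure lebesgue S + e" .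
qed

text \<open>A weak form of Lebesgue's density theorem. If every ball in \<open>X\<close> had a share
  greater than \<open>\<delta>\<close> outside \<open>D\<close>, a Vitali covering within an open
  set exceeding \<open>D\<close> by at most \<open>\<delta> * measure lebesgue D / 2\<close> would
  bound the measure of \<open>D\<close> by half of itself.\<close>

lemma density_ball:
  fixes D :: "'a::euclidean_space set"
  assumes D: "D \<in> lmeasurable" "measure lebesgue D > 0" and X: "open X" "D \<subseteq> X" and \<delta>: "\<delta> > 0"
  obtains y \<rho> where "\<rho> > 0" "ball y \<rho> \<subseteq> X" "measure lebesgue (ball y \<rho> - D) \<le> \<delta> * measure lebesgue (ball y \<rho>)"
proof (rule ccontr)
  note ball_found = that
  assume neg: "\<not> thesis"
  define e where "e = \<delta> * measure lebesgue D / 2"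
  have e: "e > 0" using D(2) \<delta> by (simp add: e_def)
  obtain O1 where O1: "open O1" "D \<subseteq> O1" "O1 - D \<in> lmeasurable" "emeasure lebesgue (O1 - D) < ennreal e"
    using sets_lebesgue_outer_open[OF fmeasurableD[OF D(1)] e] by blast
  have mO: "measure lebesgue (O1 - D) \<le> e"
    using O1(3,4) e by (simp add: emeasure_eq_measure2 fmeasurableD2 emeasure_eq_ennreal_measure ennreal_less_iff)
  define K where "K = {(x, s). 0 < s \<and> ball x s \<subseteq> O1 \<inter> X}"
  have "\<exists>i. i \<in> K \<and> x \<in> ball (fst i) (snd i) \<and> snd i < d" if xd: "x \<in> D" "d > 0" for x d
  proof -
    obtain s where s: "s > 0" "ball x s \<subseteq> O1 \<inter> X" using O1(1,2) X xd(1) open_contains_ball[of "O1 \<inter> X"] by blast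
    have "(x, min s (d / 2)) \<in> K" using s xd(2) by (auto simp: K_def)
    then show ?thesis using s xd(2) by (intro exI[of _ "(x, min s (d / 2))"]) auto
  qed
  from Vitali_covering_theorem_balls[where a = fst and r = snd, OF this]
  obtain I where I: "countable I" "I \<subseteq> K"
    "pairwise (\<lambda>i j. disjnt (ball (fst i) (snd i)) (ball (fst j) (snd j))) I"
    "negligible (D - (\<Union>i\<in>I. ball (fst i) (snd i)))"
    by blast
  let ?b = "\<lambda>i. ball (fst i) (snd i)"
  have pos: "snd i > 0" "?b i \<subseteq> O1" "?b i \<subseteq> X" if "i \<in> I" for i using subsetD[OF I(2) that] by (simp_all add: K_def case_prod_beta)
  have ineq: "\<delta> * measure lebesgue (?b i \<inter> D) \<le> measure lebesgue (?b i - D)" if i: "i \<in> I" for i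
  proof -
    have "\<not> measure lebesgue (?b i - D) \<le> \<delta> * measure lebesgue (?b i)"
      using neg ball_found[of "snd i" "fst i"] pos[OF i] by blast
    moreover have "measure lebesgue (?b i \<inter> D) \<le> measure lebesgue (?b i)"
      using D(1) by (intro measure_mono_fmeasurable) (auto simp: fmeasurableD)
    then have "\<delta> * measure lebesgue (?b i \<inter> D) \<le> \<delta> * measure lebesgue (?b i)"
      using \<delta> by (intro mult_left_mono) auto
    ultimately show ?thesis by linarith
  qed
  have bound: "measure lebesgue (\<Union>i\<in>J. ?b i \<inter> D) \<le> e / \<delta>" if J: "J \<subseteq> I" "finite J" for J
  proof -
    have "\<delta> * measure lebesgue (\<Union>i\<in>J. ?b i \<inter> D) \<le> \<delta> * (\<Sum>i\<in>J. measure lebesgue (?b i \<inter> D))"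
      using J \<delta> D(1) by (intro mult_left_mono measure_UNION_le) (auto simp: fmeasurableD)
    also have "\<dots> = (\<Sum>i\<in>J. \<delta> * measure lebesgue (?b i \<inter> D))" by (rule sum_distrib_left)
    also have "\<dots> \<le> (\<Sum>i\<in>J. measure lebesgue (?b i - D))"
      using J ineq by (intro sum_mono) auto
    also have "\<dots> = measure lebesgue (\<Union>i\<in>J. ?b i - D)"
    proof (rule measure_UNION'[symmetric, OF J(2)])
      show "?b i - D \<in> lmeasurable" for i using D(1) by (intro fmeasurable_Diff) (auto simp: fmeasurableD)
      show "pairwise (\<lambda>i j. disjnt (?b i - D) (?b j - D)) J"
        using pairwise_subset[OF I(3) J(1)] unfolding pairwise_def disjnt_def by blast
    qed
    also have "\<dots> \<le> measure lebesgue (O1 - D)"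
    proof (intro measure_mono_fmeasurable O1(3))
      show "(\<Union>i\<in>J. ?b i - D) \<subseteq> O1 - D" using J(1) pos(2) by blast
      show "(\<Union>i\<in>J. ?b i - D) \<in> sets lebesgue"
        using J(2) D(1) by (intro sets.finite_UN sets.Diff) (auto simp: fmeasurableD)
    qed
    also have "\<dots> \<le> e" by (rule mO)
    finally show ?thesis using \<delta> by (simp add: field_simps)
  qed
  have UN: "(\<Union>i\<in>I. ?b i \<inter> D) \<in> lmeasurable" "measure lebesgue (\<Union>i\<in>I. ?b i \<inter> D) \<le> e / \<delta>"
    using fmeasurable_UN_bound[OF I(1), of "\<lambda>i. ?b i \<inter> D" lebesgue "e / \<delta>"]
      measure_UN_bound[OF I(1), of "\<lambda>i. ?b i \<inter> D" lebesgue "e / \<delta>"] bound D(1)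
    by (simp_all add: fmeasurable.Int)
  have "D = (D - (\<Union>i\<in>I. ?b i)) \<union> (\<Union>i\<in>I. ?b i \<inter> D)" by auto
  then have "measure lebesgue D \<le> measure lebesgue (D - (\<Union>i\<in>I. ?b i)) + measure lebesgue (\<Union>i\<in>I. ?b i \<inter> D)"
    using measure_Un_le[of "D - (\<Union>i\<in>I. ?b i)" lebesgue "\<Union>i\<in>I. ?b i \<inter> D"] I(4) UN(1)
    by (simp add: fmeasurableD negligible_imp_measurable)
  also have "\<dots> \<le> e / \<delta>" using I(4) UN(2) by (simp add: negligible_imp_measure0)
  also have "\<dots> = measure lebesgue D / 2" using \<delta> by (simp add: e_def)
  finally show False using D(2) by simp
qed

text \<open>The map \<open>y \<mapsto> w - (h y - y)\<close> contracts by 1/2 and moves the centre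
  by at most \<open>\<rho> / 4\<close>, so it maps the closed ball of radius
  \<open>\<rho> / 2\<close> into itself. Its fixed point solves \<open>h y = w\<close>.\<close>

lemma near_identity_surj:
  fixes h :: "'a::euclidean_space \<Rightarrow> 'a"
  assumes \<rho>: "\<rho> > 0"
    and h: "\<And>y y'. y \<in> ball y1 \<rho> \<Longrightarrow> y' \<in> ball y1 \<rho> \<Longrightarrow> norm (h y - h y' - (y - y')) \<le> 1 / 2 * norm (y - y')"
    and w: "norm (h y1 - w) \<le> \<rho> / 4"
  shows "w \<in> h ` ball y1 \<rho>"
proof -
  let ?S = "cball y1 (\<rho> / 2)"
  have sub: "?S \<subseteq> ball y1 \<rho>" using \<rho> by auto
  have "\<exists>!y. y \<in> ?S \<and> w - (h y - y) = y"
  proof (rule Banach_fix[where c = "1 / 2"])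
    show "Topological_Spaces.complete ?S" by (intro compact_imp_complete compact_cball)
    show "?S \<noteq> {}" using \<rho> by simp
    show "(\<lambda>y. w - (h y - y)) ` ?S \<subseteq> ?S"
    proof safe
      fix y assume y: "y \<in> ?S"
      have "y \<in> ball y1 \<rho>" "y1 \<in> ball y1 \<rho>" using y \<rho> by (auto simp: subset_iff)
      then have "norm (h y - h y1 - (y - y1)) \<le> 1 / 2 * norm (y - y1)" by (rule h)
      also have "\<dots> \<le> \<rho> / 4" using y by (simp add: dist_norm norm_minus_commute)
      finally have "norm (h y - h y1 - (y - y1)) + norm (h y1 - w) \<le> \<rho> / 2" using w by simp
      moreover have "norm (y1 - (w - (h y - y))) \<le> norm (h y - h y1 - (y - y1)) + norm (h y1 - w)"
        using norm_triangle_ineq[of "h y - h y1 - (y - y1)" "h y1 - w"] by (simp add: algebra_simps)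
      ultimately show "w - (h y - y) \<in> ?S" by (simp add: dist_norm)
    qed
    fix y y' assume "y \<in> ?S" "y' \<in> ?S"
    then have "norm (h y - h y' - (y - y')) \<le> 1 / 2 * norm (y - y')" using h sub by blast
    then show "dist (w - (h y - y)) (w - (h y' - y')) \<le> 1 / 2 * dist y y'"
      by (simp add: dist_norm norm_minus_commute algebra_simps)
  qed auto
  then obtain y where "y \<in> ?S" "w - (h y - y) = y" by blast
  then have "h y = w" "y \<in> ball y1 \<rho>" using sub by (auto simp: algebra_simps)
  then show ?thesis by blast
qed

lemma near_identity_lipschitz:
  fixes h :: "'a::real_normed_vector \<Rightarrow> 'a"
  assumes "norm (h y - h y' - (y - y')) \<le> 1 / 2 * norm (y - y')"
  shows "norm (h y - h y') \<le> 3 / 2 * norm (y - y')"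
  using norm_triangle_sub[of "h y - h y'" "y - y'"] assms by simp

lemma borel_preimage_open:
  assumes "continuous_on X h" "open X" "B \<in> sets borel"
  shows "{y \<in> X. h y \<in> B} \<in> sets borel"
proof -
  have "h \<in> borel_measurable (restrict_space borel X)"
    by (rule borel_measurable_continuous_on_restrict[OF assms(1)])
  from measurable_sets[OF this assms(3)] have "h -` B \<inter> X \<in> sets (restrict_space borel X)"
    by (simp add: space_restrict_space)
  then have "h -` B \<inter> X \<in> sets borel" using assms(2) by (subst (asm) sets_restrict_space_iff) auto
  moreover have "{y \<in> X. h y \<in> B} = h -` B \<inter> X" by auto
  ultimately show ?thesis by simp
qed

text \<open>All of \<open>ball w (\<rho> / 8)\<close> is attained, since its points have distance at
  most \<open>\<rho> / 8 + \<rho> / 8\<close> from \<open>h y1\<close>. Its part in \<open>B\<close>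
  is then the image of the preimage under a map with Lipschitz constant 3/2.\<close>

lemma near_identity_preimage_measure:
  fixes h :: "'a::euclidean_space \<Rightarrow> 'a"
  assumes \<rho>: "\<rho> > 0"
    and h: "\<And>y y'. y \<in> ball y1 \<rho> \<Longrightarrow> y' \<in> ball y1 \<rho> \<Longrightarrow> norm (h y - h y' - (y - y')) \<le> 1 / 2 * norm (y - y')"
    and w: "norm (h y1 - w) \<le> \<rho> / 8" and B: "B \<in> sets borel"
  shows "{y \<in> ball y1 \<rho>. h y \<in> B} \<in> sets borel"
    and "measure lebesgue (B \<inter> ball w (\<rho> / 8)) \<le> (3 / 2) ^ DIM('a) * measure lebesgue {y \<in> ball y1 \<rho>. h y \<in> B}"
proof -
  have lip: "norm (h y - h y') \<le> 3 / 2 * norm (y - y')" if "y \<in> ball y1 \<rho>" "y' \<in> ball y1 \<rho>" for y y'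
    by (rule near_identity_lipschitz[OF h[OF that]])
  have cont: "continuous_on (ball y1 \<rho>) h"
  proof (rule continuous_onI)
    fix x e :: real and x' assume "e > 0" "x' \<in> ball y1 \<rho>"
    then show "\<exists>d>0. \<forall>y\<in>ball y1 \<rho>. dist y x' < d \<longrightarrow> dist (h y) (h x') \<le> e"
      using lip by (intro exI[of _ "e / 2"]) (force simp: dist_norm)
  qed
  show meas: "{y \<in> ball y1 \<rho>. h y \<in> B} \<in> sets borel" by (rule borel_preimage_open[OF cont _ B]) simp
  let ?A = "{y \<in> ball y1 \<rho>. h y \<in> B \<inter> ball w (\<rho> / 8)}"
  have A: "?A \<in> sets borel" using B by (intro borel_preimage_open[OF cont]) auto
  have sub: "?A \<subseteq> {y \<in> ball y1 \<rho>. h y \<in> B}" by auto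
  have fin: "X \<in> lmeasurable" if "X \<in> sets borel" "X \<subseteq> ball c s" for X c s
    by (rule fmeasurableI2[of "ball c s"]) (use that in auto)
  have image: "h ` ?A = B \<inter> ball w (\<rho> / 8)"
  proof safe
    fix v assume v: "v \<in> B" "v \<in> ball w (\<rho> / 8)"
    have "norm (h y1 - v) \<le> \<rho> / 4"
      using norm_triangle_ineq[of "h y1 - w" "w - v"] w v(2) by (simp add: dist_norm)
    then have "v \<in> h ` ball y1 \<rho>" by (intro near_identity_surj[OF \<rho> h])
    then show "v \<in> h ` ?A" using v by auto
  qed
  have "h ` ?A \<in> lmeasurable" unfolding image using B by (intro fin[of _ w "\<rho> / 8"]) auto
  moreover have "?A \<in> lmeasurable" using A by (intro fin[of ?A y1 \<rho>]) auto
  ultimately have "measure lebesgue (h ` ?A) \<le> (3 / 2) ^ DIM('a) * measure lebesgue ?A"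
    using lip by (intro lipschitz_image_measure[of _ "ball y1 \<rho>"]) auto
  also have "\<dots> \<le> (3 / 2) ^ DIM('a) * measure lebesgue {y \<in> ball y1 \<rho>. h y \<in> B}"
    using A meas by (intro mult_left_mono measure_mono_fmeasurable sub fin[of _ y1 \<rho>]) auto
  finally show "measure lebesgue (B \<inter> ball w (\<rho> / 8)) \<le> (3 / 2) ^ DIM('a) * measure lebesgue {y \<in> ball y1 \<rho>. h y \<in> B}"
    unfolding image .
qed

text \<open>\<open>B\<close> and its complement partition \<open>ball w (\<rho> / 8)\<close>, so
  their preimages under \<open>h\<close> and \<open>h'\<close> together have at least the measure of
  the large ball divided by \<open>12 ^ N\<close>, where 12 = 8 * (3/2). The density of
  \<open>D\<close> is chosen such that removing its complement twice costs at most half of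
  this.\<close>

lemma near_identity_overlap:
  fixes h h' :: "'a::euclidean_space \<Rightarrow> 'a"
  assumes \<rho>: "\<rho> > 0"
    and h: "\<And>y y'. y \<in> ball y1 \<rho> \<Longrightarrow> y' \<in> ball y1 \<rho> \<Longrightarrow> norm (h y - h y' - (y - y')) \<le> 1 / 2 * norm (y - y')"
    and h': "\<And>y y'. y \<in> ball y1 \<rho> \<Longrightarrow> y' \<in> ball y1 \<rho> \<Longrightarrow> norm (h' y - h' y' - (y - y')) \<le> 1 / 2 * norm (y - y')"
    and w: "norm (h y1 - w) \<le> \<rho> / 8" "norm (h' y1 - w) \<le> \<rho> / 8" and B: "B \<in> sets borel"
    and D: "D \<in> sets borel"
    and dens: "measure lebesgue (ball y1 \<rho> - D) \<le> 1 / (4 * 12 ^ DIM('a)) * measure lebesgue (ball y1 \<rho>)"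
  shows "measure lebesgue {y \<in> ball y1 \<rho> \<inter> D. h y \<in> B} + measure lebesgue {y \<in> ball y1 \<rho> \<inter> D. h' y \<notin> B}
    \<ge> measure lebesgue (ball y1 \<rho>) / (2 * 12 ^ DIM('a))"
proof -
  let ?m = "measure lebesgue" and ?N = "DIM('a)" and ?b = "ball y1 \<rho>"
  have fin: "X \<in> lmeasurable" if "X \<in> sets borel" "X \<subseteq> ball c s" for X :: "'a set" and c s
    by (rule fmeasurableI2[of "ball c s"]) (use that in auto)
  \<comment> \<open>Restricting the noise to \<open>D\<close> loses at most the measure of the ball
    outside \<open>D\<close>; this is used once for each of the two preimages.\<close>
  have drop: "?m {y \<in> ?b. P y} \<le> ?m {y \<in> ?b \<inter> D. P y} + ?m (?b - D)" if P: "{y \<in> ?b. P y} \<in> sets borel" for P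
  proof -
    have 1: "{y \<in> ?b \<inter> D. P y} \<in> sets borel"
    proof -
      have "{y \<in> ?b \<inter> D. P y} = {y \<in> ?b. P y} \<inter> D" by auto
      then show ?thesis using sets.Int[OF P D] by simp
    qed
    have "?m {y \<in> ?b. P y} \<le> ?m ({y \<in> ?b \<inter> D. P y} \<union> (?b - D))"
      using 1 P D by (intro measure_mono_fmeasurable fin[of _ y1 \<rho>]) auto
    also have "\<dots> \<le> ?m {y \<in> ?b \<inter> D. P y} + ?m (?b - D)"
      using 1 D by (intro measure_Un_le) auto
    finally show ?thesis .
  qed
  have B': "- B \<in> sets borel" using B by auto
  note p = near_identity_preimage_measure[OF \<rho> h w(1) B]
  note p' = near_identity_preimage_measure[OF \<rho> h' w(2) B']
  let ?a = "?m {y \<in> ?b \<inter> D. h y \<in> B}" and ?a' = "?m {y \<in> ?b \<inter> D. h' y \<notin> B}"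
  have "?m (ball w (\<rho> / 8)) = ?m ((B \<inter> ball w (\<rho> / 8)) \<union> (- B \<inter> ball w (\<rho> / 8)))"
    by (rule arg_cong[of _ _ ?m]) auto
  also have "\<dots> \<le> ?m (B \<inter> ball w (\<rho> / 8)) + ?m (- B \<inter> ball w (\<rho> / 8))"
    using B by (intro measure_Un_le) auto
  also have "\<dots> \<le> (3 / 2) ^ ?N * ?m {y \<in> ?b. h y \<in> B} + (3 / 2) ^ ?N * ?m {y \<in> ?b. h' y \<in> - B}"
    by (intro add_mono p(2) p'(2))
  also have "\<dots> = (3 / 2) ^ ?N * (?m {y \<in> ?b. h y \<in> B} + ?m {y \<in> ?b. h' y \<in> - B})"
    by (simp add: distrib_left)
  also have "\<dots> \<le> (3 / 2) ^ ?N * (?a + ?a' + 2 * ?m (?b - D))"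
    using drop[OF p(1)] drop[OF p'(1)] by (intro mult_left_mono) auto
  finally have 1: "?m (ball w (\<rho> / 8)) \<le> (3 / 2) ^ ?N * (?a + ?a' + 2 * ?m (?b - D))" .
  have "?m (ball w (\<rho> / 8)) = ?m ?b / 8 ^ ?N"
    using \<rho> by (simp add: content_ball power_divide)
  with 1 have "?m ?b / 8 ^ ?N \<le> (3 / 2) ^ ?N * (?a + ?a' + 2 * ?m (?b - D))" by simp
  then have "(2 / 3) ^ ?N * (?m ?b / 8 ^ ?N) \<le> (2 / 3) ^ ?N * ((3 / 2) ^ ?N * (?a + ?a' + 2 * ?m (?b - D)))"
    by (intro mult_left_mono) auto
  moreover have "(2 / 3 :: real) ^ ?N * (3 / 2) ^ ?N = 1" "(2 / 3 :: real) ^ ?N / 8 ^ ?N = 1 / 12 ^ ?N"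
    by (simp_all flip: power_mult_distrib power_divide add: power_one_over)
  moreover have "(2 / 3) ^ ?N * (?m ?b / 8 ^ ?N) = ?m ?b * ((2 / 3) ^ ?N / 8 ^ ?N)" by simp
  moreover have "(2 / 3) ^ ?N * ((3 / 2) ^ ?N * (?a + ?a' + 2 * ?m (?b - D)))
      = ((2 / 3) ^ ?N * (3 / 2) ^ ?N) * (?a + ?a' + 2 * ?m (?b - D))" by (simp only: mult.assoc)
  ultimately have "?m ?b * (1 / 12 ^ ?N) \<le> 1 * (?a + ?a' + 2 * ?m (?b - D))" by (simp only:)
  then have "?m ?b / 12 ^ ?N \<le> ?a + ?a' + 2 * ?m (?b - D)" by simp
  moreover have "2 * ?m (?b - D) \<le> ?m ?b / (2 * 12 ^ ?N)" using dens by (simp add: field_simps)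
  moreover have "?m ?b / 12 ^ ?N = 2 * (?m ?b / (2 * 12 ^ ?N))" by simp
  ultimately show ?thesis by linarith
qed

lemma ball_Pair:
  fixes a x :: "'a::real_normed_vector" and b y :: "'b::real_normed_vector"
  assumes "x \<in> ball a (d / 2)" "y \<in> ball b (d / 2)"
  shows "(x, y) \<in> ball (a, b) d"
proof -
  have "dist (a, b) (x, y) \<le> dist a x + dist b y"
    using norm_Pair_le[of "a - x" "b - y"] by (simp add: dist_norm)
  then show ?thesis using assms by simp
qed

text \<open>Composed with a linear inverse of the derivative in the noise, the maps for nearby
  states are close to the identity and to each other. Their overlap is estimated on a ball where the
  density of \<open>\<mu>\<close> exceeds a constant on almost the whole ball, with bounds that
  depend neither on the states nor on \<open>B\<close>.\<close>

theorem local_overlap: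
  fixes H :: "'a::real_normed_vector \<times> 'b::euclidean_space \<Rightarrow> 'b"
  assumes D: "strict_derivative H D (z0, y0)" and inj: "\<And>\<eta>. D (0, \<eta>) = 0 \<Longrightarrow> \<eta> = 0"
    and \<mu>: "finite_measure \<mu>" "sets \<mu> = sets borel" "absolutely_continuous lborel \<mu>"
    and supp: "\<And>X. open X \<Longrightarrow> y0 \<in> X \<Longrightarrow> emeasure \<mu> X > 0" and r0: "r0 > 0"
  obtains d r \<eta> where "d > 0" "r > 0" "r \<le> r0" "\<eta> > 0"
    "\<And>z z' B. z \<in> ball z0 d \<Longrightarrow> z' \<in> ball z0 d \<Longrightarrow> B \<in> sets borel \<Longrightarrow>
      {y \<in> ball y0 r. H (z, y) \<in> B} \<in> sets borel \<and>
      \<eta> \<le> measure \<mu> {y \<in> ball y0 r. H (z, y) \<in> B} + measure \<mu> {y \<in> ball y0 r. H (z', y) \<notin> B}"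
proof -
  interpret \<mu>: finite_measure \<mu> by fact
  interpret D: bounded_linear D by (rule strict_derivative_bounded_linear[OF D])
  let ?L = "\<lambda>\<eta>. D (0, \<eta>)"
  have L: "linear ?L"
    by (rule linearI) (simp_all flip: D.add D.scaleR)
  have "inj ?L" unfolding linear_injective_0[OF L] using inj by blast
  from linear_injective_left_inverse[OF L this] obtain L' where L': "linear L'" "L' \<circ> ?L = id" by blast
  interpret L': bounded_linear L' using L'(1) by (simp add: linear_conv_bounded_linear)
  have L'L: "L' (D (0, \<eta>)) = \<eta>" for \<eta> using L'(2) by (simp add: fun_eq_iff)
  obtain K where K: "K > 0" "\<And>v. norm (L' v) \<le> norm v * K" using L'.pos_bounded by blast
  \<comment> \<open>\<open>L'\<close> multiplies errors by at most \<open>K\<close>, so this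
    tolerance yields the constant 1/2 of the near-identity lemmas.\<close>
  have e: "1 / (2 * K) > 0" using K(1) by simp
  obtain d1 where d1: "d1 > 0" "\<And>p p'. p \<in> ball (z0, y0) d1 \<Longrightarrow> p' \<in> ball (z0, y0) d1 \<Longrightarrow>
      norm (H p - H p' - D (p - p')) \<le> 1 / (2 * K) * norm (p - p')"
    by (rule strict_derivativeD[OF D e]) blast
  obtain d2 B0 where d2: "d2 > 0" "B0 > 0" "\<And>p p'. p \<in> ball (z0, y0) d2 \<Longrightarrow> p' \<in> ball (z0, y0) d2 \<Longrightarrow>
      norm (H p - H p') \<le> B0 * norm (p - p')"
    by (rule strict_derivative_lipschitz[OF D]) blast
  define r where "r = min r0 (min d1 d2 / 2)"
  have r: "r > 0" "r \<le> r0" "r \<le> d1 / 2" "r \<le> d2 / 2" using r0 d1(1) d2(1) by (auto simp: r_def)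
  have inb: "(z, y) \<in> ball (z0, y0) d1" "(z, y) \<in> ball (z0, y0) d2" if "z \<in> ball z0 r" "y \<in> ball y0 r" for z y
    using that r by (intro ball_Pair; simp)+
  define h where "h z y = L' (H (z, y))" for z y
  have h_near: "norm (h z y - h z y' - (y - y')) \<le> 1 / 2 * norm (y - y')"
    if z: "z \<in> ball z0 r" and y: "y \<in> ball y0 r" "y' \<in> ball y0 r" for z y y'
  proof -
    have "norm (H (z, y) - H (z, y') - D ((z, y) - (z, y'))) \<le> 1 / (2 * K) * norm ((z, y) - (z, y'))"
      by (intro d1(2) inb z y)
    then have 1: "norm (H (z, y) - H (z, y') - D (0, y - y')) \<le> 1 / (2 * K) * norm (y - y')"
      by (simp add: norm_Pair)
    have "h z y - h z y' - (y - y') = L' (H (z, y) - H (z, y') - D (0, y - y'))"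
      by (simp add: h_def L'.diff L'L)
    also have "norm \<dots> \<le> norm (H (z, y) - H (z, y') - D (0, y - y')) * K" by (rule K(2))
    also have "\<dots> \<le> 1 / (2 * K) * norm (y - y') * K" using 1 K(1) by (intro mult_right_mono) auto
    also have "\<dots> = 1 / 2 * norm (y - y')" using K(1) by simp
    finally show ?thesis .
  qed
  have h_z: "norm (h z y - h z0 y) \<le> B0 * K * norm (z - z0)" if z: "z \<in> ball z0 r" and y: "y \<in> ball y0 r" for z y
  proof -
    have "norm (H (z, y) - H (z0, y)) \<le> B0 * norm ((z, y) - (z0, y))"
      using r(1) by (intro d2(3) inb z y) auto
    then have 1: "norm (H (z, y) - H (z0, y)) \<le> B0 * norm (z - z0)" by (simp add: norm_Pair)
    have "norm (h z y - h z0 y) \<le> norm (H (z, y) - H (z0, y)) * K"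
      using K(2)[of "H (z, y) - H (z0, y)"] by (simp add: h_def L'.diff)
    also have "\<dots> \<le> B0 * norm (z - z0) * K" using 1 K(1) by (intro mult_right_mono) auto
    finally show ?thesis by (simp add: mult_ac)
  qed
  obtain \<gamma> where \<gamma>: "\<gamma> \<in> borel_measurable lborel" "density lborel \<gamma> = \<mu>"
    using sigma_finite_measure.Radon_Nikodym[OF sigma_finite_lborel \<mu>(3)] \<mu>(2) by auto
  have [measurable]: "\<gamma> \<in> borel_measurable borel" using \<gamma>(1) by simp
  \<comment> \<open>On \<open>Dc k\<close> the measure \<open>\<mu>\<close> dominates Lebesgue
    measure divided by \<open>k + 1\<close>. Some \<open>Dc k\<close> is not null, because
    \<open>\<mu>\<close> charges every neighbourhood of \<open>y0\<close>.\<close>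
  define Dc where "Dc k = {y \<in> ball y0 r. ennreal (1 / Suc k) \<le> \<gamma> y}" for k :: nat
  have Dc[measurable]: "Dc k \<in> sets borel" for k unfolding Dc_def by measurable
  have "\<exists>k. emeasure lborel (Dc k) \<noteq> 0"
  proof (rule ccontr)
    assume "\<not> ?thesis"
    then have "Dc k \<in> null_sets lborel" for k by auto
    then have "(\<Union>k. Dc k) \<in> null_sets lborel" by (intro null_sets_UN)
    moreover have "{y \<in> ball y0 r. \<gamma> y \<noteq> 0} \<subseteq> (\<Union>k. Dc k)"
    proof safe
      fix y assume y: "y \<in> ball y0 r" "\<gamma> y \<noteq> 0"
      then have "0 < \<gamma> y" by (simp add: zero_less_iff_neq_zero)
      then obtain q where q: "0 < ennreal q" "ennreal q < \<gamma> y" "q \<ge> 0"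
        by (metis dense ennreal_cases less_top order.strict_trans)
      then have "q > 0" by simp
      then obtain k where "1 / Suc k < q" using nat_approx_posE by blast
      then have "ennreal (1 / Suc k) \<le> ennreal q" by (intro ennreal_leI) simp
      then show "y \<in> (\<Union>k. Dc k)" using y(1) q(2) by (auto simp: Dc_def intro!: exI[of _ k])
    qed
    moreover have "{y \<in> ball y0 r. \<gamma> y \<noteq> 0} \<in> sets lborel" by measurable
    ultimately have "{y \<in> ball y0 r. \<gamma> y \<noteq> 0} \<in> null_sets lborel" using null_sets_subset by blast
    then have "AE y in lborel. \<not> (y \<in> ball y0 r \<and> \<gamma> y \<noteq> 0)" by (intro AE_I'[of _ lborel]) auto
    then have "(\<integral>\<^sup>+y. \<gamma> y * indicator (ball y0 r) y \<partial>lborel) = 0"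
      by (intro nn_integral_zero') (auto elim!: eventually_mono split: split_indicator)
    then have "emeasure \<mu> (ball y0 r) = 0"
      unfolding \<gamma>(2)[symmetric] by (subst emeasure_density) auto
    then show False using supp[of "ball y0 r"] r(1) by simp
  qed
  then obtain k where k: "emeasure lborel (Dc k) \<noteq> 0" by blast
  have fin: "X \<in> lmeasurable" if "X \<in> sets borel" "X \<subseteq> ball c s" for X :: "'b set" and c s
    by (rule fmeasurableI2[of "ball c s"]) (use that in auto)
  have Dc_sub: "Dc k \<subseteq> ball y0 r" by (auto simp: Dc_def)
  have Dc_lm: "Dc k \<in> lmeasurable" by (rule fin[OF Dc Dc_sub])
  have "measure lebesgue (Dc k) \<noteq> 0"
  proof
    assume "measure lebesgue (Dc k) = 0"
    then have "emeasure lebesgue (Dc k) = 0" using Dc_lm by (simp add: emeasure_eq_measure2)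
    then show False using k Dc by simp
  qed
  then have pos: "measure lebesgue (Dc k) > 0" by (simp add: less_le)
  have "1 / (4 * 12 ^ DIM('b)) > (0::real)" by simp
  from density_ball[OF Dc_lm pos open_ball Dc_sub this]
  obtain y1 \<rho> where y1: "\<rho> > 0" "ball y1 \<rho> \<subseteq> ball y0 r"
    "measure lebesgue (ball y1 \<rho> - Dc k) \<le> 1 / (4 * 12 ^ DIM('b)) * measure lebesgue (ball y1 \<rho>)"
    by blast
  have "y1 \<in> ball y1 \<rho>" using y1(1) by simp
  then have y1_in: "y1 \<in> ball y0 r" using y1(2) by blast
  \<comment> \<open>Within distance \<open>d\<close> of \<open>z0\<close> the point
    \<open>h z y1\<close> moves by at most \<open>B0 * K * d \<le> \<rho> / 8\<close>.\<close>
  define d where "d = min r (\<rho> / (8 * B0 * K))"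
  \<comment> \<open>The lower bound of the density on \<open>Dc k\<close> times the volume supplied
    by \<open>near_identity_overlap\<close>.\<close>
  define \<eta> where "\<eta> = 1 / Suc k * (measure lebesgue (ball y1 \<rho>) / (2 * 12 ^ DIM('b)))"
  have "d > 0" using r(1) y1(1) d2(2) K(1) by (simp add: d_def)
  moreover have "\<eta> > 0" using y1(1) by (simp add: \<eta>_def content_ball_pos)
  moreover have "{y \<in> ball y0 r. H (z, y) \<in> B} \<in> sets borel \<and>
      \<eta> \<le> measure \<mu> {y \<in> ball y0 r. H (z, y) \<in> B} + measure \<mu> {y \<in> ball y0 r. H (z', y) \<notin> B}"
    if z: "z \<in> ball z0 d" "z' \<in> ball z0 d" and B: "B \<in> sets borel" for z z' B
  proof -
    have zr: "z \<in> ball z0 r" "z' \<in> ball z0 r" using z by (auto simp: d_def)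
    have cont: "continuous_on (ball y0 r) (\<lambda>y. H (z, y))" if "z \<in> ball z0 r" for z
    proof (rule continuous_onI)
      fix x e assume e: "e > (0::real)" and x: "x \<in> ball y0 r"
      have "dist (H (z, y)) (H (z, x)) \<le> e" if y: "y \<in> ball y0 r" "dist y x < e / B0" for y
      proof -
        have "norm (H (z, y) - H (z, x)) \<le> B0 * norm ((z, y) - (z, x))" by (intro d2(3) inb \<open>z \<in> ball z0 r\<close> x y)
        also have "\<dots> \<le> e" using y(2) d2(2) by (simp add: norm_Pair dist_norm field_simps)
        finally show ?thesis by (simp add: dist_norm)
      qed
      then show "\<exists>d>0. \<forall>y\<in>ball y0 r. dist y x < d \<longrightarrow> dist (H (z, y)) (H (z, x)) \<le> e"
        using e d2(2) by (intro exI[of _ "e / B0"]) auto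
    qed
    have meas: "{y \<in> ball y0 r. H (z, y) \<in> B'} \<in> sets borel" if "z \<in> ball z0 r" "B' \<in> sets borel" for z B'
      by (rule borel_preimage_open[OF cont[OF that(1)] open_ball that(2)])
    \<comment> \<open>The target set in the coordinates of \<open>h\<close>, which differ from those
      of \<open>H\<close> by the linear isomorphism.\<close>
    define B' where "B' = {v. D (0, v) \<in> B}"
    have bij: "D (0, L' v) = v" for v
    proof -
      have "?L \<circ> L' = id" by (rule linear_inverse_left[THEN iffD1, OF L'(1) L L'(2)])
      then show ?thesis by (simp add: fun_eq_iff)
    qed
    have hB: "h z y \<in> B' \<longleftrightarrow> H (z, y) \<in> B" for z y by (simp add: B'_def h_def bij)
    have "continuous_on UNIV ?L" using L by (intro linear_continuous_on) (simp add: linear_conv_bounded_linear)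
    then have B': "B' \<in> sets borel" using borel_preimage_open[of UNIV ?L B] B by (simp add: B'_def)
    have near: "norm (h v y1 - h z0 y1) \<le> \<rho> / 8" if v: "v \<in> ball z0 d" for v
    proof -
      have "norm (h v y1 - h z0 y1) \<le> B0 * K * norm (v - z0)"
        using v y1_in by (intro h_z) (auto simp: d_def)
      also have "\<dots> \<le> B0 * K * (\<rho> / (8 * B0 * K))"
        using v d2(2) K(1) by (intro mult_left_mono) (auto simp: d_def dist_norm norm_minus_commute)
      also have "\<dots> = \<rho> / 8" using d2(2) K(1) by simp
      finally show ?thesis .
    qed
    have lower: "1 / Suc k * measure lebesgue {y \<in> ball y1 \<rho> \<inter> Dc k. Q y} \<le> measure \<mu> {y \<in> ball y0 r. Q y}"
      if Q: "{y \<in> ball y0 r. Q y} \<in> sets borel" for Q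
    proof -
      let ?X = "{y \<in> ball y1 \<rho> \<inter> Dc k. Q y}"
      have "?X = {y \<in> ball y0 r. Q y} \<inter> (ball y1 \<rho> \<inter> Dc k)" using Dc_sub by auto
      then have X: "?X \<in> sets borel" using Q by auto
      have Xl: "?X \<in> lmeasurable" by (rule fin[OF X, of y1 \<rho>]) auto
      have em: "emeasure lborel ?X = ennreal (measure lebesgue ?X)"
        using emeasure_eq_measure2[OF Xl] X by simp
      have "ennreal (1 / Suc k * measure lebesgue ?X) = ennreal (1 / Suc k) * emeasure lborel ?X"
        unfolding em by (rule ennreal_mult) auto
      also have "\<dots> = (\<integral>\<^sup>+y. ennreal (1 / Suc k) * indicator ?X y \<partial>lborel)"
        using X by (simp add: nn_integral_cmult_indicator)
      also have "\<dots> \<le> (\<integral>\<^sup>+y. \<gamma> y * indicator ?X y \<partial>lborel)"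
        by (intro nn_integral_mono) (auto simp: Dc_def split: split_indicator)
      also have "\<dots> = emeasure \<mu> ?X" unfolding \<gamma>(2)[symmetric] using X by (subst emeasure_density) auto
      also have "\<dots> \<le> emeasure \<mu> {y \<in> ball y0 r. Q y}"
        using y1(2) Q by (intro emeasure_mono) (auto simp: \<mu>(2))
      also have "\<dots> = ennreal (measure \<mu> {y \<in> ball y0 r. Q y})" by (rule \<mu>.emeasure_eq_measure)
      finally show ?thesis by simp
    qed
    have "measure lebesgue (ball y1 \<rho>) / (2 * 12 ^ DIM('b))
      \<le> measure lebesgue {y \<in> ball y1 \<rho> \<inter> Dc k. h z y \<in> B'} + measure lebesgue {y \<in> ball y1 \<rho> \<inter> Dc k. h z' y \<notin> B'}"
      using y1(2) by (intro near_identity_overlap[OF y1(1) h_near[OF zr(1)] h_near[OF zr(2)] near near B' Dc y1(3)] z) auto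
    then have "\<eta> \<le> 1 / Suc k * (measure lebesgue {y \<in> ball y1 \<rho> \<inter> Dc k. H (z, y) \<in> B}
        + measure lebesgue {y \<in> ball y1 \<rho> \<inter> Dc k. H (z', y) \<notin> B})"
      unfolding \<eta>_def hB by (intro mult_left_mono) auto
    also have "\<dots> \<le> measure \<mu> {y \<in> ball y0 r. H (z, y) \<in> B} + measure \<mu> {y \<in> ball y0 r. H (z', y) \<notin> B}"
      using lower[OF meas[OF zr(1) B]] lower[of "\<lambda>y. H (z', y) \<notin> B"] meas[OF zr(2), of "- B"] B
      by (simp add: distrib_left)
    finally show ?thesis using meas[OF zr(1) B] by simp
  qed
  ultimately show ?thesis using that r(1,2) by blast
qed

section \<open>Markov kernels\<close>

lemma nn_integral_mono_measure_on:
  assumes Y: "Y \<in> sets M" and sets: "sets \<nu> = sets M" "sets \<mu> = sets M"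
    and le: "\<And>X. X \<in> sets M \<Longrightarrow> X \<subseteq> Y \<Longrightarrow> emeasure \<nu> X \<le> emeasure \<mu> X" and h: "h \<in> borel_measurable M"
  shows "(\<integral>\<^sup>+x. h x * indicator Y x \<partial>\<nu>) \<le> (\<integral>\<^sup>+x. h x * indicator Y x \<partial>\<mu>)"
proof -
  have [measurable]: "Y \<in> sets \<nu>" "Y \<in> sets \<mu>" "h \<in> borel_measurable \<nu>" "h \<in> borel_measurable \<mu>"
    using Y h sets by (auto simp: measurable_cong_sets[OF sets(1) refl] measurable_cong_sets[OF sets(2) refl])
  have "density \<nu> (indicator Y) \<le> density \<mu> (indicator Y)"
  proof -
    have "emeasure (density \<nu> (indicator Y)) X \<le> emeasure (density \<mu> (indicator Y)) X" for X
    proof (cases "X \<in> sets M")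
      case True
      then have X: "X \<in> sets \<nu>" "X \<in> sets \<mu>" using sets by auto
      have "emeasure (density \<kappa> (indicator Y)) X = emeasure \<kappa> (X \<inter> Y)" if "X \<in> sets \<kappa>" "Y \<in> sets \<kappa>" for \<kappa>
      proof -
        have "emeasure (density \<kappa> (indicator Y)) X = (\<integral>\<^sup>+x. indicator Y x * indicator X x \<partial>\<kappa>)"
          using that by (intro emeasure_density) auto
        also have "\<dots> = (\<integral>\<^sup>+x. indicator (X \<inter> Y) x \<partial>\<kappa>)"
          by (intro nn_integral_cong) (auto split: split_indicator)
        finally show ?thesis using that by simp
      qed
      then show ?thesis using le[of "X \<inter> Y"] True X Y sets by auto
    qed (simp add: emeasure_notin_sets sets)
    then show ?thesis
      using sets by (simp add: le_measure_iff le_fun_def sets_eq_imp_space_eq[OF sets(1)] sets_eq_imp_space_eq[OF sets(2)])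
  qed
  then have "(\<integral>\<^sup>+x. h x \<partial>density \<nu> (indicator Y)) \<le> (\<integral>\<^sup>+x. h x \<partial>density \<mu> (indicator Y))"
    using sets by (intro nn_integral_mono_measure) auto
  then show ?thesis by (simp add: nn_integral_density mult.commute)
qed

text \<open>For the Hahn set of the two measures the hypothesis bounds the mass of their minimum
  from below by \<open>\<eta>\<close>. Integrals of functions with values in [-1, 1] then differ by
  at most twice the remaining mass.\<close>

lemma overlap_integral:
  fixes f :: "'a \<Rightarrow> real"
  assumes \<mu>: "prob_space \<mu>" "sets \<mu> = sets M" and \<nu>: "prob_space \<nu>" "sets \<nu> = sets M"
    and ov: "\<And>A. A \<in> sets M \<Longrightarrow> \<eta> \<le> measure \<mu> A + measure \<nu> (space M - A)"
    and f: "f \<in> borel_measurable M" "\<And>x. x \<in> space M \<Longrightarrow> \<bar>f x\<bar> \<le> 1"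
  shows "(\<integral>x. f x \<partial>\<mu>) - (\<integral>x. f x \<partial>\<nu>) \<le> 2 * (1 - \<eta>)"
proof -
  interpret \<mu>: prob_space \<mu> by fact
  interpret \<nu>: prob_space \<nu> by fact
  have sp: "space \<mu> = space M" "space \<nu> = space M"
    using sets_eq_imp_space_eq[OF \<mu>(2)] sets_eq_imp_space_eq[OF \<nu>(2)] by auto
  obtain Y where Y: "Y \<in> sets M" "\<And>X. X \<in> sets M \<Longrightarrow> X \<subseteq> Y \<Longrightarrow> emeasure \<nu> X \<le> emeasure \<mu> X"
    "\<And>X. X \<in> sets M \<Longrightarrow> X \<inter> Y = {} \<Longrightarrow> emeasure \<mu> X \<le> emeasure \<nu> X"
    using finite_unsigned_Hahn_decomposition[of \<mu> \<nu>] \<mu>.finite_measure_axioms \<nu>.finite_measure_axioms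
      \<mu>(2) \<nu>(2) by metis
  define Z where "Z = space M - Y"
  have Z: "Z \<in> sets M" using Y(1) by (auto simp: Z_def)
  \<comment> \<open>Rescaled to values in [0, 1], so that both \<open>g\<close> and
    \<open>1 - g\<close> are nonnegative weights.\<close>
  define g where "g = (\<lambda>x. (1 + f x) / 2)"
  have g_meas: "g \<in> borel_measurable M" using f(1) by (auto simp: g_def)
  have g_bound: "0 \<le> g x \<and> g x \<le> 1" if "x \<in> space M" for x
    using f(2)[OF that] by (simp add: g_def abs_le_iff)
  note g = g_meas g_bound
  have g1: "(\<lambda>x. 1 - g x) \<in> borel_measurable M" using g(1) by auto
  have m: "h \<in> borel_measurable \<mu>" "h \<in> borel_measurable \<nu>" if "h \<in> borel_measurable M" for h :: "'a \<Rightarrow> ennreal"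
    using that by (auto simp: measurable_cong_sets[OF \<mu>(2) refl] measurable_cong_sets[OF \<nu>(2) refl])
  have split: "(\<integral>\<^sup>+x. h x \<partial>\<kappa>) = (\<integral>\<^sup>+x. h x * indicator Y x \<partial>\<kappa>) + (\<integral>\<^sup>+x. h x * indicator Z x \<partial>\<kappa>)"
    if "sets \<kappa> = sets M" "h \<in> borel_measurable M" for \<kappa> and h :: "'a \<Rightarrow> ennreal"
  proof -
    have [measurable]: "h \<in> borel_measurable \<kappa>" "Y \<in> sets \<kappa>" "Z \<in> sets \<kappa>"
      using that Y(1) Z by (auto simp: measurable_cong_sets[OF that(1) refl])
    have "(\<integral>\<^sup>+x. h x \<partial>\<kappa>) = (\<integral>\<^sup>+x. h x * indicator Y x + h x * indicator Z x \<partial>\<kappa>)"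
      using sets_eq_imp_space_eq[OF that(1)]
      by (intro nn_integral_cong) (auto simp: Z_def split: split_indicator)
    also have "\<dots> = (\<integral>\<^sup>+x. h x * indicator Y x \<partial>\<kappa>) + (\<integral>\<^sup>+x. h x * indicator Z x \<partial>\<kappa>)"
      by (rule nn_integral_add) auto
    finally show ?thesis .
  qed
  let ?g = "\<lambda>x. ennreal (g x)" and ?g1 = "\<lambda>x. ennreal (1 - g x)"
  have [measurable]: "?g \<in> borel_measurable M" "?g1 \<in> borel_measurable M" using g(1) g1 by auto
  have sum1: "?g x * indicator A x + ?g1 x * indicator A x = indicator A x" if "x \<in> space M" for x A
    using g(2)[OF that] by (auto simp flip: ennreal_plus split: split_indicator)
  have on: "(\<integral>\<^sup>+x. ?g x * indicator A x \<partial>\<kappa>) + (\<integral>\<^sup>+x. ?g1 x * indicator A x \<partial>\<kappa>) = emeasure \<kappa> A"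
    if "sets \<kappa> = sets M" "A \<in> sets M" for \<kappa> A
  proof -
    have [measurable]: "A \<in> sets \<kappa>" "?g \<in> borel_measurable \<kappa>" "?g1 \<in> borel_measurable \<kappa>"
      using that g(1) g1 by (auto simp: measurable_cong_sets[OF that(1) refl])
    have "(\<integral>\<^sup>+x. ?g x * indicator A x \<partial>\<kappa>) + (\<integral>\<^sup>+x. ?g1 x * indicator A x \<partial>\<kappa>)
      = (\<integral>\<^sup>+x. ?g x * indicator A x + ?g1 x * indicator A x \<partial>\<kappa>)" by (rule nn_integral_add[symmetric]) auto
    also have "\<dots> = (\<integral>\<^sup>+x. indicator A x \<partial>\<kappa>)"
      using sets_eq_imp_space_eq[OF that(1)] by (intro nn_integral_cong sum1) auto
    finally show ?thesis by simp
  qed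
  \<comment> \<open>The overlap condition is used for the single set \<open>Z\<close>, where
    \<open>\<mu>\<close> is the smaller measure; on \<open>Y\<close> the smaller one is
    \<open>\<nu>\<close>.\<close>
  have "ennreal \<eta> \<le> ennreal (measure \<mu> Z + measure \<nu> Y)"
    using ov[OF Z] Y(1) sets.sets_into_space[OF Y(1)] by (intro ennreal_leI) (auto simp: Z_def double_diff)
  also have "\<dots> = emeasure \<mu> Z + emeasure \<nu> Y"
    by (simp add: \<mu>.emeasure_eq_measure \<nu>.emeasure_eq_measure)
  also have "\<dots> = ((\<integral>\<^sup>+x. ?g x * indicator Z x \<partial>\<mu>) + (\<integral>\<^sup>+x. ?g1 x * indicator Z x \<partial>\<mu>))
      + ((\<integral>\<^sup>+x. ?g x * indicator Y x \<partial>\<nu>) + (\<integral>\<^sup>+x. ?g1 x * indicator Y x \<partial>\<nu>))"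
    using on[OF \<mu>(2) Z] on[OF \<nu>(2) Y(1)] by simp
  also have "\<dots> \<le> ((\<integral>\<^sup>+x. ?g x * indicator Z x \<partial>\<nu>) + (\<integral>\<^sup>+x. ?g1 x * indicator Z x \<partial>\<mu>))
      + ((\<integral>\<^sup>+x. ?g x * indicator Y x \<partial>\<nu>) + (\<integral>\<^sup>+x. ?g1 x * indicator Y x \<partial>\<mu>))"
    using nn_integral_mono_measure_on[OF Z \<mu>(2) \<nu>(2) Y(3), of ?g]
      nn_integral_mono_measure_on[OF Y(1) \<nu>(2) \<mu>(2) Y(2), of ?g1] Z_def
    by (intro add_mono) auto
  also have "\<dots> = (\<integral>\<^sup>+x. ?g x \<partial>\<nu>) + (\<integral>\<^sup>+x. ?g1 x \<partial>\<mu>)"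
    using split[OF \<nu>(2), of ?g] split[OF \<mu>(2), of ?g1] by (simp add: add_ac)
  also have "(\<integral>\<^sup>+x. ?g x \<partial>\<nu>) = ennreal (\<integral>x. g x \<partial>\<nu>)"
    using g sp by (intro nn_integral_eq_integral \<nu>.integrable_const_bound[of _ 1])
      (auto simp: measurable_cong_sets[OF \<nu>(2) refl])
  also have "(\<integral>\<^sup>+x. ?g1 x \<partial>\<mu>) = ennreal (\<integral>x. 1 - g x \<partial>\<mu>)"
    using g sp by (intro nn_integral_eq_integral \<mu>.integrable_const_bound[of _ 1])
      (auto simp: measurable_cong_sets[OF \<mu>(2) refl])
  finally have "ennreal \<eta> \<le> ennreal ((\<integral>x. g x \<partial>\<nu>) + (\<integral>x. 1 - g x \<partial>\<mu>))"
    using g(2) sp by (subst ennreal_plus) (auto intro!: integral_nonneg_AE)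
  then have "\<eta> \<le> (\<integral>x. g x \<partial>\<nu>) + (\<integral>x. 1 - g x \<partial>\<mu>)"
    using g(2) sp by (subst (asm) ennreal_le_iff) (auto intro!: add_nonneg_nonneg integral_nonneg_AE)
  moreover have fi: "integrable \<mu> f" "integrable \<nu> f"
    using f sp by (auto intro!: \<mu>.integrable_const_bound[of _ 1] \<nu>.integrable_const_bound[of _ 1]
        simp: measurable_cong_sets[OF \<mu>(2) refl] measurable_cong_sets[OF \<nu>(2) refl])
  then have "(\<integral>x. g x \<partial>\<nu>) = (1 + (\<integral>x. f x \<partial>\<nu>)) / 2" "(\<integral>x. 1 - g x \<partial>\<mu>) = 1 - (1 + (\<integral>x. f x \<partial>\<mu>)) / 2"
    by (simp_all add: g_def \<mu>.prob_space \<nu>.prob_space)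
  ultimately show ?thesis by (simp add: field_simps)
qed

locale markov_kernel =
  fixes M :: "'a measure" and K :: "'a \<Rightarrow> 'a measure"
  assumes K [measurable]: "K \<in> M \<rightarrow>\<^sub>M prob_algebra M"
begin

abbreviation P :: "nat \<Rightarrow> 'a \<Rightarrow> 'a measure" where
  "P \<equiv> kernel_power M K"

lemma P_measurable [measurable]: "P n \<in> M \<rightarrow>\<^sub>M prob_algebra M"
proof (induction n)
  case 0
  have "P 0 = return M" by (simp add: fun_eq_iff)
  then show ?case by simp
next
  case (Suc n)
  have "P (Suc n) = (\<lambda>x. K x \<bind> P n)" by (simp add: fun_eq_iff)
  then show ?case using measurable_bind_prob_space[OF K Suc] by simp
qed

lemma P_subprob [measurable]: "P n \<in> M \<rightarrow>\<^sub>M subprob_algebra M"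
  by (rule measurable_prob_algebraD[OF P_measurable])

lemma P_prob: "x \<in> space M \<Longrightarrow> prob_space (P n x)"
  and P_sets: "x \<in> space M \<Longrightarrow> sets (P n x) = sets M"
  using measurable_space[OF P_measurable] by (auto simp: space_prob_algebra)

lemma P_space: "x \<in> space M \<Longrightarrow> space (P n x) = space M"
  using P_sets sets_eq_imp_space_eq by metis

lemma P_borel: "x \<in> space M \<Longrightarrow> f \<in> borel_measurable M \<Longrightarrow> f \<in> borel_measurable (P n x)"
  by (simp add: measurable_cong_sets[OF P_sets refl])

lemma P_1: "x \<in> space M \<Longrightarrow> P 1 x = K x"
proof -
  assume x: "x \<in> space M"
  have "K x \<in> space (prob_algebra M)" by (rule measurable_space[OF K x])
  then have "sets (K x) = sets M" by (simp add: space_prob_algebra)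
  moreover have "P 0 = return M" by (simp add: fun_eq_iff)
  ultimately show ?thesis by (simp add: bind_return'')
qed

text \<open>\<open>kernel_power\<close> splits off the first step, so the induction runs over the
  first summand.\<close>

lemma P_add: "x \<in> space M \<Longrightarrow> P (n + m) x = P n x \<bind> P m"
proof (induction n arbitrary: x)
  case 0
  then show ?case by (simp add: bind_return[OF P_subprob])
next
  case (Suc n)
  have Kx: "space (K x) = space M" "sets (K x) = sets M"
    using P_space[OF Suc.prems, of 1] P_sets[OF Suc.prems, of 1] P_1[OF Suc.prems] by auto
  have "P (Suc n + m) x = K x \<bind> (\<lambda>y. P n y \<bind> P m)"
    using Suc.IH by (auto simp: Kx intro!: bind_cong)
  also have "\<dots> = (K x \<bind> P n) \<bind> P m"
    by (rule bind_assoc[symmetric, OF _ P_subprob]) (simp add: measurable_cong_sets[OF Kx(2) refl] P_subprob)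
  finally show ?case by simp
qed

lemma nn_integral_P_add:
  assumes "x \<in> space M" "f \<in> borel_measurable M"
  shows "(\<integral>\<^sup>+y. f y \<partial>P (n + m) x) = (\<integral>\<^sup>+z. (\<integral>\<^sup>+y. f y \<partial>P m z) \<partial>P n x)"
  unfolding P_add[OF assms(1)]
  by (rule nn_integral_bind[OF assms(2)]) (simp add: measurable_cong_sets[OF P_sets[OF assms(1)] refl] P_subprob)

lemma emeasure_P_add:
  assumes "x \<in> space M" "A \<in> sets M"
  shows "emeasure (P (n + m) x) A = (\<integral>\<^sup>+z. emeasure (P m z) A \<partial>P n x)"
proof -
  have "emeasure (P (n + m) x) A = (\<integral>\<^sup>+z. indicator A z \<partial>P (n + m) x)" using assms by (simp add: P_sets)
  also have "\<dots> = (\<integral>\<^sup>+z. (\<integral>\<^sup>+y. indicator A y \<partial>P m z) \<partial>P n x)"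
    using assms by (intro nn_integral_P_add) auto
  also have "\<dots> = (\<integral>\<^sup>+z. emeasure (P m z) A \<partial>P n x)"
    using assms by (intro nn_integral_cong) (simp add: P_sets P_space)
  finally show ?thesis .
qed

lemma emeasure_P_measurable [measurable]: "A \<in> sets M \<Longrightarrow> (\<lambda>x. emeasure (P n x) A) \<in> borel_measurable M"
  by (rule measurable_compose[OF P_subprob]) (rule measurable_emeasure_subprob_algebra)

lemma P_integrable:
  fixes f :: "'a \<Rightarrow> real"
  assumes "x \<in> space M" "f \<in> borel_measurable M" "\<And>y. y \<in> space M \<Longrightarrow> \<bar>f y\<bar> \<le> B"
  shows "integrable (P n x) f"
  using assms P_space[of x n]
  by (intro finite_measure.integrable_const_bound[of _ _ B] prob_space.axioms(1)[OF P_prob] P_borel AE_I2) auto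

lemma integral_P_bound:
  fixes f :: "'a \<Rightarrow> real"
  assumes "x \<in> space M" "f \<in> borel_measurable M" "\<And>y. y \<in> space M \<Longrightarrow> \<bar>f y\<bar> \<le> B"
  shows "\<bar>\<integral>y. f y \<partial>P n x\<bar> \<le> B"
proof -
  interpret prob_space "P n x" by (rule P_prob[OF assms(1)])
  have i: "integrable (P n x) f" by (rule P_integrable[OF assms])
  have B: "AE y in P n x. - B \<le> f y" "AE y in P n x. f y \<le> B"
    using assms(3) P_space[OF assms(1), of n] by (auto intro!: AE_I2 simp: abs_le_iff minus_le_iff)
  show ?thesis using integral_ge_const[OF i B(1)] integral_le_const[OF i B(2)] by simp
qed

lemma integral_P_add:
  fixes f :: "'a \<Rightarrow> real"
  assumes x: "x \<in> space M" and f: "f \<in> borel_measurable M" "\<And>y. y \<in> space M \<Longrightarrow> \<bar>f y\<bar> \<le> B"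
  shows "(\<integral>y. f y \<partial>P (n + m) x) = (\<integral>z. (\<integral>y. f y \<partial>P m z) \<partial>P n x)"
  unfolding P_add[OF x]
proof (rule integral_bind[OF f, where B' = 1])
  show "P m \<in> P n x \<rightarrow>\<^sub>M subprob_algebra M"
    by (simp add: measurable_cong_sets[OF P_sets[OF x] refl] P_subprob)
  show "finite_measure (P n x)" by (rule prob_space.axioms(1)[OF P_prob[OF x]])
  show "AE z in P n x. emeasure (P m z) (space (P m z)) \<le> ennreal 1"
    using P_space[OF x] prob_space.emeasure_space_1[OF P_prob] by (intro AE_I2) auto
qed

end

text \<open>\<open>N\<close> plays the role of the neighbourhood of \<open>T\<close>. The overlap on
  \<open>N\<close> holds at the fixed time \<open>K0\<close>, and \<open>reach\<close> asks for
  access at all large times, which excludes periodicity. The small set serves to make the access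
  uniform on sublevel sets of \<open>V\<close>.\<close>

locale drift_chain = markov_kernel M K for M :: "'a measure" and K +
  fixes V :: "'a \<Rightarrow> real" and C N :: "'a set" and \<nu> :: "'a measure" and \<alpha> b \<eta>0 :: real and k K0 :: nat
  assumes nonempty: "space M \<noteq> {}"
    and V [measurable]: "V \<in> borel_measurable M" and V_ge_1: "\<And>x. x \<in> space M \<Longrightarrow> V x \<ge> 1"
    and \<alpha>: "0 < \<alpha>" "\<alpha> < 1" and b: "0 < b" and C [measurable]: "C \<in> sets M"
    and drift: "\<And>x. x \<in> space M \<Longrightarrow> (\<integral>\<^sup>+y. ennreal (V y) \<partial>K x) \<le> ennreal (\<alpha> * V x + b * indicator C x)"
    and \<nu>: "sets \<nu> = sets M" "emeasure \<nu> (space M) \<noteq> 0"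
    and minor: "\<And>x A. x \<in> C \<Longrightarrow> A \<in> sets M \<Longrightarrow> emeasure (kernel_power M K k x) A \<ge> emeasure \<nu> A"
    and N [measurable]: "N \<in> sets M" and \<eta>0: "0 < \<eta>0" and K0: "1 \<le> K0"
    and overlap: "\<And>z z' A. z \<in> N \<Longrightarrow> z' \<in> N \<Longrightarrow> A \<in> sets M \<Longrightarrow>
      \<eta>0 \<le> measure (kernel_power M K K0 z) A + measure (kernel_power M K K0 z') (space M - A)"
    and reach: "\<And>x. x \<in> space M \<Longrightarrow> \<exists>n0. \<forall>n\<ge>n0. emeasure (kernel_power M K n x) N > 0"
begin

definition K1 :: real where "K1 = b / (1 - \<alpha>)"

text \<open>\<open>K1\<close> is the fixed point of \<open>r \<mapsto> \<alpha> * r + b\<close>, so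
  a bound of the form \<open>\<alpha> ^ n * V x + K1\<close> reproduces itself under one
  step.\<close>

lemma K1: "K1 > 0" "\<alpha> * K1 + b = K1"
  using \<alpha> b by (auto simp: K1_def field_simps)

lemma C_space: "x \<in> C \<Longrightarrow> x \<in> space M" and N_space: "x \<in> N \<Longrightarrow> x \<in> space M"
  using sets.sets_into_space[OF C] sets.sets_into_space[OF N] by auto

lemma V_nonneg: "x \<in> space M \<Longrightarrow> 0 \<le> V x"
  using V_ge_1[of x] by simp

lemma nn_integral_V_step:
  assumes x: "x \<in> space M"
  shows "(\<integral>\<^sup>+y. ennreal (V y) \<partial>P (Suc n) x) \<le> ennreal \<alpha> * (\<integral>\<^sup>+y. ennreal (V y) \<partial>P n x) + ennreal b * emeasure (P n x) C"
proof -
  have "(\<integral>\<^sup>+y. ennreal (V y) \<partial>P (n + 1) x) = (\<integral>\<^sup>+z. (\<integral>\<^sup>+y. ennreal (V y) \<partial>P 1 z) \<partial>P n x)"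
    by (rule nn_integral_P_add[OF x]) simp
  also have "\<dots> \<le> (\<integral>\<^sup>+z. ennreal \<alpha> * ennreal (V z) + ennreal b * indicator C z \<partial>P n x)"
  proof (rule nn_integral_mono)
    fix z assume "z \<in> space (P n x)"
    then have z: "z \<in> space M" by (simp add: P_space[OF x])
    have "(\<integral>\<^sup>+y. ennreal (V y) \<partial>P 1 z) \<le> ennreal (\<alpha> * V z + b * indicator C z)"
      using drift[OF z] P_1[OF z] by simp
    also have "\<dots> = ennreal \<alpha> * ennreal (V z) + ennreal b * indicator C z"
      using \<alpha> b V_nonneg[OF z] by (auto simp: ennreal_mult split: split_indicator)
    finally show "(\<integral>\<^sup>+y. ennreal (V y) \<partial>P 1 z) \<le> ennreal \<alpha> * ennreal (V z) + ennreal b * indicator C z" .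
  qed
  also have "\<dots> = ennreal \<alpha> * (\<integral>\<^sup>+y. ennreal (V y) \<partial>P n x) + ennreal b * emeasure (P n x) C"
  proof -
    have [measurable]: "V \<in> borel_measurable (P n x)" "C \<in> sets (P n x)"
      using V C by (auto simp: P_sets[OF x] measurable_cong_sets[OF P_sets[OF x] refl])
    show ?thesis by (subst nn_integral_add) (auto simp: nn_integral_cmult nn_integral_cmult_indicator)
  qed
  finally show ?thesis by simp
qed

lemma nn_integral_V:
  assumes x: "x \<in> space M"
  shows "(\<integral>\<^sup>+y. ennreal (V y) \<partial>P n x) \<le> ennreal (\<alpha> ^ n * V x + K1)"
proof (induction n)
  case 0
  have "(\<integral>\<^sup>+y. ennreal (V y) \<partial>P 0 x) = ennreal (V x)" using x by (simp add: nn_integral_return)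
  then show ?case using K1(1) by (simp add: ennreal_leI)
next
  case (Suc n)
  interpret prob_space "P n x" by (rule P_prob[OF x])
  have "(\<integral>\<^sup>+y. ennreal (V y) \<partial>P (Suc n) x) \<le> ennreal \<alpha> * ennreal (\<alpha> ^ n * V x + K1) + ennreal b * 1"
    using nn_integral_V_step[OF x, of n] Suc emeasure_le_1
    by (meson add_mono mult_left_mono order_trans zero_le)
  also have "\<dots> = ennreal (\<alpha> * (\<alpha> ^ n * V x + K1) + b)"
    using \<alpha> b K1(1) V_nonneg[OF x] by (simp add: ennreal_mult ennreal_plus)
  also have "\<alpha> * (\<alpha> ^ n * V x + K1) + b = \<alpha> ^ Suc n * V x + K1" using K1(2) by (simp add: algebra_simps)
  finally show ?case .
qed

text \<open>Keeps track of the visits to \<open>C\<close> instead of bounding them by 1; since the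
  mean of \<open>V\<close> cannot fall below 1, this forces visits.\<close>

lemma nn_integral_V_hits:
  assumes x: "x \<in> space M"
  shows "(\<integral>\<^sup>+y. ennreal (V y) \<partial>P n x) \<le> ennreal (\<alpha> ^ n * V x + b * (\<Sum>i<n. measure (P i x) C))"
proof (induction n)
  case 0
  have "(\<integral>\<^sup>+y. ennreal (V y) \<partial>P 0 x) = ennreal (V x)" using x by (simp add: nn_integral_return)
  then show ?case by simp
next
  case (Suc n)
  interpret prob_space "P n x" by (rule P_prob[OF x])
  let ?s = "\<Sum>i<n. measure (P i x) C"
  have s: "?s \<ge> 0" by (simp add: sum_nonneg)
  have "(\<integral>\<^sup>+y. ennreal (V y) \<partial>P (Suc n) x)
      \<le> ennreal \<alpha> * ennreal (\<alpha> ^ n * V x + b * ?s) + ennreal b * ennreal (measure (P n x) C)"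
    by (rule order_trans[OF nn_integral_V_step[OF x, of n]])
       (intro add_mono mult_left_mono Suc, auto simp: emeasure_eq_measure)
  also have "\<dots> = ennreal (\<alpha> * (\<alpha> ^ n * V x + b * ?s) + b * measure (P n x) C)"
    using \<alpha> b s V_nonneg[OF x] by (simp add: ennreal_mult ennreal_plus)
  also have "\<dots> \<le> ennreal (\<alpha> ^ Suc n * V x + b * (\<Sum>i<Suc n. measure (P i x) C))"
    using mult_right_mono[of \<alpha> 1 "b * ?s"] \<alpha> b s by (intro ennreal_leI) (simp add: algebra_simps)
  finally show ?case .
qed

text \<open>Without a noticeable chance of visiting \<open>C\<close> before \<open>n0\<close>, the
  drift would push the mean of \<open>V\<close> below 1.\<close>

lemma hit_C:
  assumes "R \<ge> 0"
  obtains n0 q where "q > 0" "\<And>x. x \<in> space M \<Longrightarrow> V x \<le> R \<Longrightarrow> \<exists>i<n0. q \<le> measure (P i x) C"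
proof -
  have "(\<lambda>n. \<alpha> ^ n * R) \<longlonglongrightarrow> 0 * R"
    by (intro tendsto_mult tendsto_const LIMSEQ_power_zero) (use \<alpha> in auto)
  then have "eventually (\<lambda>n. \<alpha> ^ n * R < 1 / 2) sequentially" by (rule order_tendstoD) simp
  then obtain n0 where n0: "\<alpha> ^ n0 * R < 1 / 2" by (auto simp: eventually_sequentially)
  \<comment> \<open>With this \<open>q\<close> the visits contribute at most
    \<open>b * n0 * q < 1 / 2\<close>, the other half being left to
    \<open>\<alpha> ^ n0 * R\<close>.\<close>
  define q where "q = 1 / (2 * b * (real n0 + 1))"
  have q: "q > 0" using b by (simp add: q_def)
  have "\<exists>i<n0. q \<le> measure (P i x) C" if x: "x \<in> space M" "V x \<le> R" for x
  proof (rule ccontr)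
    assume "\<not> ?thesis"
    then have "(\<Sum>i<n0. measure (P i x) C) \<le> real n0 * q"
      using sum_bounded_above[of "{..<n0}" "\<lambda>i. measure (P i x) C" q] by (auto simp: not_le less_imp_le)
    then have "b * (\<Sum>i<n0. measure (P i x) C) \<le> b * (real n0 * q)" using b by (intro mult_left_mono) auto
    also have "b * (real n0 * q) = real n0 / (2 * (real n0 + 1))" using b by (simp add: q_def)
    also have "\<dots> < 1 / 2" by (simp add: field_simps)
    finally have 1: "b * (\<Sum>i<n0. measure (P i x) C) < 1 / 2" .
    have 2: "\<alpha> ^ n0 * V x \<le> \<alpha> ^ n0 * R" using x \<alpha> by (intro mult_left_mono) auto
    interpret prob_space "P n0 x" by (rule P_prob[OF x(1)])
    have "1 \<le> (\<integral>\<^sup>+y. ennreal (V y) \<partial>P n0 x)"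
      using V_ge_1 P_space[OF x(1)] by (intro nn_integral_ge_const AE_I2) (auto simp: ennreal_1[symmetric] simp del: ennreal_1 intro!: ennreal_leI)
    also have "\<dots> \<le> ennreal (\<alpha> ^ n0 * V x + b * (\<Sum>i<n0. measure (P i x) C))" by (rule nn_integral_V_hits[OF x(1)])
    also have "\<dots> < ennreal 1" using 1 2 n0 by (intro ennreal_lessI) auto
    finally show False by simp
  qed
  then show ?thesis using that[OF q, of n0] by blast
qed

text \<open>\<open>hit_C\<close> shows that \<open>C\<close> is nonempty, and \<open>\<nu>\<close>
  lies below a probability measure there.\<close>

lemma \<nu>_finite: "emeasure \<nu> A \<le> 1"
proof -
  obtain x where x: "x \<in> space M" using nonempty by auto
  obtain n0 q where q: "q > 0" "\<And>y. y \<in> space M \<Longrightarrow> V y \<le> V x \<Longrightarrow> \<exists>i<n0. q \<le> measure (P i y) C"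
    by (rule hit_C[OF V_nonneg[OF x]]) blast
  have "C \<noteq> {}" using q(2)[OF x order_refl] q(1) by auto
  then obtain c where c: "c \<in> C" by blast
  interpret prob_space "P k c" by (rule P_prob[OF C_space[OF c]])
  show ?thesis
  proof (cases "A \<in> sets M")
    case True
    show ?thesis by (rule order_trans[OF minor[OF c True] emeasure_le_1])
  qed (simp add: emeasure_notin_sets \<nu>)
qed

text \<open>The time from which \<open>N\<close> is charged depends on the state. The states for
  which it is at most \<open>j\<close> exhaust the space, so for some \<open>j\<close> they have
  positive \<open>\<nu>\<close>-measure.\<close>

lemma \<nu>_reach: obtains n1 where "\<And>n. n \<ge> n1 \<Longrightarrow> (\<integral>\<^sup>+y. emeasure (P n y) N \<partial>\<nu>) > 0"
proof -
  have sp: "space \<nu> = space M" using sets_eq_imp_space_eq[OF \<nu>(1)] .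
  define X where "X j = {x \<in> space M. \<forall>n. j \<le> n \<longrightarrow> emeasure (P n x) N > 0}" for j
  have X: "X j \<in> sets \<nu>" for j unfolding \<nu>(1) X_def by measurable
  have "(\<Union>j. X j) = space M" using reach by (auto simp: X_def)
  have "\<exists>j. emeasure \<nu> (X j) \<noteq> 0"
  proof (rule ccontr)
    assume "\<not> ?thesis"
    then have "(\<Union>j. X j) \<in> null_sets \<nu>" using X by (intro null_sets_UN) auto
    then show False using \<nu>(2) \<open>(\<Union>j. X j) = space M\<close> by auto
  qed
  then obtain j where j: "emeasure \<nu> (X j) \<noteq> 0" by blast
  have "(\<integral>\<^sup>+y. emeasure (P n y) N \<partial>\<nu>) > 0" if "n \<ge> j" for n
  proof (rule ccontr)
    assume "\<not> ?thesis"
    moreover have "(\<lambda>y. emeasure (P n y) N) \<in> borel_measurable \<nu>" by (simp add: measurable_cong_sets[OF \<nu>(1) refl])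
    ultimately have "AE y in \<nu>. emeasure (P n y) N = 0" by (simp add: nn_integral_0_iff_AE)
    then have "AE y in \<nu>. y \<notin> X j" by eventually_elim (use that in \<open>auto simp: X_def\<close>)
    then have "X j \<in> null_sets \<nu>" using X by (simp add: AE_iff_null_sets)
    then show False using j by auto
  qed
  then show ?thesis using that by blast
qed

text \<open>After a visit to \<open>C\<close> the measure \<open>\<nu>\<close> takes over and
  forgets the starting point. The visit occurs at some \<open>i < n0\<close> depending on the state;
  waiting \<open>n0 - i\<close> steps longer before looking at \<open>N\<close> makes the total time
  \<open>m\<close> independent of it.\<close>

lemma reach_N:
  assumes "R \<ge> 0"
  obtains m p where "p > 0" "\<And>x. x \<in> space M \<Longrightarrow> V x \<le> R \<Longrightarrow> p \<le> measure (P m x) N"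
proof -
  obtain n0 q where q: "q > 0" "\<And>x. x \<in> space M \<Longrightarrow> V x \<le> R \<Longrightarrow> \<exists>i<n0. q \<le> measure (P i x) C"
    by (rule hit_C[OF assms]) blast
  obtain n1 where n1: "\<And>n. n \<ge> n1 \<Longrightarrow> (\<integral>\<^sup>+y. emeasure (P n y) N \<partial>\<nu>) > 0" by (rule \<nu>_reach) blast
  define c where "c j = enn2real (\<integral>\<^sup>+y. emeasure (P (n1 + j) y) N \<partial>\<nu>)" for j
  have sp: "space \<nu> = space M" using sets_eq_imp_space_eq[OF \<nu>(1)] .
  have c: "(\<integral>\<^sup>+y. emeasure (P (n1 + j) y) N \<partial>\<nu>) = ennreal (c j)" "c j > 0" for j
  proof -
    have "(\<integral>\<^sup>+y. emeasure (P (n1 + j) y) N \<partial>\<nu>) \<le> (\<integral>\<^sup>+y. 1 \<partial>\<nu>)"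
      using prob_space.emeasure_le_1[OF P_prob] by (intro nn_integral_mono) (simp add: sp)
    also have "\<dots> \<le> 1" using \<nu>_finite by simp
    finally have fin: "(\<integral>\<^sup>+y. emeasure (P (n1 + j) y) N \<partial>\<nu>) < \<infinity>" by (simp add: le_less_trans)
    then show "(\<integral>\<^sup>+y. emeasure (P (n1 + j) y) N \<partial>\<nu>) = ennreal (c j)" by (simp add: c_def)
    show "c j > 0" using n1[of "n1 + j"] fin by (simp add: c_def enn2real_positive_iff)
  qed
  \<comment> \<open>A common bound for the finitely many possible waiting times.\<close>
  define c0 where "c0 = Min (c ` {..n0})"
  have c0: "c0 > 0" "\<And>j. j \<le> n0 \<Longrightarrow> c0 \<le> c j" using c(2) by (auto simp: c0_def)
  define m where "m = n0 + k + n1"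
  have "q * c0 \<le> measure (P m x) N" if x: "x \<in> space M" "V x \<le> R" for x
  proof -
    obtain i where i: "i < n0" "q \<le> measure (P i x) C" using q(2)[OF x] by blast
    interpret Pi: prob_space "P i x" by (rule P_prob[OF x(1)])
    interpret Pm: prob_space "P m x" by (rule P_prob[OF x(1)])
    have m_eq: "m = i + (k + (n1 + (n0 - i)))" using i(1) by (simp add: m_def)
    have inC: "ennreal c0 \<le> emeasure (P (k + (n1 + (n0 - i))) y) N" if y: "y \<in> C" for y
    proof -
      have ysp: "y \<in> space M" by (rule C_space[OF y])
      have "ennreal c0 \<le> ennreal (c (n0 - i))" by (intro ennreal_leI c0) simp
      also have "\<dots> = (\<integral>\<^sup>+z. emeasure (P (n1 + (n0 - i)) z) N \<partial>\<nu>)" by (simp add: c)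
      also have "\<dots> \<le> (\<integral>\<^sup>+z. emeasure (P (n1 + (n0 - i)) z) N \<partial>P k y)"
      proof (rule nn_integral_mono_measure)
        show "sets \<nu> = sets (P k y)" by (simp add: \<nu>(1) P_sets[OF ysp])
        have "emeasure \<nu> A \<le> emeasure (P k y) A" for A
          using minor[OF y, of A] by (cases "A \<in> sets M") (auto simp: emeasure_notin_sets \<nu>(1))
        then show "\<nu> \<le> P k y"
          using \<nu>(1) by (simp add: le_measure_iff le_fun_def P_sets[OF ysp] P_space[OF ysp] sp)
      qed
      also have "\<dots> = emeasure (P (k + (n1 + (n0 - i))) y) N" by (rule emeasure_P_add[OF ysp N, symmetric])
      finally show ?thesis .
    qed
    have "ennreal (q * c0) \<le> ennreal c0 * emeasure (P i x) C"
      using i(2) c0(1) by (simp add: Pi.emeasure_eq_measure ennreal_mult'[symmetric] mult.commute mult_left_mono)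
    also have "\<dots> = (\<integral>\<^sup>+y. ennreal c0 * indicator C y \<partial>P i x)"
      by (simp add: nn_integral_cmult_indicator P_sets[OF x(1)])
    also have "\<dots> \<le> (\<integral>\<^sup>+y. emeasure (P (k + (n1 + (n0 - i))) y) N \<partial>P i x)"
      using inC by (intro nn_integral_mono) (auto split: split_indicator)
    also have "\<dots> = emeasure (P m x) N" unfolding m_eq by (rule emeasure_P_add[OF x(1) N, symmetric])
    finally show ?thesis by (simp add: Pm.emeasure_eq_measure)
  qed
  then show ?thesis using that[of "q * c0" m] q(1) c0(1) by simp
qed

lemma P_N_lower:
  assumes x: "x \<in> space M" and A: "A \<in> sets M" and p: "p \<le> measure (P m x) N" "p \<ge> 0"
    and g: "\<And>z. z \<in> N \<Longrightarrow> g \<le> measure (P K0 z) A" "g \<ge> 0"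
  shows "p * g \<le> measure (P (m + K0) x) A"
proof -
  interpret Pm: prob_space "P m x" by (rule P_prob[OF x])
  interpret PK: prob_space "P (m + K0) x" by (rule P_prob[OF x])
  have "ennreal (p * g) \<le> ennreal g * emeasure (P m x) N"
    using p g(2) by (simp add: Pm.emeasure_eq_measure ennreal_mult'[symmetric] mult.commute mult_left_mono)
  also have "\<dots> = (\<integral>\<^sup>+z. ennreal g * indicator N z \<partial>P m x)"
    by (simp add: nn_integral_cmult_indicator P_sets[OF x])
  also have "\<dots> \<le> (\<integral>\<^sup>+z. emeasure (P K0 z) A \<partial>P m x)"
  proof (rule nn_integral_mono)
    fix z show "ennreal g * indicator N z \<le> emeasure (P K0 z) A"
    proof (cases "z \<in> N")
      case True
      interpret prob_space "P K0 z" by (rule P_prob[OF N_space[OF True]])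
      show ?thesis using g(1)[OF True] True by (simp add: emeasure_eq_measure ennreal_leI)
    qed simp
  qed
  also have "\<dots> = emeasure (P (m + K0) x) A" by (rule emeasure_P_add[OF x A, symmetric])
  finally show ?thesis by (simp add: PK.emeasure_eq_measure)
qed

text \<open>Both starting points reach \<open>N\<close> at time \<open>m\<close> with probability at
  least \<open>p\<close>, and from there the overlap on \<open>N\<close> applies.\<close>

lemma overlap_sublevel:
  assumes "R \<ge> 0"
  obtains m \<eta> where "m \<ge> 1" "\<eta> > 0" "\<And>x x' A. x \<in> space M \<Longrightarrow> x' \<in> space M \<Longrightarrow> V x \<le> R \<Longrightarrow> V x' \<le> R \<Longrightarrow> A \<in> sets M \<Longrightarrow>
    \<eta> \<le> measure (P m x) A + measure (P m x') (space M - A)"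
proof -
  obtain m p where p: "p > 0" "\<And>x. x \<in> space M \<Longrightarrow> V x \<le> R \<Longrightarrow> p \<le> measure (P m x) N"
    by (rule reach_N[OF assms]) blast
  have "p * \<eta>0 \<le> measure (P (m + K0) x) A + measure (P (m + K0) x') (space M - A)"
    if x: "x \<in> space M" "x' \<in> space M" "V x \<le> R" "V x' \<le> R" and A: "A \<in> sets M" for x x' A
  proof -
    have "N \<noteq> {}" using p(1) p(2)[OF x(1,3)] by auto
    \<comment> \<open>The infimum over \<open>N\<close> separates the two chains: from any point of
      \<open>N\<close> one gives \<open>A\<close> at least \<open>g\<close>, the other gives the
      complement at least \<open>\<eta>0 - g\<close>, and the bounds add up to
      \<open>\<eta>0\<close>.\<close>
    define g where "g = (INF z\<in>N. measure (P K0 z) A)"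
    have bdd: "bdd_below ((\<lambda>z. measure (P K0 z) A) ` N)" by (rule bdd_belowI[of _ 0]) auto
    have g: "g \<le> measure (P K0 z) A" if "z \<in> N" for z
      unfolding g_def using bdd that by (rule cINF_lower)
    have g0: "g \<ge> 0" unfolding g_def using \<open>N \<noteq> {}\<close> by (rule cINF_greatest) simp
    have g': "max 0 (\<eta>0 - g) \<le> measure (P K0 z) (space M - A)" if z: "z \<in> N" for z
    proof -
      have "\<eta>0 - measure (P K0 z) (space M - A) \<le> g"
        unfolding g_def using \<open>N \<noteq> {}\<close> overlap[OF _ z A] by (intro cINF_greatest) (auto simp: algebra_simps)
      then show ?thesis by simp
    qed
    have "p * g \<le> measure (P (m + K0) x) A"
      using p x g g0 by (intro P_N_lower A) auto
    moreover have "p * max 0 (\<eta>0 - g) \<le> measure (P (m + K0) x') (space M - A)"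
      using p x g' A by (intro P_N_lower) auto
    moreover have "p * \<eta>0 \<le> p * g + p * max 0 (\<eta>0 - g)"
      using p(1) by (simp flip: distrib_left)
    ultimately show ?thesis by linarith
  qed
  then show ?thesis using that[of "m + K0" "p * \<eta>0"] p(1) \<eta>0 K0 by simp
qed

end

section \<open>Geometric convergence to the stationary distribution\<close>

context drift_chain
begin

text \<open>The weighted oscillation of Hairer and Mattingly's proof of Harris' theorem.\<close>

definition osc :: "real \<Rightarrow> real \<Rightarrow> ('a \<Rightarrow> real) \<Rightarrow> bool" where
  "osc \<beta> c f \<longleftrightarrow> (\<forall>x\<in>space M. \<forall>y\<in>space M. \<bar>f x - f y\<bar> \<le> c * (2 + \<beta> * (V x + V y)))"

lemma V_integrable:
  assumes x: "x \<in> space M"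
  shows "integrable (P n x) V" "(\<integral>y. V y \<partial>P n x) \<le> \<alpha> ^ n * V x + K1"
proof -
  have [measurable]: "V \<in> borel_measurable (P n x)" by (rule P_borel[OF x V])
  have nn: "(\<integral>\<^sup>+y. ennreal (V y) \<partial>P n x) \<le> ennreal (\<alpha> ^ n * V x + K1)" by (rule nn_integral_V[OF x])
  have pos: "AE y in P n x. 0 \<le> V y" using V_nonneg P_space[OF x] by (intro AE_I2) auto
  show i: "integrable (P n x) V"
    by (rule integrableI_nonneg) (use nn pos in \<open>auto intro: le_less_trans\<close>)
  have "ennreal (\<integral>y. V y \<partial>P n x) \<le> ennreal (\<alpha> ^ n * V x + K1)"
    using nn nn_integral_eq_integral[OF i pos] by simp
  then show "(\<integral>y. V y \<partial>P n x) \<le> \<alpha> ^ n * V x + K1"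
    using \<alpha> K1 V_nonneg[OF x] by (subst (asm) ennreal_le_iff) auto
qed

lemma integral_V_dominated:
  assumes x: "x \<in> space M" and h: "h \<in> borel_measurable M" "\<And>y. y \<in> space M \<Longrightarrow> \<bar>h y\<bar> \<le> a * V y"
  shows "integrable (P n x) h" "\<bar>\<integral>y. h y \<partial>P n x\<bar> \<le> a * (\<integral>y. V y \<partial>P n x)"
proof -
  have hV: "AE y in P n x. norm (h y) \<le> norm (a * V y)"
    using h(2) P_space[OF x] by (intro AE_I2) force
  have aV: "integrable (P n x) (\<lambda>y. a * V y)" using V_integrable(1)[OF x] by simp
  show i: "integrable (P n x) h" by (rule Bochner_Integration.integrable_bound[OF aV P_borel[OF x h(1)] hV])
  have "\<bar>\<integral>y. h y \<partial>P n x\<bar> \<le> (\<integral>y. \<bar>h y\<bar> \<partial>P n x)" by (rule integral_abs_bound)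
  also have "\<dots> \<le> (\<integral>y. a * V y \<partial>P n x)"
    using i aV h(2) P_space[OF x] by (intro integral_mono) auto
  finally show "\<bar>\<integral>y. h y \<partial>P n x\<bar> \<le> a * (\<integral>y. V y \<partial>P n x)" by simp
qed

text \<open>The weighted oscillation is a weighted supremum norm up to an additive constant: the
  supremum of \<open>f - c * (1 + \<beta> * V)\<close> lies below the infimum of
  \<open>f + c * (1 + \<beta> * V)\<close>.\<close>

lemma osc_shift:
  assumes f: "osc \<beta> c f"
  obtains s where "\<And>x. x \<in> space M \<Longrightarrow> \<bar>f x + s\<bar> \<le> c * (1 + \<beta> * V x)"
proof -
  define A where "A = (SUP x\<in>space M. f x - c * (1 + \<beta> * V x))"
  have le: "f x - c * (1 + \<beta> * V x) \<le> f y + c * (1 + \<beta> * V y)" if "x \<in> space M" "y \<in> space M" for x y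
  proof -
    have "\<bar>f x - f y\<bar> \<le> c * (2 + \<beta> * (V x + V y))" using f that by (auto simp: osc_def)
    then show ?thesis by (simp add: algebra_simps abs_le_iff)
  qed
  obtain y where "y \<in> space M" using nonempty by auto
  then have bdd: "bdd_above ((\<lambda>x. f x - c * (1 + \<beta> * V x)) ` space M)"
    using le by (intro bdd_aboveI2[of _ _ "f y + c * (1 + \<beta> * V y)"]) auto
  have "f x - c * (1 + \<beta> * V x) \<le> A" if "x \<in> space M" for x
    unfolding A_def using bdd that by (intro cSUP_upper) auto
  moreover have "A \<le> f x + c * (1 + \<beta> * V x)" if "x \<in> space M" for x
    unfolding A_def using nonempty le that by (intro cSUP_least) auto
  ultimately have "\<bar>f x + (- A)\<bar> \<le> c * (1 + \<beta> * V x)" if "x \<in> space M" for x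
    using that by (force simp: abs_le_iff)
  then show ?thesis using that by blast
qed

text \<open>For two states with small \<open>V\<close> the overlap reduces the bounded part of the
  oscillation; for the others the drift reduces the weighted part. A small weight
  \<open>\<beta>\<close> keeps the constant of the drift from spoiling the first case.\<close>

lemma contraction:
  obtains m \<beta> \<rho> where "m \<ge> 1" "\<beta> > 0" "0 < \<rho>" "\<rho> < 1"
    "\<And>f c B. f \<in> borel_measurable M \<Longrightarrow> (\<And>x. x \<in> space M \<Longrightarrow> \<bar>f x\<bar> \<le> B) \<Longrightarrow> c \<ge> 0 \<Longrightarrow> osc \<beta> c f \<Longrightarrow>
      osc \<beta> (\<rho> * c) (\<lambda>x. \<integral>y. f y \<partial>P m x)"
proof -
  \<comment> \<open>Chosen such that \<open>(1 - \<alpha>) / 2 * \<beta> * R = 2 * \<eta>\<close>,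
    the amount to be gained when \<open>V x + V y > R\<close>.\<close>
  define R where "R = 8 * K1 / (1 - \<alpha>)"
  have R: "R \<ge> 0" using K1(1) \<alpha> by (simp add: R_def)
  obtain m \<eta> where m: "m \<ge> 1" and \<eta>: "\<eta> > 0" and ov: "\<And>x x' A. x \<in> space M \<Longrightarrow> x' \<in> space M \<Longrightarrow>
      V x \<le> R \<Longrightarrow> V x' \<le> R \<Longrightarrow> A \<in> sets M \<Longrightarrow> \<eta> \<le> measure (P m x) A + measure (P m x') (space M - A)"
    by (rule overlap_sublevel[OF R]) blast
  \<comment> \<open>The two additive terms \<open>\<beta> * K1\<close> together cost
    \<open>\<eta>\<close>, which is half of the gain \<open>2 * \<eta>\<close> from the
    overlap.\<close>
  define \<beta> where "\<beta> = \<eta> / (2 * K1)"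
  have \<beta>: "\<beta> > 0" "\<beta> * K1 = \<eta> / 2" using \<eta> K1(1) by (auto simp: \<beta>_def)
  define \<rho> where "\<rho> = max ((1 + \<alpha>) / 2) (1 - \<eta> / 2)"
  have \<rho>: "0 < \<rho>" "\<rho> < 1" "(1 + \<alpha>) / 2 \<le> \<rho>" "1 - \<eta> / 2 \<le> \<rho>"
    using \<alpha> \<eta> by (auto simp: \<rho>_def less_max_iff_disj)
  have QV: "(\<integral>y. V y \<partial>P m x) \<le> \<alpha> * V x + K1" if x: "x \<in> space M" for x
  proof -
    have "\<alpha> ^ m \<le> \<alpha>" using m \<alpha> power_decreasing[of 1 m \<alpha>] by simp
    then have "\<alpha> ^ m * V x \<le> \<alpha> * V x" using V_nonneg[OF x] by (intro mult_right_mono)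
    then show ?thesis using V_integrable(2)[OF x, of m] by simp
  qed
  have "osc \<beta> (\<rho> * c) (\<lambda>x. \<integral>y. f y \<partial>P m x)"
    if f: "f \<in> borel_measurable M" "\<And>x. x \<in> space M \<Longrightarrow> \<bar>f x\<bar> \<le> B" and c: "c \<ge> 0" and o: "osc \<beta> c f" for f c B
  proof -
    obtain s where s: "\<And>x. x \<in> space M \<Longrightarrow> \<bar>f x + s\<bar> \<le> c * (1 + \<beta> * V x)" by (rule osc_shift[OF o]) blast
    \<comment> \<open>Truncation at \<open>c\<close>: the overlap acts on the bounded part
      \<open>f1\<close>, while the remainder \<open>f2\<close> is at most
      \<open>c * \<beta> * V\<close> and is left to the drift.\<close>
    define f1 where "f1 x = max (- c) (min c (f x + s))" for x
    define f2 where "f2 x = f x + s - f1 x" for x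
    have [measurable]: "f1 \<in> borel_measurable M" "f2 \<in> borel_measurable M"
      using f(1) by (auto simp: f1_def[abs_def] f2_def[abs_def])
    have f1: "\<bar>f1 x\<bar> \<le> c" for x using c by (auto simp: f1_def)
    have f2: "\<bar>f2 x\<bar> \<le> (c * \<beta>) * V x" if x: "x \<in> space M" for x
    proof -
      have "0 \<le> c * \<beta> * V x" using c \<beta>(1) V_nonneg[OF x] by simp
      then show ?thesis using s[OF x] c by (auto simp: f2_def f1_def algebra_simps max_def min_def abs_le_iff)
    qed
    have split: "(\<integral>y. f y \<partial>P m x) = (\<integral>y. f1 y \<partial>P m x) + (\<integral>y. f2 y \<partial>P m x) - s" if x: "x \<in> space M" for x
    proof -
      interpret prob_space "P m x" by (rule P_prob[OF x])
      have "(\<integral>y. f1 y \<partial>P m x) + (\<integral>y. f2 y \<partial>P m x) = (\<integral>y. f1 y + f2 y \<partial>P m x)"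
        by (rule Bochner_Integration.integral_add[symmetric])
           (use x f1 integral_V_dominated(1)[OF x _ f2] in \<open>auto intro!: P_integrable[of _ _ c]\<close>)
      also have "\<dots> = (\<integral>y. f y + s \<partial>P m x)" by (simp add: f2_def)
      also have "\<dots> = (\<integral>y. f y \<partial>P m x) + s"
        using P_integrable[OF x f, of m] by (simp add: prob_space)
      finally show ?thesis by simp
    qed
    have b2: "\<bar>\<integral>y. f2 y \<partial>P m x\<bar> \<le> c * \<beta> * (\<alpha> * V x + K1)" if x: "x \<in> space M" for x
    proof -
      have "\<bar>\<integral>y. f2 y \<partial>P m x\<bar> \<le> (c * \<beta>) * (\<integral>y. V y \<partial>P m x)" by (rule integral_V_dominated(2)[OF x _ f2]) auto
      also have "\<dots> \<le> c * \<beta> * (\<alpha> * V x + K1)" using c \<beta>(1) QV[OF x] by (intro mult_left_mono) auto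
      finally show ?thesis .
    qed
    have b1: "\<bar>\<integral>y. f1 y \<partial>P m x\<bar> \<le> c" if x: "x \<in> space M" for x
      by (rule integral_P_bound[OF x _ f1]) auto
    have d1: "(\<integral>z. f1 z \<partial>P m x) - (\<integral>z. f1 z \<partial>P m y) \<le> 2 * c * (1 - \<eta>)"
      if xy: "x \<in> space M" "y \<in> space M" "V x \<le> R" "V y \<le> R" for x y
    proof (cases "c = 0")
      case True
      then have "f1 z = 0" for z using f1[of z] by simp
      then show ?thesis using True by simp
    next
      case False
      then have "c > 0" using c by simp
      have "(\<integral>z. f1 z / c \<partial>P m x) - (\<integral>z. f1 z / c \<partial>P m y) \<le> 2 * (1 - \<eta>)"
        by (rule overlap_integral[of _ M])
           (use xy ov[OF xy] f1 \<open>c > 0\<close> in \<open>auto simp: P_prob P_sets abs_divide\<close>)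
      then have "((\<integral>z. f1 z \<partial>P m x) - (\<integral>z. f1 z \<partial>P m y)) / c \<le> 2 * (1 - \<eta>)"
        by (simp add: diff_divide_distrib)
      then show ?thesis using \<open>c > 0\<close> by (simp add: field_simps)
    qed
    show ?thesis unfolding osc_def
    proof (intro ballI)
      fix x y assume x: "x \<in> space M" and y: "y \<in> space M"
      let ?s = "V x + V y"
      let ?D = "\<bar>(\<integral>z. f z \<partial>P m x) - (\<integral>z. f z \<partial>P m y)\<bar>"
      let ?D1 = "\<bar>(\<integral>z. f1 z \<partial>P m x) - (\<integral>z. f1 z \<partial>P m y)\<bar>"
      have s0: "0 \<le> ?s" using V_nonneg[OF x] V_nonneg[OF y] by simp
      have "?D \<le> ?D1 + \<bar>\<integral>z. f2 z \<partial>P m x\<bar> + \<bar>\<integral>z. f2 z \<partial>P m y\<bar>"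
        unfolding split[OF x] split[OF y] by linarith
      also have "\<dots> \<le> ?D1 + (c * \<beta> * (\<alpha> * V x + K1) + c * \<beta> * (\<alpha> * V y + K1))"
        using b2[OF x] b2[OF y] by linarith
      also have "c * \<beta> * (\<alpha> * V x + K1) + c * \<beta> * (\<alpha> * V y + K1) = c * (\<beta> * \<alpha> * ?s + 2 * (\<beta> * K1))"
        by (simp add: algebra_simps)
      also have "\<dots> = c * (\<beta> * \<alpha> * ?s + \<eta>)" by (simp add: \<beta>(2))
      finally have D: "?D \<le> ?D1 + c * (\<beta> * \<alpha> * ?s + \<eta>)" .
      have \<beta>s: "0 \<le> \<beta> * ?s" using \<beta>(1) s0 by simp
      have "\<exists>d. ?D1 \<le> c * d \<and> d + (\<beta> * \<alpha> * ?s + \<eta>) \<le> \<rho> * (2 + \<beta> * ?s)"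
      proof (cases "?s \<le> R")
        case True
        then have VR: "V x \<le> R" "V y \<le> R" using V_nonneg[OF x] V_nonneg[OF y] by auto
        have "?D1 \<le> c * (2 * (1 - \<eta>))" using d1[OF x y VR] d1[OF y x VR(2,1)] by (simp add: mult_ac abs_le_iff)
        moreover have "\<beta> * ?s * \<alpha> \<le> \<beta> * ?s * \<rho>" using \<rho>(3) \<alpha> by (intro mult_left_mono \<beta>s) auto
        then have "2 * (1 - \<eta>) + (\<beta> * \<alpha> * ?s + \<eta>) \<le> \<rho> * (2 + \<beta> * ?s)"
          using \<rho>(4) by (simp add: algebra_simps)
        ultimately show ?thesis by blast
      next
        case False
        have "?D1 \<le> c * 2" using b1[OF x] b1[OF y] by linarith
        moreover have "2 + (\<beta> * \<alpha> * ?s + \<eta>) \<le> \<rho> * (2 + \<beta> * ?s)"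
        proof -
          have "2 * \<eta> = (1 - \<alpha>) / 2 * (\<beta> * R)"
          proof -
            have "1 - \<alpha> \<noteq> 0" using \<alpha> by simp
            then have "(1 - \<alpha>) / 2 * (\<beta> * R) = 4 * (\<beta> * K1)" by (simp add: R_def)
            then show ?thesis using \<beta>(2) by simp
          qed
          also have "\<dots> \<le> (1 - \<alpha>) / 2 * (\<beta> * ?s)"
            using False \<alpha> \<beta>(1) by (intro mult_left_mono) auto
          also have "\<dots> \<le> (\<rho> - \<alpha>) * (\<beta> * ?s)" using \<rho>(3) \<beta>s by (intro mult_right_mono) (auto simp: field_simps)
          finally show ?thesis using \<rho>(4) by (simp add: algebra_simps)
        qed
        ultimately show ?thesis by blast
      qed
      then obtain d where d: "?D1 \<le> c * d" "d + (\<beta> * \<alpha> * ?s + \<eta>) \<le> \<rho> * (2 + \<beta> * ?s)" by blast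
      have "?D \<le> c * (d + (\<beta> * \<alpha> * ?s + \<eta>))" using D d(1) by (simp add: distrib_left)
      also have "\<dots> \<le> c * (\<rho> * (2 + \<beta> * ?s))" using d(2) c by (rule mult_left_mono)
      finally show "?D \<le> \<rho> * c * (2 + \<beta> * ?s)" by (simp add: mult_ac)
    qed
  qed
  then show ?thesis using that[OF m \<beta>(1) \<rho>(1,2)] by blast
qed

text \<open>Time \<open>n\<close> is divided into blocks of length \<open>m\<close>, each
  contracting by \<open>r\<close>; the incomplete block is applied to \<open>f\<close> beforehand
  and keeps it bounded by 1.\<close>

lemma decay:
  obtains D \<rho> where "D \<ge> 0" "0 < \<rho>" "\<rho> < 1"
    "\<And>n f x y. f \<in> borel_measurable M \<Longrightarrow> (\<And>x. x \<in> space M \<Longrightarrow> \<bar>f x\<bar> \<le> 1) \<Longrightarrow> x \<in> space M \<Longrightarrow> y \<in> space M \<Longrightarrow>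
      \<bar>(\<integral>z. f z \<partial>P n x) - (\<integral>z. f z \<partial>P n y)\<bar> \<le> D * \<rho> ^ n * (V x + V y)"
proof -
  obtain m \<beta> r where m: "m \<ge> 1" "\<beta> > 0" "0 < r" "r < 1"
    and contr: "\<And>f c B. f \<in> borel_measurable M \<Longrightarrow> (\<And>x. x \<in> space M \<Longrightarrow> \<bar>f x\<bar> \<le> B) \<Longrightarrow> c \<ge> 0 \<Longrightarrow> osc \<beta> c f \<Longrightarrow>
      osc \<beta> (r * c) (\<lambda>x. \<integral>y. f y \<partial>P m x)"
    by (rule contraction) blast
  define \<rho> where "\<rho> = root m r"
  have \<rho>m: "\<rho> ^ m = r" using m by (simp add: \<rho>_def)
  have \<rho>: "0 < \<rho>" "\<rho> < 1" using m by (auto simp: \<rho>_def)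
  \<comment> \<open>The factor \<open>1 / r\<close> compensates for the incomplete block, and
    \<open>1 + \<beta>\<close> absorbs the constant 2 since \<open>V \<ge> 1\<close>.\<close>
  define D where "D = (1 + \<beta>) / r"
  have "\<bar>(\<integral>z. f z \<partial>P n x) - (\<integral>z. f z \<partial>P n y)\<bar> \<le> D * \<rho> ^ n * (V x + V y)"
    if f: "f \<in> borel_measurable M" "\<And>x. x \<in> space M \<Longrightarrow> \<bar>f x\<bar> \<le> 1" and x: "x \<in> space M" and y: "y \<in> space M" for n f x y
  proof -
    define h where "h x = (\<integral>z. f z \<partial>P (n mod m) x)" for x
    have h [measurable]: "h \<in> borel_measurable M" using f(1) by (simp add: h_def[abs_def])
    have hb: "\<bar>h x\<bar> \<le> 1" if "x \<in> space M" for x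
      unfolding h_def by (rule integral_P_bound[OF that f])
    have o: "osc \<beta> (r ^ j) (\<lambda>x. \<integral>z. h z \<partial>P (j * m) x)" for j
    proof (induction j)
      case 0
      show ?case unfolding osc_def
      proof (intro ballI)
        fix x y assume xy: "x \<in> space M" "y \<in> space M"
        have "0 \<le> \<beta> * (V x + V y)" using m(2) V_nonneg xy by simp
        then show "\<bar>(\<integral>z. h z \<partial>P (0 * m) x) - (\<integral>z. h z \<partial>P (0 * m) y)\<bar> \<le> r ^ 0 * (2 + \<beta> * (V x + V y))"
          using hb[OF xy(1)] hb[OF xy(2)] xy by (simp add: integral_return)
      qed
    next
      case (Suc j)
      have "osc \<beta> (r * r ^ j) (\<lambda>x. \<integral>y. (\<integral>z. h z \<partial>P (j * m) y) \<partial>P m x)"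
        by (rule contr[OF _ integral_P_bound[OF _ h hb] _ Suc]) (use m in auto)
      moreover have "(\<integral>y. (\<integral>z. h z \<partial>P (j * m) y) \<partial>P m x) = (\<integral>z. h z \<partial>P (Suc j * m) x)" if "x \<in> space M" for x
        using integral_P_add[OF that h hb, of m "j * m"] by simp
      ultimately show ?case by (simp add: osc_def)
    qed
    have eq: "(\<integral>z. f z \<partial>P n x) = (\<integral>z. h z \<partial>P (n div m * m) x)" if "x \<in> space M" for x
      using integral_P_add[OF that f, of "n div m * m" "n mod m"] by (simp add: h_def)
    have "\<bar>(\<integral>z. f z \<partial>P n x) - (\<integral>z. f z \<partial>P n y)\<bar> \<le> r ^ (n div m) * (2 + \<beta> * (V x + V y))"
      using o[of "n div m"] x y by (simp add: osc_def eq)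
    also have "\<dots> \<le> (\<rho> ^ n / r) * ((1 + \<beta>) * (V x + V y))"
    proof (intro mult_mono)
      have "r ^ (n div m) * r = \<rho> ^ (m * (n div m)) * \<rho> ^ m" by (simp add: \<rho>m power_mult)
      also have "\<dots> \<le> \<rho> ^ (m * (n div m)) * \<rho> ^ (n mod m)"
        using \<rho> m by (intro mult_left_mono power_decreasing) auto
      also have "\<dots> = \<rho> ^ n" by (simp flip: power_add)
      finally show "r ^ (n div m) \<le> \<rho> ^ n / r" using m by (simp add: field_simps)
      show "2 + \<beta> * (V x + V y) \<le> (1 + \<beta>) * (V x + V y)"
        using V_ge_1[OF x] V_ge_1[OF y] by (simp add: algebra_simps)
      show "0 \<le> 2 + \<beta> * (V x + V y)" using m(2) V_nonneg x y by simp
      show "0 \<le> \<rho> ^ n / r" using \<rho> m by simp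
    qed
    also have "\<dots> = D * \<rho> ^ n * (V x + V y)" by (simp add: D_def)
    finally show ?thesis .
  qed
  moreover have "D \<ge> 0" using m by (simp add: D_def)
  ultimately show ?thesis using that \<rho> by blast
qed

lemma measure_P_eq_integral: "x \<in> space M \<Longrightarrow> A \<in> sets M \<Longrightarrow> measure (P n x) A = (\<integral>z. indicator A z \<partial>P n x)"
  by (simp add: P_sets)

text \<open>The laws from one starting point converge on each set at a rate that does not depend on
  the set. This uniformity carries countable additivity over to the limit.\<close>

theorem geometric_convergence:
  obtains \<pi> D \<rho> where "prob_space \<pi>" "sets \<pi> = sets M" "D \<ge> 0" "0 < \<rho>" "\<rho> < 1"
    "\<And>n f x. f \<in> borel_measurable M \<Longrightarrow> (\<And>x. x \<in> space M \<Longrightarrow> \<bar>f x\<bar> \<le> 1) \<Longrightarrow> x \<in> space M \<Longrightarrow>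
      \<bar>(\<integral>z. f z \<partial>P n x) - (\<integral>z. f z \<partial>\<pi>)\<bar> \<le> D * \<rho> ^ n * V x"
proof -
  obtain D0 \<rho> where D0: "D0 \<ge> 0" and \<rho>: "0 < \<rho>" "\<rho> < 1" and dec:
    "\<And>n f x y. f \<in> borel_measurable M \<Longrightarrow> (\<And>x. x \<in> space M \<Longrightarrow> \<bar>f x\<bar> \<le> 1) \<Longrightarrow> x \<in> space M \<Longrightarrow> y \<in> space M \<Longrightarrow>
      \<bar>(\<integral>z. f z \<partial>P n x) - (\<integral>z. f z \<partial>P n y)\<bar> \<le> D0 * \<rho> ^ n * (V x + V y)"
    by (rule decay) blast
  obtain x0 where x0: "x0 \<in> space M" using nonempty by auto
  \<comment> \<open>The decay is integrated against the law at time \<open>l\<close>, where the mean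
    of \<open>V\<close> is at most \<open>V x0 + K1\<close>.\<close>
  define D1 where "D1 = D0 * (2 * V x0 + K1)"
  define a where "a n A = measure (P n x0) A" for n A
  have step: "\<bar>a (l + n) A - a n A\<bar> \<le> D1 * \<rho> ^ n" if A: "A \<in> sets M" for l n A
  proof -
    interpret prob_space "P l x0" by (rule P_prob[OF x0])
    let ?h = "\<lambda>z. measure (P n z) A"
    have h: "?h \<in> borel_measurable M"
      using A by (intro measurable_compose[OF P_subprob measurable_measure_subprob_algebra])
    have hi: "?h z = (\<integral>w. indicator A w \<partial>P n z)" if "z \<in> space M" for z
      by (rule measure_P_eq_integral[OF that A])
    have hd: "\<bar>?h z - ?h x0\<bar> \<le> (D0 * \<rho> ^ n) * (V z + V x0)" if "z \<in> space M" for z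
      unfolding hi[OF that] hi[OF x0] by (rule dec) (use A that x0 in \<open>auto split: split_indicator\<close>)
    have hb: "\<bar>?h z\<bar> \<le> 1" if "z \<in> space M" for z
      using prob_space.prob_le_1[OF P_prob[OF that]] by simp
    have "a (l + n) A = (\<integral>z. ?h z \<partial>P l x0)"
    proof -
      have "a (l + n) A = (\<integral>z. (\<integral>w. indicator A w \<partial>P n z) \<partial>P l x0)"
        unfolding a_def measure_P_eq_integral[OF x0 A] by (rule integral_P_add[OF x0, of _ 1]) (use A in \<open>auto split: split_indicator\<close>)
      also have "\<dots> = (\<integral>z. ?h z \<partial>P l x0)" by (rule Bochner_Integration.integral_cong) (auto simp: hi P_space[OF x0])
      finally show ?thesis .
    qed
    then have "a (l + n) A - a n A = (\<integral>z. ?h z - ?h x0 \<partial>P l x0)"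
      using P_integrable[OF x0 h hb, of l] by (simp add: a_def prob_space)
    also have "\<bar>\<dots>\<bar> \<le> (\<integral>z. \<bar>?h z - ?h x0\<bar> \<partial>P l x0)" by (rule integral_abs_bound)
    also have "\<dots> \<le> (\<integral>z. (D0 * \<rho> ^ n) * (V z + V x0) \<partial>P l x0)"
      using hd V_integrable(1)[OF x0, of l] P_integrable[OF x0 h hb, of l] P_space[OF x0]
      by (intro integral_mono) auto
    also have "\<dots> = (D0 * \<rho> ^ n) * ((\<integral>z. V z \<partial>P l x0) + V x0)"
      using V_integrable(1)[OF x0, of l] by (simp add: prob_space)
    also have "\<dots> \<le> (D0 * \<rho> ^ n) * ((V x0 + K1) + V x0)"
    proof -
      have "\<alpha> ^ l * V x0 \<le> 1 * V x0" using \<alpha> V_nonneg[OF x0] by (intro mult_right_mono power_le_one) auto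
      then have "(\<integral>z. V z \<partial>P l x0) \<le> V x0 + K1" using V_integrable(2)[OF x0, of l] by simp
      then show ?thesis using D0 \<rho> by (intro mult_left_mono) auto
    qed
    finally show ?thesis by (simp add: D1_def mult_ac)
  qed
  have \<rho>0: "(\<lambda>n. D1 * \<rho> ^ n) \<longlonglongrightarrow> D1 * 0"
    by (intro tendsto_mult tendsto_const LIMSEQ_power_zero) (use \<rho> in auto)
  have small: "\<exists>n. D1 * \<rho> ^ n < e" if "e > 0" for e
    using order_tendstoD(2)[OF \<rho>0, of e] that by (auto simp: eventually_sequentially)
  have conv: "convergent (\<lambda>n. a n A)" if A: "A \<in> sets M" for A
  proof (rule Cauchy_convergent, rule CauchyI)
    fix e :: real assume "e > 0"
    then obtain n where n: "D1 * \<rho> ^ n < e / 2" using small[of "e / 2"] by auto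
    have near: "\<bar>a i A - a n A\<bar> < e / 2" if "i \<ge> n" for i
      using step[OF A, of "i - n" n] n that by simp
    have "norm (a i A - a j A) < e" if "i \<ge> n" "j \<ge> n" for i j
      using near[OF that(1)] near[OF that(2)] unfolding real_norm_def by arith
    then show "\<exists>n. \<forall>i\<ge>n. \<forall>j\<ge>n. norm (a i A - a j A) < e" by blast
  qed
  define L where "L A = lim (\<lambda>n. a n A)" for A
  have aL: "(\<lambda>n. a n A) \<longlonglongrightarrow> L A" if "A \<in> sets M" for A
    using conv[OF that] by (simp add: L_def convergent_LIMSEQ_iff)
  have near: "\<bar>L A - a n A\<bar> \<le> D1 * \<rho> ^ n" if A: "A \<in> sets M" for n A
  proof (rule LIMSEQ_le_const2)
    show "(\<lambda>l. \<bar>a (l + n) A - a n A\<bar>) \<longlonglongrightarrow> \<bar>L A - a n A\<bar>"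
      by (intro tendsto_intros LIMSEQ_ignore_initial_segment aL A)
  qed (use step[OF A] in blast)
  have L_nonneg: "0 \<le> L A" if "A \<in> sets M" for A
    by (rule LIMSEQ_le_const[OF aL[OF that]]) (simp add: a_def)
  \<comment> \<open>For a decreasing sequence with empty intersection one compares \<open>L\<close>
    with a single law \<open>P n x0\<close> with a uniform error and uses the continuity of that
    law.\<close>
  have ca: "countably_additive (sets M) (\<lambda>A. ennreal (L A))"
  proof (rule sets.empty_continuous_imp_countably_additive)
    have "L {} = 0" using aL[of "{}"] by (simp add: a_def LIMSEQ_const_iff)
    then show "positive (sets M) (\<lambda>A. ennreal (L A))" by (simp add: positive_def)
    show "additive (sets M) (\<lambda>A. ennreal (L A))"
    proof (unfold additive_def, intro ballI impI)
      fix A B assume AB: "A \<in> sets M" "B \<in> sets M" "A \<inter> B = {}"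
      have "a n (A \<union> B) = a n A + a n B" for n
        unfolding a_def using AB P_sets[OF x0, of n]
        by (intro finite_measure.finite_measure_Union prob_space.axioms(1)[OF P_prob[OF x0]]) auto
      then have "(\<lambda>n. a n (A \<union> B)) \<longlonglongrightarrow> L A + L B" by (simp add: tendsto_add aL AB)
      then have "L (A \<union> B) = L A + L B" using LIMSEQ_unique[OF aL[of "A \<union> B"]] AB by auto
      then show "ennreal (L (A \<union> B)) = ennreal (L A) + ennreal (L B)" using L_nonneg AB by simp
    qed
    fix A :: "nat \<Rightarrow> 'a set" assume A: "range A \<subseteq> sets M" "decseq A" "(\<Inter>i. A i) = {}"
    have "(\<lambda>i. L (A i)) \<longlonglongrightarrow> 0"
    proof (rule LIMSEQ_I)
      fix e :: real assume "e > 0"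
      then obtain n where n: "D1 * \<rho> ^ n < e / 2" using small[of "e / 2"] by auto
      interpret prob_space "P n x0" by (rule P_prob[OF x0])
      have "(\<lambda>i. a n (A i)) \<longlonglongrightarrow> a n (\<Inter>i. A i)"
        unfolding a_def using A P_sets[OF x0, of n] by (intro finite_Lim_measure_decseq) auto
      then have "(\<lambda>i. a n (A i)) \<longlonglongrightarrow> 0" using A(3) by (simp add: a_def)
      from LIMSEQ_D[OF this, of "e / 2"] obtain i0 where i0: "\<And>i. i \<ge> i0 \<Longrightarrow> \<bar>a n (A i)\<bar> < e / 2"
        using \<open>e > 0\<close> by auto
      have "norm (L (A i) - 0) < e" if "i \<ge> i0" for i
        using i0[OF that] near[of "A i" n] A(1) n by (auto simp: subset_iff)
      then show "\<exists>i0. \<forall>i\<ge>i0. norm (L (A i) - 0) < e" by blast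
    qed
    then show "(\<lambda>i. ennreal (L (A i))) \<longlonglongrightarrow> 0" by (simp add: ennreal_0[symmetric] del: ennreal_0)
  qed auto
  define \<pi> where "\<pi> = measure_of (space M) (sets M) (\<lambda>A. ennreal (L A))"
  have \<pi>_sets: "sets \<pi> = sets M" by (simp add: \<pi>_def sets.sets_measure_of_eq)
  have \<pi>_space: "space \<pi> = space M" by (simp add: \<pi>_def)
  have em: "emeasure \<pi> A = ennreal (L A)" if A: "A \<in> sets M" for A
  proof -
    have "L {} = 0" using aL[of "{}"] by (simp add: a_def LIMSEQ_const_iff)
    then show ?thesis unfolding \<pi>_def
      using ca A by (intro emeasure_measure_of_sigma sets.sigma_algebra_axioms) (auto simp: positive_def)
  qed
  have mL: "measure \<pi> A = L A" if "A \<in> sets M" for A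
    using em[OF that] L_nonneg[OF that] by (simp add: measure_def)
  have "a n (space M) = 1" for n
    unfolding a_def using prob_space.prob_space[OF P_prob[OF x0]] P_space[OF x0] by metis
  then have "L (space M) = 1" using aL[OF sets.top] by (simp add: LIMSEQ_const_iff)
  then have \<pi>_prob: "prob_space \<pi>" using em[OF sets.top] \<pi>_space by (intro prob_spaceI) simp
  interpret \<pi>: prob_space \<pi> by fact
  \<comment> \<open>Passing from \<open>x\<close> to \<open>x0\<close> and from \<open>x0\<close> to
    the limit; additive constants are absorbed because \<open>V x \<ge> 1\<close>.\<close>
  define D where "D = D0 * (1 + V x0) + D1"
  have D1: "D1 \<ge> 0" using D0 K1(1) V_nonneg[OF x0] by (simp add: D1_def)
  have D: "D \<ge> 0" using D0 D1 V_nonneg[OF x0] by (simp add: D_def)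
  have set_bound: "\<bar>measure (P n x) A - measure \<pi> A\<bar> \<le> D * \<rho> ^ n * V x" if x: "x \<in> space M" and A: "A \<in> sets M" for n x A
  proof -
    have "\<bar>measure (P n x) A - a n A\<bar> \<le> D0 * \<rho> ^ n * (V x + V x0)"
      unfolding a_def measure_P_eq_integral[OF x A] measure_P_eq_integral[OF x0 A]
      by (rule dec) (use A x x0 in \<open>auto split: split_indicator\<close>)
    then have "\<bar>measure (P n x) A - measure \<pi> A\<bar> \<le> \<rho> ^ n * (D0 * (V x + V x0) + D1)"
      using near[OF A, of n] by (simp add: mL[OF A] algebra_simps)
    also have "D0 * (V x + V x0) + D1 \<le> D * V x"
    proof -
      have "V x0 * 1 \<le> V x0 * V x" "D1 * 1 \<le> D1 * V x"
        using V_ge_1[OF x] V_nonneg[OF x0] D1 by (intro mult_left_mono; simp)+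
      then show ?thesis using mult_left_mono[of "V x0" "V x0 * V x" D0] D0 by (simp add: D_def algebra_simps)
    qed
    finally show ?thesis using \<rho> by (simp add: mult_ac mult_left_mono)
  qed
  have "\<bar>(\<integral>z. f z \<partial>P n x) - (\<integral>z. f z \<partial>\<pi>)\<bar> \<le> (2 * D) * \<rho> ^ n * V x"
    if f: "f \<in> borel_measurable M" "\<And>x. x \<in> space M \<Longrightarrow> \<bar>f x\<bar> \<le> 1" and x: "x \<in> space M" for n f x
  proof -
    interpret Px: prob_space "P n x" by (rule P_prob[OF x])
    have compl: "measure \<pi> (space M - A) = 1 - measure \<pi> A" "measure (P n x) (space M - A) = 1 - measure (P n x) A"
      if "A \<in> sets M" for A
      using \<pi>.prob_compl[of A] Px.prob_compl[of A] that by (auto simp: \<pi>_sets \<pi>_space P_sets[OF x] P_space[OF x])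
    \<comment> \<open>Closeness on sets is an overlap close to 1, so \<open>overlap_integral\<close>
      extends it to bounded functions at the price of a factor 2.\<close>
    have ov: "1 - D * \<rho> ^ n * V x \<le> measure (P n x) A + measure \<pi> (space M - A)"
      "1 - D * \<rho> ^ n * V x \<le> measure \<pi> A + measure (P n x) (space M - A)" if A: "A \<in> sets M" for A
      using set_bound[OF x A, of n] unfolding compl[OF A] by arith+
    have "(\<integral>z. f z \<partial>P n x) - (\<integral>z. f z \<partial>\<pi>) \<le> 2 * (1 - (1 - D * \<rho> ^ n * V x))"
      by (rule overlap_integral[OF Px.prob_space_axioms P_sets[OF x] \<pi>_prob \<pi>_sets ov(1) f])
    moreover have "(\<integral>z. f z \<partial>\<pi>) - (\<integral>z. f z \<partial>P n x) \<le> 2 * (1 - (1 - D * \<rho> ^ n * V x))"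
      by (rule overlap_integral[OF \<pi>_prob \<pi>_sets Px.prob_space_axioms P_sets[OF x] ov(2) f])
    ultimately show ?thesis by (simp add: abs_le_iff)
  qed
  then show ?thesis using that[OF \<pi>_prob \<pi>_sets _ \<rho>, of "2 * D"] D by simp
qed

end

section \<open>Consequences of geometric convergence\<close>

lemma (in markov_kernel) stationary_bind:
  assumes "stationary_distribution M K \<pi>"
  shows "\<pi> \<bind> K = \<pi>"
proof (rule measure_eqI)
  have \<pi>: "prob_space \<pi>" "sets \<pi> = sets M" using assms by (auto simp: stationary_distribution_def)
  have ne: "space \<pi> \<noteq> {}" by (rule prob_space.not_empty[OF \<pi>(1)])
  have Km: "K \<in> \<pi> \<rightarrow>\<^sub>M subprob_algebra M"
    by (simp add: measurable_cong_sets[OF \<pi>(2) refl] measurable_prob_algebraD[OF K])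
  show "sets (\<pi> \<bind> K) = sets \<pi>" using sets_bind_measurable[OF Km ne] \<pi>(2) by simp
  fix B assume "B \<in> sets (\<pi> \<bind> K)"
  then have B: "B \<in> sets M" using sets_bind_measurable[OF Km ne] by simp
  show "emeasure (\<pi> \<bind> K) B = emeasure \<pi> B"
    using emeasure_bind[OF ne Km B] assms B by (simp add: stationary_distribution_def)
qed

locale ergodic_chain = markov_kernel M K for M :: "'a measure" and K +
  fixes V :: "'a \<Rightarrow> real" and \<pi> :: "'a measure" and D \<rho> c :: real
  assumes nonempty: "space M \<noteq> {}" and V [measurable]: "V \<in> borel_measurable M"
    and V_ge_1: "\<And>x. x \<in> space M \<Longrightarrow> V x \<ge> 1"
    and \<pi>_prob: "prob_space \<pi>" and \<pi>_sets: "sets \<pi> = sets M" and D: "D \<ge> 0" and \<rho>: "0 < \<rho>" "\<rho> < 1"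
    and conv: "\<And>n f x. f \<in> borel_measurable M \<Longrightarrow> (\<And>x. x \<in> space M \<Longrightarrow> \<bar>f x\<bar> \<le> 1) \<Longrightarrow> x \<in> space M \<Longrightarrow>
      \<bar>(\<integral>z. f z \<partial>kernel_power M K n x) - (\<integral>z. f z \<partial>\<pi>)\<bar> \<le> D * \<rho> ^ n * V x"
    and c: "c \<ge> 0"
    and moment: "\<And>n x. x \<in> space M \<Longrightarrow> (\<integral>\<^sup>+y. ennreal (V y) \<partial>kernel_power M K n x) \<le> ennreal (V x + c)"
begin

sublocale \<pi>: prob_space \<pi> by (rule \<pi>_prob)

lemma \<pi>_space: "space \<pi> = space M"
  by (rule sets_eq_imp_space_eq[OF \<pi>_sets])

lemma \<pi>_borel: "f \<in> borel_measurable M \<Longrightarrow> f \<in> borel_measurable \<pi>"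
  by (simp add: measurable_cong_sets[OF \<pi>_sets refl])

lemma P_tendsto:
  fixes f :: "'a \<Rightarrow> real"
  assumes f: "f \<in> borel_measurable M" "\<And>x. x \<in> space M \<Longrightarrow> \<bar>f x\<bar> \<le> 1" and x: "x \<in> space M"
  shows "(\<lambda>n. \<integral>z. f z \<partial>P n x) \<longlonglongrightarrow> (\<integral>z. f z \<partial>\<pi>)"
proof (rule LIM_zero_cancel, rule Lim_null_comparison)
  show "eventually (\<lambda>n. norm ((\<integral>z. f z \<partial>P n x) - (\<integral>z. f z \<partial>\<pi>)) \<le> D * \<rho> ^ n * V x) sequentially"
    using conv[OF f x] by simp
  have "(\<lambda>n. D * \<rho> ^ n * V x) \<longlonglongrightarrow> D * 0 * V x"
    by (intro tendsto_mult tendsto_const LIMSEQ_power_zero) (use \<rho> in auto)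
  then show "(\<lambda>n. D * \<rho> ^ n * V x) \<longlonglongrightarrow> 0" by simp
qed

lemma P_measure_tendsto:
  assumes "A \<in> sets M" "x \<in> space M"
  shows "(\<lambda>n. measure (P n x) A) \<longlonglongrightarrow> measure \<pi> A"
  using P_tendsto[of "indicator A" x] assms by (simp add: P_sets \<pi>_sets split: split_indicator)

text \<open>Pass to the limit in \<open>P (n + 1) x A = \<integral> K z A\<close> with respect to
  \<open>P n x\<close>; both sides are integrals of bounded functions.\<close>

lemma \<pi>_stationary: "stationary_distribution M K \<pi>"
  unfolding stationary_distribution_def
proof (intro conjI \<pi>_prob \<pi>_sets ballI)
  fix A assume A: "A \<in> sets M"
  obtain x where x: "x \<in> space M" using nonempty by auto
  have h: "(\<lambda>z. measure (K z) A) \<in> borel_measurable M"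
    using A by (intro measurable_compose[OF measurable_prob_algebraD[OF K] measurable_measure_subprob_algebra])
  have K_prob: "prob_space (K z)" "sets (K z) = sets M" if "z \<in> space M" for z
    using P_prob[OF that, of 1] P_sets[OF that, of 1] P_1[OF that] by auto
  have hb: "\<bar>measure (K z) A\<bar> \<le> 1" if "z \<in> space M" for z
    using prob_space.prob_le_1[OF K_prob(1)[OF that]] by simp
  have "(\<integral>z. measure (K z) A \<partial>P n x) = measure (P (Suc n) x) A" for n
  proof -
    have "measure (P (n + 1) x) A = (\<integral>w. indicator A w \<partial>P (n + 1) x)"
      using A P_sets[OF x, of "n + 1"] by simp
    also have "\<dots> = (\<integral>z. (\<integral>w. indicator A w \<partial>P 1 z) \<partial>P n x)"
      by (rule integral_P_add[OF x, of _ 1]) (use A in \<open>auto split: split_indicator\<close>)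
    also have "\<dots> = (\<integral>z. measure (K z) A \<partial>P n x)"
    proof (rule Bochner_Integration.integral_cong[OF refl])
      fix z assume "z \<in> space (P n x)"
      then have z: "z \<in> space M" by (simp add: P_space[OF x])
      show "(\<integral>w. indicator A w \<partial>P 1 z) = measure (K z) A"
        unfolding P_1[OF z] using A K_prob(2)[OF z] by simp
    qed
    finally show ?thesis by simp
  qed
  then have "(\<lambda>n. measure (P (Suc n) x) A) \<longlonglongrightarrow> (\<integral>z. measure (K z) A \<partial>\<pi>)"
    using P_tendsto[OF h hb x] by simp
  moreover have "(\<lambda>n. measure (P (Suc n) x) A) \<longlonglongrightarrow> measure \<pi> A"
    using LIMSEQ_Suc[OF P_measure_tendsto[OF A x]] .
  ultimately have "measure \<pi> A = (\<integral>z. measure (K z) A \<partial>\<pi>)" using LIMSEQ_unique by blast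
  then have "emeasure \<pi> A = ennreal (\<integral>z. measure (K z) A \<partial>\<pi>)" by (simp add: \<pi>.emeasure_eq_measure)
  also have "\<dots> = (\<integral>\<^sup>+z. ennreal (measure (K z) A) \<partial>\<pi>)"
    using hb \<pi>_space \<pi>_borel[OF h]
    by (intro nn_integral_eq_integral[symmetric] \<pi>.integrable_const_bound[of _ 1]) auto
  also have "\<dots> = (\<integral>\<^sup>+z. emeasure (K z) A \<partial>\<pi>)"
    using K_prob(1) \<pi>_space by (intro nn_integral_cong) (simp add: finite_measure.emeasure_eq_measure prob_space.axioms(1))
  finally show "emeasure \<pi> A = (\<integral>\<^sup>+z. emeasure (K z) A \<partial>\<pi>)" .
qed

lemma stationary_P:
  assumes "stationary_distribution M K \<pi>'" "A \<in> sets M"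
  shows "emeasure \<pi>' A = (\<integral>\<^sup>+x. emeasure (P n x) A \<partial>\<pi>')"
proof -
  have \<pi>': "prob_space \<pi>'" "sets \<pi>' = sets M" using assms(1) by (auto simp: stationary_distribution_def)
  have sp: "space \<pi>' = space M" by (rule sets_eq_imp_space_eq[OF \<pi>'(2)])
  have ne: "space \<pi>' \<noteq> {}" using nonempty sp by simp
  have Pm: "P n \<in> \<pi>' \<rightarrow>\<^sub>M subprob_algebra M" for n by (simp add: measurable_cong_sets[OF \<pi>'(2) refl] P_subprob)
  have Km: "K \<in> \<pi>' \<rightarrow>\<^sub>M subprob_algebra M"
    by (simp add: measurable_cong_sets[OF \<pi>'(2) refl] measurable_prob_algebraD[OF K])
  note \<pi>K = stationary_bind[OF assms(1)]
  have "\<pi>' \<bind> P n = \<pi>'"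
  proof (induction n)
    case 0
    have "P 0 = return M" by (simp add: fun_eq_iff)
    then show ?case using bind_return''[OF \<pi>'(2)[symmetric]] \<pi>'(2) by (simp add: bind_return'')
  next
    case (Suc n)
    have "P (Suc n) = (\<lambda>x. K x \<bind> P n)" by (simp add: fun_eq_iff)
    then have eq: "\<pi>' \<bind> P (Suc n) = (\<pi>' \<bind> K) \<bind> P n" using bind_assoc[OF Km P_subprob] by simp
    show ?case by (simp only: eq \<pi>K Suc)
  qed
  then show ?thesis using emeasure_bind[OF ne Pm assms(2), of n] by simp
qed

text \<open>An invariant law equals its own average of \<open>P n z A\<close> for every
  \<open>n\<close>, and these converge to \<open>\<pi> A\<close> for every \<open>z\<close>.\<close>

lemma \<pi>_unique:
  assumes st: "stationary_distribution M K \<pi>'"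
  shows "\<pi>' = \<pi>"
proof (rule measure_eqI)
  have \<pi>': "prob_space \<pi>'" "sets \<pi>' = sets M" using st by (auto simp: stationary_distribution_def)
  interpret \<pi>': prob_space \<pi>' by (rule \<pi>'(1))
  have sp: "space \<pi>' = space M" by (rule sets_eq_imp_space_eq[OF \<pi>'(2)])
  show "sets \<pi>' = sets \<pi>" using \<pi>'(2) \<pi>_sets by simp
  fix A assume "A \<in> sets \<pi>'"
  then have A: "A \<in> sets M" using \<pi>'(2) by simp
  have h: "(\<lambda>z. measure (P n z) A) \<in> borel_measurable \<pi>'" for n
    using A by (simp add: measurable_cong_sets[OF \<pi>'(2) refl]
        measurable_compose[OF P_subprob measurable_measure_subprob_algebra])
  have eq: "measure \<pi>' A = (\<integral>z. measure (P n z) A \<partial>\<pi>')" for n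
  proof -
    have "ennreal (measure \<pi>' A) = (\<integral>\<^sup>+z. emeasure (P n z) A \<partial>\<pi>')"
      using stationary_P[OF st A, of n] by (simp add: \<pi>'.emeasure_eq_measure)
    also have "\<dots> = (\<integral>\<^sup>+z. ennreal (measure (P n z) A) \<partial>\<pi>')"
      using P_prob sp by (intro nn_integral_cong) (simp add: finite_measure.emeasure_eq_measure prob_space.axioms(1))
    also have "\<dots> = ennreal (\<integral>z. measure (P n z) A \<partial>\<pi>')"
      using sp h prob_space.prob_le_1[OF P_prob]
      by (intro nn_integral_eq_integral \<pi>'.integrable_const_bound[of _ 1]) auto
    finally show ?thesis by (simp add: integral_nonneg_AE)
  qed
  have "(\<lambda>n. \<integral>z. measure (P n z) A \<partial>\<pi>') \<longlonglongrightarrow> (\<integral>z. measure \<pi> A \<partial>\<pi>')"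
    by (rule integral_dominated_convergence[where w = "\<lambda>_. 1"])
       (use h P_measure_tendsto[OF A] sp prob_space.prob_le_1[OF P_prob] in auto)
  then have "(\<lambda>n. measure \<pi>' A) \<longlonglongrightarrow> measure \<pi> A" using eq by (simp add: \<pi>'.prob_space)
  then have "measure \<pi>' A = measure \<pi> A" by (simp add: LIMSEQ_const_iff)
  then show "emeasure \<pi>' A = emeasure \<pi> A" by (simp add: \<pi>'.emeasure_eq_measure \<pi>.emeasure_eq_measure)
qed

text \<open>Convergence is known for bounded functions only, so the uniform moment bound is applied
  to truncations of \<open>V\<close> and recovered by Fatou.\<close>

lemma \<pi>_V: "(\<integral>\<^sup>+x. ennreal (V x) \<partial>\<pi>) < \<infinity>"
proof -
  obtain x where x: "x \<in> space M" using nonempty by auto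
  have Vn: "V y \<ge> 0" if "y \<in> space M" for y using V_ge_1[OF that] by simp
  have bound: "(\<integral>\<^sup>+y. ennreal (min (V y) (real (Suc j))) \<partial>\<pi>) \<le> ennreal (V x + c)" for j
  proof -
    \<comment> \<open>Truncating at \<open>Suc j\<close> allows the division that brings
      \<open>g\<close> into [-1, 1], also for \<open>j = 0\<close>.\<close>
    define g where "g y = min (V y) (real (Suc j))" for y
    have g [measurable]: "g \<in> borel_measurable M" by (simp add: g_def[abs_def])
    have gb: "0 \<le> g y" "g y \<le> real (Suc j)" if "y \<in> space M" for y using Vn[OF that] by (auto simp: g_def)
    have fb: "\<bar>g y / real (Suc j)\<bar> \<le> 1" if "y \<in> space M" for y using gb[OF that] by (simp add: field_simps)
    have gi: "integrable (P n x) g" for n by (rule P_integrable[OF x g, of "real (Suc j)"]) (use gb in auto)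
    have "(\<lambda>n. \<integral>y. g y / real (Suc j) \<partial>P n x) \<longlonglongrightarrow> (\<integral>y. g y / real (Suc j) \<partial>\<pi>)"
      by (rule P_tendsto[OF _ fb x]) simp
    moreover have "(\<integral>y. g y / real (Suc j) \<partial>P n x) \<le> (V x + c) / real (Suc j)" for n
    proof -
      have "ennreal (\<integral>y. g y \<partial>P n x) = (\<integral>\<^sup>+y. ennreal (g y) \<partial>P n x)"
        using gi gb P_space[OF x] by (intro nn_integral_eq_integral[symmetric]) auto
      also have "\<dots> \<le> (\<integral>\<^sup>+y. ennreal (V y) \<partial>P n x)" by (intro nn_integral_mono ennreal_leI) (simp add: g_def)
      also have "\<dots> \<le> ennreal (V x + c)" by (rule moment[OF x])
      finally have "(\<integral>y. g y \<partial>P n x) \<le> V x + c" using Vn[OF x] c by (subst (asm) ennreal_le_iff) auto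
      then show ?thesis by (simp add: divide_right_mono)
    qed
    ultimately have "(\<integral>y. g y / real (Suc j) \<partial>\<pi>) \<le> (V x + c) / real (Suc j)"
      by (intro LIMSEQ_le_const2) auto
    then have "(\<integral>y. g y \<partial>\<pi>) \<le> V x + c" by (simp add: divide_le_cancel)
    moreover have "(\<integral>\<^sup>+y. ennreal (g y) \<partial>\<pi>) = ennreal (\<integral>y. g y \<partial>\<pi>)"
      using gb \<pi>_space \<pi>_borel[OF g]
      by (intro nn_integral_eq_integral \<pi>.integrable_const_bound[of _ "real (Suc j)"]) auto
    ultimately show ?thesis by (simp add: g_def ennreal_leI)
  qed
  have lim: "(\<lambda>j. ennreal (min (V y) (real (Suc j)))) \<longlonglongrightarrow> ennreal (V y)" for y
  proof (rule tendsto_eventually)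
    obtain j0 :: nat where j0: "V y \<le> real j0" using real_arch_simple by blast
    show "eventually (\<lambda>j. ennreal (min (V y) (real (Suc j))) = ennreal (V y)) sequentially"
      using eventually_ge_at_top[of j0] by eventually_elim (use j0 in \<open>auto simp: min_def\<close>)
  qed
  have Vm: "V \<in> borel_measurable \<pi>" by (rule \<pi>_borel[OF V])
  have "(\<integral>\<^sup>+y. ennreal (V y) \<partial>\<pi>) = (\<integral>\<^sup>+y. liminf (\<lambda>j. ennreal (min (V y) (real (Suc j)))) \<partial>\<pi>)"
    by (intro nn_integral_cong lim_imp_Liminf[symmetric] lim) simp
  also have "\<dots> \<le> liminf (\<lambda>j. \<integral>\<^sup>+y. ennreal (min (V y) (real (Suc j))) \<partial>\<pi>)"
    by (rule nn_integral_liminf) (use Vm in auto)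
  also have "\<dots> \<le> ennreal (V x + c)" by (rule Liminf_le) (use bound in auto)
  finally show ?thesis by (simp add: le_less_trans)
qed

section \<open>Geometric ergodicity, irreducibility and subharmonic functions\<close>

lemma tv_bound:
  assumes x: "x \<in> space M"
  shows "tv_norm_diff M (P n x) \<pi> \<le> D * \<rho> ^ n * V x" "0 \<le> tv_norm_diff M (P n x) \<pi>"
proof -
  let ?G = "{g \<in> borel_measurable M. \<forall>x\<in>space M. \<bar>g x\<bar> \<le> (1::real)}"
  let ?d = "\<lambda>g. \<bar>(\<integral>z. g z \<partial>P n x) - (\<integral>z. g z \<partial>\<pi>)\<bar>"
  have zero: "(\<lambda>_. 0) \<in> ?G" by simp
  have bound: "?d g \<le> D * \<rho> ^ n * V x" if "g \<in> ?G" for g using conv[of g x n] that x by auto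
  show "tv_norm_diff M (P n x) \<pi> \<le> D * \<rho> ^ n * V x"
    unfolding tv_norm_diff_def
  proof (rule cSUP_least)
    show "?G \<noteq> {}" using zero by blast
  qed (rule bound)
  have "?d (\<lambda>_. 0) \<le> (SUP g\<in>?G. ?d g)"
    by (rule cSUP_upper[OF zero]) (use bound in \<open>auto intro!: bdd_aboveI2\<close>)
  then show "0 \<le> tv_norm_diff M (P n x) \<pi>" unfolding tv_norm_diff_def by simp
qed

lemma chain_geometrically_ergodic: "geometrically_ergodic M K"
proof -
  \<comment> \<open>Any \<open>r\<close> strictly between 1 and \<open>1 / \<rho>\<close> would do;
    here \<open>r * \<rho> = sqrt \<rho> < 1\<close>.\<close>
  define r where "r = 1 / sqrt \<rho>"
  have r: "r > 1" using \<rho> by (simp add: r_def)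
  have r\<rho>: "r * \<rho> = sqrt \<rho>" using \<rho> by (simp add: r_def real_div_sqrt)
  have "summable (\<lambda>n. r ^ n * tv_norm_diff M (P n x) \<pi>)" if x: "x \<in> space M" for x
  proof (rule summable_comparison_test')
    have "summable (\<lambda>n. (r * \<rho>) ^ n)" unfolding r\<rho> using \<rho> by (intro summable_geometric) simp
    then show "summable (\<lambda>n. (D * V x) * (r * \<rho>) ^ n)" by (rule summable_mult)
    fix n
    have "r ^ n * tv_norm_diff M (P n x) \<pi> \<le> r ^ n * (D * \<rho> ^ n * V x)"
      using tv_bound(1)[OF x] r by (intro mult_left_mono) auto
    then show "norm (r ^ n * tv_norm_diff M (P n x) \<pi>) \<le> (D * V x) * (r * \<rho>) ^ n"
      using tv_bound(2)[OF x] r by (simp add: power_mult_distrib mult_ac)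
  qed
  then show ?thesis unfolding geometrically_ergodic_def using \<pi>_stationary r by blast
qed

text \<open>Sets of positive \<open>\<pi>\<close>-measure are charged at all large times.
  Conversely, by invariance a \<open>\<pi>\<close>-null set is charged at no time from almost every
  state, so no irreducibility measure can charge it.\<close>

lemma \<pi>_maximal: "maximal_irreducibility_measure M K \<pi>"
  unfolding maximal_irreducibility_measure_def
proof (intro conjI allI impI)
  have "\<exists>n\<ge>1. emeasure (P n x) A > 0" if A: "A \<in> sets M" "emeasure \<pi> A > 0" and x: "x \<in> space M" for A x
  proof -
    have "measure \<pi> A > 0" using A(2) by (simp add: \<pi>.emeasure_eq_measure)
    from order_tendstoD(1)[OF P_measure_tendsto[OF A(1) x] this]
    obtain n0 where "\<And>n. n \<ge> n0 \<Longrightarrow> measure (P n x) A > 0" by (auto simp: eventually_sequentially)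
    then have "measure (P (max 1 n0) x) A > 0" by simp
    then show ?thesis
      using finite_measure.emeasure_eq_measure[OF prob_space.axioms(1)[OF P_prob[OF x]]]
      by (intro exI[of _ "max 1 n0"]) auto
  qed
  then show "irreducibility_measure M K \<pi>"
    unfolding irreducibility_measure_def
    using \<pi>_sets \<pi>.emeasure_space_1 \<pi>_space \<pi>.sigma_finite_measure_axioms by auto
  fix \<psi> assume \<psi>: "irreducibility_measure M K \<psi>"
  show "absolutely_continuous \<pi> \<psi>"
    unfolding absolutely_continuous_def
  proof
    fix A assume "A \<in> null_sets \<pi>"
    then have A: "A \<in> sets M" "emeasure \<pi> A = 0" by (auto simp: \<pi>_sets)
    have null: "AE x in \<pi>. emeasure (P n x) A = 0" for n
    proof -
      have "(\<lambda>x. emeasure (P n x) A) \<in> borel_measurable \<pi>"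
        using A(1) by (simp add: measurable_cong_sets[OF \<pi>_sets refl])
      then show ?thesis using stationary_P[OF \<pi>_stationary A(1), of n] A(2) by (simp add: nn_integral_0_iff_AE)
    qed
    have "AE x in \<pi>. \<forall>n. emeasure (P n x) A = 0" using null by (simp add: AE_all_countable)
    then have all0: "AE x in \<pi>. \<forall>n. emeasure (P n x) A = 0" .
    have "\<not> emeasure \<psi> A > 0"
    proof
      assume "emeasure \<psi> A > 0"
      then have pos: "\<forall>x\<in>space M. \<exists>n\<ge>1. emeasure (P n x) A > 0"
        using \<psi> A(1) unfolding irreducibility_measure_def by blast
      have "AE x in \<pi>. \<exists>n. emeasure (P n x) A > 0" using pos \<pi>_space by (intro AE_I2) auto
      with all0 have "AE x in \<pi>. False" by eventually_elim auto
      then show False by simp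
    qed
    then show "A \<in> null_sets \<psi>" using \<psi> A(1) by (auto simp: irreducibility_measure_def)
  qed
qed

text \<open>A bounded subharmonic function is dominated by its \<open>\<pi>\<close>-mean, hence \<open>\<pi>\<close>-almost everywhere
  equal to it.\<close>

lemma subharmonic_zero:
  fixes u :: "'a \<Rightarrow> real"
  assumes u: "u \<in> borel_measurable M" "\<And>x. x \<in> space M \<Longrightarrow> 0 \<le> u x \<and> u x \<le> 1"
    and sub: "\<And>x. x \<in> space M \<Longrightarrow> u x \<le> (\<integral>y. u y \<partial>K x)"
    and A: "A \<in> sets M" "emeasure \<pi> A > 0" "\<And>x. x \<in> A \<Longrightarrow> u x = 0" and x: "x \<in> space M"
  shows "u x = 0"
proof -
  have ub: "\<bar>u y\<bar> \<le> 1" if "y \<in> space M" for y using u(2)[OF that] by simp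
  have le: "u y \<le> (\<integral>z. u z \<partial>P n y)" if y: "y \<in> space M" for n y
    using y
  proof (induction n arbitrary: y)
    case 0
    then show ?case using u(1) by (simp add: integral_return)
  next
    case (Suc n)
    have "u y \<le> (\<integral>w. u w \<partial>P 1 y)" using sub[OF Suc.prems] P_1[OF Suc.prems] by simp
    also have "\<dots> \<le> (\<integral>w. (\<integral>z. u z \<partial>P n w) \<partial>P 1 y)"
      by (intro integral_mono P_integrable[OF Suc.prems _ ub] P_integrable[OF Suc.prems _ integral_P_bound[OF _ u(1) ub]])
         (use u(1) Suc.IH P_space[OF Suc.prems, of 1] in auto)
    also have "\<dots> = (\<integral>z. u z \<partial>P (1 + n) y)" by (rule integral_P_add[OF Suc.prems u(1) ub, symmetric])
    finally show ?case by simp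
  qed
  define s where "s = (\<integral>z. u z \<partial>\<pi>)"
  have us: "u y \<le> s" if y: "y \<in> space M" for y
    unfolding s_def by (rule LIMSEQ_le_const[OF P_tendsto[OF u(1) ub y]]) (use le[OF y] in auto)
  have ui: "integrable \<pi> u" using ub \<pi>_space \<pi>_borel[OF u(1)] by (intro \<pi>.integrable_const_bound[of _ 1]) auto
  have "(\<integral>z. s - u z \<partial>\<pi>) = 0" using ui by (simp add: s_def \<pi>.prob_space)
  moreover have "AE z in \<pi>. 0 \<le> s - u z" using us \<pi>_space by (intro AE_I2) auto
  ultimately have "AE z in \<pi>. s - u z = 0"
    using integral_nonneg_eq_0_iff_AE[of \<pi> "\<lambda>z. s - u z"] ui by simp
  then have "AE z in \<pi>. s \<noteq> 0 \<longrightarrow> z \<notin> A" by eventually_elim (use A(3) in auto)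
  then have "s = 0"
  proof (rule contrapos_pp)
    assume "s \<noteq> 0"
    show "\<not> (AE z in \<pi>. s \<noteq> 0 \<longrightarrow> z \<notin> A)"
    proof
      assume "AE z in \<pi>. s \<noteq> 0 \<longrightarrow> z \<notin> A"
      then have "AE z in \<pi>. z \<notin> A" using \<open>s \<noteq> 0\<close> by simp
      then have "A \<in> null_sets \<pi>" using A(1) by (simp add: AE_iff_null_sets \<pi>_sets)
      then show False using A(2) by auto
    qed
  qed
  then show ?thesis using us[OF x] u(2)[OF x] by simp
qed

end

section \<open>Markov chains driven by independent noise\<close>

locale random_system =
  fixes M :: "'a measure" and \<Gamma> :: "'b measure" and F :: "'a \<times> 'b \<Rightarrow> 'a"
  assumes \<Gamma>: "prob_space \<Gamma>" and F [measurable]: "F \<in> M \<Otimes>\<^sub>M \<Gamma> \<rightarrow>\<^sub>M M"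
begin

definition step :: "'a \<Rightarrow> 'a measure" where
  "step z = distr \<Gamma> M (\<lambda>y. F (z, y))"

lemma F_section [measurable]: "z \<in> space M \<Longrightarrow> (\<lambda>y. F (z, y)) \<in> \<Gamma> \<rightarrow>\<^sub>M M"
  using measurable_compose[OF measurable_Pair1' F] by simp

sublocale \<Gamma>: prob_space \<Gamma> by (rule \<Gamma>)

sublocale noise: sequence_space \<Gamma>
  by (intro sequence_space.intro product_prob_spaceI \<Gamma>)

abbreviation SS :: "(nat \<Rightarrow> 'b) measure" where
  "SS \<equiv> Pi\<^sub>M UNIV (\<lambda>_. \<Gamma>)"

abbreviation MS :: "('a \<times> (nat \<Rightarrow> 'b)) measure" where
  "MS \<equiv> M \<Otimes>\<^sub>M SS"

sublocale markov_kernel M step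
proof
  have "(\<lambda>z. distr \<Gamma> M (\<lambda>y. F (z, y))) \<in> M \<rightarrow>\<^sub>M prob_algebra M"
    by (rule measurable_distr_prob_space2[where M = \<Gamma>]) (auto simp: space_prob_algebra \<Gamma> case_prod_eta F)
  then show "step \<in> M \<rightarrow>\<^sub>M prob_algebra M" by (simp add: step_def[abs_def])
qed

lemma F_space: "z \<in> space M \<Longrightarrow> y \<in> space \<Gamma> \<Longrightarrow> F (z, y) \<in> space M"
  using measurable_space[OF F, of "(z, y)"] by (simp add: space_pair_measure)

lemma trajectory_measurable [measurable]:
  "(\<lambda>p. trajectory F (fst p) (snd p) t) \<in> MS \<rightarrow>\<^sub>M M"
proof (induction t)
  case (Suc t)
  have "(\<lambda>p. (trajectory F (fst p) (snd p) t, snd p t)) \<in> MS \<rightarrow>\<^sub>M M \<Otimes>\<^sub>M \<Gamma>"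
    by (intro measurable_Pair Suc measurable_compose[OF measurable_snd measurable_component_singleton]) simp
  from measurable_compose[OF this F] show ?case by simp
qed simp

lemma trajectory_section [measurable]:
  "x \<in> space M \<Longrightarrow> (\<lambda>y. trajectory F x y t) \<in> SS \<rightarrow>\<^sub>M M"
  using measurable_compose[OF measurable_Pair1'[of x M SS] trajectory_measurable[of t]] by simp

lemma case_nat_measurable [measurable]: "(\<lambda>(s, \<omega>). case_nat s \<omega>) \<in> \<Gamma> \<Otimes>\<^sub>M SS \<rightarrow>\<^sub>M SS"
proof (rule measurable_PiM_single')
  fix i show "(\<lambda>p. (case p of (s, \<omega>) \<Rightarrow> case_nat s \<omega>) i) \<in> \<Gamma> \<Otimes>\<^sub>M SS \<rightarrow>\<^sub>M \<Gamma>"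
    by (cases i) (auto simp: case_prod_beta')
qed (auto simp: space_pair_measure space_PiM PiE_iff split: nat.split)

lemma nn_integral_shift:
  assumes f: "f \<in> borel_measurable SS"
  shows "(\<integral>\<^sup>+\<omega>. f \<omega> \<partial>SS) = (\<integral>\<^sup>+s. (\<integral>\<^sup>+\<omega>. f (case_nat s \<omega>) \<partial>SS) \<partial>\<Gamma>)"
proof -
  have "(\<integral>\<^sup>+\<omega>. f \<omega> \<partial>SS) = (\<integral>\<^sup>+\<omega>. f \<omega> \<partial>distr (\<Gamma> \<Otimes>\<^sub>M SS) SS (\<lambda>(s, \<omega>). case_nat s \<omega>))"
    by (simp add: noise.PiM_iter)
  also have "\<dots> = (\<integral>\<^sup>+p. f (case_nat (fst p) (snd p)) \<partial>(\<Gamma> \<Otimes>\<^sub>M SS))"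
    using f by (subst nn_integral_distr) (auto simp: case_prod_beta')
  also have "\<dots> = (\<integral>\<^sup>+s. (\<integral>\<^sup>+\<omega>. f (case_nat s \<omega>) \<partial>SS) \<partial>\<Gamma>)"
  proof -
    have "(\<lambda>p. f (case_nat (fst p) (snd p))) \<in> borel_measurable (\<Gamma> \<Otimes>\<^sub>M SS)"
      using measurable_compose[OF case_nat_measurable f] by (simp add: case_prod_beta')
    from noise.P.nn_integral_fst[OF this] show ?thesis by simp
  qed
  finally show ?thesis .
qed

lemma nn_integral_step:
  "x \<in> space M \<Longrightarrow> h \<in> borel_measurable M \<Longrightarrow> (\<integral>\<^sup>+z. h z \<partial>step x) = (\<integral>\<^sup>+y. h (F (x, y)) \<partial>\<Gamma>)"
  by (simp add: step_def nn_integral_distr)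

text \<open>Both sides are unfolded at the first step: the kernel power by its definition, the
  trajectory by splitting off the first noise variable.\<close>

lemma P_trajectory:
  assumes "x \<in> space M"
  shows "P n x = distr SS M (\<lambda>\<omega>. trajectory F x \<omega> n)"
proof (rule measure_eqI)
  show "sets (P n x) = sets (distr SS M (\<lambda>\<omega>. trajectory F x \<omega> n))" by (simp add: P_sets[OF assms])
  fix A assume "A \<in> sets (P n x)"
  then have A [measurable]: "A \<in> sets M" by (simp add: P_sets[OF assms])
  have "emeasure (P n x) A = (\<integral>\<^sup>+\<omega>. indicator A (trajectory F x \<omega> n) \<partial>SS)"
    using assms
  proof (induction n arbitrary: x)
    case 0
    then show ?case by (simp add: noise.P.emeasure_space_1)
  next
    case (Suc n)
    have "emeasure (P (1 + n) x) A = (\<integral>\<^sup>+z. emeasure (P n z) A \<partial>P 1 x)" by (rule emeasure_P_add[OF Suc.prems A])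
    also have "\<dots> = (\<integral>\<^sup>+s. emeasure (P n (F (x, s))) A \<partial>\<Gamma>)"
      unfolding P_1[OF Suc.prems] by (rule nn_integral_step[OF Suc.prems emeasure_P_measurable[OF A]])
    also have "\<dots> = (\<integral>\<^sup>+s. (\<integral>\<^sup>+\<omega>. indicator A (trajectory F (F (x, s)) \<omega> n) \<partial>SS) \<partial>\<Gamma>)"
      by (intro nn_integral_cong Suc.IH F_space Suc.prems)
    also have "\<dots> = (\<integral>\<^sup>+s. (\<integral>\<^sup>+\<omega>. indicator A (trajectory F x (case_nat s \<omega>) (Suc n)) \<partial>SS) \<partial>\<Gamma>)"
      unfolding trajectory_Suc_shift by simp
    also have "\<dots> = (\<integral>\<^sup>+\<omega>. indicator A (trajectory F x \<omega> (Suc n)) \<partial>SS)"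
      by (rule nn_integral_shift[symmetric,
            OF measurable_compose[OF trajectory_section[OF Suc.prems] borel_measurable_indicator[OF A]]])
    finally show ?case by simp
  qed
  also have "\<dots> = emeasure (distr SS M (\<lambda>\<omega>. trajectory F x \<omega> n)) A"
    using nn_integral_distr[OF trajectory_section[OF assms, of n], of "indicator A"] A by simp
  finally show "emeasure (P n x) A = emeasure (distr SS M (\<lambda>\<omega>. trajectory F x \<omega> n)) A" .
qed

text \<open>The probability of never visiting \<open>A\<close> can only grow if the visit at time 0
  is disregarded, which makes it subharmonic; it vanishes on \<open>A\<close>. The assumption on
  subharmonic functions turns it into zero, and the Markov property does the same for visits from
  any later time on.\<close>

lemma recurrent:
  assumes A [measurable]: "A \<in> sets M"
    and subharmonic: "\<And>u x. u \<in> borel_measurable M \<Longrightarrow> (\<And>x. x \<in> space M \<Longrightarrow> 0 \<le> u x \<and> u x \<le> 1) \<Longrightarrow>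
      (\<And>x. x \<in> space M \<Longrightarrow> u x \<le> (\<integral>y. u y \<partial>step x)) \<Longrightarrow> (\<And>x. x \<in> A \<Longrightarrow> u x = 0) \<Longrightarrow> x \<in> space M \<Longrightarrow> u x = (0::real)"
    and x: "x \<in> space M"
  shows "AE \<omega> in SS. \<exists>\<^sub>\<infinity>t. trajectory F x \<omega> t \<in> A"
proof -
  \<comment> \<open>The indicator of having no visit from time \<open>s\<close> on;
    \<open>w s x\<close> below is its probability for the start \<open>x\<close>.\<close>
  define g where "g s p = (if \<forall>t\<ge>s. trajectory F (fst p) (snd p) t \<notin> A then 1 else 0 :: ennreal)" for s p
  have g [measurable]: "g s \<in> borel_measurable MS" for s
    unfolding g_def[abs_def] by measurable
  define w where "w s x = (\<integral>\<^sup>+\<omega>. g s (x, \<omega>) \<partial>SS)" for s x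
  have w [measurable]: "w s \<in> borel_measurable M" for s
    unfolding w_def[abs_def] by (intro noise.P.borel_measurable_nn_integral_fst g)
  have gx: "(\<lambda>\<omega>. g s (x, \<omega>)) \<in> borel_measurable SS" if "x \<in> space M" for s x
    using measurable_compose[OF measurable_Pair1'[OF that] g] by simp
  have w1: "w s x \<le> 1" for s x
  proof -
    have "w s x \<le> (\<integral>\<^sup>+\<omega>. 1 \<partial>SS)" unfolding w_def by (intro nn_integral_mono) (simp add: g_def)
    then show ?thesis by (simp add: noise.P.emeasure_space_1)
  qed
  have w_shift: "w (Suc s) x = (\<integral>\<^sup>+y. w s (F (x, y)) \<partial>\<Gamma>)" if x: "x \<in> space M" for s x
  proof -
    have "g (Suc s) (x, case_nat y \<omega>) = g s (F (x, y), \<omega>)" for y \<omega>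
    proof -
      have "(\<forall>t\<ge>Suc s. trajectory F x (case_nat y \<omega>) t \<notin> A) \<longleftrightarrow> (\<forall>t\<ge>s. trajectory F x (case_nat y \<omega>) (Suc t) \<notin> A)"
        by (metis Suc_le_D Suc_le_mono)
      then show ?thesis unfolding g_def trajectory_Suc_shift by simp
    qed
    then show ?thesis unfolding w_def using nn_integral_shift[OF gx[OF x, of "Suc s"]] by simp
  qed
  have w0_sub: "w 0 x \<le> (\<integral>\<^sup>+y. w 0 (F (x, y)) \<partial>\<Gamma>)" if x: "x \<in> space M" for x
  proof -
    have "w 0 x \<le> w (Suc 0) x" unfolding w_def by (intro nn_integral_mono) (auto simp: g_def)
    then show ?thesis using w_shift[OF x] by simp
  qed
  define u where "u x = enn2real (w 0 x)" for x
  have wu: "w 0 x = ennreal (u x)" for x using w1[of 0 x] by (simp add: u_def less_top le_less_trans)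
  have u [measurable]: "u \<in> borel_measurable M" by (simp add: u_def[abs_def])
  have ub: "0 \<le> u x \<and> u x \<le> 1" for x using w1[of 0 x] by (simp add: u_def enn2real_leI)
  have "u x = 0" if x: "x \<in> space M" for x
  proof (rule subharmonic[OF u ub _ _ x])
    fix x assume x: "x \<in> space M"
    have "ennreal (u x) \<le> (\<integral>\<^sup>+y. ennreal (u (F (x, y))) \<partial>\<Gamma>)" using w0_sub[OF x] by (simp add: wu)
    also have "\<dots> = (\<integral>\<^sup>+y. ennreal (u y) \<partial>step x)"
      using x by (subst nn_integral_step) auto
    also have "\<dots> = ennreal (\<integral>y. u y \<partial>step x)"
    proof -
      have "integrable (P 1 x) u" by (rule P_integrable[OF x u, of 1]) (use ub in auto)
      then have "integrable (step x) u" unfolding P_1[OF x] .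
      then show ?thesis using ub by (intro nn_integral_eq_integral) auto
    qed
    finally show "u x \<le> (\<integral>y. u y \<partial>step x)"
      using ub by (subst (asm) ennreal_le_iff) (auto intro: integral_nonneg_AE)
  next
    fix x assume "x \<in> A"
    then have "g 0 (x, \<omega>) = 0" for \<omega> by (force simp: g_def intro: exI[of _ 0])
    then show "u x = 0" by (simp add: u_def w_def)
  qed
  then have w0: "w 0 x = 0" if "x \<in> space M" for x using that wu by simp
  have ws: "w s x = 0" if "x \<in> space M" for s x
    using that
  proof (induction s arbitrary: x)
    case (Suc s)
    have "(\<integral>\<^sup>+y. w s (F (x, y)) \<partial>\<Gamma>) = (\<integral>\<^sup>+y. 0 \<partial>\<Gamma>)"
      by (intro nn_integral_cong Suc.IH F_space Suc.prems)
    then show ?case using w_shift[OF Suc.prems] by simp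
  qed (rule w0)
  have "AE \<omega> in SS. \<not> (\<forall>t\<ge>s. trajectory F x \<omega> t \<notin> A)" for s
  proof -
    have "AE \<omega> in SS. g s (x, \<omega>) = 0"
      using ws[OF x, of s] gx[OF x, of s] by (simp add: w_def nn_integral_0_iff_AE)
    then show ?thesis by eventually_elim (simp add: g_def split: if_splits)
  qed
  then have "AE \<omega> in SS. \<forall>s. \<not> (\<forall>t\<ge>s. trajectory F x \<omega> t \<notin> A)" by (simp add: AE_all_countable)
  then show ?thesis by eventually_elim (auto simp: INFM_nat_le)
qed

end

section \<open>The two-sided stationary chain\<close>

lemma measurable_Collect_mem: "f \<in> M \<rightarrow>\<^sub>M N \<Longrightarrow> A \<in> sets N \<Longrightarrow> {x \<in> space M. f x \<in> A} \<in> sets M"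
  using measurable_sets[of f M N A] by (simp add: vimage_def Int_def conj_commute)

text \<open>Kolmogorov extension to the integers: a finite set of times is shifted into the
  nonnegative half-line and given the law that \<open>N\<close> assigns to it. Stationarity makes
  the result independent of the shift.\<close>

lemma two_sided_extension:
  fixes N :: "(nat \<Rightarrow> 'a::polish_space) measure"
  assumes N: "prob_space N" "sets N = sets (Pi\<^sub>M UNIV (\<lambda>_. borel))"
    and shift: "distr N N (\<lambda>\<omega> n. \<omega> (Suc n)) = N"
  obtains Q :: "(int \<Rightarrow> 'a) measure" where "prob_space Q" "sets Q = sets (Pi\<^sub>M UNIV (\<lambda>_. borel))"
    "\<And>m. distr Q N (\<lambda>\<omega> n. \<omega> (m + int n)) = N"
proof -
  interpret N: prob_space N by (rule N(1))
  have coordN [measurable]: "(\<lambda>\<omega>. \<omega> n) \<in> N \<rightarrow>\<^sub>M borel" for n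
    by (simp add: measurable_cong_sets[OF N(2) refl])
  have spN: "space N = UNIV" using sets_eq_imp_space_eq[OF N(2)] by (simp add: space_PiM)
  have intoN: "(\<lambda>x n. f n x) \<in> L \<rightarrow>\<^sub>M N" if "\<And>n. f n \<in> L \<rightarrow>\<^sub>M borel"
    for f :: "nat \<Rightarrow> 'c \<Rightarrow> 'a" and L :: "'c measure"
    unfolding measurable_cong_sets[OF refl N(2)] using that by (intro measurable_PiM_single') auto
  have shift_k: "distr N N (\<lambda>\<omega> n. \<omega> (k + n)) = N" for k
  proof (induction k)
    case 0
    then show ?case by (simp add: distr_id)
  next
    case (Suc k)
    have "distr N N (\<lambda>\<omega> n. \<omega> (Suc k + n)) = distr (distr N N (\<lambda>\<omega> n. \<omega> (Suc n))) N (\<lambda>\<omega> n. \<omega> (k + n))"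
      by (subst distr_distr) (auto intro!: intoN simp: comp_def)
    then show ?case using shift Suc by simp
  qed
  define L where "L c J = distr N (Pi\<^sub>M J (\<lambda>_. borel)) (\<lambda>\<omega>. \<lambda>j\<in>J. \<omega> (nat (j + c)))" for c J
  have meas: "(\<lambda>\<omega>. \<lambda>j\<in>J. \<omega> (nat (j + c))) \<in> N \<rightarrow>\<^sub>M Pi\<^sub>M J (\<lambda>_. borel)" for c J
    by (intro measurable_restrict coordN)
  have L_mono: "L c' J = L c J" if "\<forall>j\<in>J. 0 \<le> j + c" "c \<le> c'" for c c' J
  proof -
    have "L c J = distr (distr N N (\<lambda>\<omega> n. \<omega> (nat (c' - c) + n))) (Pi\<^sub>M J (\<lambda>_. borel)) (\<lambda>\<omega>. \<lambda>j\<in>J. \<omega> (nat (j + c)))"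
      by (simp add: shift_k L_def)
    also have "\<dots> = distr N (Pi\<^sub>M J (\<lambda>_. borel)) (\<lambda>\<omega>. \<lambda>j\<in>J. \<omega> (nat (c' - c) + nat (j + c)))"
      by (subst distr_distr[OF meas intoN]) (auto simp: comp_def)
    also have "\<dots> = L c' J"
      unfolding L_def
    proof (rule distr_cong)
      fix \<omega>
      show "(\<lambda>j\<in>J. \<omega> (nat (c' - c) + nat (j + c))) = (\<lambda>j\<in>J. \<omega> (nat (j + c')))"
        using that by (auto simp: restrict_def fun_eq_iff nat_add_distrib[symmetric] add.commute)
    qed simp_all
    finally show ?thesis ..
  qed
  \<comment> \<open>A shift large enough for all elements of \<open>J\<close>, and monotone in
    \<open>J\<close>, as consistency of the family requires.\<close>
  define s where "s J = (\<Sum>j\<in>J. \<bar>j\<bar>)" for J :: "int set"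
  have s: "0 \<le> j + s J" if "finite J" "j \<in> J" for j J
    using member_le_sum[of j J abs] that unfolding s_def by auto
  have s_mono: "s J \<le> s H" if "finite H" "J \<subseteq> H" for J H
    unfolding s_def by (intro sum_mono2) (use that in auto)
  interpret polish_projective UNIV "\<lambda>J. L (s J) J"
  proof (intro polish_projective.intro projective_family.intro)
    fix J H :: "int set" assume JH: "J \<subseteq> H" "finite H"
    have restr: "(\<lambda>f. restrict f J) \<in> Pi\<^sub>M H (\<lambda>_. borel) \<rightarrow>\<^sub>M Pi\<^sub>M J (\<lambda>_. borel :: 'a measure)"
      by (rule measurable_restrict_subset[OF JH(1)])
    have "distr (L (s H) H) (Pi\<^sub>M J (\<lambda>_. borel)) (\<lambda>f. restrict f J) = L (s H) J"
      unfolding L_def distr_distr[OF restr meas] comp_def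
    proof (rule distr_cong)
      fix \<omega> show "restrict (\<lambda>j\<in>H. \<omega> (nat (j + s H))) J = (\<lambda>j\<in>J. \<omega> (nat (j + s H)))"
        using JH(1) by (auto simp: restrict_def fun_eq_iff)
    qed simp_all
    also have "\<dots> = L (s J) J"
      by (rule L_mono) (use s s_mono[OF JH(2,1)] finite_subset[OF JH] in auto)
    finally show "L (s J) J = distr (L (s H) H) (Pi\<^sub>M J (\<lambda>_. borel)) (\<lambda>f. restrict f J)" ..
  next
    fix J :: "int set"
    show "prob_space (L (s J) J)" unfolding L_def by (rule N.prob_space_distr[OF meas])
  qed
  have "distr lim N (\<lambda>\<omega> n. \<omega> (m + int n)) = N" for m
  proof (rule measure_eqI_PiM_infinite)
    show "sets (distr lim N (\<lambda>\<omega> n. \<omega> (m + int n))) = sets (Pi\<^sub>M UNIV (\<lambda>_. borel))"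
      "sets N = sets (Pi\<^sub>M UNIV (\<lambda>_. borel))" by (simp_all add: N(2))
    have im: "(\<lambda>\<omega> n. \<omega> (m + int n)) \<in> lim \<rightarrow>\<^sub>M N"
      by (intro intoN) (simp add: measurable_cong_sets[OF sets_lim refl])
    show "finite_measure (distr lim N (\<lambda>\<omega> n. \<omega> (m + int n)))"
      using P.prob_space_distr[OF im] by (simp add: prob_space.axioms(1))
    fix A :: "nat \<Rightarrow> 'a set" and J
    assume J: "finite J" "J \<subseteq> UNIV" and A: "\<And>i. i \<in> J \<Longrightarrow> A i \<in> sets borel"
    define J' where "J' = (\<lambda>j. m + int j) ` J"
    define X where "X = Pi\<^sub>E J' (\<lambda>i. A (nat (i - m)))"
    have fJ': "finite J'" using J by (simp add: J'_def)
    have X: "X \<in> sets (Pi\<^sub>M J' (\<lambda>_. borel))"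
      unfolding X_def using A fJ' by (intro sets_PiM_I_finite) (auto simp: J'_def)
    have E: "prod_emb UNIV (\<lambda>_. borel) J (Pi\<^sub>E J A) = {w. \<forall>j\<in>J. w j \<in> A j}"
      by (auto simp: prod_emb_def PiE_iff)
    have Em: "{w. \<forall>j\<in>J. w j \<in> A j} \<in> sets N"
      unfolding E[symmetric] N(2) using J A by (intro sets_PiM_I) auto
    \<comment> \<open>Large enough both to shift all times of \<open>J'\<close> and to make
      \<open>m + c\<close> nonnegative.\<close>
    define c where "c = max (s J') (- m)"
    have "emeasure (distr lim N (\<lambda>\<omega> n. \<omega> (m + int n))) {w. \<forall>j\<in>J. w j \<in> A j} =
        emeasure lim (prod_emb UNIV (\<lambda>_. borel) J' X)"
      unfolding emeasure_distr[OF im Em]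
      by (intro arg_cong[where f = "emeasure lim"]) (auto simp: prod_emb_def X_def PiE_iff J'_def space_PiM)
    also have "\<dots> = emeasure (L (s J') J') X" by (rule emeasure_lim_emb) (use fJ' X in auto)
    also have "L (s J') J' = L c J'" using s[OF fJ'] by (intro L_mono[symmetric]) (auto simp: c_def)
    also have "emeasure (L c J') X = emeasure (distr N N (\<lambda>\<omega> n. \<omega> (nat (m + c) + n))) {w. \<forall>j\<in>J. w j \<in> A j}"
    proof -
      have eqA: "nat (m + int j + c) = nat (m + c) + j" for j by (auto simp: c_def)
      have eqS: "(\<lambda>\<omega>. \<lambda>j\<in>J'. \<omega> (nat (j + c))) -` X \<inter> space N =
        (\<lambda>\<omega> n. \<omega> (nat (m + c) + n)) -` {w. \<forall>j\<in>J. w j \<in> A j} \<inter> space N"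
        by (auto simp: X_def PiE_iff J'_def eqA)
      have im': "(\<lambda>\<omega> n. \<omega> (nat (m + c) + n)) \<in> N \<rightarrow>\<^sub>M N" by (intro intoN coordN)
      show ?thesis unfolding L_def emeasure_distr[OF meas X] emeasure_distr[OF im' Em] by (rule arg_cong[OF eqS])
    qed
    finally show "emeasure (distr lim N (\<lambda>\<omega> n. \<omega> (m + int n))) (prod_emb UNIV (\<lambda>_. borel) J (Pi\<^sub>E J A)) =
        emeasure N (prod_emb UNIV (\<lambda>_. borel) J (Pi\<^sub>E J A))"
      unfolding E shift_k .
  qed
  then show ?thesis using that[of lim] P.prob_space_axioms by simp
qed

text \<open>Finitely many coordinates lie to the right of some \<open>m\<close>, so their law is
  determined by a one-sided section, and all of these have the law \<open>N\<close>.\<close>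

lemma two_sided_shift:
  fixes Q :: "(int \<Rightarrow> 'a::topological_space) measure"
  assumes Q: "prob_space Q" "sets Q = sets (Pi\<^sub>M UNIV (\<lambda>_. borel))" and N: "sets N = sets (Pi\<^sub>M UNIV (\<lambda>_. borel))"
    and law: "\<And>m. distr Q N (\<lambda>\<omega> n. \<omega> (m + int n)) = N"
  shows "distr Q Q (\<lambda>\<omega> t. \<omega> (t + h)) = Q"
proof (rule measure_eqI_PiM_infinite)
  interpret Q: prob_space Q by (rule Q(1))
  have coordQ [measurable]: "(\<lambda>\<omega>. \<omega> n) \<in> Q \<rightarrow>\<^sub>M borel" for n
    by (simp add: measurable_cong_sets[OF Q(2) refl])
  have im: "(\<lambda>\<omega> t. \<omega> (t + h)) \<in> Q \<rightarrow>\<^sub>M Q"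
    unfolding measurable_cong_sets[OF refl Q(2)] by (intro measurable_PiM_single') auto
  have iN: "(\<lambda>\<omega> n. \<omega> (m + int n)) \<in> Q \<rightarrow>\<^sub>M N" for m
    unfolding measurable_cong_sets[OF refl N] by (intro measurable_PiM_single') auto
  show "sets (distr Q Q (\<lambda>\<omega> t. \<omega> (t + h))) = sets (Pi\<^sub>M UNIV (\<lambda>_. borel))"
    "sets Q = sets (Pi\<^sub>M UNIV (\<lambda>_. borel))" by (simp_all add: Q(2))
  show "finite_measure (distr Q Q (\<lambda>\<omega> t. \<omega> (t + h)))"
    using Q.prob_space_distr[OF im] by (simp add: prob_space.axioms(1))
  have spQ: "space Q = UNIV" using sets_eq_imp_space_eq[OF Q(2)] by (simp add: space_PiM)
  fix A :: "int \<Rightarrow> 'a set" and J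
  assume J: "finite J" "J \<subseteq> UNIV" and A: "\<And>i. i \<in> J \<Longrightarrow> A i \<in> sets borel"
  obtain m where m: "\<And>j. j \<in> J \<Longrightarrow> m \<le> j" using bdd_below_finite[OF J(1)] unfolding bdd_below_def by blast
  define B where "B = {w. \<forall>j\<in>J. w (nat (j - m)) \<in> A j}"
  have coordN [measurable]: "(\<lambda>\<omega>. \<omega> n) \<in> N \<rightarrow>\<^sub>M borel" for n
    by (simp add: measurable_cong_sets[OF N refl])
  have spN: "space N = UNIV" using sets_eq_imp_space_eq[OF N] by (simp add: space_PiM)
  have "{w \<in> space N. \<forall>j\<in>J. w (nat (j - m)) \<in> A j} \<in> sets N"
    by (intro sets.sets_Collect_finite_All J(1) measurable_Collect_mem[OF coordN] A)
  then have B: "B \<in> sets N" by (simp add: B_def spN)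
  have E: "prod_emb UNIV (\<lambda>_. borel) J (Pi\<^sub>E J A) = {w. \<forall>j\<in>J. w j \<in> A j}"
    by (auto simp: prod_emb_def PiE_iff)
  have Em: "{w. \<forall>j\<in>J. w j \<in> A j} \<in> sets Q"
    unfolding E[symmetric] Q(2) using J A by (intro sets_PiM_I) auto
  have key: "emeasure Q {\<omega>. \<forall>j\<in>J. \<omega> (j + h) \<in> A j} = emeasure N B" for h
  proof -
    have "emeasure N B = emeasure (distr Q N (\<lambda>\<omega> n. \<omega> (m + h + int n))) B" by (simp add: law)
    also have "\<dots> = emeasure Q {\<omega>. \<forall>j\<in>J. \<omega> (j + h) \<in> A j}"
      unfolding emeasure_distr[OF iN B]
      by (intro arg_cong[where f = "emeasure Q"]) (use m in \<open>auto simp: B_def spQ add.commute\<close>)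
    finally show ?thesis ..
  qed
  have "emeasure (distr Q Q (\<lambda>\<omega> t. \<omega> (t + h))) {w. \<forall>j\<in>J. w j \<in> A j} = emeasure Q {\<omega>. \<forall>j\<in>J. \<omega> (j + h) \<in> A j}"
    unfolding emeasure_distr[OF im Em] by (intro arg_cong[where f = "emeasure Q"]) (auto simp: spQ)
  then show "emeasure (distr Q Q (\<lambda>\<omega> t. \<omega> (t + h))) (prod_emb UNIV (\<lambda>_. borel) J (Pi\<^sub>E J A)) =
      emeasure Q (prod_emb UNIV (\<lambda>_. borel) J (Pi\<^sub>E J A))"
    unfolding E using key[of h] key[of 0] by simp
qed

section \<open>Cylinder events and generated algebras\<close>

definition cylinders :: "'w measure \<Rightarrow> 'a measure \<Rightarrow> ('i \<Rightarrow> 'w \<Rightarrow> 'a) \<Rightarrow> 'i set \<Rightarrow> 'w set set" where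
  "cylinders \<Omega> M Z I =
     {{\<omega> \<in> space \<Omega>. \<forall>s\<in>J. Z s \<omega> \<in> A s} | J A. finite J \<and> J \<subseteq> I \<and> (\<forall>s. A s \<in> sets M)}"

lemma generated_algebra_simps:
  "space (generated_algebra \<Omega> M Z I) = space \<Omega>"
  "sets (generated_algebra \<Omega> M Z I) = sigma_sets (space \<Omega>) {Z s -` A \<inter> space \<Omega> | s A. s \<in> I \<and> A \<in> sets M}"
  unfolding generated_algebra_def by (auto simp: space_measure_of_conv intro!: sets_measure_of)

lemma generated_algebra_measurable:
  assumes "s \<in> I" "Z s \<in> \<Omega> \<rightarrow>\<^sub>M M"
  shows "Z s \<in> generated_algebra \<Omega> M Z I \<rightarrow>\<^sub>M M"
proof (rule measurableI)
  show "Z s \<omega> \<in> space M" if "\<omega> \<in> space (generated_algebra \<Omega> M Z I)" for \<omega>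
    using that measurable_space[OF assms(2)] by (simp add: generated_algebra_simps)
  show "Z s -` A \<inter> space (generated_algebra \<Omega> M Z I) \<in> sets (generated_algebra \<Omega> M Z I)" if "A \<in> sets M" for A
    unfolding generated_algebra_simps using that assms(1) by (intro sigma_sets.Basic) auto
qed

lemma generated_algebra_sets_le:
  assumes "\<And>s. s \<in> I \<Longrightarrow> Z s \<in> \<Omega> \<rightarrow>\<^sub>M M"
  shows "sets (generated_algebra \<Omega> M Z I) \<subseteq> sets \<Omega>"
  unfolding generated_algebra_simps
  by (rule sets.sigma_sets_subset) (use assms measurable_sets in auto)

lemma generated_algebra_cylinders:
  assumes "\<And>s. s \<in> I \<Longrightarrow> Z s \<in> \<Omega> \<rightarrow>\<^sub>M M"
  shows "sets (generated_algebra \<Omega> M Z I) = sigma_sets (space \<Omega>) (cylinders \<Omega> M Z I)"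
proof
  show "sets (generated_algebra \<Omega> M Z I) \<subseteq> sigma_sets (space \<Omega>) (cylinders \<Omega> M Z I)"
    unfolding generated_algebra_simps
  proof (rule sigma_sets_mono', rule subsetI)
    fix C assume "C \<in> {Z s -` A \<inter> space \<Omega> | s A. s \<in> I \<and> A \<in> sets M}"
    then obtain s A where "C = Z s -` A \<inter> space \<Omega>" "s \<in> I" "A \<in> sets M" by auto
    then show "C \<in> cylinders \<Omega> M Z I"
      unfolding cylinders_def by (intro CollectI exI[of _ "{s}"] exI[of _ "\<lambda>_. A"]) auto
  qed
  have "cylinders \<Omega> M Z I \<subseteq> sets (generated_algebra \<Omega> M Z I)"
  proof
    fix C assume "C \<in> cylinders \<Omega> M Z I"
    then obtain J A where JA: "C = {\<omega> \<in> space \<Omega>. \<forall>s\<in>J. Z s \<omega> \<in> A s}" "finite J" "J \<subseteq> I" "\<And>s. A s \<in> sets M"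
      unfolding cylinders_def by auto
    have "{\<omega> \<in> space (generated_algebra \<Omega> M Z I). \<forall>s\<in>J. Z s \<omega> \<in> A s} \<in> sets (generated_algebra \<Omega> M Z I)"
    proof (rule sets.sets_Collect_finite_All[OF _ JA(2)])
      fix s assume "s \<in> J"
      then have s: "s \<in> I" using JA(3) by auto
      show "{\<omega> \<in> space (generated_algebra \<Omega> M Z I). Z s \<omega> \<in> A s} \<in> sets (generated_algebra \<Omega> M Z I)"
        by (rule measurable_Collect_mem[OF generated_algebra_measurable[where Z = Z, OF s assms[OF s]] JA(4)])
    qed
    then show "C \<in> sets (generated_algebra \<Omega> M Z I)" by (simp add: JA(1) generated_algebra_simps)
  qed
  from sets.sigma_sets_subset[OF this]
  show "sigma_sets (space \<Omega>) (cylinders \<Omega> M Z I) \<subseteq> sets (generated_algebra \<Omega> M Z I)"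
    by (simp add: generated_algebra_simps(1))
qed

text \<open>Makes the cylinders a generating system closed under intersection, on which independence
  of the generated algebras can be tested.\<close>

lemma Int_stable_cylinders:
  assumes "\<And>s. s \<in> I \<Longrightarrow> Z s \<in> \<Omega> \<rightarrow>\<^sub>M M"
  shows "Int_stable (cylinders \<Omega> M Z I)"
proof (rule Int_stableI)
  fix C C' assume "C \<in> cylinders \<Omega> M Z I" "C' \<in> cylinders \<Omega> M Z I"
  then obtain J A J' A' where J: "C = {\<omega> \<in> space \<Omega>. \<forall>s\<in>J. Z s \<omega> \<in> A s}" "finite J" "J \<subseteq> I" "\<And>s. A s \<in> sets M"
    and J': "C' = {\<omega> \<in> space \<Omega>. \<forall>s\<in>J'. Z s \<omega> \<in> A' s}" "finite J'" "J' \<subseteq> I" "\<And>s. A' s \<in> sets M"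
    unfolding cylinders_def by auto
  \<comment> \<open>Times occurring in only one of the cylinders are padded by the whole
    space.\<close>
  define B where "B s = (if s \<in> J then A s else space M) \<inter> (if s \<in> J' then A' s else space M)" for s
  have B: "B s \<in> sets M" for s using J(4) J'(4) by (auto simp: B_def)
  have "C \<inter> C' = {\<omega> \<in> space \<Omega>. \<forall>s\<in>J \<union> J'. Z s \<omega> \<in> B s}"
  proof -
    have "Z s \<omega> \<in> space M" if "s \<in> J \<union> J'" "\<omega> \<in> space \<Omega>" for s \<omega>
      using measurable_space[OF assms] that J(3) J'(3) by auto
    then show ?thesis unfolding J(1) J'(1) B_def by auto
  qed
  then show "C \<inter> C' \<in> cylinders \<Omega> M Z I"
    unfolding cylinders_def using J(2,3) J'(2,3) B
    by (intro CollectI exI[of _ "J \<union> J'"] exI[of _ B]) auto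
qed

context random_system
begin

section \<open>The chain started in its stationary law\<close>

lemma space_SS: "space SS = {\<omega>. \<forall>n. \<omega> n \<in> space \<Gamma>}"
  by (auto simp: space_PiM PiE_iff)

text \<open>The noise before time \<open>k\<close> and the noise from time \<open>k\<close> on are
  two independent copies glued together by \<open>comb_seq\<close>.\<close>

lemma nn_integral_comb_seq:
  assumes f: "f \<in> borel_measurable SS"
  shows "(\<integral>\<^sup>+\<omega>. f \<omega> \<partial>SS) = (\<integral>\<^sup>+\<omega>. (\<integral>\<^sup>+\<omega>'. f (comb_seq k \<omega> \<omega>') \<partial>SS) \<partial>SS)"
proof -
  have "(\<integral>\<^sup>+\<omega>. f \<omega> \<partial>SS) = (\<integral>\<^sup>+\<omega>. f \<omega> \<partial>distr (SS \<Otimes>\<^sub>M SS) SS (\<lambda>(\<omega>, \<omega>'). comb_seq k \<omega> \<omega>'))"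
    by (simp add: noise.PiM_comb_seq)
  also have "\<dots> = (\<integral>\<^sup>+p. f (comb_seq k (fst p) (snd p)) \<partial>(SS \<Otimes>\<^sub>M SS))"
    using f measurable_comb_seq[of k \<Gamma>] by (subst nn_integral_distr) (auto simp: case_prod_beta')
  also have "\<dots> = (\<integral>\<^sup>+\<omega>. (\<integral>\<^sup>+\<omega>'. f (comb_seq k \<omega> \<omega>') \<partial>SS) \<partial>SS)"
  proof -
    have "(\<lambda>p. f (comb_seq k (fst p) (snd p))) \<in> borel_measurable (SS \<Otimes>\<^sub>M SS)"
      using measurable_compose[OF measurable_comb_seq[of k \<Gamma>] f] by (simp add: case_prod_beta')
    from noise.P.nn_integral_fst[OF this] show ?thesis by simp
  qed
  finally show ?thesis .
qed

lemma SS_shift_measurable [measurable]: "(\<lambda>\<omega> n. \<omega> (k + n)) \<in> SS \<rightarrow>\<^sub>M SS"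
proof (rule measurable_PiM_single')
  show "(\<lambda>\<omega>. \<omega> (k + n)) \<in> SS \<rightarrow>\<^sub>M \<Gamma>" for n by (rule measurable_component_singleton) simp
qed (auto simp: space_SS)

lemma comb_seq_space: "\<omega> \<in> space SS \<Longrightarrow> \<omega>' \<in> space SS \<Longrightarrow> comb_seq k \<omega> \<omega>' \<in> space SS"
  by (auto simp: space_SS comb_seq_def)

lemma trajectory_comb_seq: "t \<le> k \<Longrightarrow> trajectory F x (comb_seq k \<omega> \<omega>') t = trajectory F x \<omega> t"
  by (rule trajectory_cong) (simp add: comb_seq_less)

context
  fixes \<pi> assumes stationary: "stationary_distribution M step \<pi>"
begin

lemma stationary_prob: "prob_space \<pi>" "sets \<pi> = sets M" "space \<pi> = space M"
  using stationary sets_eq_imp_space_eq[of \<pi> M] by (auto simp: stationary_distribution_def)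

lemma sets_stationary_pair: "sets (\<pi> \<Otimes>\<^sub>M SS) = sets MS"
  by (rule sets_pair_measure_cong[OF stationary_prob(2) refl])

lemma nn_integral_stationary:
  assumes h: "h \<in> borel_measurable M"
  shows "(\<integral>\<^sup>+x. (\<integral>\<^sup>+y. h (F (x, y)) \<partial>\<Gamma>) \<partial>\<pi>) = (\<integral>\<^sup>+x. h x \<partial>\<pi>)"
proof -
  have Km: "step \<in> \<pi> \<rightarrow>\<^sub>M subprob_algebra M"
    by (simp add: measurable_cong_sets[OF stationary_prob(2) refl] measurable_prob_algebraD[OF K])
  have "(\<integral>\<^sup>+x. h x \<partial>\<pi>) = (\<integral>\<^sup>+x. h x \<partial>(\<pi> \<bind> step))" by (simp add: stationary_bind[OF stationary])
  also have "\<dots> = (\<integral>\<^sup>+x. (\<integral>\<^sup>+z. h z \<partial>step x) \<partial>\<pi>)" by (rule nn_integral_bind[OF h Km])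
  also have "\<dots> = (\<integral>\<^sup>+x. (\<integral>\<^sup>+y. h (F (x, y)) \<partial>\<Gamma>) \<partial>\<pi>)"
    using h stationary_prob(3) by (intro nn_integral_cong nn_integral_step) auto
  finally show ?thesis ..
qed

lemma SS_0_measurable: "(\<lambda>\<omega>. \<omega> 0) \<in> SS \<rightarrow>\<^sub>M \<Gamma>"
  by (rule measurable_component_singleton) simp

lemma advance_measurable: "(\<lambda>p. (F (fst p, snd p 0), \<lambda>n. snd p (Suc n))) \<in> MS \<rightarrow>\<^sub>M MS"
proof -
  have "(\<lambda>p. (fst p, snd p 0)) \<in> MS \<rightarrow>\<^sub>M M \<Otimes>\<^sub>M \<Gamma>"
    by (rule measurable_Pair[OF measurable_fst measurable_compose[OF measurable_snd SS_0_measurable]])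
  from measurable_compose[OF this F] have 1: "(\<lambda>p. F (fst p, snd p 0)) \<in> MS \<rightarrow>\<^sub>M M" .
  have 2: "(\<lambda>p n. snd p (Suc n)) \<in> MS \<rightarrow>\<^sub>M SS"
    using measurable_compose[OF measurable_snd SS_shift_measurable[of "Suc 0"], of M] by simp
  show ?thesis by (rule measurable_Pair[OF 1 2])
qed

text \<open>One step uses up the first noise variable; the new state has the law
  \<open>\<pi>\<close> by stationarity and is independent of the remaining noise.\<close>

lemma advance_invariant:
  "distr (\<pi> \<Otimes>\<^sub>M SS) (\<pi> \<Otimes>\<^sub>M SS) (\<lambda>p. (F (fst p, snd p 0), \<lambda>n. snd p (Suc n))) = \<pi> \<Otimes>\<^sub>M SS" (is "distr _ _ ?\<Psi> = _")
proof (rule measure_eqI)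
  have \<Psi>: "?\<Psi> \<in> \<pi> \<Otimes>\<^sub>M SS \<rightarrow>\<^sub>M \<pi> \<Otimes>\<^sub>M SS"
    unfolding measurable_cong_sets[OF sets_stationary_pair sets_stationary_pair] by (rule advance_measurable)
  fix B assume "B \<in> sets (distr (\<pi> \<Otimes>\<^sub>M SS) (\<pi> \<Otimes>\<^sub>M SS) ?\<Psi>)"
  then have B: "B \<in> sets (\<pi> \<Otimes>\<^sub>M SS)" by simp
  define f :: "_ \<Rightarrow> ennreal" where "f = indicator B"
  have f: "f \<in> borel_measurable (\<pi> \<Otimes>\<^sub>M SS)" using B by (simp add: f_def)
  have f': "f \<in> borel_measurable MS"
    using f by (simp add: measurable_cong_sets[OF sets_stationary_pair refl])
  have fx: "(\<lambda>\<omega>. f (?\<Psi> (x, \<omega>))) \<in> borel_measurable SS" if "x \<in> space M" for x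
    by (rule measurable_compose[OF measurable_Pair1'[OF that] measurable_compose[OF advance_measurable f']])
  have "emeasure (distr (\<pi> \<Otimes>\<^sub>M SS) (\<pi> \<Otimes>\<^sub>M SS) ?\<Psi>) B = (\<integral>\<^sup>+p. f p \<partial>distr (\<pi> \<Otimes>\<^sub>M SS) (\<pi> \<Otimes>\<^sub>M SS) ?\<Psi>)"
    unfolding f_def by (rule nn_integral_indicator[symmetric]) (simp only: sets_distr B)
  also have "\<dots> = (\<integral>\<^sup>+p. f (?\<Psi> p) \<partial>(\<pi> \<Otimes>\<^sub>M SS))" by (rule nn_integral_distr[OF \<Psi>]) (use f in simp)
  also have "\<dots> = (\<integral>\<^sup>+x. (\<integral>\<^sup>+\<omega>. f (?\<Psi> (x, \<omega>)) \<partial>SS) \<partial>\<pi>)"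
    by (rule noise.P.nn_integral_fst[symmetric, OF measurable_compose[OF \<Psi> f]])
  also have "\<dots> = (\<integral>\<^sup>+x. (\<integral>\<^sup>+s. (\<integral>\<^sup>+\<omega>. f (F (x, s), \<omega>) \<partial>SS) \<partial>\<Gamma>) \<partial>\<pi>)"
  proof (rule nn_integral_cong)
    fix x assume "x \<in> space \<pi>"
    then have "x \<in> space M" by (simp add: stationary_prob)
    from nn_integral_shift[OF fx[OF this]]
    show "(\<integral>\<^sup>+\<omega>. f (?\<Psi> (x, \<omega>)) \<partial>SS) = (\<integral>\<^sup>+s. (\<integral>\<^sup>+\<omega>. f (F (x, s), \<omega>) \<partial>SS) \<partial>\<Gamma>)" by simp
  qed
  also have "\<dots> = (\<integral>\<^sup>+x. (\<integral>\<^sup>+\<omega>. f (x, \<omega>) \<partial>SS) \<partial>\<pi>)"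
    by (rule nn_integral_stationary) (rule noise.P.borel_measurable_nn_integral_fst[OF f'])
  also have "\<dots> = emeasure (\<pi> \<Otimes>\<^sub>M SS) B"
    using noise.P.nn_integral_fst[OF f] B by (simp add: f_def)
  finally show "emeasure (distr (\<pi> \<Otimes>\<^sub>M SS) (\<pi> \<Otimes>\<^sub>M SS) ?\<Psi>) B = emeasure (\<pi> \<Otimes>\<^sub>M SS) B" .
qed simp

text \<open>That \<open>E1\<close> depends only on the state and the first \<open>k\<close> noise
  variables is expressed by its invariance under replacing the later ones.\<close>

lemma past_future_independent:
  assumes E1: "E1 \<in> sets MS" and E2: "E2 \<in> sets SS"
    and past: "\<And>x \<omega> \<omega>'. x \<in> space M \<Longrightarrow> \<omega> \<in> space SS \<Longrightarrow> \<omega>' \<in> space SS \<Longrightarrow> (x, comb_seq k \<omega> \<omega>') \<in> E1 \<longleftrightarrow> (x, \<omega>) \<in> E1"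
  shows "emeasure (\<pi> \<Otimes>\<^sub>M SS) {p \<in> space MS. p \<in> E1 \<and> (\<lambda>i. snd p (k + i)) \<in> E2} =
    emeasure (\<pi> \<Otimes>\<^sub>M SS) E1 * emeasure SS E2"
proof -
  define E where "E = {p \<in> space MS. p \<in> E1 \<and> (\<lambda>i. snd p (k + i)) \<in> E2}"
  have "{p \<in> space MS. (\<lambda>i. snd p (k + i)) \<in> E2} \<in> sets MS"
    by (rule measurable_Collect_mem[OF measurable_compose[OF measurable_snd SS_shift_measurable] E2])
  from sets.Int[OF E1 this] have E: "E \<in> sets MS"
    unfolding E_def by (simp add: Collect_conj_eq inf_left_commute)
  have ind: "indicator E (x, comb_seq k \<omega> \<omega>') = (indicator E1 (x, \<omega>) * indicator E2 \<omega>' :: ennreal)"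
    if "x \<in> space M" "\<omega> \<in> space SS" "\<omega>' \<in> space SS" for x \<omega> \<omega>'
  proof -
    have "(\<lambda>i. comb_seq k \<omega> \<omega>' (k + i)) = \<omega>'" by (simp add: comb_seq_def fun_eq_iff)
    then show ?thesis using past[OF that] that comb_seq_space[OF that(2,3)]
      by (simp add: E_def space_pair_measure split: split_indicator)
  qed
  have Ex: "(\<lambda>\<omega>. indicator E (x, \<omega>) :: ennreal) \<in> borel_measurable SS" if "x \<in> space M" for x
    using measurable_compose[OF measurable_Pair1'[OF that] borel_measurable_indicator[OF E]] by simp
  have "emeasure (\<pi> \<Otimes>\<^sub>M SS) E = (\<integral>\<^sup>+x. (\<integral>\<^sup>+\<omega>. indicator E (x, \<omega>) \<partial>SS) \<partial>\<pi>)"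
    using noise.P.nn_integral_fst[OF borel_measurable_indicator, of E \<pi>] E sets_stationary_pair by simp
  also have "\<dots> = (\<integral>\<^sup>+x. (\<integral>\<^sup>+\<omega>. indicator E1 (x, \<omega>) \<partial>SS) * emeasure SS E2 \<partial>\<pi>)"
  proof (rule nn_integral_cong)
    fix x assume "x \<in> space \<pi>"
    then have x: "x \<in> space M" by (simp add: stationary_prob)
    have E1x: "(\<lambda>\<omega>. indicator E1 (x, \<omega>) :: ennreal) \<in> borel_measurable SS"
      using measurable_compose[OF measurable_Pair1'[OF x] borel_measurable_indicator[OF E1]] by simp
    have "(\<integral>\<^sup>+\<omega>. indicator E (x, \<omega>) \<partial>SS) = (\<integral>\<^sup>+\<omega>. (\<integral>\<^sup>+\<omega>'. indicator E (x, comb_seq k \<omega> \<omega>') \<partial>SS) \<partial>SS)"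
      by (rule nn_integral_comb_seq[OF Ex[OF x]])
    also have "\<dots> = (\<integral>\<^sup>+\<omega>. (\<integral>\<^sup>+\<omega>'. indicator E1 (x, \<omega>) * indicator E2 \<omega>' \<partial>SS) \<partial>SS)"
      using ind[OF x] by (intro nn_integral_cong) auto
    also have "\<dots> = (\<integral>\<^sup>+\<omega>. indicator E1 (x, \<omega>) * emeasure SS E2 \<partial>SS)"
      using E2 by (simp add: nn_integral_cmult)
    also have "\<dots> = (\<integral>\<^sup>+\<omega>. indicator E1 (x, \<omega>) \<partial>SS) * emeasure SS E2"
      by (rule nn_integral_multc[OF E1x])
    finally show "(\<integral>\<^sup>+\<omega>. indicator E (x, \<omega>) \<partial>SS) = (\<integral>\<^sup>+\<omega>. indicator E1 (x, \<omega>) \<partial>SS) * emeasure SS E2" .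
  qed
  also have "\<dots> = (\<integral>\<^sup>+x. (\<integral>\<^sup>+\<omega>. indicator E1 (x, \<omega>) \<partial>SS) \<partial>\<pi>) * emeasure SS E2"
    using noise.P.borel_measurable_nn_integral_fst[of "indicator E1 :: _ \<Rightarrow> ennreal" M] E1
    by (intro nn_integral_multc) (simp add: measurable_cong_sets[OF stationary_prob(2) refl])
  also have "(\<integral>\<^sup>+x. (\<integral>\<^sup>+\<omega>. indicator E1 (x, \<omega>) \<partial>SS) \<partial>\<pi>) = emeasure (\<pi> \<Otimes>\<^sub>M SS) E1"
    using noise.P.nn_integral_fst[OF borel_measurable_indicator, of E1 \<pi>] E1 sets_stationary_pair by simp
  finally show ?thesis unfolding E_def .
qed

end

end

text \<open>The chain started in \<open>\<pi>\<close> is recorded together with its noise, so the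
  recursion and the independence are properties of one law on sequences of pairs. This law is shift
  invariant and extends to the integers, and both properties are read off from finite
  windows.\<close>

lemma stationary_chain_exists:
  fixes S :: "'a::euclidean_space set" and \<Gamma> :: "'b::euclidean_space measure"
  assumes sys: "random_system M \<Gamma> F" and M: "M = restrict_space borel S" "S \<in> sets borel" and borel: "sets \<Gamma> = sets borel"
    and stationary: "stationary_distribution M (random_system.step M \<Gamma> F) \<pi>"
  obtains Q :: "(int \<Rightarrow> 'a \<times> 'b) measure" and X \<epsilon> where "stationary_chain Q M F \<Gamma> X \<epsilon>"
proof -
  interpret random_system M \<Gamma> F by (rule sys)
  note \<pi> = stationary_prob[OF stationary]
  have spM: "space M = S" using M(2) by (simp add: M(1) space_restrict_space)
  have sp\<Gamma>: "space \<Gamma> = UNIV" using sets_eq_imp_space_eq[OF borel] by simp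
  have spSS: "space SS = UNIV" by (simp add: space_SS sp\<Gamma>)
  have M_borel: "f \<in> L \<rightarrow>\<^sub>M borel" if "f \<in> L \<rightarrow>\<^sub>M M" for f and L :: "'c measure"
    using that by (simp add: M(1) measurable_restrict_space2_iff)
  define G where "G p = (\<lambda>n. (trajectory F (fst p) (snd p) n, snd p n))" for p
  let ?B = "Pi\<^sub>M UNIV (\<lambda>_. borel) :: (nat \<Rightarrow> 'a \<times> 'b) measure"
  interpret P: prob_space "\<pi> \<Otimes>\<^sub>M SS"
    using \<pi>(1) noise.P.prob_space_axioms by (rule prob_space_pair)
  have snd_n: "(\<lambda>p. snd p n) \<in> MS \<rightarrow>\<^sub>M borel" for n
  proof -
    have "(\<lambda>\<omega>. \<omega> n) \<in> SS \<rightarrow>\<^sub>M borel"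
      unfolding measurable_cong_sets[OF refl borel[symmetric]] by (rule measurable_component_singleton) simp
    from measurable_compose[OF measurable_snd this] show ?thesis .
  qed
  have G: "G \<in> \<pi> \<Otimes>\<^sub>M SS \<rightarrow>\<^sub>M ?B"
    unfolding measurable_cong_sets[OF sets_stationary_pair[OF stationary] refl] G_def[abs_def]
    by (intro measurable_PiM_single' borel_measurable_Pair M_borel trajectory_measurable snd_n) auto
  define N where "N = distr (\<pi> \<Otimes>\<^sub>M SS) ?B G"
  have N: "prob_space N" "sets N = sets ?B" unfolding N_def by (auto intro: P.prob_space_distr G)
  have G': "G \<in> \<pi> \<Otimes>\<^sub>M SS \<rightarrow>\<^sub>M N" using G by (simp add: N_def)
  have coordN: "(\<lambda>\<omega>. \<omega> n) \<in> N \<rightarrow>\<^sub>M borel" for n by (simp add: measurable_cong_sets[OF N(2) refl])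
  have shiftN: "(\<lambda>\<omega> n. \<omega> (Suc n)) \<in> N \<rightarrow>\<^sub>M N"
    unfolding measurable_cong_sets[OF refl N(2)] by (intro measurable_PiM_single' coordN) auto
  have NG: "distr (\<pi> \<Otimes>\<^sub>M SS) N G = N" unfolding N_def by (rule distr_cong) simp_all
  have "distr N N (\<lambda>\<omega> n. \<omega> (Suc n)) = distr (distr (\<pi> \<Otimes>\<^sub>M SS) N G) N (\<lambda>\<omega> n. \<omega> (Suc n))"
    by (simp only: NG)
  also have "\<dots> = distr (\<pi> \<Otimes>\<^sub>M SS) N (\<lambda>p. G (F (fst p, snd p 0), \<lambda>n. snd p (Suc n)))"
    unfolding distr_distr[OF shiftN G'] comp_def
  proof (rule distr_cong)
    fix p
    show "(\<lambda>n. G p (Suc n)) = G (F (fst p, snd p 0), \<lambda>n. snd p (Suc n))"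
      by (simp add: G_def trajectory_Suc_shift del: trajectory.simps)
  qed simp_all
  also have "\<dots> = distr (distr (\<pi> \<Otimes>\<^sub>M SS) (\<pi> \<Otimes>\<^sub>M SS) (\<lambda>p. (F (fst p, snd p 0), \<lambda>n. snd p (Suc n)))) N G"
  proof -
    have "(\<lambda>p. (F (fst p, snd p 0), \<lambda>n. snd p (Suc n))) \<in> \<pi> \<Otimes>\<^sub>M SS \<rightarrow>\<^sub>M \<pi> \<Otimes>\<^sub>M SS"
      unfolding measurable_cong_sets[OF sets_stationary_pair[OF stationary] sets_stationary_pair[OF stationary]]
      by (rule advance_measurable[OF stationary])
    from distr_distr[OF G' this] show ?thesis by (simp add: comp_def)
  qed
  also have "\<dots> = N" unfolding advance_invariant[OF stationary] by (rule NG)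
  finally have shift: "distr N N (\<lambda>\<omega> n. \<omega> (Suc n)) = N" .
  obtain Q :: "(int \<Rightarrow> 'a \<times> 'b) measure" where Q: "prob_space Q" "sets Q = sets (Pi\<^sub>M UNIV (\<lambda>_. borel))"
    and law: "\<And>m. distr Q N (\<lambda>\<omega> n. \<omega> (m + int n)) = N"
    by (rule two_sided_extension[OF N shift]) (rule that)
  interpret Q: prob_space Q by (rule Q(1))
  have spQ: "space Q = UNIV" using sets_eq_imp_space_eq[OF Q(2)] by (simp add: space_PiM)
  have spN: "space N = UNIV" using sets_eq_imp_space_eq[OF N(2)] by (simp add: space_PiM)
  have coordQ: "(\<lambda>\<omega>. \<omega> n) \<in> Q \<rightarrow>\<^sub>M borel" for n by (simp add: measurable_cong_sets[OF Q(2) refl])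
  have QN: "(\<lambda>\<omega> n. \<omega> (m + int n)) \<in> Q \<rightarrow>\<^sub>M N" for m
    unfolding measurable_cong_sets[OF refl N(2)] by (intro measurable_PiM_single' coordQ) auto
  have transfer: "emeasure Q {\<omega>. (\<lambda>n. \<omega> (m + int n)) \<in> B} = emeasure (\<pi> \<Otimes>\<^sub>M SS) {p \<in> space MS. G p \<in> B}"
    if B: "B \<in> sets N" for B m
  proof -
    have "emeasure Q {\<omega>. (\<lambda>n. \<omega> (m + int n)) \<in> B} = emeasure (distr Q N (\<lambda>\<omega> n. \<omega> (m + int n))) B"
      unfolding emeasure_distr[OF QN B] by (simp add: vimage_def spQ)
    also have "\<dots> = emeasure (distr (\<pi> \<Otimes>\<^sub>M SS) N G) B" by (simp only: law NG)
    also have "\<dots> = emeasure (\<pi> \<Otimes>\<^sub>M SS) {p \<in> space MS. G p \<in> B}"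
      unfolding emeasure_distr[OF G' B] sets_eq_imp_space_eq[OF sets_stationary_pair[OF stationary]]
      by (intro arg_cong[where f = "emeasure _"]) auto
    finally show ?thesis .
  qed
  obtain T0 where T0: "T0 \<in> S" using prob_space.not_empty[OF \<pi>(1)] \<pi>(3) spM by auto
  \<comment> \<open>The extension lives on the whole Euclidean space. Sending coordinates outside
    \<open>S\<close> to a fixed point of \<open>S\<close> gives a process with values in the state
    space everywhere.\<close>
  define pr where "pr z = (if z \<in> S then z else T0)" for z
  have pr: "pr \<in> borel \<rightarrow>\<^sub>M M"
    unfolding M(1) measurable_restrict_space2_iff
    using M(2) T0 by (auto simp: pr_def[abs_def] intro!: measurable_If_set)
  define X where "X t \<omega> = pr (fst (\<omega> t))" for t :: int and \<omega> :: "int \<Rightarrow> 'a \<times> 'b"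
  define \<epsilon> where "\<epsilon> t \<omega> = snd (\<omega> t)" for t :: int and \<omega> :: "int \<Rightarrow> 'a \<times> 'b"
  have fst_b: "fst \<in> borel \<rightarrow>\<^sub>M (borel :: 'a measure)" "snd \<in> borel \<rightarrow>\<^sub>M (borel :: 'b measure)"
    by (auto intro!: borel_measurable_continuous_onI continuous_on_fst continuous_on_snd continuous_on_id)
  have fst_pr: "(\<lambda>w. pr (fst w)) \<in> borel \<rightarrow>\<^sub>M M" by (rule measurable_compose[OF fst_b(1) pr])
  have X: "X t \<in> Q \<rightarrow>\<^sub>M M" for t
    unfolding X_def[abs_def] by (rule measurable_compose[OF coordQ fst_pr])
  have \<epsilon>: "\<epsilon> t \<in> Q \<rightarrow>\<^sub>M borel" for t
    unfolding \<epsilon>_def[abs_def] by (rule measurable_compose[OF coordQ fst_b(2)])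
  have G_space: "pr (fst (G p n)) = trajectory F (fst p) (snd p) n" if "p \<in> space MS" for p n
    using measurable_space[OF trajectory_measurable that, of n] by (simp add: G_def pr_def spM)
  \<comment> \<open>The joint law of states up to \<open>t\<close> and noise from \<open>t\<close>
    on, read in a window that starts at some \<open>m\<close> to the left of all times involved.
    Empty index sets give the two marginals.\<close>
  have cyl: "emeasure Q {\<omega>. (\<forall>s\<in>J. X s \<omega> \<in> A s) \<and> (\<forall>s\<in>J'. \<epsilon> s \<omega> \<in> B s)} =
      emeasure (\<pi> \<Otimes>\<^sub>M SS) {p \<in> space MS. \<forall>s\<in>J. trajectory F (fst p) (snd p) (nat (s - m)) \<in> A s} *
      emeasure SS {\<omega>. \<forall>s\<in>J'. \<omega> (nat (s - t)) \<in> B s}"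
    if J: "finite J" "\<And>s. s \<in> J \<Longrightarrow> s \<le> t" "\<And>s. A s \<in> sets M" "finite J'" "\<And>s. s \<in> J' \<Longrightarrow> t \<le> s" "\<And>s. B s \<in> sets borel"
      and m: "m \<le> t" "\<And>s. s \<in> J \<Longrightarrow> m \<le> s" for J J' A B t m
  proof -
    define D where "D = {w. (\<forall>s\<in>J. pr (fst (w (nat (s - m)))) \<in> A s) \<and> (\<forall>s\<in>J'. snd (w (nat (s - m))) \<in> B s)}"
    have "{w \<in> space N. \<forall>s\<in>J. pr (fst (w (nat (s - m)))) \<in> A s} \<in> sets N"
    proof (rule sets.sets_Collect_finite_All[OF _ J(1)])
      fix s assume "s \<in> J"
      have "(\<lambda>w. pr (fst (w (nat (s - m))))) \<in> N \<rightarrow>\<^sub>M M" by (rule measurable_compose[OF coordN fst_pr])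
      from measurable_Collect_mem[OF this J(3)[of s]] show "{w \<in> space N. pr (fst (w (nat (s - m)))) \<in> A s} \<in> sets N" .
    qed
    moreover have "{w \<in> space N. \<forall>s\<in>J'. snd (w (nat (s - m))) \<in> B s} \<in> sets N"
    proof (rule sets.sets_Collect_finite_All[OF _ J(4)])
      fix s assume "s \<in> J'"
      have "(\<lambda>w. snd (w (nat (s - m)))) \<in> N \<rightarrow>\<^sub>M borel" by (rule measurable_compose[OF coordN fst_b(2)])
      from measurable_Collect_mem[OF this J(6)[of s]] show "{w \<in> space N. snd (w (nat (s - m))) \<in> B s} \<in> sets N" .
    qed
    ultimately have D: "D \<in> sets N" unfolding D_def using sets.Int by (fastforce simp: spN Collect_conj_eq)
    define E1 where "E1 = {p \<in> space MS. \<forall>s\<in>J. trajectory F (fst p) (snd p) (nat (s - m)) \<in> A s}"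
    define E2 where "E2 = {\<omega>. \<forall>s\<in>J'. \<omega> (nat (s - t)) \<in> B s}"
    have E1: "E1 \<in> sets MS"
      unfolding E1_def
    proof (rule sets.sets_Collect_finite_All[OF _ J(1)])
      fix s assume "s \<in> J"
      from measurable_Collect_mem[OF trajectory_measurable[of "nat (s - m)"] J(3)[of s]]
      show "{p \<in> space MS. trajectory F (fst p) (snd p) (nat (s - m)) \<in> A s} \<in> sets MS" .
    qed
    have "{\<omega> \<in> space SS. \<forall>s\<in>J'. \<omega> (nat (s - t)) \<in> B s} \<in> sets SS"
    proof (rule sets.sets_Collect_finite_All[OF _ J(4)])
      fix s assume "s \<in> J'"
      have "(\<lambda>\<omega>. \<omega> (nat (s - t))) \<in> SS \<rightarrow>\<^sub>M \<Gamma>" by (rule measurable_component_singleton) simp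
      from measurable_Collect_mem[OF this, of "B s"] show "{\<omega> \<in> space SS. \<omega> (nat (s - t)) \<in> B s} \<in> sets SS"
        using borel J(6)[of s] by simp
    qed
    then have E2: "E2 \<in> sets SS" by (simp add: E2_def spSS)
    have "{\<omega>. (\<forall>s\<in>J. X s \<omega> \<in> A s) \<and> (\<forall>s\<in>J'. \<epsilon> s \<omega> \<in> B s)} = {\<omega>. (\<lambda>n. \<omega> (m + int n)) \<in> D}"
      using m J(5) order_trans[OF m(1) J(5)] by (auto simp: D_def X_def \<epsilon>_def)
    then have "emeasure Q {\<omega>. (\<forall>s\<in>J. X s \<omega> \<in> A s) \<and> (\<forall>s\<in>J'. \<epsilon> s \<omega> \<in> B s)} =
        emeasure (\<pi> \<Otimes>\<^sub>M SS) {p \<in> space MS. G p \<in> D}" by (simp only: transfer[OF D])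
    also have "{p \<in> space MS. G p \<in> D} =
        {p \<in> space MS. p \<in> E1 \<and> (\<lambda>i. snd p (nat (t - m) + i)) \<in> E2}"
    proof -
      have "nat (t - m) + nat (s - t) = nat (s - m)" if "s \<in> J'" for s using m(1) J(5)[OF that] by auto
      moreover have "snd (G p n) = snd p n" for p n by (simp add: G_def)
      ultimately show ?thesis by (auto simp: D_def E1_def E2_def G_space)
    qed
    also have "emeasure (\<pi> \<Otimes>\<^sub>M SS) \<dots> = emeasure (\<pi> \<Otimes>\<^sub>M SS) E1 * emeasure SS E2"
    proof (rule past_future_independent[OF stationary E1 E2])
      fix x \<omega> \<omega>' assume "x \<in> space M" "\<omega> \<in> space SS" "\<omega>' \<in> space SS"
      moreover have "nat (s - m) \<le> nat (t - m)" if "s \<in> J" for s using J(2)[OF that] by auto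
      ultimately show "(x, comb_seq (nat (t - m)) \<omega> \<omega>') \<in> E1 \<longleftrightarrow> (x, \<omega>) \<in> E1"
        by (auto simp: E1_def space_pair_measure spSS trajectory_comb_seq)
    qed
    finally show ?thesis unfolding E1_def E2_def .
  qed
  have pSS: "emeasure (\<pi> \<Otimes>\<^sub>M SS) (space MS) = 1"
    using P.emeasure_space_1 sets_eq_imp_space_eq[OF sets_stationary_pair[OF stationary]] by simp
  have SS_prod: "emeasure SS {\<omega>. \<forall>s\<in>J. \<omega> (nat (s - m)) \<in> B s} = (\<Prod>s\<in>J. emeasure \<Gamma> (B s))"
    if J: "finite J" "\<And>s. s \<in> J \<Longrightarrow> m \<le> s" "\<And>s. B s \<in> sets borel" for J B and m :: int
  proof -
    let ?i = "\<lambda>s. nat (s - m)"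
    have inj: "inj_on ?i J"
    proof (rule inj_onI)
      fix x y assume "x \<in> J" "y \<in> J" "?i x = ?i y"
      then show "x = y" using J(2)[of x] J(2)[of y] by linarith
    qed
    have ret: "m + int (?i s) = s" if "s \<in> J" for s using J(2)[OF that] by simp
    have "{\<omega>. \<forall>s\<in>J. \<omega> (?i s) \<in> B s} = {\<omega> \<in> space SS. \<forall>i\<in>?i ` J. \<omega> i \<in> B (m + int i)}"
      using ret by (auto simp: spSS)
    also have "emeasure SS \<dots> = (\<Prod>i\<in>?i ` J. emeasure \<Gamma> (B (m + int i)))"
      by (rule noise.emeasure_PiM_Collect) (use J borel in auto)
    also have "\<dots> = (\<Prod>s\<in>J. emeasure \<Gamma> (B s))"
      using ret by (simp add: prod.reindex[OF inj])
    finally show ?thesis .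
  qed
  have \<epsilon>_prod: "emeasure Q {\<omega>. \<forall>s\<in>J. \<epsilon> s \<omega> \<in> B s} = (\<Prod>s\<in>J. emeasure \<Gamma> (B s))"
    if J: "finite J" "\<And>s. B s \<in> sets borel" for J B
  proof -
    obtain m where m: "\<And>j. j \<in> J \<Longrightarrow> m \<le> j" using bdd_below_finite[OF J(1)] unfolding bdd_below_def by blast
    show ?thesis using cyl[of "{}" m "\<lambda>_. space M" J B m] SS_prod[OF J(1) m J(2)] J m pSS by simp
  qed
  have law_\<epsilon>: "distr Q borel (\<epsilon> t) = \<Gamma>" for t
  proof (rule measure_eqI)
    fix A assume "A \<in> sets (distr Q borel (\<epsilon> t))"
    then have A: "A \<in> sets borel" by simp
    show "emeasure (distr Q borel (\<epsilon> t)) A = emeasure \<Gamma> A"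
      using \<epsilon>_prod[of "{t}" "\<lambda>_. A"] A unfolding emeasure_distr[OF \<epsilon> A] by (simp add: vimage_def spQ)
  qed (simp add: borel)
  have iid: "iid_process Q \<epsilon> \<Gamma>"
    unfolding iid_process_def
  proof (intro conjI allI law_\<epsilon> Q(1))
    show "Q.indep_vars (\<lambda>_. borel) \<epsilon> UNIV"
      unfolding Q.indep_vars_def2
    proof (intro conjI ballI \<epsilon> Q.indep_setsI)
      show "{\<epsilon> i -` A \<inter> space Q | A. A \<in> sets borel} \<subseteq> Q.events" for i using measurable_sets[OF \<epsilon>, of _ i] by blast
      fix A and J :: "int set"
      assume J: "finite J" and A: "\<forall>j\<in>J. A j \<in> {\<epsilon> j -` A \<inter> space Q | A. A \<in> sets borel}"
      have "\<forall>j\<in>J. \<exists>C. A j = {\<omega>. \<epsilon> j \<omega> \<in> C} \<and> C \<in> sets borel"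
      proof
        fix j assume "j \<in> J"
        then obtain C where "A j = \<epsilon> j -` C \<inter> space Q" "C \<in> sets borel" using A by blast
        then show "\<exists>C. A j = {\<omega>. \<epsilon> j \<omega> \<in> C} \<and> C \<in> sets borel" by (intro exI[of _ C]) (auto simp: spQ)
      qed
      then have "\<exists>C. \<forall>j\<in>J. A j = {\<omega>. \<epsilon> j \<omega> \<in> C j} \<and> C j \<in> sets borel" by (rule bchoice)
      then obtain C where C: "\<And>j. j \<in> J \<Longrightarrow> A j = {\<omega>. \<epsilon> j \<omega> \<in> C j}" "\<And>j. j \<in> J \<Longrightarrow> C j \<in> sets borel"
        by blast
      define B where "B j = (if j \<in> J then C j else {})" for j
      have B: "B j \<in> sets borel" for j using C(2) by (simp add: B_def)
      have "(\<Inter>j\<in>J. A j) = {\<omega>. \<forall>s\<in>J. \<epsilon> s \<omega> \<in> B s}" using C(1) by (auto simp: B_def)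
      then have "emeasure Q (\<Inter>j\<in>J. A j) = (\<Prod>s\<in>J. emeasure \<Gamma> (B s))" using \<epsilon>_prod[OF J B] by simp
      also have "\<dots> = (\<Prod>s\<in>J. emeasure Q (A s))"
      proof (rule prod.cong[OF refl])
        fix s assume s: "s \<in> J"
        have "emeasure Q {\<omega>. \<epsilon> s \<omega> \<in> B s} = emeasure \<Gamma> (B s)" using \<epsilon>_prod[of "{s}" B, OF _ B] by simp
        then show "emeasure \<Gamma> (B s) = emeasure Q (A s)" using C(1)[OF s] s by (simp add: B_def)
      qed
      finally have "ennreal (Q.prob (\<Inter>j\<in>J. A j)) = ennreal (\<Prod>s\<in>J. Q.prob (A s))"
        by (simp add: Q.emeasure_eq_measure prod_ennreal)
      then show "Q.prob (\<Inter>j\<in>J. A j) = (\<Prod>s\<in>J. Q.prob (A s))" by (simp add: prod_nonneg)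
    qed
  qed
  have stat: "strictly_stationary Q M X"
    unfolding strictly_stationary_def
  proof (intro conjI allI X)
    fix h
    have im: "(\<lambda>\<omega> t. \<omega> (t + h)) \<in> Q \<rightarrow>\<^sub>M Q"
      unfolding measurable_cong_sets[OF refl Q(2)] by (intro measurable_PiM_single' coordQ) auto
    have imX: "(\<lambda>\<omega> t. X t \<omega>) \<in> Q \<rightarrow>\<^sub>M Pi\<^sub>M UNIV (\<lambda>_. M)"
      using measurable_space[OF X] by (intro measurable_PiM_single' X) auto
    have "distr Q (Pi\<^sub>M UNIV (\<lambda>_. M)) (\<lambda>\<omega> t. X t \<omega>) =
        distr (distr Q Q (\<lambda>\<omega> t. \<omega> (t + h))) (Pi\<^sub>M UNIV (\<lambda>_. M)) (\<lambda>\<omega> t. X t \<omega>)"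
      by (simp only: two_sided_shift[OF Q N(2) law])
    also have "\<dots> = distr Q (Pi\<^sub>M UNIV (\<lambda>_. M)) (\<lambda>\<omega> t. X (t + h) \<omega>)"
      unfolding distr_distr[OF imX im] by (simp add: comp_def X_def)
    finally show "distr Q (Pi\<^sub>M UNIV (\<lambda>_. M)) (\<lambda>\<omega> t. X (t + h) \<omega>) = distr Q (Pi\<^sub>M UNIV (\<lambda>_. M)) (\<lambda>\<omega> t. X t \<omega>)" ..
  qed
  have recursion: "AE \<omega> in Q. X (t + 1) \<omega> = F (X t \<omega>, \<epsilon> t \<omega>)" for t
  proof -
    have "(\<lambda>w. (pr (fst w), snd w)) \<in> borel \<rightarrow>\<^sub>M M \<Otimes>\<^sub>M \<Gamma>"
      using fst_pr fst_b(2) by (intro measurable_Pair) (auto simp: measurable_cong_sets[OF refl borel])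
    from measurable_compose[OF this F]
    have Fm: "(\<lambda>w. F (pr (fst w), snd w)) \<in> borel \<rightarrow>\<^sub>M borel" by (rule M_borel)
    have prb: "(\<lambda>w. pr (fst w)) \<in> borel \<rightarrow>\<^sub>M (borel :: 'a measure)" by (rule M_borel[OF fst_pr])
    \<comment> \<open>Violations of the recursion between two neighbouring times; on the paths of
      the original chain they do not occur at all.\<close>
    define D where "D = {w. pr (fst (w (Suc 0))) \<noteq> F (pr (fst (w 0)), snd (w (0::nat)))}"
    have "{w \<in> space N. pr (fst (w (Suc 0))) \<noteq> F (pr (fst (w 0)), snd (w 0))} \<in> sets N"
      by (rule sets.sets_Collect_neg[OF measurable_equality_set[OF
              measurable_compose[OF coordN prb] measurable_compose[OF coordN Fm]]])
    then have D: "D \<in> sets N" by (simp add: D_def spN)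
    have GD: "G p \<notin> D" if "p \<in> space MS" for p
      using G_space[OF that, of "Suc 0"] G_space[OF that, of 0] by (simp add: D_def G_def)
    then have empty: "{p \<in> space MS. G p \<in> D} = {}" by blast
    have "emeasure Q {\<omega>. (\<lambda>n. \<omega> (t + int n)) \<in> D} = 0" unfolding transfer[OF D] empty by simp
    then have e0: "emeasure Q {\<omega>. \<not> (X (t + 1) \<omega> = F (X t \<omega>, \<epsilon> t \<omega>))} = 0" by (simp add: D_def X_def \<epsilon>_def)
    show ?thesis
    proof (rule AE_I[OF _ e0])
      have "{\<omega> \<in> space Q. (\<lambda>n. \<omega> (t + int n)) \<in> D} \<in> sets Q" by (rule measurable_Collect_mem[OF QN D])
      then show "{\<omega>. \<not> (X (t + 1) \<omega> = F (X t \<omega>, \<epsilon> t \<omega>))} \<in> sets Q" by (simp add: spQ D_def X_def \<epsilon>_def)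
    qed auto
  qed
  have indep: "Q.indep_set (sets (generated_algebra Q M X {..t})) (sets (generated_algebra Q borel \<epsilon> {t..}))" for t
  proof -
    have "Q.indep_set (cylinders Q M X {..t}) (cylinders Q borel \<epsilon> {t..})"
    proof (rule Q.indep_setI)
      show "cylinders Q M X {..t} \<subseteq> Q.events" "cylinders Q borel \<epsilon> {t..} \<subseteq> Q.events"
        using generated_algebra_cylinders[of "{..t}" X Q M, OF X] generated_algebra_cylinders[of "{t..}" \<epsilon> Q borel, OF \<epsilon>]
          generated_algebra_sets_le[of "{..t}" X Q M, OF X] generated_algebra_sets_le[of "{t..}" \<epsilon> Q borel, OF \<epsilon>]
        by (auto intro: sigma_sets.Basic)
      fix C1 C2 assume "C1 \<in> cylinders Q M X {..t}" "C2 \<in> cylinders Q borel \<epsilon> {t..}"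
      then obtain J A J' B where C1: "C1 = {\<omega>. \<forall>s\<in>J. X s \<omega> \<in> A s}" "finite J" "J \<subseteq> {..t}" "\<And>s. A s \<in> sets M"
        and C2: "C2 = {\<omega>. \<forall>s\<in>J'. \<epsilon> s \<omega> \<in> B s}" "finite J'" "J' \<subseteq> {t..}" "\<And>s. B s \<in> sets borel"
        unfolding cylinders_def by (auto simp: spQ)
      obtain m where m: "\<And>j. j \<in> insert t J \<Longrightarrow> m \<le> j"
        using bdd_below_finite[of "insert t J"] C1(2) unfolding bdd_below_def by blast
      have "emeasure Q (C1 \<inter> C2) = emeasure Q C1 * emeasure Q C2"
        using cyl[of J t A J' B m] cyl[of J t A "{}" B m] cyl[of "{}" t A J' B m] C1(2,3,4) C2(2,3,4) m pSS noise.P.emeasure_space_1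
        by (auto simp: C1(1) C2(1) Collect_conj_eq[symmetric] spSS subset_iff)
      then have "ennreal (Q.prob (C1 \<inter> C2)) = ennreal (Q.prob C1 * Q.prob C2)"
        by (simp add: Q.emeasure_eq_measure ennreal_mult)
      then show "Q.prob (C1 \<inter> C2) = Q.prob C1 * Q.prob C2" by (simp add: zero_le_mult_iff)
    qed
    from Q.indep_set_sigma_sets[OF this Int_stable_cylinders Int_stable_cylinders]
    show ?thesis using X \<epsilon> by (simp add: generated_algebra_cylinders)
  qed
  have "stationary_chain Q M F \<Gamma> X \<epsilon>"
    unfolding stationary_chain_def using iid stat recursion indep by blast
  then show ?thesis by (rule that)
qed

section \<open>Mixing of stationary chains\<close>

text \<open>Exhaustion: among the suprema of countable subfamilies one has maximal integral. Adding
  any further member cannot increase it beyond a null set.\<close>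

lemma essential_supremum_exists:
  fixes Y :: "'i \<Rightarrow> 'w \<Rightarrow> real"
  assumes Q: "finite_measure Q" and I: "I \<noteq> {}" and Y: "\<And>i. i \<in> I \<Longrightarrow> Y i \<in> borel_measurable Q"
    and bound: "\<And>i. i \<in> I \<Longrightarrow> AE \<omega> in Q. 0 \<le> Y i \<omega> \<and> Y i \<omega> \<le> 1"
  shows "\<exists>S. is_essential_supremum Q I Y S"
proof -
  interpret finite_measure Q by (rule Q)
  \<comment> \<open>Truncated at 1 everywhere and taken in \<open>ennreal\<close>, so that countable
    suprema always exist and have finite integral.\<close>
  define Z where "Z i \<omega> = ennreal (min 1 (Y i \<omega>))" for i \<omega>
  have Z: "Z i \<in> borel_measurable Q" if "i \<in> I" for i using Y[OF that] by (simp add: Z_def[abs_def])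
  have Z_le: "Z i \<omega> \<le> 1" for i \<omega> by (simp add: Z_def ennreal_le_1)
  have YZ: "AE \<omega> in Q. Y i \<omega> = enn2real (Z i \<omega>)" if "i \<in> I" for i
    using bound[OF that] by eventually_elim (simp add: Z_def)
  define s where "s f \<omega> = (SUP n. Z (f n) \<omega>)" for f :: "nat \<Rightarrow> 'i" and \<omega>
  have s: "s f \<in> borel_measurable Q" if "range f \<subseteq> I" for f
    unfolding s_def[abs_def] using Z that by (intro borel_measurable_SUP) auto
  have s_le: "s f \<omega> \<le> 1" for f \<omega> unfolding s_def by (intro SUP_least Z_le)
  let ?A = "{f :: nat \<Rightarrow> 'i. range f \<subseteq> I}"
  let ?u = "\<lambda>f. \<integral>\<^sup>+\<omega>. s f \<omega> \<partial>Q"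
  have ne: "?u ` ?A \<noteq> {}" using I by (auto intro: exI[of _ "\<lambda>_. _"])
  obtain v :: "nat \<Rightarrow> ennreal" where v: "range v \<subseteq> ?u ` ?A" "Sup (?u ` ?A) = (SUP i. v i)"
    using ennreal_Sup_countable_SUP[OF ne] by blast
  have "\<forall>n. \<exists>f. f \<in> ?A \<and> v n = ?u f" using v(1) by blast
  then have "\<exists>fs. \<forall>n. fs n \<in> ?A \<and> v n = ?u (fs n)" by (rule choice)
  then obtain fs where fs: "\<And>n. fs n \<in> ?A" "\<And>n. v n = ?u (fs n)" by blast
  \<comment> \<open>A single sequence running through all members of the maximising
    sequences.\<close>
  define f where "f m = fs (fst (prod_decode m)) (snd (prod_decode m))" for m
  have f: "f \<in> ?A" using fs(1) by (auto simp: f_def)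
  then have fn: "f n \<in> I" for n by auto
  have f_ge: "s (fs n) \<omega> \<le> s f \<omega>" for n \<omega>
    unfolding s_def
  proof (rule SUP_least)
    fix m
    have "Z (fs n m) \<omega> = Z (f (prod_encode (n, m))) \<omega>" by (simp add: f_def)
    also have "\<dots> \<le> (SUP n. Z (f n) \<omega>)" by (rule SUP_upper) simp
    finally show "Z (fs n m) \<omega> \<le> (SUP n. Z (f n) \<omega>)" .
  qed
  have max: "?u g \<le> ?u f" if "g \<in> ?A" for g
  proof -
    have "?u g \<le> Sup (?u ` ?A)" using that by (intro Sup_upper) blast
    also have "\<dots> \<le> ?u f" unfolding v(2) fs(2) by (intro SUP_least nn_integral_mono f_ge)
    finally show ?thesis .
  qed
  have fin: "?u f < top" for f
  proof -
    have "?u f \<le> (\<integral>\<^sup>+\<omega>. 1 \<partial>Q)" by (intro nn_integral_mono s_le)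
    then show ?thesis using emeasure_finite by (auto simp: less_top[symmetric] top_unique)
  qed
  have Z_s: "AE \<omega> in Q. Z i \<omega> \<le> s f \<omega>" if i: "i \<in> I" for i
  proof -
    define g where "g = case_nat i f"
    have g: "g \<in> ?A" using f i by (auto simp: g_def fn split: nat.split)
    have gf: "s f \<omega> \<le> s g \<omega>" for \<omega>
      unfolding s_def
    proof (rule SUP_least)
      fix m
      have "Z (f m) \<omega> = Z (g (Suc m)) \<omega>" by (simp add: g_def)
      also have "\<dots> \<le> (SUP n. Z (g n) \<omega>)" by (rule SUP_upper) simp
      finally show "Z (f m) \<omega> \<le> (SUP n. Z (g n) \<omega>)" .
    qed
    have "(\<integral>\<^sup>+\<omega>. s g \<omega> - s f \<omega> \<partial>Q) = ?u g - ?u f"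
      using s f g gf fin[of f] by (intro nn_integral_diff) auto
    also have "\<dots> = 0" using max[OF g] by (simp add: diff_eq_0_iff_ennreal fin)
    finally have "AE \<omega> in Q. s g \<omega> - s f \<omega> = 0" using s f g by (subst (asm) nn_integral_0_iff_AE) auto
    then show ?thesis
    proof eventually_elim
      fix \<omega> assume "s g \<omega> - s f \<omega> = 0"
      moreover have "s f \<omega> < top" using s_le[of f \<omega>] by (simp add: le_less_trans)
      ultimately have "s g \<omega> \<le> s f \<omega>" by (metis diff_eq_0_iff_ennreal gf le_less less_top order.strict_iff_order)
      moreover have "Z i \<omega> \<le> s g \<omega>" unfolding s_def by (rule SUP_upper2[of 0]) (simp_all add: g_def)
      ultimately show "Z i \<omega> \<le> s f \<omega>" by simp
    qed
  qed
  have "is_essential_supremum Q I Y (\<lambda>\<omega>. enn2real (s f \<omega>))"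
    unfolding is_essential_supremum_def
  proof (intro conjI ballI impI)
    show "(\<lambda>\<omega>. enn2real (s f \<omega>)) \<in> borel_measurable Q" using s f by simp
  next
    fix i assume i: "i \<in> I"
    from YZ[OF i] Z_s[OF i] show "AE \<omega> in Q. Y i \<omega> \<le> enn2real (s f \<omega>)"
      by eventually_elim (simp add: enn2real_mono le_less_trans[OF s_le])
  next
    fix S' assume "S' \<in> borel_measurable Q" and S': "\<forall>i\<in>I. AE \<omega> in Q. Y i \<omega> \<le> S' \<omega>"
    have "AE \<omega> in Q. Z (f n) \<omega> \<le> ennreal (S' \<omega>) \<and> 0 \<le> S' \<omega>" for n
      using S'[rule_format, OF fn[of n]] bound[OF fn[of n]]
      by eventually_elim (auto simp: Z_def intro: ennreal_leI)
    then have "AE \<omega> in Q. \<forall>n. Z (f n) \<omega> \<le> ennreal (S' \<omega>) \<and> 0 \<le> S' \<omega>" by (simp add: AE_all_countable)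
    then show "AE \<omega> in Q. enn2real (s f \<omega>) \<le> S' \<omega>"
      by eventually_elim (auto simp: s_def intro!: enn2real_leI SUP_least)
  qed
  then show ?thesis by blast
qed

text \<open>Turns an abstract future event into a condition on the path from time \<open>k\<close>
  on, to which the Markov property can be applied.\<close>

lemma generated_algebra_tail:
  fixes Z :: "int \<Rightarrow> 'w \<Rightarrow> 'a"
  assumes Z: "\<And>t. Z t \<in> \<Omega> \<rightarrow>\<^sub>M M" and A: "A \<in> sets (generated_algebra \<Omega> M Z {k..})"
  obtains B where "B \<in> sets (Pi\<^sub>M UNIV (\<lambda>_. M))" "A = {\<omega> \<in> space \<Omega>. (\<lambda>n. Z (k + int n) \<omega>) \<in> B}"
proof -
  let ?N = "Pi\<^sub>M UNIV (\<lambda>_::nat. M)"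
  have Y: "(\<lambda>\<omega> n. Z (k + int n) \<omega>) \<in> \<Omega> \<rightarrow>\<^sub>M ?N"
    using measurable_space[OF Z] by (intro measurable_PiM_single' Z) auto
  have "A \<in> sigma_sets (space \<Omega>) {Z s -` A \<inter> space \<Omega> | s A. s \<in> {k..} \<and> A \<in> sets M}"
    using A by (simp add: generated_algebra_simps)
  then have "\<exists>B. B \<in> sets ?N \<and> A = {\<omega> \<in> space \<Omega>. (\<lambda>n. Z (k + int n) \<omega>) \<in> B}"
  proof induction
    case (Basic a)
    then obtain s C where s: "a = Z s -` C \<inter> space \<Omega>" "s \<ge> k" "C \<in> sets M" by auto
    define n where "n = nat (s - k)"
    have n: "k + int n = s" using s(2) by (simp add: n_def)
    have "(\<lambda>w. w n) \<in> ?N \<rightarrow>\<^sub>M M" by (rule measurable_component_singleton) simp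
    from measurable_Collect_mem[OF this s(3)] have "{w \<in> space ?N. w n \<in> C} \<in> sets ?N" .
    moreover have "a = {\<omega> \<in> space \<Omega>. (\<lambda>n. Z (k + int n) \<omega>) \<in> {w \<in> space ?N. w n \<in> C}}"
      using measurable_space[OF Y] by (auto simp: s(1) n)
    ultimately show ?case by blast
  next
    case Empty
    show ?case by (intro exI[of _ "{}"]) simp
  next
    case (Compl a)
    then obtain B where B: "B \<in> sets ?N" "a = {\<omega> \<in> space \<Omega>. (\<lambda>n. Z (k + int n) \<omega>) \<in> B}" by blast
    have "space \<Omega> - a = {\<omega> \<in> space \<Omega>. (\<lambda>n. Z (k + int n) \<omega>) \<in> space ?N - B}"
      using measurable_space[OF Y] by (auto simp: B(2))
    then show ?case using B(1) by blast
  next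
    case (Union a)
    have "\<exists>B. \<forall>i. B i \<in> sets ?N \<and> a i = {\<omega> \<in> space \<Omega>. (\<lambda>n. Z (k + int n) \<omega>) \<in> B i}"
      by (rule choice) (use Union.IH in blast)
    then obtain B where B: "\<And>i. B i \<in> sets ?N" "\<And>i. a i = {\<omega> \<in> space \<Omega>. (\<lambda>n. Z (k + int n) \<omega>) \<in> B i}" by blast
    have "(\<Union>i. a i) = {\<omega> \<in> space \<Omega>. (\<lambda>n. Z (k + int n) \<omega>) \<in> (\<Union>i. B i)}" using B(2) by auto
    moreover have "(\<Union>i. B i) \<in> sets ?N" using B(1) by auto
    ultimately show ?case by blast
  qed
  then show ?thesis using that by blast
qed

text \<open>Passes from independence on an arbitrary probability space to the product measure on
  noise sequences, where the recurrence statement and the law of the future noise are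
  computed.\<close>

lemma iid_process_law:
  fixes e :: "'i \<Rightarrow> 'w \<Rightarrow> 'b::topological_space"
  assumes iid: "iid_process \<Omega> e \<Gamma>"
  shows "sets \<Gamma> = sets borel" "e i \<in> \<Omega> \<rightarrow>\<^sub>M borel" "(\<lambda>\<omega> i. e i \<omega>) \<in> \<Omega> \<rightarrow>\<^sub>M Pi\<^sub>M UNIV (\<lambda>_. \<Gamma>)"
    "distr \<Omega> (Pi\<^sub>M UNIV (\<lambda>_. \<Gamma>)) (\<lambda>\<omega> i. e i \<omega>) = Pi\<^sub>M UNIV (\<lambda>_. \<Gamma>)"
proof -
  interpret \<Omega>: prob_space \<Omega> using iid by (simp add: iid_process_def)
  have law: "distr \<Omega> borel (e i) = \<Gamma>" and indep: "\<Omega>.indep_vars (\<lambda>_. borel) e UNIV" for i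
    using iid by (simp_all add: iid_process_def)
  show e: "e i \<in> \<Omega> \<rightarrow>\<^sub>M borel" for i using indep by (simp add: \<Omega>.indep_vars_def2)
  show \<Gamma>: "sets \<Gamma> = sets borel" using law sets_distr[of \<Omega> borel "e _"] by auto
  have s: "sets (Pi\<^sub>M UNIV (\<lambda>_. \<Gamma>)) = sets (Pi\<^sub>M (UNIV :: 'i set) (\<lambda>_. borel))" by (rule sets_PiM_cong) (simp_all add: \<Gamma>)
  show "(\<lambda>\<omega> i. e i \<omega>) \<in> \<Omega> \<rightarrow>\<^sub>M Pi\<^sub>M UNIV (\<lambda>_. \<Gamma>)"
    unfolding measurable_cong_sets[OF refl s] by (intro measurable_PiM_single' e) auto
  have "distr \<Omega> (Pi\<^sub>M UNIV (\<lambda>_. borel)) (\<lambda>\<omega>. \<lambda>i\<in>UNIV. e i \<omega>) = Pi\<^sub>M UNIV (\<lambda>i. distr \<Omega> borel (e i))"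
    using indep by (subst (asm) \<Omega>.indep_vars_iff_distr_eq_PiM) (use e in auto)
  then have "distr \<Omega> (Pi\<^sub>M UNIV (\<lambda>_. borel)) (\<lambda>\<omega> i. e i \<omega>) = Pi\<^sub>M UNIV (\<lambda>_. \<Gamma>)" by (simp add: law restrict_def)
  moreover have "distr \<Omega> (Pi\<^sub>M UNIV (\<lambda>_. \<Gamma>)) (\<lambda>\<omega> i. e i \<omega>) = distr \<Omega> (Pi\<^sub>M UNIV (\<lambda>_. borel)) (\<lambda>\<omega> i. e i \<omega>)"
    by (rule distr_cong) (simp_all add: s)
  ultimately show "distr \<Omega> (Pi\<^sub>M UNIV (\<lambda>_. \<Gamma>)) (\<lambda>\<omega> i. e i \<omega>) = Pi\<^sub>M UNIV (\<lambda>_. \<Gamma>)" by simp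
qed

section \<open>Arbitrary realisations of the stationary chain\<close>

locale ergodic_system = random_system M \<Gamma> F + ergodic_chain M "random_system.step M \<Gamma> F" V \<pi> D \<rho> c
  for M :: "'a measure" and \<Gamma> :: "'b::topological_space measure" and F V \<pi> D \<rho> c +
  assumes borel: "sets \<Gamma> = sets borel"

locale stationary_system = ergodic_system M \<Gamma> F V \<pi> D \<rho> c
  for M :: "'a measure" and \<Gamma> :: "'b::topological_space measure" and F V \<pi> D \<rho> c +
  fixes Q :: "'w measure" and X :: "int \<Rightarrow> 'w \<Rightarrow> 'a" and \<epsilon> :: "int \<Rightarrow> 'w \<Rightarrow> 'b"
  assumes chain: "stationary_chain Q M F \<Gamma> X \<epsilon>"
begin

sublocale Q: prob_space Q
  using chain by (simp add: stationary_chain_def iid_process_def)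

lemma X: "X t \<in> Q \<rightarrow>\<^sub>M M"
  using chain by (simp add: stationary_chain_def strictly_stationary_def)

lemma noise_iid: "iid_process Q \<epsilon> \<Gamma>"
  using chain by (simp add: stationary_chain_def)

lemmas \<epsilon> = iid_process_law(2)[OF noise_iid]

definition future :: "int \<Rightarrow> 'w \<Rightarrow> nat \<Rightarrow> 'b" where
  "future t \<omega> n = \<epsilon> (t + int n) \<omega>"

lemma sets_SS: "sets SS = sets (Pi\<^sub>M UNIV (\<lambda>_. borel))"
  by (rule sets_PiM_cong) (simp_all add: borel)

lemma future_measurable_algebra: "future t \<in> generated_algebra Q borel \<epsilon> {t..} \<rightarrow>\<^sub>M SS"
  unfolding measurable_cong_sets[OF refl sets_SS] future_def[abs_def]
  by (intro measurable_PiM_single' generated_algebra_measurable[where Z = \<epsilon>] \<epsilon>) auto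

lemma future_measurable: "future t \<in> Q \<rightarrow>\<^sub>M SS"
  unfolding measurable_cong_sets[OF refl sets_SS] future_def[abs_def]
  by (intro measurable_PiM_single' \<epsilon>) auto

lemma future_law: "distr Q SS (future t) = SS"
proof -
  let ?N = "Pi\<^sub>M UNIV (\<lambda>_::int. \<Gamma>)"
  have co: "(\<lambda>\<omega> n. \<omega> (t + int n)) \<in> ?N \<rightarrow>\<^sub>M SS"
  proof (rule measurable_PiM_single')
    show "(\<lambda>\<omega>. \<omega> (t + int n)) \<in> ?N \<rightarrow>\<^sub>M \<Gamma>" for n by (rule measurable_component_singleton) simp
  qed (auto simp: space_PiM PiE_iff)
  have "distr Q SS (future t) = distr (distr Q ?N (\<lambda>\<omega> i. \<epsilon> i \<omega>)) SS (\<lambda>\<omega> n. \<omega> (t + int n))"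
    unfolding distr_distr[OF co iid_process_law(3)[OF noise_iid]] by (simp add: comp_def future_def[abs_def])
  also have "\<dots> = distr ?N SS (\<lambda>\<omega> n. \<omega> (t + int n))" by (simp only: iid_process_law(4)[OF noise_iid])
  also have "\<dots> = SS"
    using distr_PiM_reindex[of UNIV "\<lambda>_. \<Gamma>" "\<lambda>n. t + int n" UNIV] \<Gamma> by (simp add: inj_on_def restrict_def)
  finally show ?thesis .
qed

text \<open>For a past event \<open>A\<close>, the state at \<open>t\<close> and the noise from
  \<open>t\<close> on are still independent under \<open>Q\<close> restricted to \<open>A\<close>;
  Fubini gives the rest.\<close>

lemma markov_property:
  assumes A: "A \<in> sets (generated_algebra Q M X {..t})" and \<phi>: "\<phi> \<in> borel_measurable MS"
  shows "(\<integral>\<^sup>+\<omega>. indicator A \<omega> * \<phi> (X t \<omega>, future t \<omega>) \<partial>Q) = (\<integral>\<^sup>+\<omega>. indicator A \<omega> * (\<integral>\<^sup>+y. \<phi> (X t \<omega>, y) \<partial>SS) \<partial>Q)"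
proof -
  let ?FX = "generated_algebra Q M X {..t}"
  have AQ: "A \<in> sets Q" using generated_algebra_sets_le[of "{..t}" X Q M, OF X] A by blast
  \<comment> \<open>The restriction is not normalised, so events \<open>A\<close> of probability
    zero need no separate treatment.\<close>
  define QA where "QA = density Q (indicator A)"
  have sQA: "sets QA = sets Q" "space QA = space Q" by (simp_all add: QA_def)
  have QA: "emeasure QA B = emeasure Q (A \<inter> B)" if "B \<in> sets Q" for B
    unfolding QA_def using emeasure_restricted[OF AQ that] .
  have XA: "X t \<in> QA \<rightarrow>\<^sub>M M" using X by (simp add: measurable_cong_sets[OF sQA(1) refl])
  have fA: "future t \<in> QA \<rightarrow>\<^sub>M SS" using future_measurable by (simp add: measurable_cong_sets[OF sQA(1) refl])
  have XfA: "(\<lambda>\<omega>. (X t \<omega>, future t \<omega>)) \<in> QA \<rightarrow>\<^sub>M MS" by (rule measurable_Pair[OF XA fA])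
  have prod: "distr QA M (X t) \<Otimes>\<^sub>M SS = distr QA MS (\<lambda>\<omega>. (X t \<omega>, future t \<omega>))"
  proof (rule pair_measure_eqI)
    have "finite_measure QA"
      by (rule finite_measureI) (use QA[OF sets.top] in \<open>simp add: sQA\<close>)
    from finite_measure.finite_measure_distr[OF this XA]
    show "sigma_finite_measure (distr QA M (X t))" by (simp add: finite_measure_def)
    show "sigma_finite_measure SS" by (rule noise.P.sigma_finite_measure_axioms)
    show "sets (distr QA M (X t) \<Otimes>\<^sub>M SS) = sets (distr QA MS (\<lambda>\<omega>. (X t \<omega>, future t \<omega>)))"
      by (simp cong: sets_pair_measure_cong)
    fix B C assume "B \<in> sets (distr QA M (X t))" and C: "C \<in> sets SS"
    then have B: "B \<in> sets M" by simp
    define a where "a = A \<inter> (X t -` B \<inter> space Q)"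
    define f where "f = future t -` C \<inter> space Q"
    have XF: "X t \<in> ?FX \<rightarrow>\<^sub>M M" by (rule generated_algebra_measurable[where Z = X, OF _ X]) simp
    have "X t -` B \<inter> space Q \<in> sets ?FX" using measurable_sets[OF XF B] by (simp add: generated_algebra_simps(1))
    with A have a: "a \<in> sets ?FX" by (simp add: a_def)
    have f: "f \<in> sets (generated_algebra Q borel \<epsilon> {t..})"
      using measurable_sets[OF future_measurable_algebra C, of t] by (simp add: f_def generated_algebra_simps(1))
    have "Q.indep_set (sets ?FX) (sets (generated_algebra Q borel \<epsilon> {t..}))"
      using chain by (simp add: stationary_chain_def)
    from Q.indep_setD[OF this a f] have "emeasure Q (a \<inter> f) = emeasure Q a * emeasure Q f"
      by (simp add: Q.emeasure_eq_measure ennreal_mult)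
    moreover have "emeasure Q f = emeasure SS C"
    proof -
      have "emeasure SS C = emeasure (distr Q SS (future t)) C" by (simp only: future_law)
      then show ?thesis unfolding emeasure_distr[OF future_measurable C] f_def ..
    qed
    moreover have "emeasure (distr QA M (X t)) B = emeasure Q a"
      unfolding emeasure_distr[OF XA B] using QA[OF measurable_sets[OF X B]] by (simp add: sQA a_def)
    moreover have "emeasure (distr QA MS (\<lambda>\<omega>. (X t \<omega>, future t \<omega>))) (B \<times> C) = emeasure Q (a \<inter> f)"
    proof -
      have BC: "B \<times> C \<in> sets MS" using B C by simp
      have "(\<lambda>\<omega>. (X t \<omega>, future t \<omega>)) -` (B \<times> C) \<inter> space QA \<in> sets Q"
        using measurable_sets[OF XfA BC] by (simp add: sQA)
      then show ?thesis unfolding emeasure_distr[OF XfA BC]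
        by (subst QA) (auto simp: a_def f_def sQA intro!: arg_cong[where f = "emeasure Q"])
    qed
    ultimately show "emeasure (distr QA M (X t)) B * emeasure SS C =
        emeasure (distr QA MS (\<lambda>\<omega>. (X t \<omega>, future t \<omega>))) (B \<times> C)" by simp
  qed
  have m1: "(\<lambda>\<omega>. \<phi> (X t \<omega>, future t \<omega>)) \<in> borel_measurable Q"
    using measurable_compose[OF measurable_Pair[OF X future_measurable] \<phi>] .
  have m2: "(\<lambda>x. \<integral>\<^sup>+y. \<phi> (x, y) \<partial>SS) \<in> borel_measurable M" by (rule noise.P.borel_measurable_nn_integral_fst[OF \<phi>])
  have iA: "(indicator A :: _ \<Rightarrow> ennreal) \<in> borel_measurable Q" using AQ by simp
  have "(\<integral>\<^sup>+\<omega>. indicator A \<omega> * \<phi> (X t \<omega>, future t \<omega>) \<partial>Q) = (\<integral>\<^sup>+\<omega>. \<phi> (X t \<omega>, future t \<omega>) \<partial>QA)"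
    unfolding QA_def by (rule nn_integral_density[OF iA m1, symmetric])
  also have "\<dots> = (\<integral>\<^sup>+p. \<phi> p \<partial>distr QA MS (\<lambda>\<omega>. (X t \<omega>, future t \<omega>)))"
    by (rule nn_integral_distr[OF XfA, symmetric]) (use \<phi> in simp)
  also have "\<dots> = (\<integral>\<^sup>+p. \<phi> p \<partial>(distr QA M (X t) \<Otimes>\<^sub>M SS))" by (simp only: prod)
  also have "\<dots> = (\<integral>\<^sup>+x. (\<integral>\<^sup>+y. \<phi> (x, y) \<partial>SS) \<partial>distr QA M (X t))"
    by (rule noise.P.nn_integral_fst[symmetric]) (use \<phi> in \<open>simp cong: measurable_cong_sets sets_pair_measure_cong\<close>)
  also have "\<dots> = (\<integral>\<^sup>+\<omega>. (\<integral>\<^sup>+y. \<phi> (X t \<omega>, y) \<partial>SS) \<partial>QA)"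
    by (rule nn_integral_distr[OF XA]) (use m2 in simp)
  also have "\<dots> = (\<integral>\<^sup>+\<omega>. indicator A \<omega> * (\<integral>\<^sup>+y. \<phi> (X t \<omega>, y) \<partial>SS) \<partial>Q)"
    unfolding QA_def by (rule nn_integral_density[OF iA measurable_compose[OF X m2]])
  finally show ?thesis .
qed

lemma path: "AE \<omega> in Q. \<forall>n. X (t + int n) \<omega> = trajectory F (X t \<omega>) (future t \<omega>) n"
proof -
  have "AE \<omega> in Q. \<forall>n. X (t + int n + 1) \<omega> = F (X (t + int n) \<omega>, \<epsilon> (t + int n) \<omega>)"
    unfolding AE_all_countable using chain by (simp add: stationary_chain_def)
  then show ?thesis
  proof eventually_elim
    fix \<omega> assume rec: "\<forall>n. X (t + int n + 1) \<omega> = F (X (t + int n) \<omega>, \<epsilon> (t + int n) \<omega>)"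
    show "\<forall>n. X (t + int n) \<omega> = trajectory F (X t \<omega>) (future t \<omega>) n"
    proof
      fix n show "X (t + int n) \<omega> = trajectory F (X t \<omega>) (future t \<omega>) n"
      proof (induction n)
        case (Suc n)
        have "t + int (Suc n) = t + int n + 1" by simp
        then show ?case using rec Suc by (simp only: trajectory.simps future_def)
      qed simp
    qed
  qed
qed

lemma space_in_past: "space Q \<in> sets (generated_algebra Q M X {..t})"
  using sets.top[of "generated_algebra Q M X {..t}"] by (simp add: generated_algebra_simps(1))

lemma law_shift: "distr Q M (X (t + h)) = distr Q M (X t)"
proof -
  let ?N = "Pi\<^sub>M UNIV (\<lambda>_::int. M)"
  have co: "(\<lambda>w. w t) \<in> ?N \<rightarrow>\<^sub>M M" by (rule measurable_component_singleton) simp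
  have im: "(\<lambda>\<omega> t. X (t + h) \<omega>) \<in> Q \<rightarrow>\<^sub>M ?N" for h
    using measurable_space[OF X] by (intro measurable_PiM_single' X) auto
  have "distr Q ?N (\<lambda>\<omega> t. X (t + h) \<omega>) = distr Q ?N (\<lambda>\<omega> t. X (t + 0) \<omega>)"
    using chain by (simp add: stationary_chain_def strictly_stationary_def)
  then have "distr (distr Q ?N (\<lambda>\<omega> t. X (t + h) \<omega>)) M (\<lambda>w. w t) = distr (distr Q ?N (\<lambda>\<omega> t. X (t + 0) \<omega>)) M (\<lambda>w. w t)"
    by simp
  then show ?thesis unfolding distr_distr[OF co im] by (simp add: comp_def)
qed

text \<open>By the Markov property and stationarity in time, the one-dimensional law is invariant
  under the kernel, hence it is \<open>\<pi>\<close> by uniqueness.\<close>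

lemma law: "distr Q M (X t) = \<pi>"
proof (rule \<pi>_unique, unfold stationary_distribution_def, intro conjI ballI)
  show "prob_space (distr Q M (X t))" by (rule Q.prob_space_distr[OF X])
  show "sets (distr Q M (X t)) = sets M" by simp
  fix A assume A: "A \<in> sets M"
  define \<phi> :: "_ \<Rightarrow> ennreal" where "\<phi> p = indicator A (trajectory F (fst p) (snd p) 1)" for p
  have \<phi>: "\<phi> \<in> borel_measurable MS"
    unfolding \<phi>_def[abs_def] by (rule measurable_compose[OF trajectory_measurable borel_measurable_indicator[OF A]])
  have step_A: "(\<integral>\<^sup>+y. \<phi> (x, y) \<partial>SS) = emeasure (step x) A" if x: "x \<in> space M" for x
  proof -
    have "emeasure (step x) A = emeasure (P 1 x) A" by (simp only: P_1[OF x])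
    also have "\<dots> = emeasure (distr SS M (\<lambda>\<omega>. trajectory F x \<omega> 1)) A" by (simp only: P_trajectory[OF x])
    also have "\<dots> = (\<integral>\<^sup>+y. indicator A y \<partial>distr SS M (\<lambda>\<omega>. trajectory F x \<omega> 1))" using A by simp
    also have "\<dots> = (\<integral>\<^sup>+y. \<phi> (x, y) \<partial>SS)"
      unfolding \<phi>_def fst_conv snd_conv by (rule nn_integral_distr[OF trajectory_section[OF x]]) (use A in simp)
    finally show ?thesis ..
  qed
  have step_m: "(\<lambda>x. emeasure (step x) A) \<in> borel_measurable M"
    by (rule measurable_compose[OF measurable_prob_algebraD[OF K] measurable_emeasure_subprob_algebra[OF A]])
  have "emeasure (distr Q M (X t)) A = emeasure (distr Q M (X (t + 1))) A" by (simp only: law_shift)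
  also have "\<dots> = (\<integral>\<^sup>+x. indicator A x \<partial>distr Q M (X (t + 1)))" using A by simp
  also have "\<dots> = (\<integral>\<^sup>+\<omega>. indicator A (X (t + 1) \<omega>) \<partial>Q)" by (rule nn_integral_distr[OF X]) (use A in simp)
  also have "\<dots> = (\<integral>\<^sup>+\<omega>. indicator (space Q) \<omega> * \<phi> (X t \<omega>, future t \<omega>) \<partial>Q)"
  proof (rule nn_integral_cong_AE)
    from path[of t] AE_space
    show "AE \<omega> in Q. indicator A (X (t + 1) \<omega>) = indicator (space Q) \<omega> * \<phi> (X t \<omega>, future t \<omega>)"
    proof eventually_elim
      fix \<omega> assume "\<forall>n. X (t + int n) \<omega> = trajectory F (X t \<omega>) (future t \<omega>) n" "\<omega> \<in> space Q"
      then show "indicator A (X (t + 1) \<omega>) = indicator (space Q) \<omega> * \<phi> (X t \<omega>, future t \<omega>)"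
        unfolding \<phi>_def fst_conv snd_conv by (metis indicator_simps(1) mult_1 of_nat_1)
    qed
  qed
  also have "\<dots> = (\<integral>\<^sup>+\<omega>. indicator (space Q) \<omega> * (\<integral>\<^sup>+y. \<phi> (X t \<omega>, y) \<partial>SS) \<partial>Q)"
    by (rule markov_property[OF space_in_past \<phi>])
  also have "\<dots> = (\<integral>\<^sup>+\<omega>. emeasure (step (X t \<omega>)) A \<partial>Q)"
    using measurable_space[OF X] by (intro nn_integral_cong) (simp add: step_A)
  also have "\<dots> = (\<integral>\<^sup>+x. emeasure (step x) A \<partial>distr Q M (X t))"
    by (rule nn_integral_distr[OF X, symmetric]) (use step_m in simp)
  finally show "emeasure (distr Q M (X t)) A = (\<integral>\<^sup>+x. emeasure (step x) A \<partial>distr Q M (X t))" .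
qed

lemma nn_integral_X:
  assumes f: "f \<in> borel_measurable M"
  shows "(\<integral>\<^sup>+\<omega>. f (X t \<omega>) \<partial>Q) = (\<integral>\<^sup>+x. f x \<partial>\<pi>)"
proof -
  have "(\<integral>\<^sup>+x. f x \<partial>\<pi>) = (\<integral>\<^sup>+x. f x \<partial>distr Q M (X t))" by (simp only: law)
  also have "\<dots> = (\<integral>\<^sup>+\<omega>. f (X t \<omega>) \<partial>Q)" by (rule nn_integral_distr[OF X]) (use f in simp)
  finally show ?thesis ..
qed

lemma trajectory_comb_seq_add:
  "trajectory F x (comb_seq k \<omega> \<omega>') (k + n) = trajectory F (trajectory F x \<omega> k) \<omega>' n"
proof (induction n)
  case 0
  show ?case using trajectory_comb_seq[of k k x \<omega> \<omega>'] by simp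
next
  case (Suc n)
  then show ?case using comb_seq_add[of k \<omega> \<omega>' n] by (simp add: add.commute)
qed

text \<open>For an event determined by the path from time \<open>k\<close> on, the conditional
  probability is a bounded function of the state, averaged with \<open>P k (X 0)\<close>; its
  unconditional value is the mean of the same function under \<open>\<pi>\<close>.\<close>

lemma conditional_probability:
  assumes A: "A \<in> sets (generated_algebra Q M X {int k..})"
  shows "AE \<omega> in Q. \<bar>real_cond_exp Q (generated_algebra Q M X {..0}) (indicator A) \<omega> - measure Q A\<bar> \<le> D * \<rho> ^ k * V (X 0 \<omega>)"
    and "AE \<omega> in Q. \<bar>real_cond_exp Q (generated_algebra Q M X {..0}) (indicator A) \<omega> - measure Q A\<bar> \<le> 1"
proof -
  let ?N = "Pi\<^sub>M UNIV (\<lambda>_::nat. M)" and ?FX = "generated_algebra Q M X {..0}"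
  obtain B where B: "B \<in> sets ?N" "A = {\<omega> \<in> space Q. (\<lambda>n. X (int k + int n) \<omega>) \<in> B}"
    by (rule generated_algebra_tail[of X Q M A "int k", OF X A]) (rule that)
  have AQ: "A \<in> sets Q" using generated_algebra_sets_le[of "{int k..}" X Q M, OF X] A by blast
  have sub: "subalgebra Q ?FX"
    unfolding subalgebra_def using generated_algebra_sets_le[of "{..0}" X Q M, OF X]
    by (simp add: generated_algebra_simps(1))
  interpret sub: finite_measure_subalgebra Q ?FX
    by (intro finite_measure_subalgebra.intro finite_measure_subalgebra_axioms.intro sub Q.finite_measure_axioms)
  \<comment> \<open>The path observed from time \<open>j\<close> on: \<open>\<phi> 0\<close>
    describes the event from the state at time \<open>k\<close>, \<open>\<phi> k\<close> the same
    event from the state at time 0.\<close>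
  define \<phi> :: "nat \<Rightarrow> _ \<Rightarrow> ennreal" where "\<phi> j p = indicator B (\<lambda>n. trajectory F (fst p) (snd p) (j + n))" for j p
  have \<phi>: "\<phi> j \<in> borel_measurable MS" for j
  proof -
    have "(\<lambda>p n. trajectory F (fst p) (snd p) (j + n)) \<in> MS \<rightarrow>\<^sub>M ?N"
      using measurable_space[OF trajectory_measurable] by (intro measurable_PiM_single' trajectory_measurable) auto
    from measurable_compose[OF this borel_measurable_indicator[OF B(1)]] show ?thesis by (simp add: \<phi>_def[abs_def])
  qed
  define g where "g x = (\<integral>\<^sup>+y. \<phi> 0 (x, y) \<partial>SS)" for x
  define h where "h x = (\<integral>\<^sup>+y. \<phi> k (x, y) \<partial>SS)" for x
  have gm: "g \<in> borel_measurable M" and hm: "h \<in> borel_measurable M"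
    unfolding g_def[abs_def] h_def[abs_def] by (rule noise.P.borel_measurable_nn_integral_fst[OF \<phi>])+
  have le1: "(\<integral>\<^sup>+y. \<phi> j (x, y) \<partial>SS) \<le> 1" for j x
  proof -
    have "(\<integral>\<^sup>+y. \<phi> j (x, y) \<partial>SS) \<le> (\<integral>\<^sup>+y. 1 \<partial>SS)" by (intro nn_integral_mono) (simp add: \<phi>_def split: split_indicator)
    then show ?thesis by (simp add: noise.P.emeasure_space_1)
  qed
  have g1: "g x \<le> 1" and h1: "h x \<le> 1" for x using le1 by (simp_all add: g_def h_def)
  have hg: "h x = (\<integral>\<^sup>+z. g z \<partial>P k x)" if x: "x \<in> space M" for x
  proof -
    have \<phi>x: "(\<lambda>y. \<phi> k (x, y)) \<in> borel_measurable SS"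
      by (rule measurable_compose[OF measurable_Pair1'[OF x] \<phi>])
    have "h x = (\<integral>\<^sup>+\<omega>. (\<integral>\<^sup>+\<omega>'. \<phi> k (x, comb_seq k \<omega> \<omega>') \<partial>SS) \<partial>SS)"
      unfolding h_def by (rule nn_integral_comb_seq[OF \<phi>x])
    also have "\<dots> = (\<integral>\<^sup>+\<omega>. g (trajectory F x \<omega> k) \<partial>SS)"
      by (simp add: g_def \<phi>_def trajectory_comb_seq_add)
    also have "\<dots> = (\<integral>\<^sup>+z. g z \<partial>distr SS M (\<lambda>\<omega>. trajectory F x \<omega> k))"
      by (rule nn_integral_distr[OF trajectory_section[OF x], symmetric]) (use gm in simp)
    finally show ?thesis by (simp only: P_trajectory[OF x])
  qed
  define gr where "gr x = enn2real (g x)" for x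
  define hr where "hr x = enn2real (h x)" for x
  have g_gr: "g x = ennreal (gr x)" and h_hr: "h x = ennreal (hr x)" for x
    using g1[of x] h1[of x] by (simp_all add: gr_def hr_def less_top le_less_trans)
  have gr: "gr \<in> borel_measurable M" "\<bar>gr x\<bar> \<le> 1" for x
    using gm g1[of x] by (auto simp: gr_def[abs_def] enn2real_leI)
  have hr: "hr \<in> borel_measurable M" "0 \<le> hr x" "hr x \<le> 1" for x
    using hm h1[of x] by (auto simp: hr_def[abs_def] enn2real_leI)
  have hr_P: "hr x = (\<integral>z. gr z \<partial>P k x)" if x: "x \<in> space M" for x
  proof -
    have "gr \<in> borel_measurable (P k x)" using gr(1) by (simp add: measurable_cong_sets[OF P_sets[OF x] refl])
    then have "(\<integral>z. gr z \<partial>P k x) = enn2real (\<integral>\<^sup>+z. ennreal (gr z) \<partial>P k x)"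
      by (intro integral_eq_nn_integral) (assumption | simp add: gr_def)+
    then show ?thesis using hg[OF x] by (simp add: hr_def g_gr[symmetric])
  qed
  have QA: "measure Q A = (\<integral>z. gr z \<partial>\<pi>)"
  proof -
    have "emeasure Q A = (\<integral>\<^sup>+\<omega>. indicator A \<omega> \<partial>Q)" using AQ by simp
    also have "\<dots> = (\<integral>\<^sup>+\<omega>. indicator (space Q) \<omega> * \<phi> 0 (X (int k) \<omega>, future (int k) \<omega>) \<partial>Q)"
    proof (rule nn_integral_cong_AE)
      from path[of "int k"] AE_space
      show "AE \<omega> in Q. indicator A \<omega> = indicator (space Q) \<omega> * \<phi> 0 (X (int k) \<omega>, future (int k) \<omega>)"
        by eventually_elim (simp add: \<phi>_def B(2) indicator_def)
    qed
    also have "\<dots> = (\<integral>\<^sup>+\<omega>. indicator (space Q) \<omega> * g (X (int k) \<omega>) \<partial>Q)"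
      unfolding g_def by (rule markov_property[OF space_in_past \<phi>])
    also have "\<dots> = (\<integral>\<^sup>+\<omega>. g (X (int k) \<omega>) \<partial>Q)" by (intro nn_integral_cong) simp
    also have "\<dots> = (\<integral>\<^sup>+x. g x \<partial>\<pi>)" by (rule nn_integral_X[OF gm])
    finally have "measure Q A = enn2real (\<integral>\<^sup>+x. ennreal (gr x) \<partial>\<pi>)" by (simp add: measure_def g_gr)
    also have "\<dots> = (\<integral>z. gr z \<partial>\<pi>)"
      using \<pi>_borel[OF gr(1)] by (intro integral_eq_nn_integral[symmetric]) (assumption | simp add: gr_def)+
    finally show ?thesis .
  qed
  have X0: "X 0 \<in> ?FX \<rightarrow>\<^sub>M M" by (rule generated_algebra_measurable[where Z = X, OF _ X]) simp
  have cond: "AE \<omega> in Q. real_cond_exp Q ?FX (indicator A) \<omega> = hr (X 0 \<omega>)"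
  proof (rule sub.real_cond_exp_charact)
    show "integrable Q (indicator A :: _ \<Rightarrow> real)" using AQ by (intro integrable_real_indicator) (auto simp: less_top[symmetric])
    show "(\<lambda>\<omega>. hr (X 0 \<omega>)) \<in> borel_measurable ?FX" by (rule measurable_compose[OF X0 hr(1)])
    have hrX: "(\<lambda>\<omega>. hr (X 0 \<omega>)) \<in> borel_measurable Q" by (rule measurable_compose[OF X hr(1)])
    then show "integrable Q (\<lambda>\<omega>. hr (X 0 \<omega>))" using hr by (intro Q.integrable_const_bound[of _ 1]) auto
    fix E assume E: "E \<in> sets ?FX"
    then have EQ: "E \<in> sets Q" using sub by (auto simp: subalgebra_def)
    have "(\<integral>\<^sup>+\<omega>. ennreal (indicator E \<omega> * indicator A \<omega>) \<partial>Q) = (\<integral>\<^sup>+\<omega>. indicator E \<omega> * \<phi> k (X 0 \<omega>, future 0 \<omega>) \<partial>Q)"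
    proof (rule nn_integral_cong_AE)
      from path[of 0] AE_space
      show "AE \<omega> in Q. ennreal (indicator E \<omega> * indicator A \<omega>) = indicator E \<omega> * \<phi> k (X 0 \<omega>, future 0 \<omega>)"
      proof eventually_elim
        fix \<omega> assume *: "\<forall>n. X (0 + int n) \<omega> = trajectory F (X 0 \<omega>) (future 0 \<omega>) n" "\<omega> \<in> space Q"
        have "X (int k + int n) \<omega> = trajectory F (X 0 \<omega>) (future 0 \<omega>) (k + n)" for n
          using *(1)[rule_format, of "k + n"] by simp
        then show "ennreal (indicator E \<omega> * indicator A \<omega>) = indicator E \<omega> * \<phi> k (X 0 \<omega>, future 0 \<omega>)"
          using *(2) by (simp add: \<phi>_def B(2) indicator_def)
      qed
    qed
    also have "\<dots> = (\<integral>\<^sup>+\<omega>. indicator E \<omega> * h (X 0 \<omega>) \<partial>Q)" unfolding h_def by (rule markov_property[OF E \<phi>])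
    also have "\<dots> = (\<integral>\<^sup>+\<omega>. ennreal (indicator E \<omega> * hr (X 0 \<omega>)) \<partial>Q)"
      by (intro nn_integral_cong) (simp add: h_hr indicator_def)
    finally have "(\<integral>\<omega>. indicator E \<omega> * indicator A \<omega> \<partial>Q) = (\<integral>\<omega>. indicator E \<omega> * hr (X 0 \<omega>) \<partial>Q)"
      using EQ AQ hrX hr(2) by (subst (1 2) integral_eq_nn_integral) auto
    then show "(LINT \<omega>:E|Q. indicator A \<omega>) = (LINT \<omega>:E|Q. hr (X 0 \<omega>))" by (simp add: set_lebesgue_integral_def)
  qed
  from cond AE_space
  show "AE \<omega> in Q. \<bar>real_cond_exp Q ?FX (indicator A) \<omega> - measure Q A\<bar> \<le> D * \<rho> ^ k * V (X 0 \<omega>)"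
  proof eventually_elim
    fix \<omega> assume *: "real_cond_exp Q ?FX (indicator A) \<omega> = hr (X 0 \<omega>)" "\<omega> \<in> space Q"
    have x: "X 0 \<omega> \<in> space M" by (rule measurable_space[OF X *(2)])
    show "\<bar>real_cond_exp Q ?FX (indicator A) \<omega> - measure Q A\<bar> \<le> D * \<rho> ^ k * V (X 0 \<omega>)"
      unfolding *(1) QA hr_P[OF x] by (rule conv[OF gr x])
  qed
  from cond show "AE \<omega> in Q. \<bar>real_cond_exp Q ?FX (indicator A) \<omega> - measure Q A\<bar> \<le> 1"
  proof eventually_elim
    fix \<omega> assume *: "real_cond_exp Q ?FX (indicator A) \<omega> = hr (X 0 \<omega>)"
    show "\<bar>real_cond_exp Q ?FX (indicator A) \<omega> - measure Q A\<bar> \<le> 1"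
      unfolding * using hr(2,3)[of "X 0 \<omega>"] Q.prob_le_1[of A] measure_nonneg[of Q A] by linarith
  qed
qed

text \<open>The bound for each single future event is one integrable random variable, so it also
  bounds the essential supremum of the family.\<close>

theorem mixing: "geometrically_beta_mixing Q M X"
proof -
  have VX: "(\<lambda>\<omega>. V (X 0 \<omega>)) \<in> borel_measurable Q" by (rule measurable_compose[OF X V])
  have V0: "0 \<le> V (X 0 \<omega>)" if "\<omega> \<in> space Q" for \<omega> using V_ge_1[OF measurable_space[OF X that]] by (simp add: order_trans[OF zero_le_one])
  have V_int: "integrable Q (\<lambda>\<omega>. V (X 0 \<omega>))"
  proof (rule integrableI_nonneg[OF VX])
    show "AE \<omega> in Q. 0 \<le> V (X 0 \<omega>)" using V0 by (rule AE_I2)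
    show "(\<integral>\<^sup>+\<omega>. ennreal (V (X 0 \<omega>)) \<partial>Q) < \<infinity>" using nn_integral_X[of "\<lambda>x. ennreal (V x)" 0] V \<pi>_V by simp
  qed
  have "beta_coefficient Q M X k \<le> (D * (\<integral>\<omega>. V (X 0 \<omega>) \<partial>Q)) * \<rho> ^ k" for k
  proof -
    let ?I = "sets (generated_algebra Q M X {int k..})"
    let ?Y = "\<lambda>A \<omega>. \<bar>real_cond_exp Q (generated_algebra Q M X {..0}) (indicator A) \<omega> - measure Q A\<bar>"
    define S where "S = (SOME S. is_essential_supremum Q ?I ?Y S)"
    have "\<exists>S. is_essential_supremum Q ?I ?Y S"
    proof (rule essential_supremum_exists[OF Q.finite_measure_axioms])
      show "?I \<noteq> {}" using sets.empty_sets by blast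
      show "?Y A \<in> borel_measurable Q" for A by (intro borel_measurable_abs borel_measurable_diff borel_measurable_cond_exp2) simp
      show "AE \<omega> in Q. 0 \<le> ?Y A \<omega> \<and> ?Y A \<omega> \<le> 1" if "A \<in> ?I" for A
        using conditional_probability(2)[OF that] by eventually_elim simp
    qed
    then have S: "is_essential_supremum Q ?I ?Y S" unfolding S_def by (rule someI_ex)
    have 1: "(\<lambda>\<omega>. D * \<rho> ^ k * V (X 0 \<omega>)) \<in> borel_measurable Q" using VX by simp
    have 2: "\<forall>A\<in>?I. AE \<omega> in Q. ?Y A \<omega> \<le> D * \<rho> ^ k * V (X 0 \<omega>)"
      by (rule ballI) (rule conditional_probability(1))
    have "\<forall>S'\<in>borel_measurable Q. (\<forall>A\<in>?I. AE \<omega> in Q. ?Y A \<omega> \<le> S' \<omega>) \<longrightarrow> (AE \<omega> in Q. S \<omega> \<le> S' \<omega>)"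
      by (rule conjunct2[OF conjunct2[OF S[unfolded is_essential_supremum_def]]])
    from mp[OF bspec[OF this 1] 2] have S_le: "AE \<omega> in Q. S \<omega> \<le> D * \<rho> ^ k * V (X 0 \<omega>)" .
    \<comment> \<open>Should the chosen \<open>S\<close> fail to be integrable, its integral is zero
      by convention and the bound is nonnegative.\<close>
    have "(\<integral>\<omega>. S \<omega> \<partial>Q) \<le> (\<integral>\<omega>. D * \<rho> ^ k * V (X 0 \<omega>) \<partial>Q)"
    proof (cases "integrable Q S")
      case True
      show ?thesis by (rule integral_mono_AE[OF True _ S_le]) (use V_int in simp)
    next
      case False
      have "0 \<le> (\<integral>\<omega>. D * \<rho> ^ k * V (X 0 \<omega>) \<partial>Q)" by (rule integral_nonneg_AE, rule AE_I2) (use V0 D \<rho> in simp)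
      then show ?thesis using False by (simp add: not_integrable_integral_eq)
    qed
    also have "(\<integral>\<omega>. D * \<rho> ^ k * V (X 0 \<omega>) \<partial>Q) = D * (\<integral>\<omega>. V (X 0 \<omega>) \<partial>Q) * \<rho> ^ k" by simp
    finally show ?thesis unfolding beta_coefficient_def S_def .
  qed
  then show ?thesis unfolding geometrically_beta_mixing_def using \<rho> by blast
qed

end

section \<open>The law of finitely many noise variables\<close>

lemma vec_lambda_measurable:
  assumes "sets N = sets borel"
  shows "vec_lambda \<in> Pi\<^sub>M UNIV (\<lambda>_::'n::finite. N) \<rightarrow>\<^sub>M (borel :: ('b::euclidean_space ^ 'n) measure)"
  unfolding borel_measurable_euclidean_space[where f = vec_lambda]
proof
  fix v :: "'b ^ 'n" assume "v \<in> Basis"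
  then obtain i b where v: "v = axis i b" "b \<in> Basis" unfolding Basis_vec_def by auto
  have "(\<lambda>\<omega>. \<omega> i) \<in> Pi\<^sub>M UNIV (\<lambda>_. N) \<rightarrow>\<^sub>M borel"
    unfolding measurable_cong_sets[OF refl assms[symmetric]] by (rule measurable_component_singleton) simp
  then show "(\<lambda>\<omega>. vec_lambda \<omega> \<bullet> v) \<in> borel_measurable (Pi\<^sub>M UNIV (\<lambda>_. N))"
    unfolding v(1) inner_axis by simp
qed

text \<open>Both measures give boxes the product of their side lengths; the basis of the vector
  space is indexed by pairs of component and basis vector.\<close>

lemma lborel_vec:
  "(lborel :: ('b::euclidean_space ^ 'n) measure) = distr (Pi\<^sub>M UNIV (\<lambda>_. lborel)) borel vec_lambda"
proof (rule lborel_eqI)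
  interpret product_sigma_finite "\<lambda>_::'n. lborel :: 'b measure" by standard
  have m: "vec_lambda \<in> Pi\<^sub>M UNIV (\<lambda>_::'n. lborel) \<rightarrow>\<^sub>M (borel :: ('b ^ 'n) measure)"
    by (rule vec_lambda_measurable) simp
  fix l u :: "'b ^ 'n" assume lu: "\<And>b. b \<in> Basis \<Longrightarrow> l \<bullet> b \<le> u \<bullet> b"
  have Basis_eq: "(Basis :: ('b ^ 'n) set) = (\<lambda>(i, b). axis i b) ` (UNIV \<times> Basis)"
    unfolding Basis_vec_def by auto
  have inj: "inj_on (\<lambda>(i :: 'n, b :: 'b). axis i b) (UNIV \<times> Basis)"
    by (auto simp: inj_on_def axis_eq_axis nonzero_Basis)
  have le: "l $ i \<bullet> b \<le> u $ i \<bullet> b" if "b \<in> Basis" for i b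
    using lu[of "axis i b"] that by (auto simp: Basis_eq inner_axis)
  have box: "vec_lambda -` box l u \<inter> space (Pi\<^sub>M UNIV (\<lambda>_::'n. lborel)) = Pi\<^sub>E UNIV (\<lambda>i. box (l $ i) (u $ i))"
    by (auto simp: mem_box Basis_eq inner_axis space_PiM PiE_iff)
  have "emeasure (distr (Pi\<^sub>M UNIV (\<lambda>_. lborel)) borel vec_lambda) (box l u) =
      emeasure (Pi\<^sub>M UNIV (\<lambda>_. lborel)) (Pi\<^sub>E UNIV (\<lambda>i. box (l $ i) (u $ i)))"
    by (subst emeasure_distr[OF m]) (simp_all add: box)
  also have "\<dots> = (\<Prod>i\<in>UNIV. emeasure lborel (box (l $ i) (u $ i)))" by (rule emeasure_PiM) auto
  also have "\<dots> = (\<Prod>i\<in>UNIV. ennreal (\<Prod>b\<in>Basis. (u $ i - l $ i) \<bullet> b))"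
    using le by (intro prod.cong refl emeasure_lborel_box)
  also have "\<dots> = ennreal (\<Prod>i\<in>UNIV. \<Prod>b\<in>Basis. (u $ i - l $ i) \<bullet> b)"
    using le by (intro prod_ennreal prod_nonneg) (simp add: inner_diff_left)
  also have "(\<Prod>i\<in>UNIV. \<Prod>b\<in>Basis. (u $ i - l $ i) \<bullet> b) = (\<Prod>(i, b)\<in>UNIV \<times> Basis. (u $ i - l $ i) \<bullet> b)"
    by (rule prod.cartesian_product)
  also have "\<dots> = (\<Prod>v\<in>Basis. (u - l) \<bullet> v)"
    unfolding Basis_eq prod.reindex[OF inj] by (intro prod.cong) (auto simp: inner_axis)
  finally show "emeasure (distr (Pi\<^sub>M UNIV (\<lambda>_. lborel)) borel vec_lambda) (box l u) = ennreal (\<Prod>v\<in>Basis. (u - l) \<bullet> v)" .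
qed simp

text \<open>The product of the densities is a density of the product.\<close>

lemma absolutely_continuous_PiM:
  fixes \<Gamma> :: "'b measure"
  assumes N: "sigma_finite_measure N" and \<Gamma>: "prob_space \<Gamma>" "sets \<Gamma> = sets N" and ac: "absolutely_continuous N \<Gamma>"
  shows "absolutely_continuous (Pi\<^sub>M UNIV (\<lambda>_::'n::finite. N)) (Pi\<^sub>M UNIV (\<lambda>_. \<Gamma>))"
proof -
  obtain g where g: "g \<in> borel_measurable N" "density N g = \<Gamma>"
    using sigma_finite_measure.Radon_Nikodym[OF N ac \<Gamma>(2)] by auto
  interpret L: product_sigma_finite "\<lambda>_::'n. N" by (rule product_sigma_finite.intro) (rule N)
  interpret G: product_sigma_finite "\<lambda>_::'n. \<Gamma>"
    by (rule product_sigma_finite.intro) (rule prob_space_imp_sigma_finite[OF \<Gamma>(1)])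
  let ?g = "\<lambda>\<omega>. \<Prod>i\<in>UNIV. g (\<omega> i)"
  have co: "(\<lambda>\<omega>. \<omega> i) \<in> Pi\<^sub>M UNIV (\<lambda>_::'n. N) \<rightarrow>\<^sub>M N" for i by (rule measurable_component_singleton) simp
  have gm: "?g \<in> borel_measurable (Pi\<^sub>M UNIV (\<lambda>_::'n. N))"
    by (rule borel_measurable_prod_ennreal) (rule measurable_compose[OF co g(1)])
  have "density (Pi\<^sub>M UNIV (\<lambda>_. N)) ?g = Pi\<^sub>M UNIV (\<lambda>_::'n. \<Gamma>)"
  proof (rule G.PiM_eqI)
    show "sets (density (Pi\<^sub>M UNIV (\<lambda>_. N)) ?g) = sets (Pi\<^sub>M UNIV (\<lambda>_::'n. \<Gamma>))"
      unfolding sets_density by (rule sets_PiM_cong) (simp_all add: \<Gamma>(2))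
    fix A assume "\<And>i::'n. i \<in> UNIV \<Longrightarrow> A i \<in> sets \<Gamma>"
    then have A: "A i \<in> sets N" for i by (simp add: \<Gamma>(2))
    have PA: "Pi\<^sub>E UNIV A \<in> sets (Pi\<^sub>M UNIV (\<lambda>_. N))" using A by (intro sets_PiM_I_finite) auto
    have ind: "(\<Prod>i\<in>UNIV. indicator (A i) (\<omega> i)) = (indicator (Pi\<^sub>E UNIV A) \<omega> :: ennreal)" for \<omega>
      by (auto simp: indicator_def PiE_iff intro!: prod_zero)
    have "emeasure (density (Pi\<^sub>M UNIV (\<lambda>_. N)) ?g) (Pi\<^sub>E UNIV A) =
        (\<integral>\<^sup>+\<omega>. ?g \<omega> * indicator (Pi\<^sub>E UNIV A) \<omega> \<partial>Pi\<^sub>M UNIV (\<lambda>_. N))"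
      by (rule emeasure_density[OF gm PA])
    also have "\<dots> = (\<integral>\<^sup>+\<omega>. (\<Prod>i\<in>UNIV. g (\<omega> i) * indicator (A i) (\<omega> i)) \<partial>Pi\<^sub>M UNIV (\<lambda>_. N))"
      by (simp add: prod.distrib ind)
    also have "\<dots> = (\<Prod>i\<in>UNIV. \<integral>\<^sup>+x. g x * indicator (A i) x \<partial>N)"
      using g(1) A by (intro L.product_nn_integral_prod) auto
    also have "\<dots> = (\<Prod>i\<in>UNIV. emeasure \<Gamma> (A i))"
      using emeasure_density[OF g(1) A] by (simp add: g(2))
    finally show "emeasure (density (Pi\<^sub>M UNIV (\<lambda>_. N)) ?g) (Pi\<^sub>E UNIV A) = (\<Prod>i\<in>UNIV. emeasure \<Gamma> (A i))" .
  qed simp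
  then show ?thesis using absolutely_continuousI_density[OF gm] by simp
qed

text \<open>Places the first \<open>CARD('n)\<close> noise variables in a Euclidean space, the
  setting of \<open>local_overlap\<close>.\<close>

definition block_law :: "'b::euclidean_space measure \<Rightarrow> ('b ^ 'n::finite) measure" where
  "block_law \<Gamma> = distr (Pi\<^sub>M UNIV (\<lambda>_::nat. \<Gamma>)) borel (\<lambda>\<omega>. \<chi> j. \<omega> (pos j))"

context
  fixes \<Gamma> :: "'b::euclidean_space measure"
  assumes \<Gamma>: "prob_space \<Gamma>" and borel: "sets \<Gamma> = sets borel"
begin

lemma block_measurable:
  "(\<lambda>\<omega>. (\<chi> j. \<omega> (pos j)) :: 'b ^ 'n::finite) \<in> Pi\<^sub>M UNIV (\<lambda>_::nat. \<Gamma>) \<rightarrow>\<^sub>M borel"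
proof (rule measurable_compose[OF _ vec_lambda_measurable[OF borel]])
  show "(\<lambda>\<omega> j. \<omega> (pos j)) \<in> Pi\<^sub>M UNIV (\<lambda>_. \<Gamma>) \<rightarrow>\<^sub>M Pi\<^sub>M UNIV (\<lambda>_::'n. \<Gamma>)"
  proof (rule measurable_PiM_single')
    show "(\<lambda>\<omega>. \<omega> (pos j)) \<in> Pi\<^sub>M UNIV (\<lambda>_. \<Gamma>) \<rightarrow>\<^sub>M \<Gamma>" for j :: 'n by (rule measurable_component_singleton) simp
  qed (auto simp: space_PiM PiE_iff)
qed

lemma block_law_PiM: "block_law \<Gamma> = distr (Pi\<^sub>M UNIV (\<lambda>_::'n::finite. \<Gamma>)) borel vec_lambda"
proof -
  let ?r = "\<lambda>\<omega>. \<lambda>j\<in>UNIV. \<omega> (pos (j :: 'n))"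
  have inj: "inj (pos :: 'n \<Rightarrow> nat)" by (rule inj_on_inverseI[where g = idx]) simp
  have r: "?r \<in> Pi\<^sub>M UNIV (\<lambda>_. \<Gamma>) \<rightarrow>\<^sub>M Pi\<^sub>M UNIV (\<lambda>_::'n. \<Gamma>)"
    by (intro measurable_restrict measurable_component_singleton) simp
  have "Pi\<^sub>M UNIV (\<lambda>_::'n. \<Gamma>) = distr (Pi\<^sub>M UNIV (\<lambda>_. \<Gamma>)) (Pi\<^sub>M UNIV (\<lambda>_::'n. \<Gamma>)) ?r"
    by (rule distr_PiM_reindex[symmetric]) (use inj \<Gamma> in auto)
  then have "distr (Pi\<^sub>M UNIV (\<lambda>_::'n. \<Gamma>)) borel vec_lambda = distr (distr (Pi\<^sub>M UNIV (\<lambda>_. \<Gamma>)) (Pi\<^sub>M UNIV (\<lambda>_::'n. \<Gamma>)) ?r) borel vec_lambda"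
    by simp
  also have "\<dots> = block_law \<Gamma>"
    unfolding distr_distr[OF vec_lambda_measurable[OF borel] r] block_law_def by (simp add: comp_def restrict_def)
  finally show ?thesis ..
qed

lemma block_law_prob: "prob_space (block_law \<Gamma> :: ('b ^ 'n::finite) measure)"
  unfolding block_law_def
proof (rule prob_space.prob_space_distr[OF _ block_measurable])
  show "prob_space (Pi\<^sub>M UNIV (\<lambda>_::nat. \<Gamma>))" by (rule prob_space_PiM) (rule \<Gamma>)
qed

lemma block_law_absolutely_continuous:
  assumes ac: "absolutely_continuous lborel \<Gamma>"
  shows "absolutely_continuous lborel (block_law \<Gamma> :: ('b ^ 'n::finite) measure)"
  unfolding absolutely_continuous_def
proof
  let ?L = "Pi\<^sub>M UNIV (\<lambda>_::'n. lborel :: 'b measure)" and ?G = "Pi\<^sub>M UNIV (\<lambda>_::'n. \<Gamma>)"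
  fix A :: "('b ^ 'n) set" assume A: "A \<in> null_sets lborel"
  then have Ab: "A \<in> sets borel" by auto
  have mL: "vec_lambda \<in> ?L \<rightarrow>\<^sub>M (borel :: ('b ^ 'n) measure)" by (rule vec_lambda_measurable) simp
  have mG: "vec_lambda \<in> ?G \<rightarrow>\<^sub>M (borel :: ('b ^ 'n) measure)" by (rule vec_lambda_measurable) (rule borel)
  have sp: "space ?L = space ?G" using sets_eq_imp_space_eq[OF borel] by (simp add: space_PiM)
  have "A \<in> null_sets (distr ?L borel vec_lambda)" using A by (simp only: lborel_vec[symmetric])
  then have "vec_lambda -` A \<inter> space ?L \<in> null_sets ?L" using null_sets_distr_iff[OF mL] by simp
  moreover have "absolutely_continuous ?L ?G"
    by (rule absolutely_continuous_PiM[OF _ \<Gamma> _ ac]) (simp_all add: borel lborel.sigma_finite_measure_axioms)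
  ultimately have "vec_lambda -` A \<inter> space ?G \<in> null_sets ?G" by (auto simp: absolutely_continuous_def sp)
  then show "A \<in> null_sets (block_law \<Gamma>)"
    unfolding block_law_PiM using null_sets_distr_iff[OF mG] Ab by simp
qed

lemma block_law_positive:
  fixes y :: "'b ^ 'n::finite"
  assumes X: "open X" "y \<in> X" and y: "\<And>j. y $ j \<in> measure_support \<Gamma>"
  shows "emeasure (block_law \<Gamma>) X > 0"
proof -
  interpret product_sigma_finite "\<lambda>_::'n. \<Gamma>"
    by (rule product_sigma_finite.intro) (rule prob_space_imp_sigma_finite[OF \<Gamma>])
  have sp: "space \<Gamma> = UNIV" using sets_eq_imp_space_eq[OF borel] by simp
  obtain A where A: "\<And>i. open (A i)" "\<And>i. y $ i \<in> A i" "\<And>y'. (\<And>i. y' $ i \<in> A i) \<Longrightarrow> y' \<in> X"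
    using X unfolding open_vec_def by metis
  have mG: "vec_lambda \<in> Pi\<^sub>M UNIV (\<lambda>_::'n. \<Gamma>) \<rightarrow>\<^sub>M (borel :: ('b ^ 'n) measure)"
    by (rule vec_lambda_measurable) (rule borel)
  have "emeasure (Pi\<^sub>M UNIV (\<lambda>_. \<Gamma>)) (Pi\<^sub>E UNIV A) = (\<Prod>i\<in>UNIV. emeasure \<Gamma> (A i))"
    using A(1) by (intro emeasure_PiM) (auto simp: borel)
  moreover have "emeasure \<Gamma> (A i) \<noteq> 0" for i
    using y[of i] A(1,2)[of i] by (auto simp: measure_support_def)
  ultimately have "0 < emeasure (Pi\<^sub>M UNIV (\<lambda>_. \<Gamma>)) (Pi\<^sub>E UNIV A)" by (simp add: prod_zero_iff zero_less_iff_neq_zero)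
  also have "\<dots> \<le> emeasure (block_law \<Gamma>) X"
  proof -
    have Xb: "X \<in> sets borel" using X(1) by simp
    have sub: "Pi\<^sub>E UNIV A \<subseteq> vec_lambda -` X \<inter> space (Pi\<^sub>M UNIV (\<lambda>_. \<Gamma>))"
      using A(3) by (auto simp: space_PiM sp PiE_iff)
    show ?thesis unfolding block_law_PiM emeasure_distr[OF mG Xb]
      by (rule emeasure_mono[OF sub measurable_sets[OF mG Xb]])
  qed
  finally show ?thesis .
qed

end

section \<open>The attracting chain\<close>

locale attracting_chain = attracting_system V U F f \<phi> "measure_support \<Gamma>" a T
  for V U :: "(real ^ 'n) set" and F :: "(real ^ 'n) \<times> (real ^ 'm) \<Rightarrow> real ^ 'n" and f \<phi> \<Gamma> a T +
  assumes \<Gamma>_prob: "prob_space \<Gamma>" and \<Gamma>_borel: "sets \<Gamma> = sets borel" and \<Gamma>_ac: "absolutely_continuous lborel \<Gamma>"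
begin

definition state_space :: "(real ^ 'n) measure" where
  "state_space = restrict_space borel (W \<inter> U)"

lemma WU_borel: "W \<inter> U \<in> sets borel"
  using closed_W U by (intro sets.Int) auto

lemma space_state_space [simp]: "space state_space = W \<inter> U"
  by (simp add: state_space_def space_restrict_space)

lemma sets_state_space: "A \<in> sets state_space \<longleftrightarrow> A \<in> sets borel \<and> A \<subseteq> W \<inter> U"
  unfolding state_space_def using WU_borel by (auto simp: sets_restrict_space_iff)

lemma F_measurable: "F \<in> state_space \<Otimes>\<^sub>M \<Gamma> \<rightarrow>\<^sub>M state_space"
proof -
  have sp: "space (state_space \<Otimes>\<^sub>M \<Gamma>) = (W \<inter> U) \<times> UNIV"
    using sets_eq_imp_space_eq[OF \<Gamma>_borel] by (simp add: space_pair_measure)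
  have 1: "fst \<in> state_space \<Otimes>\<^sub>M \<Gamma> \<rightarrow>\<^sub>M borel"
    using measurable_fst[of state_space \<Gamma>] by (simp add: state_space_def measurable_restrict_space2_iff)
  have 2: "snd \<in> state_space \<Otimes>\<^sub>M \<Gamma> \<rightarrow>\<^sub>M borel"
    using measurable_snd[of state_space \<Gamma>] by (simp add: measurable_cong_sets[OF refl \<Gamma>_borel])
  have "(\<lambda>p. (fst p, snd p)) \<in> state_space \<Otimes>\<^sub>M \<Gamma> \<rightarrow>\<^sub>M borel" by (rule borel_measurable_Pair[OF 1 2])
  then have "(\<lambda>p. p) \<in> state_space \<Otimes>\<^sub>M \<Gamma> \<rightarrow>\<^sub>M restrict_space borel ((W \<inter> U) \<times> UNIV)"
    using sp by (intro measurable_restrict_space2) auto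
  moreover have "F \<in> restrict_space borel ((W \<inter> U) \<times> UNIV) \<rightarrow>\<^sub>M borel"
    by (rule borel_measurable_continuous_on_restrict[OF continuous_on_subset[OF F_cont]]) auto
  ultimately have "(\<lambda>p. F p) \<in> state_space \<Otimes>\<^sub>M \<Gamma> \<rightarrow>\<^sub>M borel" by (rule measurable_compose)
  then show ?thesis
    unfolding state_space_def measurable_restrict_space2_iff using F_W sp by (auto simp: state_space_def)
qed

sublocale sys: random_system state_space \<Gamma> F
  by (intro random_system.intro \<Gamma>_prob F_measurable)

lemma trajectory_W: "z \<in> W \<inter> U \<Longrightarrow> trajectory F z y k \<in> W \<inter> U"
  using F_W by (induction k) auto

lemma trajectory_constant_continuous: "continuous_on U (\<lambda>z. trajectory F z (\<lambda>_. y) k)"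
proof (induction k)
  case (Suc k)
  have "continuous_on U (\<lambda>z. F (trajectory F z (\<lambda>_. y) k, y))"
    by (rule continuous_on_compose2[OF F_cont continuous_on_Pair[OF Suc continuous_on_const]])
       (use trajectory_U in auto)
  then show ?case by simp
qed (simp add: continuous_on_id)

lemma trajectory_blocks_continuous:
  "continuous_on (U \<times> UNIV) (\<lambda>p :: (real ^ 'n) \<times> ((real ^ 'm) ^ 'n). trajectory F (fst p) (blocks (snd p)) k)"
proof (induction k)
  case (Suc k)
  have "continuous_on (U \<times> UNIV) (\<lambda>p :: (real ^ 'n) \<times> ((real ^ 'm) ^ 'n). (trajectory F (fst p) (blocks (snd p)) k, blocks (snd p) k))"
  proof (rule continuous_on_Pair[OF Suc])
    show "continuous_on (U \<times> UNIV) (\<lambda>p :: (real ^ 'n) \<times> ((real ^ 'm) ^ 'n). blocks (snd p) k)"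
      unfolding blocks_def by (intro continuous_intros)
  qed
  from continuous_on_compose2[OF F_cont this]
  have "continuous_on (U \<times> UNIV) (\<lambda>p :: (real ^ 'n) \<times> ((real ^ 'm) ^ 'n). F (trajectory F (fst p) (blocks (snd p)) k, blocks (snd p) k))"
    by (rule meta_mp) (auto intro: trajectory_U)
  then show ?case by simp
qed (auto intro!: continuous_intros)

text \<open>By continuity an open set of first noise values around \<open>a\<close> keeps the path
  on its way into \<open>O'\<close>, and such a set has positive probability because
  \<open>a\<close> lies in the support.\<close>

lemma P_reach:
  assumes "open O'" "z \<in> W \<inter> U" "trajectory F z (\<lambda>_. a) k \<in> O'"
  shows "emeasure (sys.P k z) (O' \<inter> (W \<inter> U)) > 0"
  using assms
proof (induction k arbitrary: z)
  case 0
  have "O' \<inter> (W \<inter> U) \<in> sets state_space" using 0(1) WU_borel by (auto simp: sets_state_space)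
  then show ?case using 0 by simp
next
  case (Suc k)
  have A: "O' \<inter> (W \<inter> U) \<in> sets state_space" using Suc.prems(1) WU_borel by (auto simp: sets_state_space)
  have z: "z \<in> space state_space" "z \<in> U" using Suc.prems(2) by auto
  have FU: "F (z, y) \<in> U" for y using F_U z(2) by auto
  have "continuous_on UNIV (\<lambda>y. F (z, y))"
    by (rule continuous_on_compose2[OF F_cont]) (use z(2) in \<open>auto intro!: continuous_intros\<close>)
  then have "continuous_on UNIV (\<lambda>y. trajectory F (F (z, y)) (\<lambda>_. a) k)"
    by (rule continuous_on_compose2[OF trajectory_constant_continuous]) (use FU in auto)
  then have "open ((\<lambda>y. trajectory F (F (z, y)) (\<lambda>_. a) k) -` O')" by (intro open_vimage Suc.prems(1))
  moreover have "a \<in> (\<lambda>y. trajectory F (F (z, y)) (\<lambda>_. a) k) -` O'"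
    using Suc.prems(3) by (simp add: trajectory_Suc_shift del: trajectory.simps)
  moreover have "a \<in> measure_support \<Gamma>" using a interior_subset by blast
  ultimately have pos: "emeasure \<Gamma> ((\<lambda>y. trajectory F (F (z, y)) (\<lambda>_. a) k) -` O') > 0"
    by (auto simp: measure_support_def)
  have m: "(\<lambda>x. emeasure (sys.P k x) (O' \<inter> (W \<inter> U))) \<in> borel_measurable state_space"
    by (rule sys.emeasure_P_measurable[OF A])
  have mF: "(\<lambda>y. emeasure (sys.P k (F (z, y))) (O' \<inter> (W \<inter> U))) \<in> borel_measurable \<Gamma>"
    by (rule measurable_compose[OF sys.F_section[OF z(1)] m])
  have "emeasure (sys.P (1 + k) z) (O' \<inter> (W \<inter> U)) = (\<integral>\<^sup>+x. emeasure (sys.P k x) (O' \<inter> (W \<inter> U)) \<partial>sys.P 1 z)"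
    by (rule sys.emeasure_P_add[OF z(1) A])
  also have "\<dots> = (\<integral>\<^sup>+y. emeasure (sys.P k (F (z, y))) (O' \<inter> (W \<inter> U)) \<partial>\<Gamma>)"
    unfolding sys.P_1[OF z(1)] by (rule sys.nn_integral_step[OF z(1) m])
  finally have eq: "emeasure (sys.P (Suc k) z) (O' \<inter> (W \<inter> U)) = (\<integral>\<^sup>+y. emeasure (sys.P k (F (z, y))) (O' \<inter> (W \<inter> U)) \<partial>\<Gamma>)"
    by simp
  have "(\<integral>\<^sup>+y. emeasure (sys.P k (F (z, y))) (O' \<inter> (W \<inter> U)) \<partial>\<Gamma>) \<noteq> 0"
  proof
    assume "(\<integral>\<^sup>+y. emeasure (sys.P k (F (z, y))) (O' \<inter> (W \<inter> U)) \<partial>\<Gamma>) = 0"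
    then have "AE y in \<Gamma>. emeasure (sys.P k (F (z, y))) (O' \<inter> (W \<inter> U)) = 0" by (simp add: nn_integral_0_iff_AE[OF mF])
    moreover have "emeasure (sys.P k (F (z, y))) (O' \<inter> (W \<inter> U)) > 0" if "trajectory F (F (z, y)) (\<lambda>_. a) k \<in> O'" for y
      by (rule Suc.IH[OF Suc.prems(1) _ that]) (use F_W Suc.prems(2) in auto)
    ultimately have "AE y in \<Gamma>. y \<notin> (\<lambda>y. trajectory F (F (z, y)) (\<lambda>_. a) k) -` O'"
      by (elim eventually_mono) force
    then have "(\<lambda>y. trajectory F (F (z, y)) (\<lambda>_. a) k) -` O' \<in> null_sets \<Gamma>"
      using \<open>open (_ -` O')\<close> by (subst (asm) AE_iff_null_sets[symmetric]) (auto simp: \<Gamma>_borel)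
    then show False using pos by auto
  qed
  then show ?case unfolding eq by (simp add: zero_less_iff_neq_zero)
qed

lemma blocks_trajectory:
  fixes \<omega> :: "nat \<Rightarrow> real ^ 'm"
  shows "trajectory F z (blocks ((\<chi> j. \<omega> (pos j)) :: (real ^ 'm) ^ 'n)) CARD('n) = trajectory F z \<omega> CARD('n)"
  by (rule trajectory_cong) (simp add: blocks_def)

text \<open>Only an inequality, since the estimates are available for noise in a ball around the
  generic sequence and other noise is disregarded.\<close>

lemma block_event_le:
  assumes z: "z \<in> W \<inter> U" and A: "A \<in> sets state_space" and Y: "Y \<in> sets borel"
    and imp: "\<And>y. y \<in> Y \<Longrightarrow> trajectory F z (blocks y) CARD('n) \<in> A"
  shows "measure (block_law \<Gamma> :: ((real ^ 'm) ^ 'n) measure) Y \<le> measure (sys.P CARD('n) z) A"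
proof -
  have z': "z \<in> space state_space" using z by simp
  let ?h = "\<lambda>\<omega>. (\<chi> j. \<omega> (pos j)) :: (real ^ 'm) ^ 'n"
  have h: "?h \<in> sys.SS \<rightarrow>\<^sub>M borel" by (rule block_measurable[OF \<Gamma>_prob \<Gamma>_borel])
  have tr: "(\<lambda>\<omega>. trajectory F z \<omega> CARD('n)) \<in> sys.SS \<rightarrow>\<^sub>M state_space" by (rule sys.trajectory_section[OF z'])
  have "measure (block_law \<Gamma>) Y = measure sys.SS (?h -` Y \<inter> space sys.SS)"
    unfolding block_law_def by (rule measure_distr[OF h Y])
  also have "\<dots> \<le> measure sys.SS ((\<lambda>\<omega>. trajectory F z \<omega> CARD('n)) -` A \<inter> space sys.SS)"
  proof (rule sys.noise.P.finite_measure_mono[OF _ measurable_sets[OF tr A]])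
    have "trajectory F z \<omega> CARD('n) \<in> A" if "?h \<omega> \<in> Y" for \<omega>
      using imp[OF that] by (simp only: blocks_trajectory)
    then show "?h -` Y \<inter> space sys.SS \<subseteq> (\<lambda>\<omega>. trajectory F z \<omega> CARD('n)) -` A \<inter> space sys.SS" by auto
  qed
  also have "\<dots> = measure (distr sys.SS state_space (\<lambda>\<omega>. trajectory F z \<omega> CARD('n))) A"
    by (rule measure_distr[OF tr A, symmetric])
  finally show ?thesis by (simp only: sys.P_trajectory[OF z'])
qed

text \<open>Local coordinates turn the event that the endpoint lies in \<open>A\<close> into an
  event for \<open>H\<close>, to which the overlap of densities applies.\<close>

lemma overlap_near_T:
  obtains N \<eta> where "N \<in> sets state_space" "0 < (\<eta>::real)"
    "\<And>z z' A. z \<in> N \<Longrightarrow> z' \<in> N \<Longrightarrow> A \<in> sets state_space \<Longrightarrow>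
      \<eta> \<le> measure (sys.P CARD('n) z) A +
        measure (sys.P CARD('n) z') (space state_space - A)"
    "\<exists>d>0. N = ball T d \<inter> (W \<inter> U)"
proof -
  obtain H :: "(real ^ 'n) \<times> ((real ^ 'm) ^ 'n) \<Rightarrow> (real ^ 'm) ^ 'n"
      and G :: "real ^ 'n \<Rightarrow> (real ^ 'm) ^ 'n" and pr :: "(real ^ 'm) ^ 'n \<Rightarrow> (real ^ 'm) ^ 'n" and D y e where
    y: "\<And>j. y $ j \<in> interior (measure_support \<Gamma>)" and H: "strict_derivative H D (T, y)" "\<And>\<eta>. D (0, \<eta>) = 0 \<Longrightarrow> \<eta> = 0"
    and pr: "bounded_linear pr" and G: "continuous_on UNIV G"
    and prH: "\<And>z y. z \<in> U \<Longrightarrow> pr (H (z, y)) = G (trajectory F z (blocks y) CARD('n))"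
    and e: "e > 0" and inj: "inj_on G (W \<inter> cball (trajectory F T (blocks y) CARD('n)) e)"
    by (rule local_coordinates) blast
  define x0 where "x0 = trajectory F T (blocks y) CARD('n)"
  have T': "T \<in> U" using T_W by auto
  have x0U: "x0 \<in> U" using trajectory_U[OF T'] by (simp add: x0_def)
  obtain e' where e': "e' > 0" "cball x0 e' \<subseteq> U" using open_contains_cball U x0U by blast
  define e1 where "e1 = min e e'"
  \<comment> \<open>Compactness makes the inverse of \<open>G\<close> on \<open>Kc\<close>
    continuous, so that images of Borel subsets of \<open>Kc\<close> under \<open>G\<close> are
    Borel sets.\<close>
  define Kc where "Kc = W \<inter> cball x0 e1"
  have e1: "e1 > 0" "cball x0 e1 \<subseteq> cball x0 e" "cball x0 e1 \<subseteq> U" using e e' by (auto simp: e1_def)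
  have Kc: "compact Kc" unfolding Kc_def using closed_W by (intro closed_Int_compact) auto
  have KcU: "Kc \<subseteq> W \<inter> U" using e1(3) by (auto simp: Kc_def)
  have injK: "inj_on G Kc" using inj by (rule inj_on_subset) (use e1(2) in \<open>auto simp: Kc_def x0_def\<close>)
  have GK: "continuous_on Kc G" using G continuous_on_subset by blast
  have inv: "continuous_on (G ` Kc) (inv_into Kc G)"
    by (rule continuous_on_inv[OF GK Kc]) (use injK in \<open>auto simp: inv_into_f_f\<close>)
  have image_borel: "G ` (A \<inter> Kc) \<in> sets borel" if A: "A \<in> sets borel" for A
  proof -
    have GKb: "G ` Kc \<in> sets borel" using compact_continuous_image[OF GK Kc] by (intro borel_closed compact_imp_closed)
    have "inv_into Kc G \<in> borel_measurable (restrict_space borel (G ` Kc))"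
      by (rule borel_measurable_continuous_on_restrict[OF inv])
    from measurable_sets[OF this A] have "inv_into Kc G -` A \<inter> G ` Kc \<in> sets (restrict_space borel (G ` Kc))"
      by (simp add: space_restrict_space)
    moreover have "inv_into Kc G -` A \<inter> G ` Kc = G ` (A \<inter> Kc)" using injK by (auto simp: inv_into_f_f)
    ultimately show ?thesis using GKb by (auto simp: sets_restrict_space_iff)
  qed
  let ?tr = "\<lambda>p. trajectory F (fst p) (blocks (snd p)) CARD('n)"
  have "isCont ?tr (T, y)"
    using trajectory_blocks_continuous continuous_on_eq_continuous_at[of "U \<times> (UNIV :: ((real ^ 'm) ^ 'n) set)" ?tr] U T'
    by (auto simp: open_Times)
  then have "\<exists>s>0. \<forall>p. dist p (T, y) < s \<longrightarrow> dist (?tr p) (?tr (T, y)) < e1"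
    using e1(1) unfolding continuous_at_eps_delta by blast
  then obtain s where s: "s > 0" "\<And>p. dist p (T, y) < s \<Longrightarrow> dist (?tr p) x0 < e1" by (auto simp: x0_def)
  interpret \<mu>: prob_space "block_law \<Gamma> :: ((real ^ 'm) ^ 'n) measure" by (rule block_law_prob[OF \<Gamma>_prob \<Gamma>_borel])
  have fin: "finite_measure (block_law \<Gamma> :: ((real ^ 'm) ^ 'n) measure)" by (rule \<mu>.finite_measure_axioms)
  have setsb: "sets (block_law \<Gamma> :: ((real ^ 'm) ^ 'n) measure) = sets borel" by (simp add: block_law_def)
  have ac: "absolutely_continuous lborel (block_law \<Gamma> :: ((real ^ 'm) ^ 'n) measure)"
    by (rule block_law_absolutely_continuous[OF \<Gamma>_prob \<Gamma>_borel \<Gamma>_ac])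
  have supp: "emeasure (block_law \<Gamma>) X > 0" if "open X" "y \<in> X" for X
    by (rule block_law_positive[OF \<Gamma>_prob \<Gamma>_borel that]) (use y interior_subset in blast)
  have s2: "s / 2 > 0" using s(1) by simp
  obtain d r \<eta> where d: "d > 0" and r: "r > 0" "r \<le> s / 2" and \<eta>: "\<eta> > 0"
    and ov: "\<And>z z' B. z \<in> ball T d \<Longrightarrow> z' \<in> ball T d \<Longrightarrow> B \<in> sets borel \<Longrightarrow>
      {y' \<in> ball y r. H (z, y') \<in> B} \<in> sets borel \<and>
      \<eta> \<le> measure (block_law \<Gamma>) {y' \<in> ball y r. H (z, y') \<in> B} + measure (block_law \<Gamma>) {y' \<in> ball y r. H (z', y') \<notin> B}"
  proof (rule local_overlap[OF H fin setsb ac supp s2])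
    fix d r \<eta> :: real
    assume *: "d > 0" "r > 0" "r \<le> s / 2" "\<eta> > 0"
      "\<And>z z' B. z \<in> ball T d \<Longrightarrow> z' \<in> ball T d \<Longrightarrow> B \<in> sets borel \<Longrightarrow>
        {y' \<in> ball y r. H (z, y') \<in> B} \<in> sets borel \<and>
        \<eta> \<le> measure (block_law \<Gamma>) {y' \<in> ball y r. H (z, y') \<in> B} + measure (block_law \<Gamma>) {y' \<in> ball y r. H (z', y') \<notin> B}"
    show thesis by (rule that[OF *])
  qed
  \<comment> \<open>State and noise are each within \<open>s / 2\<close> of \<open>(T, y)\<close>,
    which keeps the endpoint in \<open>Kc\<close>.\<close>
  define d1 where "d1 = min d (s / 2)"
  define N where "N = ball T d1 \<inter> (W \<inter> U)"
  have d1: "d1 > 0" using d s2 by (simp add: d1_def)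
  have N: "N \<in> sets state_space" using WU_borel by (auto simp: N_def sets_state_space)
  have trK: "trajectory F z (blocks y') CARD('n) \<in> Kc" if "z \<in> N" "y' \<in> ball y r" for z y'
  proof -
    have "dist (z, y') (T, y) \<le> dist z T + dist y' y"
      unfolding dist_Pair_Pair by (rule sqrt_sum_squares_le_sum) simp_all
    also have "\<dots> < s" using that r(2) by (auto simp: N_def d1_def dist_commute)
    finally have "dist (trajectory F z (blocks y') CARD('n)) x0 < e1" using s(2)[of "(z, y')"] by simp
    moreover have "trajectory F z (blocks y') CARD('n) \<in> W" using trajectory_W that(1) by (auto simp: N_def)
    ultimately show ?thesis by (simp add: Kc_def dist_commute less_imp_le)
  qed
  have "\<eta> \<le> measure (sys.P CARD('n) z) A +
      measure (sys.P CARD('n) z') (space state_space - A)"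
    if zN: "z \<in> N" "z' \<in> N" and A: "A \<in> sets state_space" for z z' A
  proof -
    \<comment> \<open>For noise in the ball, \<open>H\<close> lies in \<open>B\<close> exactly if
      the endpoint lies in \<open>A\<close>, by injectivity of \<open>G\<close> on
      \<open>Kc\<close>; hence \<open>B\<close> may depend on \<open>A\<close> but not on the
      starting point.\<close>
    define B where "B = pr -` (G ` (A \<inter> Kc))"
    have Ab: "A \<in> sets borel" using A by (simp add: sets_state_space)
    have "pr \<in> borel_measurable borel"
      by (rule borel_measurable_continuous_onI[OF linear_continuous_on[OF pr]])
    from measurable_sets[OF this image_borel[OF Ab]] have B: "B \<in> sets borel" by (simp add: B_def)
    have HB: "H (w, y') \<in> B \<longleftrightarrow> trajectory F w (blocks y') CARD('n) \<in> A" if w: "w \<in> N" "y' \<in> ball y r" for w y'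
    proof -
      have "pr (H (w, y')) = G (trajectory F w (blocks y') CARD('n))" using prH w(1) by (simp add: N_def)
      then show ?thesis using trK[OF w] injK by (auto simp: B_def inj_on_def)
    qed
    have zW: "z \<in> W \<inter> U" "z' \<in> W \<inter> U" and zb: "z \<in> ball T d" "z' \<in> ball T d" using zN by (auto simp: N_def d1_def)
    have mB: "{y' \<in> ball y r. H (z, y') \<in> B} \<in> sets borel" and mB': "{y' \<in> ball y r. H (z', y') \<notin> B} \<in> sets borel"
      using ov[OF zb B] ov[OF zb(2,1), of "- B"] B by auto
    have "measure (block_law \<Gamma>) {y' \<in> ball y r. H (z, y') \<in> B} \<le> measure (sys.P CARD('n) z) A"
      by (rule block_event_le[OF zW(1) A mB]) (use HB zN(1) in auto)
    moreover have "measure (block_law \<Gamma>) {y' \<in> ball y r. H (z', y') \<notin> B} \<le>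
        measure (sys.P CARD('n) z') (space state_space - A)"
      by (rule block_event_le[OF zW(2) sets.compl_sets[OF A] mB']) (use HB zN(2) trK KcU in auto)
    ultimately show ?thesis using ov[OF zb B] by linarith
  qed
  then show ?thesis using that[OF N \<eta>] d1 N_def by blast
qed

text \<open>The path under constant input \<open>a\<close> eventually stays in the ball around
  \<open>T\<close>, so access holds at all large times and not only at some.\<close>

lemma reach_T:
  assumes N: "N = ball T d \<inter> (W \<inter> U)" "d > 0" and z: "z \<in> W \<inter> U"
  shows "\<exists>n0. \<forall>n\<ge>n0. emeasure (sys.P n z) N > 0"
proof -
  have "(\<lambda>t. trajectory F z (\<lambda>_. a) t) \<longlonglongrightarrow> T" using attracting z W_V by auto
  from tendstoD[OF this N(2)] obtain n0 where "\<forall>n\<ge>n0. trajectory F z (\<lambda>_. a) n \<in> ball T d"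
    by (auto simp: eventually_sequentially dist_commute)
  then show ?thesis unfolding N(1) using P_reach[OF open_ball z] by blast
qed

end

text \<open>The stationary process enters through all its realisations on arbitrary probability
  spaces. The existence of one, on two-sided sequences of states and noise, is asserted separately
  so that the mixing statement is not vacuous.\<close>

theorem theorem3p11:
  fixes V U W C :: "(real ^ 'n) set"
    and F :: "(real ^ 'n) \<times> (real ^ 'm) \<Rightarrow> real ^ 'n"
    and \<Gamma> :: "(real ^ 'm) measure"
    and \<Omega> :: "'w measure"
    and e :: "nat \<Rightarrow> 'w \<Rightarrow> real ^ 'm"
    and a :: "real ^ 'm" and T :: "real ^ 'n"
    and M :: "(real ^ 'n) measure"
    and P :: "real ^ 'n \<Rightarrow> (real ^ 'n) measure"
    and Lyap :: "real ^ 'n \<Rightarrow> real"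
    and \<alpha> b :: real
  defines "W \<equiv> zariski_closure (orbit F (measure_support \<Gamma>) T)"
    and "M \<equiv> restrict_space borel (W \<inter> U)"
    and "P \<equiv> transition_kernel \<Gamma> F (W \<inter> U)"
  assumes semi_poly: "semi_polynomial V U F"
    and iid: "iid_process \<Omega> e \<Gamma>"
    and abs_cont: "absolutely_continuous lborel \<Gamma>"
    and a: "a \<in> interior (measure_support \<Gamma>)"
    and T: "T \<in> V \<inter> U"
    and attracting: "\<And>z. z \<in> V \<inter> U \<Longrightarrow> (\<lambda>t. trajectory F z (\<lambda>_. a) t) \<longlonglongrightarrow> T"
    and small: "small_set M P C"
    and constants: "0 < \<alpha>" "\<alpha> < 1" "0 < b"
    and Lyap_measurable: "Lyap \<in> borel_measurable M"
    and Lyap_ge_1: "\<And>x. x \<in> W \<inter> U \<Longrightarrow> Lyap x \<ge> 1"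
    and drift: "\<And>x. x \<in> W \<inter> U \<Longrightarrow>
      (\<integral>\<^sup>+y. ennreal (Lyap y) \<partial>P x) \<le> ennreal (\<alpha> * Lyap x + b * indicator C x)"
  shows "algebraic_variety W \<and> F ` ((W \<inter> U) \<times> UNIV) \<subseteq> W \<inter> U \<and>
    positive_harris_recurrent M P \<Omega> (\<lambda>x t \<omega>. trajectory F x (\<lambda>i. e i \<omega>) t) \<and>
    geometrically_ergodic M P \<and>
    (\<exists>\<pi>. (\<forall>\<pi>'. stationary_distribution M P \<pi>' \<longleftrightarrow> \<pi>' = \<pi>) \<and>
      (\<integral>\<^sup>+x. ennreal (Lyap x) \<partial>\<pi>) < \<infinity> \<and>
      (\<exists>(Q :: (int \<Rightarrow> (real ^ 'n) \<times> (real ^ 'm)) measure) X \<epsilon>. stationary_chain Q M F \<Gamma> X \<epsilon>) \<and>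
      (\<forall>(Q :: 'v measure) X \<epsilon>. stationary_chain Q M F \<Gamma> X \<epsilon> \<longrightarrow>
         geometrically_beta_mixing Q M X \<and>
         (\<forall>t. distr Q M (X t) = \<pi> \<and>
            (\<integral>\<^sup>+x. ennreal (Lyap x) \<partial>\<pi>) = (\<integral>\<^sup>+\<omega>. ennreal (Lyap (X t \<omega>)) \<partial>Q))))"
proof -
  have \<Gamma>: "prob_space \<Gamma>" "sets \<Gamma> = sets borel"
    using prob_space.prob_space_distr[OF _ iid_process_law(2)[OF iid]] iid iid_process_law(1)[OF iid]
    by (auto simp: iid_process_def)
  obtain f \<phi> where f: "attracting_chain V U F f \<phi> \<Gamma> a T"
  proof -
    obtain f :: "(real ^ 'n) \<times> (real ^ 'm) \<Rightarrow> real ^ 'm" and \<phi> :: "(real ^ 'n) \<times> (real ^ 'm) \<Rightarrow> real ^ 'n" where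
      *: "algebraic_variety V" "open U" "F ` (U \<times> UNIV) \<subseteq> U" "C1_on (U \<times> UNIV) F" "C1_on (U \<times> UNIV) f"
      "\<forall>z\<in>U. \<forall>y. F (z, y) = \<phi> (z, f (z, y))" "\<phi> ` ((V \<inter> U) \<times> UNIV) \<subseteq> V \<inter> U"
      "regular_on UNIV \<phi>" "\<forall>z\<in>U. C1_diffeomorphism (\<lambda>y. f (z, y))"
      "continuous_on (U \<times> UNIV) (\<lambda>(z, y). inv (\<lambda>u. f (z, u)) y)"
      using semi_poly unfolding semi_polynomial_def by (elim conjE exE) (rule that)
    have "attracting_system V U F f \<phi> (measure_support \<Gamma>) a T"
      using * a T attracting by (intro attracting_system.intro) auto
    then show ?thesis
      using that[of f \<phi>] \<Gamma> abs_cont by (intro that attracting_chain.intro attracting_chain_axioms.intro)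
  qed
  interpret A: attracting_chain V U F f \<phi> \<Gamma> a T by (rule f)
  have W: "W = A.W" by (simp add: W_def A.W_def)
  have M: "M = A.state_space" by (simp add: M_def A.state_space_def W)
  have P: "P = A.sys.step"
    by (intro ext) (simp add: P_def W transition_kernel_def A.sys.step_def A.state_space_def[symmetric])
  obtain k \<nu> where k: "k \<ge> 1" and C: "C \<in> sets M" and \<nu>: "sets \<nu> = sets M" "emeasure \<nu> (space M) \<noteq> 0"
    "\<And>x A. x \<in> C \<Longrightarrow> A \<in> sets M \<Longrightarrow> emeasure \<nu> A \<le> emeasure (kernel_power M P k x) A"
    using small unfolding small_set_def by blast
  obtain N \<eta> where N: "N \<in> sets A.state_space" and \<eta>: "0 < (\<eta>::real)"
    and overlap: "\<And>z z' A. z \<in> N \<Longrightarrow> z' \<in> N \<Longrightarrow> A \<in> sets A.state_space \<Longrightarrow>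
      \<eta> \<le> measure (A.sys.P CARD('n) z) A +
        measure (A.sys.P CARD('n) z') (space A.state_space - A)"
    and ball: "\<exists>d>0. N = ball T d \<inter> (A.W \<inter> U)"
    by (rule A.overlap_near_T) blast
  interpret drift: drift_chain A.state_space A.sys.step Lyap C N \<nu> \<alpha> b \<eta> k "CARD('n)"
  proof (intro drift_chain.intro drift_chain_axioms.intro)
    show "markov_kernel A.state_space A.sys.step" by (rule A.sys.markov_kernel_axioms)
    show "space A.state_space \<noteq> {}" using A.T_W by auto
    show "\<exists>n0. \<forall>n\<ge>n0. emeasure (A.sys.P n x) N > 0" if "x \<in> space A.state_space" for x
      using ball A.reach_T[of N _ x] that by auto
  qed (use Lyap_measurable Lyap_ge_1 constants C drift \<nu> N \<eta> overlap in \<open>simp_all add: M P W Suc_leI\<close>)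
  obtain \<pi> D \<rho> where \<pi>: "prob_space \<pi>" "sets \<pi> = sets A.state_space" and D: "D \<ge> 0" and \<rho>: "0 < \<rho>" "\<rho> < 1"
    and conv: "\<And>n f x. f \<in> borel_measurable A.state_space \<Longrightarrow> (\<And>x. x \<in> space A.state_space \<Longrightarrow> \<bar>f x\<bar> \<le> 1) \<Longrightarrow>
      x \<in> space A.state_space \<Longrightarrow>
      \<bar>(\<integral>z. f z \<partial>A.sys.P n x) - (\<integral>z. f z \<partial>\<pi>)\<bar> \<le> D * \<rho> ^ n * Lyap x"
    by (rule drift.geometric_convergence) blast
  interpret E: ergodic_system A.state_space \<Gamma> F Lyap \<pi> D \<rho> drift.K1
  proof (intro ergodic_system.intro ergodic_system_axioms.intro ergodic_chain.intro ergodic_chain_axioms.intro)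
    show "random_system A.state_space \<Gamma> F" by (rule A.sys.random_system_axioms)
    show "(\<integral>\<^sup>+y. ennreal (Lyap y) \<partial>A.sys.P n x) \<le> ennreal (Lyap x + drift.K1)"
      if x: "x \<in> space A.state_space" for n x
    proof -
      have "\<alpha> ^ n * Lyap x \<le> 1 * Lyap x"
        using constants drift.V_nonneg[OF x] by (intro mult_right_mono power_le_one) auto
      then show ?thesis using drift.nn_integral_V[OF x, of n] by (rule_tac order_trans) (auto intro!: ennreal_leI)
    qed
  qed (use \<Gamma> A.sys.markov_kernel_axioms drift.nonempty drift.V drift.V_ge_1 \<pi> D \<rho> conv drift.K1(1) in auto)
  have harris: "positive_harris_recurrent M P \<Omega> (\<lambda>x t \<omega>. trajectory F x (\<lambda>i. e i \<omega>) t)"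
    unfolding positive_harris_recurrent_def harris_recurrent_def M P
  proof (intro conjI exI[of _ \<pi>] ballI impI E.\<pi>_maximal E.\<pi>_stationary)
    fix B x assume B: "B \<in> sets A.state_space" "emeasure \<pi> B > 0" and x: "x \<in> space A.state_space"
    \<comment> \<open>Recurrence holds under the product measure on noise sequences, which is the
      law of the given noise on \<open>\<Omega>\<close>.\<close>
    have "AE \<omega> in A.sys.SS. \<exists>\<^sub>\<infinity>t. trajectory F x \<omega> t \<in> B"
      by (rule A.sys.recurrent[OF B(1) _ x]) (rule E.subharmonic_zero[where A = B], use B in auto)
    then have "AE \<omega> in distr \<Omega> A.sys.SS (\<lambda>\<omega> i. e i \<omega>). \<exists>\<^sub>\<infinity>t. trajectory F x \<omega> t \<in> B"
      by (simp only: iid_process_law(4)[OF iid])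
    from AE_distrD[OF iid_process_law(3)[OF iid] this] show "AE \<omega> in \<Omega>. \<exists>\<^sub>\<infinity>t. trajectory F x (\<lambda>i. e i \<omega>) t \<in> B" .
  qed
  have ergodic: "geometrically_ergodic M P" unfolding M P by (rule E.chain_geometrically_ergodic)
  have unique: "\<forall>\<pi>'. stationary_distribution M P \<pi>' \<longleftrightarrow> \<pi>' = \<pi>"
    unfolding M P using E.\<pi>_unique E.\<pi>_stationary by blast
  have exist: "\<exists>(Q :: (int \<Rightarrow> (real ^ 'n) \<times> (real ^ 'm)) measure) X \<epsilon>. stationary_chain Q M F \<Gamma> X \<epsilon>"
  proof -
    obtain Q :: "(int \<Rightarrow> (real ^ 'n) \<times> (real ^ 'm)) measure" and X \<epsilon> where "stationary_chain Q A.state_space F \<Gamma> X \<epsilon>"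
      by (rule stationary_chain_exists[OF A.sys.random_system_axioms A.state_space_def A.WU_borel \<Gamma>(2) E.\<pi>_stationary])
    then show ?thesis unfolding M by blast
  qed
  have mixing: "geometrically_beta_mixing Q M X \<and> (\<forall>t. distr Q M (X t) = \<pi> \<and>
      (\<integral>\<^sup>+x. ennreal (Lyap x) \<partial>\<pi>) = (\<integral>\<^sup>+\<omega>. ennreal (Lyap (X t \<omega>)) \<partial>Q))"
    if "stationary_chain Q M F \<Gamma> X \<epsilon>" for Q :: "'v measure" and X \<epsilon>
  proof -
    interpret S: stationary_system A.state_space \<Gamma> F Lyap \<pi> D \<rho> drift.K1 Q X \<epsilon>
      by (intro stationary_system.intro stationary_system_axioms.intro E.ergodic_system_axioms) (use that M in simp)
    have "(\<integral>\<^sup>+\<omega>. ennreal (Lyap (X t \<omega>)) \<partial>Q) = (\<integral>\<^sup>+x. ennreal (Lyap x) \<partial>\<pi>)" for t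
      by (rule S.nn_integral_X) (use drift.V in simp)
    then show ?thesis unfolding M using S.mixing S.law by simp
  qed
  show ?thesis
  proof (intro conjI exI[of _ \<pi>] unique exist harris ergodic E.\<pi>_V allI impI)
    show "algebraic_variety W" unfolding W by (rule A.W_variety)
    show "F ` ((W \<inter> U) \<times> UNIV) \<subseteq> W \<inter> U" unfolding W by (rule A.F_W)
  qed (use mixing in auto)
qed

end
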